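(* Let $\mathcal{V}=H^1_0(\Omega)$ and let $a_h$, $a_h^+$ be uniformly coercive and continuous bilinear forms on $\mathcal{V}\times\mathcal{V}$ (with respect to $\|\cdot\|_{1,2}$). Suppose there is a constant $\eta\in[2,\infty]$ such that: (A1) For every $h\le h_0$, $\mathcal{V}_h,\mathcal{V}_h^+\subset W^{1,\eta}(\Omega)\cap\mathcal{V}$. (A2) There exists $C>0$ independent of $h$ such that $\|w_h\|_{m,\eta}\le Ch^{-m}\|w_h\|_{0,\eta}$ for $m=0,1$, every $w_h\in\mathcal{V}_h^+\cap\mathcal{V}_h$, and every $h\le h_0$. (A3) There exist constants $\gamma\ge0$ and $C>0$ independent of $h$ and a map $\pi_h:\mathcal{V}_h^++\mathcal{V}_h\to\mathcal{V}_h^+\cap\mathcal{V}_h$ such that $\|\pi_hw_h\|_{0,\eta}\le C\|w_h\|_{0,\eta}$ and $|\mathrm{supp}(\pi_hw_h-w_h)|\le Ch^\gamma$ for every $w_h\in\mathcal{V}_h^++\mathcal{V}_h$ and every $h\le h_0$. (A4) There exist constants $C_1>0$, $\delta\ge0$, $1\le q\le\eta$, and $\mu,\nu\in\{0,1\}$ independent of $h$ such that $|a_h^+(v,w)-a_h(v,w)|\le C_1h^\delta\|v\|_{\mu,\eta}\|w\|_{\nu,q}$ for every $v,w\in W^{1,\eta}(\Omega)\cap\mathcal{V}$ and every $h\le h_0$. Assume further: (B1) $a_h$ and $a_h^+$ have smoothing properties uniformly in $h$: there exists $C>0$ independent of $h$ such that for every $f\in L^2(\Omega)$ and every $h\le h_0$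 there is a unique $w\in\mathcal{V}$ with $a_h(y,w)=\int_\Omega fy$ for all $y\in\mathcal{V}$, and it satisfies $\|w\|_{2,2}\le C\|f\|_{0,2}$; and likewise with $a_h^+$ in place of $a_h$. (B2) There exists $C>0$ such that for any $h\le h_0$, any subdomain $R\subseteq\Omega$, and any $v,w\in\mathcal{V}$ with $\mathrm{supp}(w)\subseteq R$, $|a_h(v,w)|\le C\|v\|_{1,2,R}\|w\|_{1,2,R}$, where $C$ is independent of $h$ and $R$; and similarly for $a_h^+$. (B3) The constant $q$ in (A4) satisfies $q<\infty$ if $d=4-2\nu$, and $q\le\frac{2d}{d-4+2\nu}$ if $d>4-2\nu$ (no additional restriction if $d<4-2\nu$). Assume also that there exist interpolation operators $i_h:\bar{\mathcal{V}}\to\mathcal{V}_h$ and $i_h^+:\bar{\mathcal{V}}\to\mathcal{V}_h^+$, defined on a space $\bar{\mathcal{V}}$ with $H^2(\Omega)\cap\mathcal{V}\subseteq\bar{\mathcal{V}}\subseteq\mathcal{V}$, such that: (B4) There exists $C>0$ independent of $h$ such that $\|i_hw\|_{\nu,q}+\|i_h^+w\|_{\nu,q}\le C\|w\|_{\nu,q}$ for every $w\in H^2(\Omega)\cap\mathcal{V}$ and every $h\le h_0$. (B5) There exists $C>0$ independent of $h$ such that $\|i_hw-w\|_{1,2}+\|i_h^+w-w\|_{1,2}\le Ch|w|_{2,2}$ for every $w\in H^2(\Omega)\cap\mathcal{V}$ and every $h\le h_0$. (B6) For every $w\in H^2(\Omega)\cap\mathcal{V}$ and every $h\le h_0$, $\mathrm{supp}(i_h^+w-i_hw)\subseteq\mathcal{R}_h$,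 where $\mathcal{R}_h:=\bigcup_{w_h\in\mathcal{V}_h+\mathcal{V}_h^+}\mathrm{supp}(w_h-\pi_hw_h)$ and $\pi_h$ is the map in (A3). Then there exists $C>0$ independent of $h$ such that for every $u\in W^{1,\eta}(\Omega)\cap\mathcal{V}$ and every $h\le h_0$, $$ \begin{split} \|r_h^+ u - r_h u\|_{0,2} \le C h^{\sigma'} \, \Big[ &h\|r_h^+ u - u\|_{1,\eta} + h\|r_h u - u\|_{1,\eta} + \|r_h^+ u - u\|_{0,\eta} + \|r_h u - u\|_{0,\eta} \\ &+ \left(h^\mu \|r_h u - u\|_{\mu,\eta}\right)^{1/2} \left(\|r_h^+ u - u\|_{0,\eta} + \|r_h u - u\|_{0,\eta} \right)^{1/2} \\ &+ h^\mu \|r_h u - u\|_{\mu,\eta} \Big], \end{split} $$ with $$\sigma'=\min\left\{\gamma\left(\frac12-\frac1\eta\right),\frac{\delta+2-\mu-\nu}{2},\delta-\mu\right\}.$$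
   Context: Let $\Omega\subset\mathbb{R}^d$ ($d \ge 1$) be an open, bounded, Lipschitz domain. $\|\cdot\|_{k,p}$ and $|\cdot|_{k,p}$ denote the norm and semi-norm of the Sobolev space $W^{k,p}(\Omega)$ (with $W^{0,p}=L^p$ and $H^k=W^{k,2}$); $\|\cdot\|_{k,p,R}$ is the corresponding norm over $R\subseteq\Omega$; $|E|$ denotes the Lebesgue measure of a set $E$. $H^1_0(\Omega)$ is the space of functions in $H^1(\Omega)$ with vanishing trace on $\partial\Omega$. Let $h_0>0$. For each $0<h\le h_0$, $a_h,a_h^+:\mathcal{V}\times\mathcal{V}\to\mathbb{R}$ are (not necessarily symmetric) bilinear forms. "Uniformly continuous and coercive" means there are constants $\alpha>0$ and $M>0$ independent of $h$ such that $a_h(u,u)\ge\alpha\|u\|_{1,2}^2$ and $a_h(u,w)\le M\|u\|_{1,2}\|w\|_{1,2}$ for all $u,w\in\mathcal{V}$ and all $h\le h_0$, and the same inequalities hold for $a_h^+$ with the same constants. Let $\{\mathcal{V}_h\}_{0<h\le h_0}$ and $\{\mathcal{V}_h^+\}_{0<h\le h_0}$ be two families of finite element (finite-dimensional) subspaces of $\mathcal{V}$. The linear projectors $r_h:\mathcal{V}\to\mathcal{V}_h$ and $r_h^+:\mathcal{V}\to\mathcal{V}_h^+$ are defined (uniquely, by Lax-Milgram) by $a_h(r_hu-u,w_h)=0$ for all $w_h\in\mathcal{V}_h$, and $a_h^+(r_h^+u-u,w_h^+)=0$ for all $w_h^+\in\mathcal{V}_h^+$. The letter $C$ denotes a constant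 independent of $h$, not necessarily the same at each occurrence (and, where a bound is asserted for every function in a class, independent of that function). The convention $1/\infty=0$ is used.
   Formalization: The map π_h in (A3) is assumed to be linear (up to almost everywhere equality); for an arbitrary nonlinear map the set R_h in (B6) need not have measure O(h^γ), and the stated estimate can then fail. *)

theory Defs
  imports
    "HOL-Analysis.Analysis"
    "HOL-Probability.Essential_Supremum"
    "HOL-Library.Function_Algebras"
    "HOL-Library.Set_Algebras"
begin

text \<open>
  Elements of function spaces over an open set \<open>\<Omega>\<close> are represented by total functions; only their
  values on \<open>\<Omega>\<close> up to a Lebesgue null set matter. All sets of functions used as function spaces are
  closed under almost everywhere equality on \<open>\<Omega>\<close>, so that they correspond to sets of equivalence
  classes and their sums and intersections are those of the spaces of classes.
\<close>


section \<open>Lebesgue spaces, exponents in \<open>[1, \<infinity>]\<close>\<close>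

definition Lp_space :: "ereal \<Rightarrow> 'a::euclidean_space set \<Rightarrow> ('a \<Rightarrow> real) set" where
  "Lp_space p \<Omega> = {f. f \<in> borel_measurable (lebesgue_on \<Omega>) \<and>
     (if p = \<infinity> then esssup (lebesgue_on \<Omega>) (\<lambda>x. ennreal \<bar>f x\<bar>) < \<infinity>
      else integrable (lebesgue_on \<Omega>) (\<lambda>x. \<bar>f x\<bar> powr real_of_ereal p))}"

definition Lp_norm :: "ereal \<Rightarrow> 'a::euclidean_space set \<Rightarrow> ('a \<Rightarrow> real) \<Rightarrow> real" where
  "Lp_norm p \<Omega> f =
     (if p = \<infinity> then enn2real (esssup (lebesgue_on \<Omega>) (\<lambda>x. ennreal \<bar>f x\<bar>))
      else (\<integral>x. \<bar>f x\<bar> powr real_of_ereal p \<partial>lebesgue_on \<Omega>) powr (1 / real_of_ereal p))"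


section \<open>Weak derivatives and Sobolev spaces\<close>

definition partial :: "'n \<Rightarrow> (real^'n \<Rightarrow> real) \<Rightarrow> real^'n \<Rightarrow> real" where
  "partial i f = (\<lambda>x. frechet_derivative f (at x) (axis i 1))"

primrec partials :: "'n list \<Rightarrow> (real^'n \<Rightarrow> real) \<Rightarrow> real^'n \<Rightarrow> real" where
  "partials [] f = f"
| "partials (i # js) f = partial i (partials js f)"

text \<open>Differentiability of all iterated partial derivatives amounts to \<open>C\<^sup>\<infinity>\<close>, since
  differentiable functions are continuous.\<close>

definition smooth_fun :: "(real^'n \<Rightarrow> real) \<Rightarrow> bool" where
  "smooth_fun f \<longleftrightarrow> (\<forall>js x. partials js f differentiable (at x))"

definition test_fun :: "(real^'n) set \<Rightarrow> (real^'n \<Rightarrow> real) \<Rightarrow> bool" where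
  "test_fun \<Omega> \<phi> \<longleftrightarrow> smooth_fun \<phi> \<and> (\<exists>K. compact K \<and> K \<subseteq> \<Omega> \<and> (\<forall>x. x \<notin> K \<longrightarrow> \<phi> x = 0))"

definition locally_integrable :: "(real^'n) set \<Rightarrow> (real^'n \<Rightarrow> real) \<Rightarrow> bool" where
  "locally_integrable \<Omega> f \<longleftrightarrow> (\<forall>K. compact K \<and> K \<subseteq> \<Omega> \<longrightarrow> integrable (lebesgue_on K) f)"

text \<open>Multi-indices are functions \<open>'n \<Rightarrow> nat\<close>. The derivative \<open>D\<^sup>\<alpha> \<phi>\<close> of a smooth function is
  \<open>partials js \<phi>\<close> for any list \<open>js\<close> in which every \<open>i\<close> occurs exactly \<open>\<alpha> i\<close> times; the order is
  irrelevant by symmetry of the higher derivatives.\<close>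

definition mi_order :: "('n::finite \<Rightarrow> nat) \<Rightarrow> nat" where
  "mi_order \<alpha> = (\<Sum>i\<in>UNIV. \<alpha> i)"

definition is_weak_deriv ::
    "(real^'n) set \<Rightarrow> ('n::finite \<Rightarrow> nat) \<Rightarrow> (real^'n \<Rightarrow> real) \<Rightarrow> (real^'n \<Rightarrow> real) \<Rightarrow> bool" where
  "is_weak_deriv \<Omega> \<alpha> u v \<longleftrightarrow> locally_integrable \<Omega> u \<and> locally_integrable \<Omega> v \<and>
     (\<forall>\<phi> js. test_fun \<Omega> \<phi> \<and> (\<forall>i. count_list js i = \<alpha> i) \<longrightarrow>
        (\<integral>x. u x * partials js \<phi> x \<partial>lebesgue_on \<Omega>) =
        (-1) ^ mi_order \<alpha> * (\<integral>x. v x * \<phi> x \<partial>lebesgue_on \<Omega>))"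

text \<open>Weak derivatives are unique almost everywhere; a representative is chosen.\<close>

definition weak_deriv ::
    "(real^'n) set \<Rightarrow> ('n::finite \<Rightarrow> nat) \<Rightarrow> (real^'n \<Rightarrow> real) \<Rightarrow> real^'n \<Rightarrow> real" where
  "weak_deriv \<Omega> \<alpha> u = (if mi_order \<alpha> = 0 then u else (SOME v. is_weak_deriv \<Omega> \<alpha> u v))"

definition sobolev :: "nat \<Rightarrow> ereal \<Rightarrow> (real^'n) set \<Rightarrow> (real^'n \<Rightarrow> real) set" where
  "sobolev k p \<Omega> = {u \<in> Lp_space p \<Omega>.
     \<forall>\<alpha>. mi_order \<alpha> \<le> k \<longrightarrow> (\<exists>v \<in> Lp_space p \<Omega>. is_weak_deriv \<Omega> \<alpha> u v)}"

definition Lp_norm_family ::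
    "ereal \<Rightarrow> (real^'n) set \<Rightarrow> ('n::finite \<Rightarrow> nat) set \<Rightarrow> (real^'n \<Rightarrow> real) \<Rightarrow> real" where
  "Lp_norm_family p \<Omega> A u =
     (if p = \<infinity> then Max ((\<lambda>\<alpha>. Lp_norm p \<Omega> (weak_deriv \<Omega> \<alpha> u)) ` A)
      else (\<Sum>\<alpha>\<in>A. Lp_norm p \<Omega> (weak_deriv \<Omega> \<alpha> u) powr real_of_ereal p)
             powr (1 / real_of_ereal p))"

definition sobolev_norm :: "nat \<Rightarrow> ereal \<Rightarrow> (real^'n) set \<Rightarrow> (real^'n \<Rightarrow> real) \<Rightarrow> real" where
  "sobolev_norm k p \<Omega> u = Lp_norm_family p \<Omega> {\<alpha>. mi_order \<alpha> \<le> k} u"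

definition sobolev_seminorm :: "nat \<Rightarrow> ereal \<Rightarrow> (real^'n) set \<Rightarrow> (real^'n \<Rightarrow> real) \<Rightarrow> real" where
  "sobolev_seminorm k p \<Omega> u = Lp_norm_family p \<Omega> {\<alpha>. mi_order \<alpha> = k} u"

text \<open>The sums and maxima above range over finite sets of multi-indices.\<close>

lemma finite_multi_indices: "finite {\<alpha> :: 'n::finite \<Rightarrow> nat. mi_order \<alpha> \<le> k}"
proof (rule finite_subset)
  show "{\<alpha> :: 'n \<Rightarrow> nat. mi_order \<alpha> \<le> k} \<subseteq> PiE UNIV (\<lambda>_. {..k})"
  proof
    fix \<alpha> :: "'n \<Rightarrow> nat"
    assume "\<alpha> \<in> {\<alpha>. mi_order \<alpha> \<le> k}"
    moreover have "\<alpha> i \<le> mi_order \<alpha>" for i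
      unfolding mi_order_def by (rule member_le_sum) auto
    ultimately show "\<alpha> \<in> PiE UNIV (\<lambda>_. {..k})"
      by (auto intro: order_trans)
  qed
qed (auto intro: finite_PiE)


section \<open>Lipschitz domains, boundary traces\<close>

text \<open>Near each boundary point, \<open>\<Omega>\<close> lies on one side of the graph of a Lipschitz function \<open>g\<close> defined
  on the hyperplane orthogonal to a unit vector \<open>n\<close>.\<close>

definition lipschitz_domain :: "'a::euclidean_space set \<Rightarrow> bool" where
  "lipschitz_domain \<Omega> \<longleftrightarrow> open \<Omega> \<and>
     (\<forall>x \<in> frontier \<Omega>. \<exists>U n g L. open U \<and> x \<in> U \<and> norm n = 1 \<and>
        L-lipschitz_on {y. y \<bullet> n = 0} g \<and>
        \<Omega> \<inter> U = {y \<in> U. y \<bullet> n > g (y - (y \<bullet> n) *\<^sub>R n)})"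

definition hausdorff_outer :: "nat \<Rightarrow> 'a::metric_space set \<Rightarrow> ennreal" where
  "hausdorff_outer s A = (SUP \<epsilon> \<in> {0<..}.
     INF U \<in> {U :: nat \<Rightarrow> 'a set. A \<subseteq> (\<Union>i. U i) \<and> (\<forall>i. bounded (U i) \<and> diameter (U i) \<le> \<epsilon>)}.
       (\<Sum>i. if U i = {} then 0
            else ennreal (unit_ball_vol (real s) * (diameter (U i) / 2) ^ s)))"

text \<open>A metric outer measure, hence countably additive on the Borel sets.\<close>

definition hausdorff_measure :: "nat \<Rightarrow> 'a::metric_space measure" where
  "hausdorff_measure s = measure_of UNIV (sets borel) (hausdorff_outer s)"

text \<open>The trace operator \<open>H\<^sup>1(\<Omega>) \<rightarrow> L\<^sup>2(\<partial>\<Omega>)\<close> is the continuous extension of the restriction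
  \<open>\<phi> \<mapsto> \<phi>|\<^bsub>\<partial>\<Omega>\<^esub>\<close> of smooth functions, which are dense in \<open>H\<^sup>1(\<Omega>)\<close> when \<open>\<Omega>\<close> is a bounded Lipschitz
  domain.\<close>

definition has_trace :: "(real^'n) set \<Rightarrow> (real^'n \<Rightarrow> real) \<Rightarrow> (real^'n \<Rightarrow> real) \<Rightarrow> bool" where
  "has_trace \<Omega> u g \<longleftrightarrow> (\<exists>\<phi> :: nat \<Rightarrow> real^'n \<Rightarrow> real.
     (\<forall>k. smooth_fun (\<phi> k) \<and> \<phi> k \<in> sobolev 1 2 \<Omega>) \<and>
     (\<lambda>k. sobolev_norm 1 2 \<Omega> (\<phi> k - u)) \<longlonglongrightarrow> 0 \<and>
     (\<lambda>k. \<integral>\<^sup>+x\<in>frontier \<Omega>. ennreal ((\<phi> k x - g x)\<^sup>2) \<partial>hausdorff_measure (CARD('n) - 1))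
       \<longlonglongrightarrow> 0)"

definition H10 :: "(real^'n) set \<Rightarrow> (real^'n \<Rightarrow> real) set" where
  "H10 \<Omega> = {u \<in> sobolev 1 2 \<Omega>. has_trace \<Omega> u (\<lambda>x. 0)}"


section \<open>Spaces of functions modulo almost everywhere equality\<close>

definition ae_eq :: "'a::euclidean_space set \<Rightarrow> ('a \<Rightarrow> real) \<Rightarrow> ('a \<Rightarrow> real) \<Rightarrow> bool" where
  "ae_eq \<Omega> f g \<longleftrightarrow> (AE x in lebesgue_on \<Omega>. f x = g x)"

definition function_space :: "'a::euclidean_space set \<Rightarrow> ('a \<Rightarrow> real) set \<Rightarrow> bool" where
  "function_space \<Omega> W \<longleftrightarrow> 0 \<in> W \<and> (\<forall>f\<in>W. \<forall>g\<in>W. f + g \<in> W) \<and>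
     (\<forall>c. \<forall>f\<in>W. (\<lambda>x. c * f x) \<in> W) \<and> (\<forall>f\<in>W. \<forall>g. ae_eq \<Omega> f g \<longrightarrow> g \<in> W)"

definition finite_dimensional_space :: "'a::euclidean_space set \<Rightarrow> ('a \<Rightarrow> real) set \<Rightarrow> bool" where
  "finite_dimensional_space \<Omega> W \<longleftrightarrow> function_space \<Omega> W \<and>
     (\<exists>B. finite B \<and> B \<subseteq> W \<and> (\<forall>f\<in>W. \<exists>c. ae_eq \<Omega> f (\<lambda>x. \<Sum>b\<in>B. c b * b x)))"

text \<open>A linear map of equivalence classes, given on representatives.\<close>

definition linear_map_on ::
    "'a::euclidean_space set \<Rightarrow> ('a \<Rightarrow> real) set \<Rightarrow> (('a \<Rightarrow> real) \<Rightarrow> ('a \<Rightarrow> real)) \<Rightarrow> bool" where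
  "linear_map_on \<Omega> W T \<longleftrightarrow>
     (\<forall>f\<in>W. \<forall>g\<in>W. ae_eq \<Omega> (T (f + g)) (T f + T g)) \<and>
     (\<forall>c. \<forall>f\<in>W. ae_eq \<Omega> (T (\<lambda>x. c * f x)) (\<lambda>x. c * T f x))"

definition bilinear_form_on ::
    "('a \<Rightarrow> real) set \<Rightarrow> (('a \<Rightarrow> real) \<Rightarrow> ('a \<Rightarrow> real) \<Rightarrow> real) \<Rightarrow> bool" where
  "bilinear_form_on V a \<longleftrightarrow>
     (\<forall>u\<in>V. \<forall>v\<in>V. \<forall>w\<in>V. a (u + v) w = a u w + a v w \<and> a w (u + v) = a w u + a w v) \<and>
     (\<forall>c. \<forall>u\<in>V. \<forall>w\<in>V. a (\<lambda>x. c * u x) w = c * a u w \<and> a w (\<lambda>x. c * u x) = c * a w u)"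

text \<open>The essential support, as a relatively closed subset of \<open>\<Omega>\<close>.\<close>

definition ess_supp :: "'a::euclidean_space set \<Rightarrow> ('a \<Rightarrow> real) \<Rightarrow> 'a set" where
  "ess_supp \<Omega> f = {x \<in> \<Omega>. \<forall>U. open U \<and> x \<in> U \<longrightarrow> \<not> ae_eq (\<Omega> \<inter> U) f 0}"


section \<open>Uniformly coercive forms, Galerkin projectors, smoothing property\<close>

definition coercive_continuous ::
    "(real^'n) set \<Rightarrow> (real^'n \<Rightarrow> real) set \<Rightarrow> real \<Rightarrow> real \<Rightarrow>
     ((real^'n \<Rightarrow> real) \<Rightarrow> (real^'n \<Rightarrow> real) \<Rightarrow> real) \<Rightarrow> bool" where
  "coercive_continuous \<Omega> V \<alpha> M a \<longleftrightarrow>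
     (\<forall>u\<in>V. a u u \<ge> \<alpha> * (sobolev_norm 1 2 \<Omega> u)\<^sup>2) \<and>
     (\<forall>u\<in>V. \<forall>w\<in>V. a u w \<le> M * sobolev_norm 1 2 \<Omega> u * sobolev_norm 1 2 \<Omega> w)"

text \<open>For coercive \<open>a\<close> and finite-dimensional \<open>W\<close>, the projector exists and is determined up to
  almost everywhere equality.\<close>

definition galerkin_projector ::
    "((real^'n \<Rightarrow> real) \<Rightarrow> (real^'n \<Rightarrow> real) \<Rightarrow> real) \<Rightarrow> (real^'n \<Rightarrow> real) set \<Rightarrow>
     (real^'n \<Rightarrow> real) set \<Rightarrow> ((real^'n \<Rightarrow> real) \<Rightarrow> (real^'n \<Rightarrow> real)) \<Rightarrow> bool" where
  "galerkin_projector a V W r \<longleftrightarrow> (\<forall>u\<in>V. r u \<in> W \<and> (\<forall>w\<in>W. a (r u - u) w = 0))"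

definition smoothing_property ::
    "(real^'n) set \<Rightarrow> (real^'n \<Rightarrow> real) set \<Rightarrow> real \<Rightarrow>
     ((real^'n \<Rightarrow> real) \<Rightarrow> (real^'n \<Rightarrow> real) \<Rightarrow> real) \<Rightarrow> bool" where
  "smoothing_property \<Omega> V C a \<longleftrightarrow> (\<forall>f \<in> Lp_space 2 \<Omega>.
     \<exists>w\<in>V. (\<forall>y\<in>V. a y w = (\<integral>x. f x * y x \<partial>lebesgue_on \<Omega>)) \<and>
       (\<forall>w'\<in>V. (\<forall>y\<in>V. a y w' = (\<integral>x. f x * y x \<partial>lebesgue_on \<Omega>)) \<longrightarrow> ae_eq \<Omega> w' w) \<and>
       w \<in> sobolev 2 2 \<Omega> \<and> sobolev_norm 2 2 \<Omega> w \<le> C * Lp_norm 2 \<Omega> f)"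

text \<open>Subdomains are arbitrary open subsets; they need not be connected.\<close>

definition local_continuity ::
    "(real^'n) set \<Rightarrow> (real^'n \<Rightarrow> real) set \<Rightarrow> real \<Rightarrow>
     ((real^'n \<Rightarrow> real) \<Rightarrow> (real^'n \<Rightarrow> real) \<Rightarrow> real) \<Rightarrow> bool" where
  "local_continuity \<Omega> V C a \<longleftrightarrow>
     (\<forall>R. open R \<and> R \<subseteq> \<Omega> \<longrightarrow> (\<forall>v\<in>V. \<forall>w\<in>V. ess_supp \<Omega> w \<subseteq> R \<longrightarrow>
        \<bar>a v w\<bar> \<le> C * sobolev_norm 1 2 R v * sobolev_norm 1 2 R w))"

end

theory Submission imports Defs begin

text \<open>
  Let \<open>z = r\<^sub>h\<^sup>+ u - r\<^sub>h u\<close>. Coercivity bounds \<open>\<alpha> \<parallel>z\<parallel>\<^sup>2\<close> by \<open>a\<^sub>h\<^sup>+(z, \<pi>\<^sub>h z) + a\<^sub>h\<^sup>+(z, z - \<pi>\<^sub>h z)\<close>. Since \<open>\<pi>\<^sub>h z\<close> lies in both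
  discrete spaces, Galerkin orthogonality turns the first term into the perturbation \<open>(a\<^sub>h - a\<^sub>h\<^sup>+)(r\<^sub>h u - u, \<pi>\<^sub>h z)\<close>; the
  second one only sees the small support of \<open>z - \<pi>\<^sub>h z\<close>, where Hoelder's inequality gains \<open>h\<close> to the power
  \<open>\<gamma> (1/2 - 1/\<eta>)\<close>. An Aubin-Nitsche argument with the solution \<open>w\<close> of \<open>a\<^sub>h(y, w) = (z, y)\<close> then gives
  \<open>\<parallel>z\<parallel>\<^sup>2 = a\<^sub>h(z, w - i\<^sub>h w) + a\<^sub>h(r\<^sub>h\<^sup>+ u - u, i\<^sub>h w - i\<^sub>h\<^sup>+ w) + (a\<^sub>h - a\<^sub>h\<^sup>+)(r\<^sub>h\<^sup>+ u - u, i\<^sub>h\<^sup>+ w)\<close> in \<open>L\<^sup>2\<close>. The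
  set \<open>R\<^sub>h\<close> containing the support of \<open>i\<^sub>h w - i\<^sub>h\<^sup>+ w\<close> is a union over infinitely many functions, but it is small
  because it is already the support of one generic \<open>v - \<pi>\<^sub>h v\<close>. The last term needs the embedding
  of \<open>W\<^bsup>2,2\<^esup>\<close> into \<open>W\<^bsup>\<nu>,q\<^esup>\<close>: the interior cone of a Lipschitz domain bounds a function pointwise by the Riesz
  potential of its gradient, and the potential is estimated by splitting it into small and large scales.
\<close>

section \<open>Lebesgue spaces\<close>

text \<open>The difference of the two projections lies only in the sum of the discrete spaces, so
  neither Galerkin equation can be tested with it; hence the detour through their intersection. Each
  entry of the minimum comes from one estimate. The entry \<gamma> (1/2 - 1/\<eta>) is gained twice
  in the quadratic energy bound, so once after the square root, and once in the duality bound. The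
  entry (\<delta> + 2 - \<mu> - \<nu>) / 2 comes from the perturbation in the energy bound after an
  inverse estimate, a factor h^2 and a square root; \<delta> - \<mu> comes from the perturbation in
  the duality bound. (A3) controls one defect at a time while (B6) speaks of all of them; linearity
  of the map reduces the union to a single support. The embedding is derived without extension
  operators or maximal functions: averages over cubes shrinking along a cone telescope into a
  potential, and the critical exponent is reached by truncating the gradient at a height depending
  on the level. Constants are never optimised, and triangle inequalities carry factors that count
  multi-indices.\<close>

lemma powr_add_le:
  fixes x y p :: real
  assumes "0 \<le> x" "0 \<le> y" "1 \<le> p"
  shows "x powr p + y powr p \<le> (x + y) powr p"
proof (cases "x + y = 0")
  case True
  then show ?thesis using assms by (simp add: add_nonneg_eq_0_iff)
next
  case False
  define s where "s = x + y"
  have s: "s > 0" using False assms by (simp add: s_def)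
  have le: "t powr p \<le> s powr p * (t / s)" if "0 \<le> t" "t \<le> s" for t
  proof -
    have "(t / s) powr p \<le> (t / s) powr 1"
      using that s assms(3) by (intro powr_mono') auto
    then show ?thesis
      using that s by (simp add: powr_divide field_simps)
  qed
  have "x powr p + y powr p \<le> s powr p * (x / s) + s powr p * (y / s)"
    using assms by (intro add_mono le) (auto simp: s_def)
  also have "\<dots> = s powr p * ((x + y) / s)"
    by (simp add: add_divide_distrib distrib_left)
  finally show ?thesis using s by (simp add: s_def)
qed

text \<open>The sum is at most twice the larger entry. This crude bound covers every exponent p >= 0
  and is the source of the factor 2 in \<open>Lp_lincomb\<close> for finite exponents.\<close>

lemma powr_add_le_max:
  fixes x y p :: real
  assumes "0 \<le> p"
  shows "\<bar>x + y\<bar> powr p \<le> 2 powr p * (\<bar>x\<bar> powr p + \<bar>y\<bar> powr p)"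
proof -
  have "\<bar>x + y\<bar> powr p \<le> (2 * max \<bar>x\<bar> \<bar>y\<bar>) powr p"
    using assms by (intro powr_mono2) auto
  also have "\<dots> = 2 powr p * max \<bar>x\<bar> \<bar>y\<bar> powr p"
    by (simp add: powr_mult)
  also have "\<dots> \<le> 2 powr p * (\<bar>x\<bar> powr p + \<bar>y\<bar> powr p)"
    by (intro mult_left_mono) (auto simp: max_def)
  finally show ?thesis .
qed

text \<open>Hoelder's inequality against the constant 1. It is obtained by integrating Young's
  inequality with weights \<open>p / r\<close> and \<open>1 - p / r\<close> for the normalised
  function \<open>\<bar>f x\<bar> powr r * (m / A)\<close>, whose mean is 1; the cases where the
  normalisation would divide by zero are those of a vanishing function.\<close>

lemma (in finite_measure) integral_powr_mono:
  fixes f :: "'a \<Rightarrow> real" and p r :: real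
  assumes f: "f \<in> borel_measurable M" and int: "integrable M (\<lambda>x. \<bar>f x\<bar> powr r)"
    and pr: "0 < p" "p \<le> r"
  shows "integrable M (\<lambda>x. \<bar>f x\<bar> powr p)"
    and "(\<integral>x. \<bar>f x\<bar> powr p \<partial>M) \<le>
      measure M (space M) powr (1 - p / r) * (\<integral>x. \<bar>f x\<bar> powr r \<partial>M) powr (p / r)"
proof -
  define m where "m = measure M (space M)"
  define A where "A = (\<integral>x. \<bar>f x\<bar> powr r \<partial>M)"
  have r: "r > 0" using pr by simp
  have A0: "A \<ge> 0" unfolding A_def by simp
  show i: "integrable M (\<lambda>x. \<bar>f x\<bar> powr p)"
  proof (rule Bochner_Integration.integrable_bound)
    show "integrable M (\<lambda>x. 1 + \<bar>f x\<bar> powr r)" using int by simp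
    have "\<bar>f x\<bar> powr p \<le> 1 + \<bar>f x\<bar> powr r" for x
    proof (cases "\<bar>f x\<bar> \<le> 1")
      case True
      then have "\<bar>f x\<bar> powr p \<le> 1" using pr by (intro powr_le1) auto
      then show ?thesis by (simp add: add_increasing2)
    next
      case False
      then have "\<bar>f x\<bar> powr p \<le> \<bar>f x\<bar> powr r" using pr by (intro powr_mono) auto
      then show ?thesis by simp
    qed
    then show "AE x in M. norm (\<bar>f x\<bar> powr p) \<le> norm (1 + \<bar>f x\<bar> powr r)"
      by (simp add: abs_of_nonneg add_nonneg_nonneg)
  qed (use f in measurable)
  show "(\<integral>x. \<bar>f x\<bar> powr p \<partial>M) \<le> measure M (space M) powr (1 - p / r) * A powr (p / r)"
  proof (cases "A = 0 \<or> m = 0")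
    case True
    then have "AE x in M. \<bar>f x\<bar> powr p = 0"
    proof
      assume "A = 0"
      then have "AE x in M. \<bar>f x\<bar> powr r = 0"
        using int unfolding A_def by (subst (asm) integral_nonneg_eq_0_iff_AE) auto
      then show ?thesis by simp
    next
      assume "m = 0"
      then have "emeasure M (space M) = 0" by (simp add: m_def emeasure_eq_measure)
      then show ?thesis by (intro AE_I[where N="space M"]) auto
    qed
    then have "(\<integral>x. \<bar>f x\<bar> powr p \<partial>M) = (\<integral>x. 0 \<partial>M)"
      using f by (intro integral_cong_AE) auto
    then show ?thesis by simp
  next
    case False
    then have A: "A > 0" and m: "m > 0" using A0 by (auto simp: m_def less_le)
    define c where "c = (m / A) powr (p / r)"
    have c: "c > 0" using A m by (simp add: c_def)
    have pt: "c * \<bar>f x\<bar> powr p \<le> (p / r) * (m / A) * \<bar>f x\<bar> powr r + (1 - p / r)" for x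
    proof -
      have "(\<bar>f x\<bar> powr r * (m / A)) powr (p / r) * 1 powr (1 - p / r)
         \<le> (p / r) * (\<bar>f x\<bar> powr r * (m / A)) + (1 - p / r) * 1"
      proof (cases "f x = 0")
        case True then show ?thesis using pr by simp
      next
        case False
        then show ?thesis using pr r A m by (intro Youngs_inequality_0) auto
      qed
      moreover have "(\<bar>f x\<bar> powr r * (m / A)) powr (p / r) = c * \<bar>f x\<bar> powr p"
        using r A m by (subst powr_mult) (auto simp: powr_powr c_def)
      ultimately show ?thesis by (simp add: mult_ac)
    qed
    have "(\<integral>x. c * \<bar>f x\<bar> powr p \<partial>M) \<le> (\<integral>x. (p / r) * (m / A) * \<bar>f x\<bar> powr r + (1 - p / r) \<partial>M)"
      using i int pt by (intro integral_mono) auto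
    also have "\<dots> = (p / r) * (m / A) * A + m * (1 - p / r)"
      using int by (simp add: A_def m_def)
    also have "\<dots> = m" using A by (simp add: field_simps)
    finally have "(\<integral>x. \<bar>f x\<bar> powr p \<partial>M) \<le> m / c"
      using c by (simp add: field_simps)
    also have "m / c = m powr (1 - p / r) * A powr (p / r)"
      using A m by (simp add: c_def powr_divide powr_diff)
    finally show ?thesis by (simp add: m_def)
  qed
qed

lemma Lp_norm_nonneg [simp]: "0 \<le> Lp_norm p S f"
  by (simp add: Lp_norm_def)

text \<open>Rests on the completeness of Lebesgue measure; extension by zero moves the question to
  the whole space.\<close>

lemma borel_measurable_lebesgue_on_cong_AE:
  fixes f g :: "'a::euclidean_space \<Rightarrow> real"
  assumes S: "S \<in> sets lebesgue" and ae: "AE x in lebesgue_on S. f x = g x"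
    and f: "f \<in> borel_measurable (lebesgue_on S)"
  shows "g \<in> borel_measurable (lebesgue_on S)"
proof -
  have "(\<lambda>x. if x \<in> S then f x else 0) \<in> borel_measurable lebesgue"
    using f S by (simp add: borel_measurable_if)
  moreover have "AE x in lebesgue. (if x \<in> S then f x else 0) = (if x \<in> S then g x else 0)"
    using ae S by (subst (asm) AE_restrict_space_iff) auto
  ultimately have "(\<lambda>x. if x \<in> S then g x else 0) \<in> borel_measurable lebesgue"
    by (rule borel_measurable_AE)
  then show ?thesis using S by (simp add: borel_measurable_if)
qed

lemma Lp_space_cong_AE:
  assumes S: "S \<in> sets lebesgue" and ae: "AE x in lebesgue_on S. f x = g x"
    and f: "f \<in> Lp_space p S"
  shows "g \<in> Lp_space p S" and "Lp_norm p S g = Lp_norm p S f"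
proof -
  have fm: "f \<in> borel_measurable (lebesgue_on S)" using f by (simp add: Lp_space_def)
  have gm: "g \<in> borel_measurable (lebesgue_on S)"
    using borel_measurable_lebesgue_on_cong_AE[OF S ae fm] .
  have e: "esssup (lebesgue_on S) (\<lambda>x. ennreal \<bar>f x\<bar>) = esssup (lebesgue_on S) (\<lambda>x. ennreal \<bar>g x\<bar>)"
    using fm gm ae by (intro esssup_AE_cong) auto
  have i: "integrable (lebesgue_on S) (\<lambda>x. \<bar>f x\<bar> powr real_of_ereal p) =
      integrable (lebesgue_on S) (\<lambda>x. \<bar>g x\<bar> powr real_of_ereal p)"
    using fm gm ae by (intro integrable_cong_AE) auto
  have j: "(\<integral>x. \<bar>f x\<bar> powr real_of_ereal p \<partial>lebesgue_on S) =
      (\<integral>x. \<bar>g x\<bar> powr real_of_ereal p \<partial>lebesgue_on S)"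
    using fm gm ae by (intro integral_cong_AE) auto
  show "g \<in> Lp_space p S" using f gm e i by (auto simp: Lp_space_def)
  show "Lp_norm p S g = Lp_norm p S f" using e j by (simp add: Lp_norm_def)
qed

lemma AE_le_Lp_norm_infinity:
  assumes "f \<in> Lp_space \<infinity> S"
  shows "AE x in lebesgue_on S. \<bar>f x\<bar> \<le> Lp_norm \<infinity> S f"
proof -
  have fin: "esssup (lebesgue_on S) (\<lambda>x. ennreal \<bar>f x\<bar>) < \<infinity>" using assms by (simp add: Lp_space_def)
  have "AE x in lebesgue_on S. ennreal \<bar>f x\<bar> \<le> esssup (lebesgue_on S) (\<lambda>x. ennreal \<bar>f x\<bar>)"
    by (rule esssup_AE)
  then show ?thesis
  proof eventually_elim
    case (elim x)
    then show ?case using fin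
      by (auto simp: Lp_norm_def top_unique less_top dest: enn2real_mono)
  qed
qed

lemma Lp_infinityI:
  assumes "f \<in> borel_measurable (lebesgue_on S)" "AE x in lebesgue_on S. \<bar>f x\<bar> \<le> c" "0 \<le> c"
  shows "f \<in> Lp_space \<infinity> S" and "Lp_norm \<infinity> S f \<le> c"
proof -
  have le: "esssup (lebesgue_on S) (\<lambda>x. ennreal \<bar>f x\<bar>) \<le> ennreal c"
    using assms by (intro esssup_I) (auto simp: ennreal_leI)
  then show "f \<in> Lp_space \<infinity> S" using assms(1) by (auto simp: Lp_space_def intro: le_less_trans)
  show "Lp_norm \<infinity> S f \<le> c"
    using enn2real_mono[OF le] assms(3) by (simp add: Lp_norm_def)
qed

lemma Lp_norm_powr:
  fixes p :: real
  assumes "0 < p"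
  shows "Lp_norm (ereal p) S f powr p = (\<integral>x. \<bar>f x\<bar> powr p \<partial>lebesgue_on S)"
  using assms by (simp add: Lp_norm_def powr_powr)

lemma Lp_norm_le_iff:
  fixes p :: real
  assumes "0 < p" "0 \<le> c"
  shows "Lp_norm (ereal p) S f \<le> c \<longleftrightarrow> (\<integral>x. \<bar>f x\<bar> powr p \<partial>lebesgue_on S) \<le> c powr p"
  using Lp_norm_powr[OF assms(1), of S f] assms
  by (metis Lp_norm_nonneg powr_mono2 powr_less_mono2 not_le less_le)

text \<open>Minkowski's inequality is replaced by a quasi-triangle inequality: a pointwise bound is
  integrated and the two norms are collected by superadditivity of the power. The factor 2 only
  enters the final constant.\<close>

lemma Lp_lincomb:
  fixes p :: ereal
  assumes p: "1 \<le> p" and f: "f \<in> Lp_space p S" and g: "g \<in> Lp_space p S"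
  shows "(\<lambda>x. a * f x + b * g x) \<in> Lp_space p S"
    and "Lp_norm p S (\<lambda>x. a * f x + b * g x) \<le> 2 * (\<bar>a\<bar> * Lp_norm p S f + \<bar>b\<bar> * Lp_norm p S g)"
proof -
  define h where "h = (\<lambda>x. a * f x + b * g x)"
  define c where "c = \<bar>a\<bar> * Lp_norm p S f + \<bar>b\<bar> * Lp_norm p S g"
  have c: "0 \<le> c" by (simp add: c_def)
  have m [measurable]: "f \<in> borel_measurable (lebesgue_on S)" "g \<in> borel_measurable (lebesgue_on S)"
    using f g by (auto simp: Lp_space_def)
  have hm: "h \<in> borel_measurable (lebesgue_on S)" unfolding h_def by measurable
  have "h \<in> Lp_space p S \<and> Lp_norm p S h \<le> 2 * c"
  proof (cases p)
    case PInf
    have "AE x in lebesgue_on S. \<bar>h x\<bar> \<le> c"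
      using AE_le_Lp_norm_infinity[OF f[unfolded PInf]] AE_le_Lp_norm_infinity[OF g[unfolded PInf]]
    proof eventually_elim
      case (elim x)
      have "\<bar>h x\<bar> \<le> \<bar>a\<bar> * \<bar>f x\<bar> + \<bar>b\<bar> * \<bar>g x\<bar>"
        unfolding h_def by (metis abs_mult abs_triangle_ineq)
      also have "\<dots> \<le> c"
        using elim unfolding c_def PInf by (intro add_mono mult_left_mono) auto
      finally show ?case .
    qed
    from Lp_infinityI[OF hm this c] show ?thesis using c by (auto simp: PInf)
  next
    case (real r)
    have r: "1 \<le> r" using p real by simp
    have fi: "integrable (lebesgue_on S) (\<lambda>x. \<bar>f x\<bar> powr r)"
      and gi: "integrable (lebesgue_on S) (\<lambda>x. \<bar>g x\<bar> powr r)"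
      using f g real by (auto simp: Lp_space_def)
    define F where "F = (\<lambda>x. 2 powr r * (\<bar>a\<bar> powr r * \<bar>f x\<bar> powr r + \<bar>b\<bar> powr r * \<bar>g x\<bar> powr r))"
    have F: "integrable (lebesgue_on S) F" unfolding F_def using fi gi by simp
    have le: "\<bar>h x\<bar> powr r \<le> F x" for x
      using powr_add_le_max[of r "a * f x" "b * g x"] r
      by (simp add: F_def h_def abs_mult powr_mult)
    have hi: "integrable (lebesgue_on S) (\<lambda>x. \<bar>h x\<bar> powr r)"
      using le by (intro Bochner_Integration.integrable_bound[OF F])
        (use hm in \<open>auto intro: order_trans[OF _ abs_ge_self]\<close>)
    have "(\<integral>x. \<bar>h x\<bar> powr r \<partial>lebesgue_on S) \<le> (\<integral>x. F x \<partial>lebesgue_on S)"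
      by (intro integral_mono hi F le)
    also have "\<dots> = 2 powr r * (\<bar>a\<bar> powr r * Lp_norm p S f powr r + \<bar>b\<bar> powr r * Lp_norm p S g powr r)"
      using fi gi r by (simp add: F_def real Lp_norm_powr)
    also have "\<dots> = 2 powr r * ((\<bar>a\<bar> * Lp_norm p S f) powr r + (\<bar>b\<bar> * Lp_norm p S g) powr r)"
      by (simp add: powr_mult)
    also have "\<dots> \<le> 2 powr r * c powr r"
      unfolding c_def using r by (intro mult_left_mono powr_add_le) auto
    also have "\<dots> = (2 * c) powr r" using c by (simp add: powr_mult)
    finally have "Lp_norm p S h \<le> 2 * c"
      unfolding real using r c by (subst Lp_norm_le_iff) auto
    moreover have "h \<in> Lp_space p S" using hm hi real by (simp add: Lp_space_def)
    ultimately show ?thesis by simp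
  qed (use p in auto)
  then show "(\<lambda>x. a * f x + b * g x) \<in> Lp_space p S"
    and "Lp_norm p S (\<lambda>x. a * f x + b * g x) \<le> 2 * (\<bar>a\<bar> * Lp_norm p S f + \<bar>b\<bar> * Lp_norm p S g)"
    by (auto simp: h_def c_def)
qed

lemma zero_in_Lp_space [simp]: "(\<lambda>x. 0) \<in> Lp_space p S"
  by (cases "p = \<infinity>") (auto simp: Lp_space_def intro!: le_less_trans[OF esssup_I[where c=0]])

lemma Lp_norm_zero [simp]: "0 < p \<Longrightarrow> Lp_norm p S (\<lambda>x. 0) = 0"
  using Lp_infinityI(2)[of "\<lambda>x. 0" S 0] by (cases p) (auto simp: Lp_norm_def intro: antisym)

lemma AE_lebesgue_on_subset:
  assumes "AE x in lebesgue_on S. P x" "T \<subseteq> S" "S \<in> sets lebesgue" "T \<in> sets lebesgue"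
  shows "AE x in lebesgue_on T. P x"
  using assms by (auto simp: AE_restrict_space_iff elim!: eventually_mono)

lemma integrable_lebesgue_on_subset:
  fixes f :: "'a::euclidean_space \<Rightarrow> real"
  assumes "integrable (lebesgue_on S) f" "T \<subseteq> S" "S \<in> sets lebesgue" "T \<in> sets lebesgue"
  shows "integrable (lebesgue_on T) f"
proof -
  have "integrable lebesgue (\<lambda>x. indicat_real S x *\<^sub>R f x)"
    using assms by (simp add: integrable_restrict_space)
  from integrable_mult_indicator[OF assms(4) this]
  have "integrable lebesgue (\<lambda>x. indicat_real T x *\<^sub>R (indicat_real S x *\<^sub>R f x))" .
  also have "(\<lambda>x. indicat_real T x *\<^sub>R (indicat_real S x *\<^sub>R f x)) = (\<lambda>x. indicat_real T x *\<^sub>R f x)"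
    using assms(2) by (auto simp: indicator_def fun_eq_iff)
  finally show ?thesis using assms by (simp add: integrable_restrict_space)
qed

lemma borel_measurable_lebesgue_on_subset:
  fixes f :: "'a::euclidean_space \<Rightarrow> real"
  assumes "f \<in> borel_measurable (lebesgue_on S)" "T \<subseteq> S"
  shows "f \<in> borel_measurable (lebesgue_on T)"
  using assms by (rule measurable_restrict_mono)

lemma Lp_subset:
  fixes p :: ereal
  assumes p: "1 \<le> p" and f: "f \<in> Lp_space p S"
    and T: "T \<subseteq> S" "S \<in> sets lebesgue" "T \<in> sets lebesgue"
  shows "f \<in> Lp_space p T" and "Lp_norm p T f \<le> Lp_norm p S f"
proof -
  have m: "f \<in> borel_measurable (lebesgue_on S)" using f by (simp add: Lp_space_def)
  have mT: "f \<in> borel_measurable (lebesgue_on T)"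
    by (rule borel_measurable_lebesgue_on_subset[OF m T(1)])
  have "f \<in> Lp_space p T \<and> Lp_norm p T f \<le> Lp_norm p S f"
  proof (cases p)
    case PInf
    have "AE x in lebesgue_on T. \<bar>f x\<bar> \<le> Lp_norm \<infinity> S f"
      using AE_lebesgue_on_subset[OF AE_le_Lp_norm_infinity T] f PInf by simp
    from Lp_infinityI[OF mT this] show ?thesis by (simp add: PInf)
  next
    case (real r)
    have r: "1 \<le> r" using p real by simp
    have i: "integrable (lebesgue_on S) (\<lambda>x. \<bar>f x\<bar> powr r)" using f real by (simp add: Lp_space_def)
    have iT: "integrable (lebesgue_on T) (\<lambda>x. \<bar>f x\<bar> powr r)"
      by (rule integrable_lebesgue_on_subset[OF i T])
    have "(\<integral>x. \<bar>f x\<bar> powr r \<partial>lebesgue_on T) \<le> (\<integral>x. \<bar>f x\<bar> powr r \<partial>lebesgue_on S)"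
      by (rule integral_mono_lebesgue_on_AE[OF i]) (use T in auto)
    then have "Lp_norm p T f \<le> Lp_norm p S f"
      unfolding real using r by (subst Lp_norm_le_iff) (auto simp: Lp_norm_powr)
    then show ?thesis using mT iT real by (simp add: Lp_space_def)
  qed (use p in auto)
  then show "f \<in> Lp_space p T" and "Lp_norm p T f \<le> Lp_norm p S f" by auto
qed

lemma measure_lebesgue_on:
  "S \<in> sets lebesgue \<Longrightarrow> measure (lebesgue_on S) S = measure lebesgue S"
  by (simp add: measure_restrict_space)

text \<open>The power of the measure produced here becomes, for p = 2 and a set of measure of order
  h^\<gamma>, the gain with exponent \<gamma> (1/2 - 1/\<eta>). For r = \<infinity> the term
  \<open>real_of_ereal (1 / r)\<close> is 0, so one formula serves both cases.\<close>

lemma Lp_mono_exponent: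
  fixes p :: real and r :: ereal
  assumes p: "1 \<le> p" "ereal p \<le> r" and f: "f \<in> Lp_space r S" and S: "S \<in> lmeasurable"
  shows "f \<in> Lp_space (ereal p) S"
    and "Lp_norm (ereal p) S f \<le> measure lebesgue S powr (1 / p - real_of_ereal (1 / r)) * Lp_norm r S f"
proof -
  interpret finite_measure "lebesgue_on S" using S by (rule finite_measure_lebesgue_on)
  have Ss: "S \<in> sets lebesgue" using S by auto
  have m: "f \<in> borel_measurable (lebesgue_on S)" using f by (simp add: Lp_space_def)
  have "f \<in> Lp_space (ereal p) S \<and>
    Lp_norm (ereal p) S f \<le> measure lebesgue S powr (1 / p - real_of_ereal (1 / r)) * Lp_norm r S f"
  proof (cases r)
    case PInf
    define N where "N = Lp_norm \<infinity> S f"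
    have N: "0 \<le> N" by (simp add: N_def)
    have ae: "AE x in lebesgue_on S. \<bar>f x\<bar> powr p \<le> N powr p"
      using AE_le_Lp_norm_infinity[OF f[unfolded PInf]] p
      by (auto simp: N_def elim!: eventually_mono intro!: powr_mono2)
    have i: "integrable (lebesgue_on S) (\<lambda>x. \<bar>f x\<bar> powr p)"
      using ae m by (intro integrable_const_bound[where B="N powr p"]) auto
    have "(\<integral>x. \<bar>f x\<bar> powr p \<partial>lebesgue_on S) \<le> (\<integral>x. N powr p \<partial>lebesgue_on S)"
      using i ae by (intro integral_mono_AE) auto
    also have "\<dots> = measure lebesgue S * N powr p"
      using Ss by (simp add: measure_lebesgue_on)
    also have "\<dots> = (measure lebesgue S powr (1 / p) * N) powr p"
      using p N by (simp add: powr_mult powr_powr)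
    finally have "Lp_norm (ereal p) S f \<le> measure lebesgue S powr (1 / p) * N"
      using p N by (subst Lp_norm_le_iff) auto
    then show ?thesis using i m by (simp add: PInf N_def Lp_space_def)
  next
    case (real s)
    have s: "p \<le> s" "0 < s" using p real by auto
    have i: "integrable (lebesgue_on S) (\<lambda>x. \<bar>f x\<bar> powr s)" using f real by (simp add: Lp_space_def)
    have p0: "0 < p" using p by simp
    note * = integral_powr_mono[OF m i p0 s(1)]
    have "(\<integral>x. \<bar>f x\<bar> powr p \<partial>lebesgue_on S) \<le>
       measure lebesgue S powr (1 - p / s) * (Lp_norm r S f powr s) powr (p / s)"
      using *(2) Ss s by (simp add: measure_lebesgue_on real Lp_norm_powr)
    also have "\<dots> = (measure lebesgue S powr (1 / p - 1 / s) * Lp_norm r S f) powr p"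
    proof -
      have "(1 / p - 1 / s) * p = 1 - p / s" using p by (simp add: left_diff_distrib)
      then show ?thesis using s by (simp add: powr_mult powr_powr)
    qed
    finally have "Lp_norm (ereal p) S f \<le> measure lebesgue S powr (1 / p - 1 / s) * Lp_norm r S f"
      using p by (subst Lp_norm_le_iff) auto
    moreover have "real_of_ereal (1 / r) = 1 / s" using s real by (simp add: one_ereal_def)
    ultimately show ?thesis using *(1) m by (simp add: Lp_space_def)
  qed (use p in auto)
  then show "f \<in> Lp_space (ereal p) S"
    and "Lp_norm (ereal p) S f \<le> measure lebesgue S powr (1 / p - real_of_ereal (1 / r)) * Lp_norm r S f"
    by auto
qed

lemma Lp_embedding:
  fixes p r :: ereal
  assumes p: "1 \<le> p" "p \<le> r" and S: "S \<in> lmeasurable"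
  shows "\<exists>C>0. \<forall>f\<in>Lp_space r S. f \<in> Lp_space p S \<and> Lp_norm p S f \<le> C * Lp_norm r S f"
proof (cases p)
  case PInf
  then show ?thesis using p by (intro exI[of _ 1]) auto
next
  case (real s)
  define C where "C = 1 + measure lebesgue S powr (1 / s - real_of_ereal (1 / r))"
  have C: "C > 0" by (simp add: C_def add_pos_nonneg)
  moreover have "f \<in> Lp_space p S \<and> Lp_norm p S f \<le> C * Lp_norm r S f" if f: "f \<in> Lp_space r S" for f
  proof -
    note * = Lp_mono_exponent[of s r f S] 
    have "f \<in> Lp_space p S"
      "Lp_norm p S f \<le> measure lebesgue S powr (1 / s - real_of_ereal (1 / r)) * Lp_norm r S f"
      using * p real f S by auto
    moreover have "\<dots> \<le> C * Lp_norm r S f" by (intro mult_right_mono) (auto simp: C_def)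
    ultimately show ?thesis by simp
  qed
  ultimately show ?thesis by blast
qed (use p in auto)

lemma Lp_integrable:
  fixes p :: ereal
  assumes "1 \<le> p" "f \<in> Lp_space p S" "S \<in> lmeasurable"
  shows "integrable (lebesgue_on S) f"
proof -
  have "f \<in> Lp_space (ereal 1) S"
    using Lp_mono_exponent(1)[of 1 p f S] assms by (simp add: one_ereal_def)
  then have "integrable (lebesgue_on S) (\<lambda>x. \<bar>f x\<bar>)" and "f \<in> borel_measurable (lebesgue_on S)"
    by (auto simp: Lp_space_def powr_one')
  then show ?thesis using integrable_abs_cancel by blast
qed

lemma Lp_norm_two_square:
  "(\<integral>x. z x * z x \<partial>lebesgue_on S) = (Lp_norm 2 S z)\<^sup>2"
proof -
  have "(Lp_norm (ereal 2) S z) powr 2 = (\<integral>x. \<bar>z x\<bar> powr 2 \<partial>lebesgue_on S)"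
    by (rule Lp_norm_powr) simp
  then show ?thesis by (simp add: power2_eq_square powr_numeral flip: abs_mult)
qed

section \<open>Families of derivatives and their finite l^p norms\<close>

lemma Lp_norm_le_family:
  assumes A: "finite A" and \<alpha>: "\<alpha> \<in> A" and p: "1 \<le> p"
  shows "Lp_norm p S (weak_deriv S \<alpha> u) \<le> Lp_norm_family p S A u"
proof (cases p)
  case PInf
  then show ?thesis using A \<alpha> by (auto simp: Lp_norm_family_def)
next
  case (real r)
  have r: "1 \<le> r" using p real by simp
  let ?x = "\<lambda>\<alpha>. Lp_norm p S (weak_deriv S \<alpha> u)"
  have "?x \<alpha> = (?x \<alpha> powr r) powr (1 / r)" using r by (simp add: powr_powr)
  also have "\<dots> \<le> (\<Sum>\<alpha>\<in>A. ?x \<alpha> powr r) powr (1 / r)"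
    using r A \<alpha> by (intro powr_mono2 member_le_sum) auto
  finally show ?thesis using real by (simp add: Lp_norm_family_def)
qed (use p in auto)

text \<open>Superadditivity of the power, iterated over the finite family. Together with
  \<open>Lp_norm_le_family\<close> it reduces every Sobolev norm estimate to one derivative at a
  time, at the price of the number of multi-indices.\<close>

lemma Lp_norm_family_le_sum:
  assumes A: "finite A" "A \<noteq> {}" and p: "1 \<le> p"
  shows "Lp_norm_family p S A u \<le> (\<Sum>\<alpha>\<in>A. Lp_norm p S (weak_deriv S \<alpha> u))"
proof (cases p)
  case PInf
  then show ?thesis using A by (auto simp: Lp_norm_family_def intro!: member_le_sum)
next
  case (real r)
  have r: "1 \<le> r" using p real by simp
  let ?x = "\<lambda>\<alpha>. Lp_norm p S (weak_deriv S \<alpha> u)"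
  have "(\<Sum>\<alpha>\<in>A. ?x \<alpha> powr r) \<le> (\<Sum>\<alpha>\<in>A. ?x \<alpha>) powr r"
    using A(1)
  proof (induction A rule: finite_induct)
    case (insert b B)
    have "(\<Sum>\<alpha>\<in>insert b B. ?x \<alpha> powr r) \<le> ?x b powr r + (\<Sum>\<alpha>\<in>B. ?x \<alpha>) powr r"
      using insert by simp
    also have "\<dots> \<le> (?x b + (\<Sum>\<alpha>\<in>B. ?x \<alpha>)) powr r"
      using r by (intro powr_add_le sum_nonneg) auto
    finally show ?case using insert by simp
  qed simp
  then have "(\<Sum>\<alpha>\<in>A. ?x \<alpha> powr r) powr (1 / r) \<le> ((\<Sum>\<alpha>\<in>A. ?x \<alpha>) powr r) powr (1 / r)"
    using r by (intro powr_mono2 sum_nonneg) auto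
  also have "\<dots> = (\<Sum>\<alpha>\<in>A. ?x \<alpha>)" using r by (simp add: powr_powr sum_nonneg)
  finally show ?thesis using real by (simp add: Lp_norm_family_def)
qed (use p in auto)

section \<open>Smooth functions\<close>

text \<open>Smoothness of a given order is witnessed by a chain of derivative functions. Asking for
  a witness instead of iterating \<open>deriv\<close> lets sums, products and inverses be treated by
  induction with explicit formulas.\<close>

primrec Ck_real :: "nat \<Rightarrow> (real \<Rightarrow> real) \<Rightarrow> bool" where
  "Ck_real 0 f \<longleftrightarrow> True"
| "Ck_real (Suc n) f \<longleftrightarrow> (\<exists>f'. (\<forall>x. (f has_real_derivative f' x) (at x)) \<and> Ck_real n f')"

lemma Ck_real_SucI:
  "(\<And>x. (f has_real_derivative f' x) (at x)) \<Longrightarrow> Ck_real n f' \<Longrightarrow> Ck_real (Suc n) f"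
  by auto

lemma Ck_real_mono: "Ck_real (Suc n) f \<Longrightarrow> Ck_real n f"
  by (induction n arbitrary: f) (simp, metis Ck_real.simps(2))

lemma Ck_real_const: "Ck_real n (\<lambda>x. c)"
proof (induction n arbitrary: c)
  case (Suc n)
  show ?case by (rule Ck_real_SucI[OF _ Suc[of 0]]) auto
qed simp

lemma Ck_real_add: "Ck_real n f \<Longrightarrow> Ck_real n g \<Longrightarrow> Ck_real n (\<lambda>x. f x + g x)"
proof (induction n arbitrary: f g)
  case (Suc n)
  then obtain f' g' where *: "\<And>x. (f has_real_derivative f' x) (at x)" "Ck_real n f'"
    "\<And>x. (g has_real_derivative g' x) (at x)" "Ck_real n g'" by auto
  show ?case
    by (rule Ck_real_SucI[where f'="\<lambda>x. f' x + g' x"]) (auto intro!: Suc.IH * derivative_intros)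
qed simp

lemma Ck_real_mult: "Ck_real n f \<Longrightarrow> Ck_real n g \<Longrightarrow> Ck_real n (\<lambda>x. f x * g x)"
proof (induction n arbitrary: f g)
  case (Suc n)
  then obtain f' g' where *: "\<And>x. (f has_real_derivative f' x) (at x)" "Ck_real n f'"
    "\<And>x. (g has_real_derivative g' x) (at x)" "Ck_real n g'" by auto
  have fg: "Ck_real n f" "Ck_real n g"
    using Ck_real_mono[OF Suc.prems(1)] Ck_real_mono[OF Suc.prems(2)] by auto
  show ?case
  proof (rule Ck_real_SucI[where f'="\<lambda>x. f' x * g x + g' x * f x"])
    show "Ck_real n (\<lambda>x. f' x * g x + g' x * f x)"
      using * fg by (intro Ck_real_add Suc.IH)
    show "((\<lambda>x. f x * g x) has_real_derivative f' x * g x + g' x * f x) (at x)" for x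
      by (rule DERIV_mult[OF *(1) *(3)])
  qed
qed simp

lemma Ck_real_inverse:
  "Ck_real n f \<Longrightarrow> (\<And>x. f x \<noteq> 0) \<Longrightarrow> Ck_real n (\<lambda>x. inverse (f x))"
proof (induction n)
  case (Suc n)
  then obtain f' where *: "\<And>x. (f has_real_derivative f' x) (at x)" "Ck_real n f'" by auto
  have i: "Ck_real n (\<lambda>x. inverse (f x))" using Suc.IH[OF Ck_real_mono[OF Suc.prems(1)] Suc.prems(2)] .
  show ?case
  proof (rule Ck_real_SucI)
    show "((\<lambda>x. inverse (f x)) has_real_derivative (-1) * (f' x * (inverse (f x) * inverse (f x)))) (at x)" for x
      using DERIV_inverse_fun[OF *(1) Suc.prems(2), of x] by (simp add: power2_eq_square mult_ac)
    show "Ck_real n (\<lambda>x. (-1) * (f' x * (inverse (f x) * inverse (f x))))"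
      by (intro Ck_real_mult Ck_real_const * i)
  qed
qed simp

lemma Ck_real_affine: "Ck_real n f \<Longrightarrow> Ck_real n (\<lambda>x. f (c * x + d))"
proof (induction n arbitrary: f)
  case (Suc n)
  then obtain f' where *: "\<And>x. (f has_real_derivative f' x) (at x)" "Ck_real n f'" by auto
  show ?case
  proof (rule Ck_real_SucI)
    show "((\<lambda>x. f (c * x + d)) has_real_derivative f' (c * x + d) * c) (at x)" for x
      by (rule DERIV_chain2[OF *(1)]) (auto intro!: derivative_eq_intros)
    show "Ck_real n (\<lambda>x. f' (c * x + d) * c)"
      by (intro Ck_real_mult Ck_real_const Suc.IH *)
  qed
qed simp

text \<open>For \<open>m = 0\<close> this is the classical function exp(-1/t), flat at the origin.
  The additional negative powers of t make the linear span of the family closed under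
  differentiation, which is what the induction on the order uses.\<close>

definition flat_fun :: "nat \<Rightarrow> real \<Rightarrow> real" where
  "flat_fun m t = (if t > 0 then exp (- inverse t) * inverse t ^ m else 0)"

lemma flat_fun_tendsto: "(flat_fun m \<longlongrightarrow> 0) (at_right 0)"
proof -
  have "((\<lambda>t. inverse t ^ m / exp (inverse t)) \<longlongrightarrow> 0) (at_right (0::real))"
    by (rule filterlim_compose[OF tendsto_power_div_exp_0 filterlim_inverse_at_top_right])
  then show ?thesis
    by (rule Lim_transform_eventually)
      (auto simp: flat_fun_def eventually_at_filter exp_minus field_simps)
qed

lemma DERIV_flat_fun:
  "(flat_fun m has_real_derivative flat_fun (m + 2) t + (- real m) * flat_fun (m + 1) t) (at t)"
proof -
  consider "t > 0" | "t < 0" | "t = 0" by linarith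
  then show ?thesis
  proof cases
    case 1
    have i: "(inverse has_real_derivative - (inverse t ^ 2)) (at t)"
      using DERIV_inverse[of t] 1 by (simp add: numeral_2_eq_2)
    have p: "((\<lambda>t. inverse t ^ m) has_real_derivative - real m * inverse t ^ (m + 1)) (at t)"
      by (rule DERIV_cong[OF DERIV_power[OF i, of m]]) (cases m, auto simp: power2_eq_square algebra_simps)
    have e: "((\<lambda>t. exp (- inverse t)) has_real_derivative exp (- inverse t) * inverse t ^ 2) (at t)"
      by (rule DERIV_cong[OF DERIV_fun_exp[OF DERIV_minus[OF i]]]) simp
    have "((\<lambda>t. exp (- inverse t) * inverse t ^ m) has_real_derivative
        flat_fun (m + 2) t + (- real m) * flat_fun (m + 1) t) (at t)"
      by (rule DERIV_cong[OF DERIV_mult[OF e p]]) (simp add: flat_fun_def 1 power_add algebra_simps power2_eq_square)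
    then show ?thesis
      by (rule has_field_derivative_transform_within_open[where S="{0<..}"]) (use 1 in \<open>auto simp: flat_fun_def\<close>)
  next
    case 2
    have "((\<lambda>t. 0) has_real_derivative flat_fun (m + 2) t + (- real m) * flat_fun (m + 1) t) (at t)"
      using 2 by (simp add: flat_fun_def)
    then show ?thesis
      by (rule has_field_derivative_transform_within_open[where S="{..<0}"]) (use 2 in \<open>auto simp: flat_fun_def\<close>)
  next
    case 3
    have "((\<lambda>h. (flat_fun m (0 + h) - flat_fun m 0) / h) \<longlongrightarrow> 0) (at 0)"
    proof (rule filterlim_split_at)
      show "((\<lambda>h. (flat_fun m (0 + h) - flat_fun m 0) / h) \<longlongrightarrow> 0) (at_left 0)"
        by (rule Lim_transform_eventually[OF tendsto_const])
          (auto simp: flat_fun_def eventually_at_filter)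
      \<comment> \<open>For \<open>h > 0\<close> the difference quotient at the origin is
        \<open>flat_fun (Suc m) h\<close>.\<close>
      show "((\<lambda>h. (flat_fun m (0 + h) - flat_fun m 0) / h) \<longlongrightarrow> 0) (at_right 0)"
        by (rule Lim_transform_eventually[OF flat_fun_tendsto[of "Suc m"]])
          (auto simp: flat_fun_def eventually_at_filter divide_inverse)
    qed
    then show ?thesis using 3 by (simp add: DERIV_def flat_fun_def)
  qed
qed

lemma Ck_real_flat_fun: "Ck_real n (flat_fun m)"
proof (induction n arbitrary: m)
  case (Suc n)
  show ?case
    by (rule Ck_real_SucI[OF DERIV_flat_fun]) (intro Ck_real_add Ck_real_mult Ck_real_const Suc)
qed simp

text \<open>The step is f(1 + t) / (f(1 + t) + f(1 - t)) with f = \<open>flat_fun 0\<close>; the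
  denominator is positive because 1 + t or 1 - t is. The step yields bumps on boxes, and its
  derivative \<open>b\<close> yields averaging kernels.\<close>

lemma smooth_step_exists:
  obtains \<beta> b :: "real \<Rightarrow> real" and C :: real where
    "\<And>n. Ck_real n \<beta>" "\<And>n. Ck_real n b" "\<And>t. (\<beta> has_real_derivative b t) (at t)"
    "\<And>t. t \<le> -1 \<Longrightarrow> \<beta> t = 0" "\<And>t. 1 \<le> t \<Longrightarrow> \<beta> t = 1" "\<And>t. 0 \<le> \<beta> t" "\<And>t. \<beta> t \<le> 1"
    "\<And>t. 1 < \<bar>t\<bar> \<Longrightarrow> b t = 0" "\<And>t. \<bar>b t\<bar> \<le> C" "0 < C"
proof -
  \<comment> \<open>The redundant factor 1 gives the argument the affine shape that
    \<open>Ck_real_affine\<close> expects.\<close>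
  define num where "num t = flat_fun 0 (1 * t + 1)" for t
  define den where "den t = flat_fun 0 (1 * t + 1) + flat_fun 0 ((-1) * t + 1)" for t
  define \<beta> where "\<beta> t = num t * inverse (den t)" for t
  have den: "den t > 0" for t
    by (auto simp: den_def flat_fun_def intro: add_pos_pos)
  have den0: "den t \<noteq> 0" for t using den[of t] by simp
  have "Ck_real n den" "Ck_real n num" for n
    unfolding den_def num_def by (intro Ck_real_add Ck_real_affine Ck_real_flat_fun)+
  then have CK: "Ck_real n \<beta>" for n
    unfolding \<beta>_def by (intro Ck_real_mult Ck_real_inverse den0)
  define b where "b = deriv \<beta>"
  have D: "(\<beta> has_real_derivative b t) (at t)" for t
  proof -
    obtain f' where f': "\<And>x. (\<beta> has_real_derivative f' x) (at x)" using CK[of "Suc 0"] by auto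
    then show ?thesis unfolding b_def DERIV_imp_deriv[OF f'] by simp
  qed
  have Ckb: "Ck_real n b" for n
  proof -
    obtain f' where f': "\<And>x. (\<beta> has_real_derivative f' x) (at x)" "Ck_real n f'"
      using CK[of "Suc n"] by auto
    then have "f' = b" using D DERIV_unique by blast
    then show ?thesis using f' by simp
  qed
  have b0: "\<beta> t = 0" if "t \<le> -1" for t using that by (simp add: \<beta>_def num_def flat_fun_def)
  have b1: "\<beta> t = 1" if "1 \<le> t" for t
    using that by (simp add: \<beta>_def num_def den_def flat_fun_def)
  have bd: "0 \<le> \<beta> t" "\<beta> t \<le> 1" for t
  proof -
    have "0 \<le> num t" "num t \<le> den t" by (auto simp: num_def den_def flat_fun_def)
    then show "0 \<le> \<beta> t" "\<beta> t \<le> 1"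
      using den[of t] by (auto simp: \<beta>_def divide_inverse[symmetric])
  qed
  have z: "b t = 0" if t: "1 < \<bar>t\<bar>" for t
  proof -
    have "(\<beta> has_real_derivative 0) (at t)"
    proof (cases "t > 1")
      case True
      show ?thesis
        by (rule has_field_derivative_transform_within_open[where S="{1<..}" and f="\<lambda>_. 1"])
          (use True b1 in auto)
    next
      case False
      then have "t < -1" using t by auto
      then show ?thesis
        by (intro has_field_derivative_transform_within_open[where S="{..<-1}" and f="\<lambda>_. 0" and g=\<beta>])
          (use b0 in auto)
    qed
    then show ?thesis using D DERIV_unique by blast
  qed
  have "continuous_on {-1..1} b"
  proof -
    obtain b' where "\<And>x. (b has_real_derivative b' x) (at x)" using Ckb[of "Suc 0"] by auto
    then show ?thesis by (intro continuous_at_imp_continuous_on ballI DERIV_isCont)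
  qed
  then have "bounded (b ` {-1..1})" by (intro compact_imp_bounded compact_continuous_image) auto
  then obtain C where C: "C > 0" "\<And>t. t \<in> {-1..1} \<Longrightarrow> \<bar>b t\<bar> \<le> C"
    unfolding bounded_pos by auto
  have bC: "\<bar>b t\<bar> \<le> C" for t
  proof (cases "\<bar>t\<bar> \<le> 1")
    case True
    then show ?thesis by (intro C(2)) (simp add: abs_le_iff)
  next
    case False
    then show ?thesis using C(1) z[of t] by simp
  qed
  show thesis
    by (rule that[OF CK Ckb D b0 b1 bd z bC C(1)])
qed

text \<open>Here derivatives are taken off on the inside, whereas \<open>partials\<close> adds them
  on the outside; \<open>partials_snoc\<close> reconciles the two orders. The bounded order makes
  the product rule accessible to induction.\<close>

primrec smooth_upto :: "nat \<Rightarrow> (real^'n \<Rightarrow> real) \<Rightarrow> bool" where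
  "smooth_upto 0 f \<longleftrightarrow> True"
| "smooth_upto (Suc n) f \<longleftrightarrow> (\<forall>x. f differentiable (at x)) \<and> (\<forall>i. smooth_upto n (partial i f))"

lemma partials_snoc: "partials (js @ [i]) f = partials js (partial i f)"
  by (induction js) auto

lemma smooth_upto_partials:
  "smooth_upto (Suc (length js)) f \<Longrightarrow> partials js f differentiable (at x)"
  by (induction js arbitrary: f rule: rev_induct) (auto simp: partials_snoc)

lemma smooth_funI: "(\<And>n. smooth_upto n f) \<Longrightarrow> smooth_fun f"
  unfolding smooth_fun_def using smooth_upto_partials by blast

lemma smooth_fun_partial: "smooth_fun f \<Longrightarrow> smooth_fun (partial i f)"
  unfolding smooth_fun_def by (metis partials_snoc)

lemma partial_eqI: "(f has_derivative f') (at x) \<Longrightarrow> partial i f x = f' (axis i 1)"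
  by (simp add: partial_def flip: frechet_derivative_at)

lemma smooth_upto_mono: "smooth_upto (Suc n) f \<Longrightarrow> smooth_upto n f"
  by (induction n arbitrary: f) auto

lemma smooth_upto_const: "smooth_upto n (\<lambda>x::real^'n. c)"
proof (induction n arbitrary: c)
  case (Suc n)
  have "partial i (\<lambda>x::real^'n. c) = (\<lambda>x. 0)" for i
    by (auto simp: fun_eq_iff intro!: partial_eqI[where f'="\<lambda>_. 0", THEN trans])
  then show ?case using Suc by simp
qed simp

lemma smooth_upto_add:
  "smooth_upto n f \<Longrightarrow> smooth_upto n g \<Longrightarrow> smooth_upto n (\<lambda>x. f x + g x)"
proof (induction n arbitrary: f g)
  case (Suc n)
  have d: "(f has_derivative frechet_derivative f (at x)) (at x)"
    "(g has_derivative frechet_derivative g (at x)) (at x)" for x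
    using Suc.prems by (auto simp: frechet_derivative_works)
  have "partial i (\<lambda>x. f x + g x) = (\<lambda>x. partial i f x + partial i g x)" for i
    by (auto simp: fun_eq_iff partial_def intro!: partial_eqI[OF has_derivative_add[OF d], unfolded partial_def])
  then show ?case using Suc by (auto intro: differentiable_add)
qed simp

lemma smooth_upto_mult:
  "smooth_upto n f \<Longrightarrow> smooth_upto n g \<Longrightarrow> smooth_upto n (\<lambda>x. f x * g x)"
proof (induction n arbitrary: f g)
  case (Suc n)
  have d: "(f has_derivative frechet_derivative f (at x)) (at x)"
    "(g has_derivative frechet_derivative g (at x)) (at x)" for x
    using Suc.prems by (auto simp: frechet_derivative_works)
  have "partial i (\<lambda>x. f x * g x) = (\<lambda>x. f x * partial i g x + partial i f x * g x)" for i
    by (auto simp: fun_eq_iff partial_def intro!: partial_eqI[OF has_derivative_mult[OF d], unfolded partial_def])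
  note p = this
  have fg: "smooth_upto n f" "smooth_upto n g"
    using smooth_upto_mono[OF Suc.prems(1)] smooth_upto_mono[OF Suc.prems(2)] by auto
  show ?case
    unfolding smooth_upto.simps p
  proof (intro conjI allI)
    show "(\<lambda>x. f x * g x) differentiable at x" for x
      using Suc.prems by (intro differentiable_mult) auto
    show "smooth_upto n (\<lambda>x. f x * partial i g x + partial i f x * g x)" for i
      using Suc.prems fg by (intro smooth_upto_add Suc.IH) auto
  qed
qed simp

section \<open>Smooth products of functions of a single coordinate\<close>

lemma has_derivative_coordinate:
  fixes x :: "real^'n"
  assumes "(G has_real_derivative G') (at (x $ j))"
  shows "((\<lambda>x. G (x $ j)) has_derivative (\<lambda>h. G' * (h $ j))) (at x)"
  using has_derivative_compose[OF bounded_linear_imp_has_derivative[OF bounded_linear_vec_nth]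
      assms[unfolded has_field_derivative_def]]
  by simp

lemma smooth_upto_coordinate: "Ck_real n G \<Longrightarrow> smooth_upto n (\<lambda>x. G (x $ j))"
proof (induction n arbitrary: G)
  case (Suc n)
  then obtain G' where G': "\<And>x. (G has_real_derivative G' x) (at x)" "Ck_real n G'" by auto
  have "partial i (\<lambda>x. G (x $ j)) = (\<lambda>x. G' (x $ j) * (if i = j then 1 else 0))" for i
    by (auto simp: fun_eq_iff axis_def partial_eqI[OF has_derivative_coordinate[OF G'(1)]])
  note p = this
  show ?case
    unfolding smooth_upto.simps p
    using smooth_upto_mult[OF Suc.IH[OF G'(2)] smooth_upto_const]
      differentiableI[OF has_derivative_coordinate[OF G'(1)]]
    by (intro conjI allI)
qed simp

lemma smooth_upto_prod:
  "finite I \<Longrightarrow> (\<And>j. j \<in> I \<Longrightarrow> smooth_upto n (f j)) \<Longrightarrow> smooth_upto n (\<lambda>x. \<Prod>j\<in>I. f j x)"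
  by (induction I rule: finite_induct) (auto intro!: smooth_upto_const smooth_upto_mult)

lemma smooth_fun_product:
  fixes G :: "'n::finite \<Rightarrow> real \<Rightarrow> real"
  assumes "\<And>j n. Ck_real n (G j)"
  shows "smooth_fun (\<lambda>x::real^'n. \<Prod>j\<in>UNIV. G j (x $ j))"
  by (intro smooth_funI smooth_upto_prod smooth_upto_coordinate assms) auto

lemma partial_product:
  fixes G :: "'n::finite \<Rightarrow> real \<Rightarrow> real"
  assumes G: "\<And>j t. (G j has_real_derivative G' j t) (at t)"
  shows "partial i (\<lambda>x::real^'n. \<Prod>j\<in>UNIV. G j (x $ j)) x =
    G' i (x $ i) * (\<Prod>j\<in>UNIV - {i}. G j (x $ j))"
proof -
  have "((\<lambda>x::real^'n. \<Prod>j\<in>UNIV. G j (x $ j)) has_derivative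
    (\<lambda>h. \<Sum>k\<in>UNIV. (G' k (x $ k) * h $ k) * (\<Prod>j\<in>UNIV - {k}. G j (x $ j)))) (at x)"
    by (intro has_derivative_prod has_derivative_coordinate G)
  from partial_eqI[OF this, of i] show ?thesis
    by (simp add: axis_def if_distrib if_distribR sum.delta' cong: if_cong)
qed

section \<open>Test functions and their derivatives\<close>

lemma partials_eq_0_outside:
  assumes K: "closed K" and z: "\<And>x. x \<notin> K \<Longrightarrow> \<phi> x = 0" and x: "x \<notin> K"
  shows "partials js \<phi> x = 0"
  using x
proof (induction js arbitrary: x)
  case (Cons i js)
  have "(partials js \<phi> has_derivative (\<lambda>_. 0)) (at x)"
    by (rule has_derivative_transform_within_open[OF has_derivative_const, of "- K"])
      (use Cons K in auto)
  from partial_eqI[OF this] show ?case by simp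
qed (use z in simp)

lemma test_fun_partial:
  assumes "test_fun \<Omega> \<phi>" shows "test_fun \<Omega> (partial i \<phi>)"
proof -
  obtain K where K: "compact K" "K \<subseteq> \<Omega>" "\<And>x. x \<notin> K \<Longrightarrow> \<phi> x = 0"
    using assms by (auto simp: test_fun_def)
  have "partial i \<phi> x = 0" if "x \<notin> K" for x
    using partials_eq_0_outside[of K \<phi> x "[i]"] K that by (simp add: compact_imp_closed)
  then show ?thesis using assms K smooth_fun_partial by (auto simp: test_fun_def)
qed

lemma test_fun_partials: "test_fun \<Omega> \<phi> \<Longrightarrow> test_fun \<Omega> (partials js \<phi>)"
  by (induction js) (auto intro: test_fun_partial)

lemma continuous_on_test_fun: "test_fun \<Omega> \<phi> \<Longrightarrow> continuous_on A \<phi>"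
proof (rule continuous_at_imp_continuous_on, rule ballI)
  fix x
  assume "test_fun \<Omega> \<phi>"
  then have "partials [] \<phi> differentiable (at x)" unfolding test_fun_def smooth_fun_def by blast
  then show "isCont \<phi> x" by (simp add: differentiable_imp_continuous_within)
qed

section \<open>Weak derivatives\<close>

text \<open>The positive and the negative part of \<open>g\<close> are densities of two measures
  that agree on boxes. Boxes form an intersection-stable generator of the Borel sets, so the
  measures coincide, and uniqueness of densities forces the two parts to be equal, hence
  zero.\<close>

lemma AE_eq_0_if_box_integrals_0:
  fixes g :: "'a::euclidean_space \<Rightarrow> real"
  assumes g: "integrable lborel g" and 0: "\<And>c d. (\<integral>x. indicator (box c d) x *\<^sub>R g x \<partial>lborel) = 0"
  shows "AE x in lborel. g x = 0"
proof -
  have gm [measurable]: "g \<in> borel_measurable borel" using borel_measurable_integrable[OF g] by simp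
  have i: "integrable lborel (\<lambda>x. indicator (box c d) x *\<^sub>R g x)" for c d :: 'a
    by (rule integrable_mult_indicator[OF _ g]) simp
  have P: "emeasure (density lborel (\<lambda>x. ennreal (g x))) (box c d) =
      (\<integral>\<^sup>+x. ennreal (indicator (box c d) x *\<^sub>R g x) \<partial>lborel)" for c d
    by (subst emeasure_density) (auto intro!: nn_integral_cong simp: indicator_def)
  have N: "emeasure (density lborel (\<lambda>x. ennreal (- g x))) (box c d) =
      (\<integral>\<^sup>+x. ennreal (- (indicator (box c d) x *\<^sub>R g x)) \<partial>lborel)" for c d
    by (subst emeasure_density) (auto intro!: nn_integral_cong simp: indicator_def)
  have fin: "(\<integral>\<^sup>+x. ennreal (indicator (box c d) x *\<^sub>R g x) \<partial>lborel) \<noteq> \<infinity>"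
    "(\<integral>\<^sup>+x. ennreal (- (indicator (box c d) x *\<^sub>R g x)) \<partial>lborel) \<noteq> \<infinity>" for c d
    by (rule conjunct1[OF conjunct2[OF iffD1[OF real_integrable_def i]]],
        rule conjunct2[OF conjunct2[OF iffD1[OF real_integrable_def i]]])
  have eq: "(\<integral>\<^sup>+x. ennreal (indicator (box c d) x *\<^sub>R g x) \<partial>lborel) =
    (\<integral>\<^sup>+x. ennreal (- (indicator (box c d) x *\<^sub>R g x)) \<partial>lborel)" (is "?p = ?n") for c d
  proof -
    have "enn2real ?p = enn2real ?n"
      using real_lebesgue_integral_def[OF i[of c d]] 0[of c d] by linarith
    then have "ennreal (enn2real ?p) = ennreal (enn2real ?n)" by (rule arg_cong)
    moreover have "ennreal (enn2real ?p) = ?p" "ennreal (enn2real ?n) = ?n"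
      using fin[of c d] by (auto intro!: ennreal_enn2real simp: less_top)
    ultimately show ?thesis by (rule box_equals)
  qed
  let ?E = "range (\<lambda>(a, b). box a b::'a set)"
  let ?A = "\<lambda>n::nat. box (- (real n *\<^sub>R One)) (real n *\<^sub>R One) :: 'a set"
  have "density lborel (\<lambda>x. ennreal (g x)) = density lborel (\<lambda>x. ennreal (- g x))"
  proof (rule measure_eqI_generator_eq[of ?E UNIV _ _ ?A])
    show "Int_stable ?E" by (auto simp: Int_stable_def box_Int_box)
    show "?E \<subseteq> Pow UNIV" by simp
    show "sets (density lborel (\<lambda>x. ennreal (g x))) = sigma_sets UNIV ?E"
      "sets (density lborel (\<lambda>x. ennreal (- g x))) = sigma_sets UNIV ?E"
      by (simp_all add: borel_eq_box)
    show "range ?A \<subseteq> ?E" "(\<Union>i. ?A i) = UNIV" unfolding UN_box_eq_UNIV by auto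
    show "emeasure (density lborel (\<lambda>x. ennreal (g x))) (?A i) \<noteq> \<infinity>" for i
      unfolding P by (rule fin)
    fix X assume "X \<in> ?E"
    then obtain c d where X: "X = box c d" by auto
    show "emeasure (density lborel (\<lambda>x. ennreal (g x))) X = emeasure (density lborel (\<lambda>x. ennreal (- g x))) X"
      unfolding X P N by (rule eq)
  qed
  then have "AE x in lborel. ennreal (g x) = ennreal (- g x)"
    by (subst (asm) sigma_finite_measure.density_unique_iff[OF lborel.sigma_finite_measure_axioms]) auto
  then show ?thesis
  proof eventually_elim
    case (elim x)
    then show ?case
      by (cases "0 \<le> g x") (auto simp: ennreal_neg ennreal_eq_0_iff eq_commute[of "0::ennreal"])
  qed
qed

text \<open>Smooth bumps converge boundedly to the indicator of a box, so the integrals of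
  \<open>v\<close> over boxes whose closure lies in \<open>\<Omega>\<close> vanish. This makes
  \<open>v\<close> zero almost everywhere on each such box, and countably many boxes exhaust
  \<open>\<Omega>\<close>.\<close>

lemma fundamental_lemma:
  fixes v :: "real^'n \<Rightarrow> real"
  assumes \<Omega>: "open \<Omega>" and v: "locally_integrable \<Omega> v"
    and 0: "\<And>\<phi>. test_fun \<Omega> \<phi> \<Longrightarrow> (\<integral>x. v x * \<phi> x \<partial>lebesgue_on \<Omega>) = 0"
  shows "AE x in lebesgue_on \<Omega>. v x = 0"
proof -
  obtain \<beta> b :: "real \<Rightarrow> real" and C :: real where \<beta>:
    "\<And>n. Ck_real n \<beta>" "\<And>n. Ck_real n b" "\<And>t. (\<beta> has_real_derivative b t) (at t)"
    "\<And>t. t \<le> -1 \<Longrightarrow> \<beta> t = 0" "\<And>t. 1 \<le> t \<Longrightarrow> \<beta> t = 1" "\<And>t. 0 \<le> \<beta> t" "\<And>t. \<beta> t \<le> 1"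
    using smooth_step_exists by metis
  have \<Omega>s: "\<Omega> \<in> sets lebesgue" using \<Omega> by auto
  have box: "(\<integral>x. v x \<partial>lebesgue_on (box c d)) = 0" if cd: "cbox c d \<subseteq> \<Omega>" for c d
  proof -
    \<comment> \<open>For \<open>k > 0\<close> the factor of a coordinate vanishes outside the side
      of the box and equals 1 at distance at least \<open>2 / k\<close> from both ends of
      it.\<close>
    define \<phi> where "\<phi> k x = (\<Prod>j\<in>UNIV. \<beta> (real k * x $ j + (- real k * c $ j - 1)) *
        \<beta> (- real k * x $ j + (real k * d $ j - 1)))" for k :: nat and x :: "real^'n"
    have z: "\<phi> k x = 0" if "x \<notin> box c d" for k x
    proof -
      have "\<not> (\<forall>j. c $ j < x $ j \<and> x $ j < d $ j)" using that by (simp add: mem_box_cart)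
      then obtain j where "x $ j \<le> c $ j \<or> d $ j \<le> x $ j" by (meson not_less)
      then have "real k * x $ j \<le> real k * c $ j \<or> real k * d $ j \<le> real k * x $ j"
        by (auto intro: mult_left_mono)
      then have "\<beta> (real k * x $ j + (- real k * c $ j - 1)) *
        \<beta> (- real k * x $ j + (real k * d $ j - 1)) = 0"
        by (auto intro!: \<beta>(4))
      then show ?thesis unfolding \<phi>_def by (intro prod_zero) auto
    qed
    have z': "\<phi> k x = 0" if "x \<notin> cbox c d" for k x
      using z[of x k] that box_subset_cbox by blast
    have tf: "test_fun \<Omega> (\<phi> k)" for k
      unfolding test_fun_def
    proof (intro conjI exI[of _ "cbox c d"])
      show "smooth_fun (\<phi> k)"
        unfolding \<phi>_def by (intro smooth_fun_product Ck_real_mult Ck_real_affine \<beta>)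
    qed (use cd z' in auto)
    have cont: "continuous_on A (\<phi> k)" for A k
      by (rule continuous_on_test_fun[OF tf])
    have one: "\<phi> k x \<in> {0..1}" for k x
      unfolding \<phi>_def using \<beta>(6,7) by (auto intro!: prod_nonneg prod_le_1 mult_le_one)
    have lim: "(\<lambda>k. \<phi> k x) \<longlonglongrightarrow> indicat_real (box c d) x" for x
    proof (cases "x \<in> box c d")
      case True
      have "\<forall>\<^sub>F k in sequentially. \<forall>j\<in>UNIV. \<beta> (real k * x $ j + (- real k * c $ j - 1)) *
        \<beta> (- real k * x $ j + (real k * d $ j - 1)) = 1"
      proof (intro eventually_ball_finite ballI)
        fix j :: 'n
        have p: "x $ j - c $ j > 0" "d $ j - x $ j > 0" using True by (auto simp: mem_box_cart)
        have "\<forall>\<^sub>F k in sequentially. 2 / (x $ j - c $ j) \<le> real k"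
          and "\<forall>\<^sub>F k in sequentially. 2 / (d $ j - x $ j) \<le> real k"
          using filterlim_real_sequentially unfolding filterlim_at_top by blast+
        then show "\<forall>\<^sub>F k in sequentially. \<beta> (real k * x $ j + (- real k * c $ j - 1)) *
          \<beta> (- real k * x $ j + (real k * d $ j - 1)) = 1"
        proof eventually_elim
          case (elim k)
          then have "2 \<le> real k * (x $ j - c $ j)" "2 \<le> real k * (d $ j - x $ j)"
            using p by (auto simp: pos_divide_le_eq)
          then show ?case by (auto simp: algebra_simps \<beta>(5))
        qed
      qed auto
      then have "\<forall>\<^sub>F k in sequentially. \<phi> k x = 1"
        by eventually_elim (simp add: \<phi>_def)
      then show ?thesis using True by (auto intro: tendsto_eventually)
    next
      case False
      then show ?thesis using z by simp
    qed
    have iv: "integrable (lebesgue_on (cbox c d)) v"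
      using v cd by (auto simp: locally_integrable_def)
    then have mv: "v \<in> borel_measurable (lebesgue_on (cbox c d))" by auto
    have m\<phi>: "\<phi> k \<in> borel_measurable (lebesgue_on (cbox c d))" for k
      by (intro continuous_imp_measurable_on_sets_lebesgue cont) auto
    have "(\<lambda>k. \<integral>x. v x * \<phi> k x \<partial>lebesgue_on (cbox c d)) \<longlonglongrightarrow>
       (\<integral>x. v x * indicat_real (box c d) x \<partial>lebesgue_on (cbox c d))"
    proof (rule integral_dominated_convergence[where w="\<lambda>x. \<bar>v x\<bar>"])
      show "(\<lambda>x. v x * indicat_real (box c d) x) \<in> borel_measurable (lebesgue_on (cbox c d))"
      proof (intro borel_measurable_times mv borel_measurable_indicator)
        have "box c d = cbox c d \<inter> box c d" using box_subset_cbox by blast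
        then show "box c d \<in> sets (lebesgue_on (cbox c d))" by (auto simp: sets_restrict_space)
      qed
      show "(\<lambda>x. v x * \<phi> k x) \<in> borel_measurable (lebesgue_on (cbox c d))" for k
        using mv m\<phi> by (intro borel_measurable_times)
      show "integrable (lebesgue_on (cbox c d)) (\<lambda>x. \<bar>v x\<bar>)" using iv by simp
      show "AE x in lebesgue_on (cbox c d). (\<lambda>k. v x * \<phi> k x) \<longlonglongrightarrow> v x * indicat_real (box c d) x"
        by (intro AE_I2 tendsto_mult tendsto_const lim)
      show "AE x in lebesgue_on (cbox c d). norm (v x * \<phi> k x) \<le> \<bar>v x\<bar>" for k
        using one by (intro AE_I2) (auto simp: abs_mult intro!: mult_left_le)
    qed
    moreover have "(\<integral>x. v x * \<phi> k x \<partial>lebesgue_on (cbox c d)) = 0" for k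
    proof -
      have "(\<integral>x. v x * \<phi> k x \<partial>lebesgue_on (cbox c d)) =
        (\<integral>x. (if x \<in> cbox c d then v x * \<phi> k x else 0) \<partial>lebesgue_on \<Omega>)"
        by (rule integral_restrict[OF cd _ \<Omega>s, symmetric]) auto
      also have "\<dots> = (\<integral>x. v x * \<phi> k x \<partial>lebesgue_on \<Omega>)"
        by (intro Bochner_Integration.integral_cong) (auto simp: z')
      finally show ?thesis using 0[OF tf] by simp
    qed
    moreover have "(\<integral>x. v x * indicat_real (box c d) x \<partial>lebesgue_on (cbox c d)) =
        (\<integral>x. v x \<partial>lebesgue_on (box c d))"
    proof -
      have "(\<lambda>x. v x * indicat_real (box c d) x) = (\<lambda>x. if x \<in> box c d then v x else 0)"
        by (auto simp: indicator_def)
      then show ?thesis using integral_restrict[of "box c d" "cbox c d" v] by (simp add: box_subset_cbox)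
    qed
    ultimately show ?thesis by (simp add: LIMSEQ_const_iff)
  qed
  have loc: "AE x in lebesgue_on (box c d). v x = 0" if cd: "cbox c d \<subseteq> \<Omega>" for c d
  proof -
    have bs: "box c d \<in> sets lebesgue" by auto
    have "integrable (lebesgue_on (cbox c d)) v"
      using v cd by (auto simp: locally_integrable_def)
    then have iv: "integrable (lebesgue_on (box c d)) v"
      by (rule integrable_lebesgue_on_subset) (auto simp: box_subset_cbox)
    define w where "w x = (if x \<in> box c d then v x else 0)" for x
    have iw: "integrable lebesgue w"
      unfolding w_def using iv bs Lebesgue_Measure.integrable_restrict_UNIV[of "box c d" v] by simp
    then have wm: "w \<in> borel_measurable lebesgue" by auto
    \<comment> \<open>Box integrals determine Borel functions on \<open>lborel\<close>, so the
      Lebesgue measurable \<open>w\<close> is replaced by a Borel version.\<close>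
    then obtain g where g: "g \<in> borel_measurable lborel" and wg: "AE x in lborel. w x = g x"
      using completion_ex_borel_measurable_real by blast
    have wg': "AE x in lebesgue. w x = g x" using wg by (rule AE_completion)
    have gm: "g \<in> borel_measurable lebesgue" using g by (rule measurable_completion)
    have ig: "integrable lborel g"
    proof -
      have "integrable lebesgue g" using integrable_cong_AE[OF wm gm wg'] iw by blast
      then show ?thesis using integrable_completion[OF g] by blast
    qed
    have gbox: "(\<integral>x. indicator (box e f) x *\<^sub>R g x \<partial>lborel) = 0" for e f
    proof -
      have "(\<integral>x. indicator (box e f) x *\<^sub>R g x \<partial>lborel) = (\<integral>x. indicator (box e f) x *\<^sub>R g x \<partial>lebesgue)"
        using g by (intro integral_completion[symmetric]) simp
      also have "\<dots> = (\<integral>x. indicator (box e f) x *\<^sub>R w x \<partial>lebesgue)"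
      proof (intro integral_cong_AE borel_measurable_scaleR gm wm borel_measurable_indicator)
        show "AE x in lebesgue. indicat_real (box e f) x *\<^sub>R g x = indicat_real (box e f) x *\<^sub>R w x"
          using wg' by eventually_elim simp
      qed auto
      also have "\<dots> = (\<integral>x. (if x \<in> box c d \<inter> box e f then v x else 0) \<partial>lebesgue)"
        by (intro Bochner_Integration.integral_cong) (auto simp: w_def indicator_def)
      also have "\<dots> = (\<integral>x. v x \<partial>lebesgue_on (box c d \<inter> box e f))"
        by (rule Lebesgue_Measure.integral_restrict_UNIV) auto
      also have "\<dots> = 0"
      proof -
        \<comment> \<open>Testing \<open>g\<close> on an arbitrary box amounts to integrating
          \<open>v\<close> over an intersection of boxes. This is again a box, and its closure stays
          in \<open>cbox c d\<close>, so the vanishing of box integrals applies.\<close>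
        obtain e' f' where ef: "box c d \<inter> box e f = box e' f'" using box_Int_box[of c d e f] by blast
        show ?thesis
        proof (cases "box e' f' = {}")
          case False
          have "box e' f' \<subseteq> cbox c d" using ef box_subset_cbox by blast
          then have "cbox e' f' \<subseteq> cbox c d"
            using closure_minimal[OF _ closed_cbox] closure_box[OF False] by metis
          then show ?thesis unfolding ef using box cd by blast
        qed (simp add: ef)
      qed
      finally show ?thesis .
    qed
    have "AE x in lborel. g x = 0" by (rule AE_eq_0_if_box_integrals_0[OF ig gbox])
    then have "AE x in lebesgue. g x = 0" by (rule AE_completion)
    with wg' have "AE x in lebesgue. w x = 0" by eventually_elim simp
    then show ?thesis
      using bs by (subst AE_restrict_space_iff) (auto simp: w_def elim!: eventually_mono)
  qed
  obtain D where D: "countable D" "D \<subseteq> Pow \<Omega>" "\<And>X. X \<in> D \<Longrightarrow> \<exists>a b. X = cbox a b" "\<Union>D = \<Omega>"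
    using open_countable_Union_open_cbox[OF \<Omega>] by blast
  have "AE x in lebesgue. \<forall>X\<in>D. x \<in> X \<longrightarrow> v x = 0"
  proof (subst AE_ball_countable[OF D(1)], intro ballI)
    fix X assume X: "X \<in> D"
    then obtain c d where cd: "X = cbox c d" using D(3) by blast
    have "cbox c d \<subseteq> \<Omega>" using D(2) X cd by auto
    then have "AE x in lebesgue. x \<in> box c d \<longrightarrow> v x = 0"
      using loc by (subst (asm) AE_restrict_space_iff) auto
    \<comment> \<open>The local statement concerns open boxes; the faces by which the closed boxes
      of the cover exceed them are null sets.\<close>
    moreover have "AE x in lebesgue. x \<notin> cbox c d - box c d"
      using negligible_frontier_interval[of c d] by (intro AE_not_in) (simp add: negligible_iff_null_sets)
    ultimately show "AE x in lebesgue. x \<in> X \<longrightarrow> v x = 0"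
      unfolding cd by eventually_elim auto
  qed
  then have "AE x in lebesgue. x \<in> \<Omega> \<longrightarrow> v x = 0"
    by eventually_elim (use D(4) in auto)
  then show ?thesis using \<Omega>s by (subst AE_restrict_space_iff) auto
qed

section \<open>Calculus of weak derivatives\<close>

lemma is_weak_derivD:
  assumes "is_weak_deriv \<Omega> \<alpha> u v"
  shows "locally_integrable \<Omega> u" and "locally_integrable \<Omega> v"
    and "\<lbrakk>test_fun \<Omega> \<phi>; \<forall>i. count_list js i = \<alpha> i\<rbrakk> \<Longrightarrow>
      (\<integral>x. u x * partials js \<phi> x \<partial>lebesgue_on \<Omega>) =
        (-1) ^ mi_order \<alpha> * (\<integral>x. v x * \<phi> x \<partial>lebesgue_on \<Omega>)"
  using assms unfolding is_weak_deriv_def by blast+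

text \<open>Weak derivatives are defined through all lists realising a multi-index; the defining
  identity yields information only because there is at least one.\<close>

lemma ex_count_list:
  fixes \<alpha> :: "'n::finite \<Rightarrow> nat"
  shows "\<exists>js. \<forall>i. count_list js i = \<alpha> i"
proof -
  obtain js where js: "mset js = (\<Sum>i\<in>UNIV. replicate_mset (\<alpha> i) i)" using ex_mset by blast
  have "count_list js i = \<alpha> i" for i
    by (simp add: js count_sum flip: count_mset)
  then show ?thesis by blast
qed

lemma integrable_mult_test_fun:
  fixes v :: "real^'n \<Rightarrow> real"
  assumes \<Omega>: "open \<Omega>" and v: "locally_integrable \<Omega> v" and \<phi>: "test_fun \<Omega> \<phi>"
  shows "integrable (lebesgue_on \<Omega>) (\<lambda>x. v x * \<phi> x)"
proof -
  obtain K where K: "compact K" "K \<subseteq> \<Omega>" "\<And>x. x \<notin> K \<Longrightarrow> \<phi> x = 0"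
    using \<phi> by (auto simp: test_fun_def)
  have \<Omega>s: "\<Omega> \<in> sets lebesgue" using \<Omega> by auto
  have Ks: "K \<in> sets lebesgue" using K(1) by (simp add: compact_imp_closed)
  have iv: "integrable (lebesgue_on K) v" using v K by (auto simp: locally_integrable_def)
  have "bounded (\<phi> ` K)"
    using K(1) continuous_on_test_fun[OF \<phi>] by (intro compact_imp_bounded compact_continuous_image)
  then obtain B where B: "B > 0" "\<And>x. x \<in> K \<Longrightarrow> \<bar>\<phi> x\<bar> \<le> B" unfolding bounded_pos by auto
  have "integrable (lebesgue_on K) (\<lambda>x. v x * \<phi> x)"
  proof (rule Bochner_Integration.integrable_bound[where f="\<lambda>x. B * v x"])
    show "integrable (lebesgue_on K) (\<lambda>x. B * v x)" using iv by simp
    show "(\<lambda>x. v x * \<phi> x) \<in> borel_measurable (lebesgue_on K)"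
      by (intro borel_measurable_times borel_measurable_integrable[OF iv]
          continuous_imp_measurable_on_sets_lebesgue continuous_on_test_fun[OF \<phi>] Ks)
    have "norm (v x * \<phi> x) \<le> norm (B * v x)" if "x \<in> K" for x
    proof -
      have "norm (v x * \<phi> x) = \<bar>v x\<bar> * \<bar>\<phi> x\<bar>" by (simp add: abs_mult)
      also have "\<dots> \<le> \<bar>v x\<bar> * B" by (intro mult_left_mono B that) auto
      finally show ?thesis using B by (simp add: abs_mult mult.commute)
    qed
    then show "AE x in lebesgue_on K. norm (v x * \<phi> x) \<le> norm (B * v x)" by (intro AE_I2) simp
  qed
  then have "integrable lebesgue (\<lambda>x. if x \<in> K then v x * \<phi> x else 0)"
    by (rule iffD2[OF Lebesgue_Measure.integrable_restrict_UNIV[OF Ks]])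
  also have "(\<lambda>x. if x \<in> K then v x * \<phi> x else 0) = (\<lambda>x. if x \<in> \<Omega> then v x * \<phi> x else 0)"
    using K by (auto simp: fun_eq_iff)
  finally show ?thesis by (rule iffD1[OF Lebesgue_Measure.integrable_restrict_UNIV[OF \<Omega>s]])
qed

lemma locally_integrable_lincomb:
  "locally_integrable \<Omega> u \<Longrightarrow> locally_integrable \<Omega> v \<Longrightarrow> locally_integrable \<Omega> (\<lambda>x. a * u x + b * v x)"
  by (auto simp: locally_integrable_def)

lemma is_weak_deriv_lincomb:
  fixes u v :: "real^'n \<Rightarrow> real"
  assumes \<Omega>: "open \<Omega>" and u: "is_weak_deriv \<Omega> \<alpha> u u'" and v: "is_weak_deriv \<Omega> \<alpha> v v'"
  shows "is_weak_deriv \<Omega> \<alpha> (\<lambda>x. a * u x + b * v x) (\<lambda>x. a * u' x + b * v' x)"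
proof -
  have l: "locally_integrable \<Omega> u" "locally_integrable \<Omega> v" "locally_integrable \<Omega> u'" "locally_integrable \<Omega> v'"
    using is_weak_derivD(1,2)[OF u] is_weak_derivD(1,2)[OF v] by auto
  have lin: "(\<integral>x. (a * f x + b * g x) * \<psi> x \<partial>lebesgue_on \<Omega>) =
      a * (\<integral>x. f x * \<psi> x \<partial>lebesgue_on \<Omega>) + b * (\<integral>x. g x * \<psi> x \<partial>lebesgue_on \<Omega>)"
    if "locally_integrable \<Omega> f" "locally_integrable \<Omega> g" "test_fun \<Omega> \<psi>" for f g \<psi>
  proof -
    have "(\<integral>x. (a * f x + b * g x) * \<psi> x \<partial>lebesgue_on \<Omega>) =
      (\<integral>x. a * (f x * \<psi> x) + b * (g x * \<psi> x) \<partial>lebesgue_on \<Omega>)"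
      by (simp add: algebra_simps)
    then show ?thesis
      using integrable_mult_test_fun[OF \<Omega> that(1,3)] integrable_mult_test_fun[OF \<Omega> that(2,3)] by simp
  qed
  show ?thesis
    unfolding is_weak_deriv_def
  proof (intro conjI allI impI)
    show "locally_integrable \<Omega> (\<lambda>x. a * u x + b * v x)" "locally_integrable \<Omega> (\<lambda>x. a * u' x + b * v' x)"
      by (rule locally_integrable_lincomb[OF l(1,2)] locally_integrable_lincomb[OF l(3,4)])+
    fix \<phi> js assume *: "test_fun \<Omega> \<phi> \<and> (\<forall>i. count_list js i = \<alpha> i)"
    then have \<phi>: "test_fun \<Omega> \<phi>" "test_fun \<Omega> (partials js \<phi>)" by (auto intro: test_fun_partials)
    have "(\<integral>x. u x * partials js \<phi> x \<partial>lebesgue_on \<Omega>) = (-1) ^ mi_order \<alpha> * (\<integral>x. u' x * \<phi> x \<partial>lebesgue_on \<Omega>)"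
      "(\<integral>x. v x * partials js \<phi> x \<partial>lebesgue_on \<Omega>) = (-1) ^ mi_order \<alpha> * (\<integral>x. v' x * \<phi> x \<partial>lebesgue_on \<Omega>)"
      using is_weak_derivD(3)[OF u] is_weak_derivD(3)[OF v] * by blast+
    then show "(\<integral>x. (a * u x + b * v x) * partials js \<phi> x \<partial>lebesgue_on \<Omega>) =
        (-1) ^ mi_order \<alpha> * (\<integral>x. (a * u' x + b * v' x) * \<phi> x \<partial>lebesgue_on \<Omega>)"
      unfolding lin[OF l(1,2) \<phi>(2)] lin[OF l(3,4) \<phi>(1)] by (simp add: distrib_left mult.left_commute)
  qed
qed

lemma is_weak_deriv_unique:
  fixes u :: "real^'n \<Rightarrow> real"
  assumes \<Omega>: "open \<Omega>" and v: "is_weak_deriv \<Omega> \<alpha> u v" and v': "is_weak_deriv \<Omega> \<alpha> u v'"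
  shows "AE x in lebesgue_on \<Omega>. v x = v' x"
proof -
  have l: "locally_integrable \<Omega> v" "locally_integrable \<Omega> v'"
    using is_weak_derivD(2)[OF v] is_weak_derivD(2)[OF v'] by auto
  have "AE x in lebesgue_on \<Omega>. 1 * v x + (-1) * v' x = 0"
  proof (rule fundamental_lemma[OF \<Omega>])
    show "locally_integrable \<Omega> (\<lambda>x. 1 * v x + (-1) * v' x)" by (rule locally_integrable_lincomb[OF l])
    fix \<phi> assume \<phi>: "test_fun \<Omega> \<phi>"
    obtain js where js: "\<forall>i. count_list js i = \<alpha> i" using ex_count_list by blast
    have "(-1) ^ mi_order \<alpha> * (\<integral>x. v x * \<phi> x \<partial>lebesgue_on \<Omega>) = (-1) ^ mi_order \<alpha> * (\<integral>x. v' x * \<phi> x \<partial>lebesgue_on \<Omega>)"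
      using is_weak_derivD(3)[OF v \<phi> js] is_weak_derivD(3)[OF v' \<phi> js] by simp
    then have eq: "(\<integral>x. v x * \<phi> x \<partial>lebesgue_on \<Omega>) = (\<integral>x. v' x * \<phi> x \<partial>lebesgue_on \<Omega>)" by simp
    have "(\<integral>x. (1 * v x + (-1) * v' x) * \<phi> x \<partial>lebesgue_on \<Omega>) =
      (\<integral>x. v x * \<phi> x - v' x * \<phi> x \<partial>lebesgue_on \<Omega>)" by (simp add: algebra_simps)
    also have "\<dots> = 0"
      using eq integrable_mult_test_fun[OF \<Omega> l(1) \<phi>] integrable_mult_test_fun[OF \<Omega> l(2) \<phi>] by simp
    finally show "(\<integral>x. (1 * v x + (-1) * v' x) * \<phi> x \<partial>lebesgue_on \<Omega>) = 0" .
  qed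
  then show ?thesis by eventually_elim simp
qed

text \<open>A test function of the smaller set is one of the larger set. The norms over
  \<open>R\<close> in \<open>local_continuity\<close> use weak derivatives chosen on
  \<open>R\<close> rather than restrictions of those on \<open>\<Omega>\<close>, and this lemma
  connects the two.\<close>

lemma is_weak_deriv_restrict:
  fixes u :: "real^'n \<Rightarrow> real"
  assumes \<Omega>: "open \<Omega>" and u: "is_weak_deriv \<Omega> \<alpha> u v" and R: "open R" "R \<subseteq> \<Omega>"
  shows "is_weak_deriv R \<alpha> u v"
  unfolding is_weak_deriv_def
proof (intro conjI allI impI)
  show "locally_integrable R u" "locally_integrable R v"
    using is_weak_derivD(1,2)[OF u] R unfolding locally_integrable_def by blast+
  have s: "\<Omega> \<in> sets lebesgue" "R \<in> sets lebesgue" using \<Omega> R by auto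
  fix \<phi> js assume *: "test_fun R \<phi> \<and> (\<forall>i. count_list js i = \<alpha> i)"
  have eq: "(\<integral>x. f x * \<psi> x \<partial>lebesgue_on \<Omega>) = (\<integral>x. f x * \<psi> x \<partial>lebesgue_on R)"
    if "test_fun R \<psi>" for f \<psi>
  proof -
    have "\<psi> x = 0" if "x \<notin> R" for x using \<open>test_fun R \<psi>\<close> that by (auto simp: test_fun_def)
    then have "(\<integral>x. f x * \<psi> x \<partial>lebesgue_on \<Omega>) = (\<integral>x. (if x \<in> R then f x * \<psi> x else 0) \<partial>lebesgue_on \<Omega>)"
      by (intro Bochner_Integration.integral_cong) auto
    also have "\<dots> = (\<integral>x. f x * \<psi> x \<partial>lebesgue_on R)" by (rule integral_restrict[OF R(2) s(2,1)])
    finally show ?thesis .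
  qed
  have t: "test_fun R \<phi>" "test_fun R (partials js \<phi>)" using * by (auto intro: test_fun_partials)
  have "test_fun \<Omega> \<phi>" using t(1) R(2) by (auto simp: test_fun_def)
  then have "(\<integral>x. u x * partials js \<phi> x \<partial>lebesgue_on \<Omega>) = (-1) ^ mi_order \<alpha> * (\<integral>x. v x * \<phi> x \<partial>lebesgue_on \<Omega>)"
    using is_weak_derivD(3)[OF u] * by blast
  then show "(\<integral>x. u x * partials js \<phi> x \<partial>lebesgue_on R) = (-1) ^ mi_order \<alpha> * (\<integral>x. v x * \<phi> x \<partial>lebesgue_on R)"
    using eq[OF t(1)] eq[OF t(2)] by simp
qed

lemma mi_order_eq_0: "mi_order \<alpha> = 0 \<longleftrightarrow> \<alpha> = (\<lambda>_. 0)"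
  by (auto simp: mi_order_def)

lemma is_weak_deriv_order_0:
  assumes "locally_integrable \<Omega> u" "mi_order \<alpha> = 0" shows "is_weak_deriv \<Omega> \<alpha> u u"
proof -
  have js: "js = []" if "\<forall>i. count_list js i = \<alpha> i" for js
  proof (cases js)
    case (Cons i js')
    then have "count_list js i \<noteq> 0" by simp
    then show ?thesis using that assms(2) by (simp add: mi_order_eq_0)
  qed
  show ?thesis
    unfolding is_weak_deriv_def
  proof (intro conjI allI impI assms(1))
    fix \<phi> js assume "test_fun \<Omega> \<phi> \<and> (\<forall>i. count_list js i = \<alpha> i)"
    then have "js = []" using js by blast
    then show "(\<integral>x. u x * partials js \<phi> x \<partial>lebesgue_on \<Omega>) = (-1) ^ mi_order \<alpha> * (\<integral>x. u x * \<phi> x \<partial>lebesgue_on \<Omega>)"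
      using assms(2) by simp
  qed
qed

text \<open>The representative picked by \<open>SOME\<close> is a weak derivative, but its
  integrability is not part of the choice; uniqueness identifies it almost everywhere with one that
  lies in L^p.\<close>

lemma sobolev_weak_deriv:
  fixes u :: "real^'n \<Rightarrow> real"
  assumes \<Omega>: "open \<Omega>" and u: "u \<in> sobolev k p \<Omega>" and \<alpha>: "mi_order \<alpha> \<le> k"
  shows "is_weak_deriv \<Omega> \<alpha> u (weak_deriv \<Omega> \<alpha> u)" and "weak_deriv \<Omega> \<alpha> u \<in> Lp_space p \<Omega>"
proof -
  have s: "\<Omega> \<in> sets lebesgue" using \<Omega> by auto
  obtain v where v: "v \<in> Lp_space p \<Omega>" "is_weak_deriv \<Omega> \<alpha> u v" using u \<alpha> by (auto simp: sobolev_def)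
  have "is_weak_deriv \<Omega> \<alpha> u (weak_deriv \<Omega> \<alpha> u) \<and> weak_deriv \<Omega> \<alpha> u \<in> Lp_space p \<Omega>"
  proof (cases "mi_order \<alpha> = 0")
    case True
    then show ?thesis
    proof -
      have "locally_integrable \<Omega> u" using v(2) by (simp add: is_weak_deriv_def)
      then have "is_weak_deriv \<Omega> \<alpha> u u" by (rule is_weak_deriv_order_0[OF _ True])
      moreover have "u \<in> Lp_space p \<Omega>" using u by (simp add: sobolev_def)
      ultimately show ?thesis using True by (simp add: weak_deriv_def)
    qed
  next
    case False
    then have w: "is_weak_deriv \<Omega> \<alpha> u (weak_deriv \<Omega> \<alpha> u)"
      using someI[of "is_weak_deriv \<Omega> \<alpha> u", OF v(2)] by (simp add: weak_deriv_def)
    have "AE x in lebesgue_on \<Omega>. v x = weak_deriv \<Omega> \<alpha> u x"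
      by (rule is_weak_deriv_unique[OF \<Omega> v(2) w])
    then show ?thesis using w Lp_space_cong_AE(1)[OF s _ v(1)] by blast
  qed
  then show "is_weak_deriv \<Omega> \<alpha> u (weak_deriv \<Omega> \<alpha> u)" "weak_deriv \<Omega> \<alpha> u \<in> Lp_space p \<Omega>" by auto
qed

text \<open>Lets the norm of a derivative be computed with whatever weak derivative is at hand
  instead of the chosen one.\<close>

lemma Lp_norm_weak_deriv:
  fixes u :: "real^'n \<Rightarrow> real"
  assumes \<Omega>: "open \<Omega>" and v: "is_weak_deriv \<Omega> \<alpha> u v" "v \<in> Lp_space p \<Omega>"
  shows "weak_deriv \<Omega> \<alpha> u \<in> Lp_space p \<Omega>" and "Lp_norm p \<Omega> (weak_deriv \<Omega> \<alpha> u) = Lp_norm p \<Omega> v"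
proof -
  have s: "\<Omega> \<in> sets lebesgue" using \<Omega> by auto
  have "is_weak_deriv \<Omega> \<alpha> u (weak_deriv \<Omega> \<alpha> u)"
  proof (cases "mi_order \<alpha> = 0")
    case True
    have "locally_integrable \<Omega> u" using v(1) by (simp add: is_weak_deriv_def)
    then show ?thesis using is_weak_deriv_order_0[OF _ True] True by (simp add: weak_deriv_def)
  next
    case False
    then show ?thesis
      using someI[of "is_weak_deriv \<Omega> \<alpha> u", OF v(1)] by (simp add: weak_deriv_def)
  qed
  from is_weak_deriv_unique[OF \<Omega> v(1) this] have "AE x in lebesgue_on \<Omega>. v x = weak_deriv \<Omega> \<alpha> u x" .
  from Lp_space_cong_AE[OF s this v(2)]
  show "weak_deriv \<Omega> \<alpha> u \<in> Lp_space p \<Omega>" and "Lp_norm p \<Omega> (weak_deriv \<Omega> \<alpha> u) = Lp_norm p \<Omega> v" by auto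
qed

section \<open>Sobolev norms\<close>

lemma sobolev_norm_nonneg [simp]: "0 \<le> sobolev_norm k p \<Omega> u"
proof -
  have "Lp_norm p \<Omega> (weak_deriv \<Omega> (\<lambda>_. 0) u) \<le> Max ((\<lambda>\<alpha>. Lp_norm p \<Omega> (weak_deriv \<Omega> \<alpha> u)) ` {\<alpha>. mi_order \<alpha> \<le> k})"
  proof (rule Max_ge)
    show "finite ((\<lambda>\<alpha>. Lp_norm p \<Omega> (weak_deriv \<Omega> \<alpha> u)) ` {\<alpha>. mi_order \<alpha> \<le> k})"
      by (rule finite_imageI[OF finite_multi_indices])
    show "Lp_norm p \<Omega> (weak_deriv \<Omega> (\<lambda>_. 0) u) \<in> (\<lambda>\<alpha>. Lp_norm p \<Omega> (weak_deriv \<Omega> \<alpha> u)) ` {\<alpha>. mi_order \<alpha> \<le> k}"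
      by (rule imageI) (simp add: mi_order_def)
  qed
  then show ?thesis
    using order_trans[OF Lp_norm_nonneg] by (auto simp: sobolev_norm_def Lp_norm_family_def)
qed

lemma Lp_norm_le_sobolev_norm:
  assumes "mi_order \<alpha> \<le> k" "1 \<le> p"
  shows "Lp_norm p \<Omega> (weak_deriv \<Omega> \<alpha> u) \<le> sobolev_norm k p \<Omega> u"
  unfolding sobolev_norm_def
  by (rule Lp_norm_le_family) (use assms finite_multi_indices in auto)

lemma sobolev_norm_le_sum:
  assumes "1 \<le> p"
  shows "sobolev_norm k p \<Omega> (u :: real^'n \<Rightarrow> real) \<le> (\<Sum>\<alpha> | mi_order \<alpha> \<le> k. Lp_norm p \<Omega> (weak_deriv \<Omega> \<alpha> u))"
proof -
  have "(\<lambda>_::'n. 0) \<in> {\<alpha>. mi_order \<alpha> \<le> k}" by (simp add: mi_order_def)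
  then show ?thesis unfolding sobolev_norm_def
    by (intro Lp_norm_family_le_sum finite_multi_indices assms) blast
qed

lemma sobolev_norm_le_bound:
  fixes u :: "real^'n \<Rightarrow> real"
  assumes "1 \<le> p" "\<And>\<alpha>. mi_order \<alpha> \<le> k \<Longrightarrow> Lp_norm p \<Omega> (weak_deriv \<Omega> \<alpha> u) \<le> c"
  shows "sobolev_norm k p \<Omega> u \<le> real (card {\<alpha> :: 'n \<Rightarrow> nat. mi_order \<alpha> \<le> k}) * c"
  using sobolev_norm_le_sum[OF assms(1), of k \<Omega> u]
    sum_bounded_above[of "{\<alpha> :: 'n \<Rightarrow> nat. mi_order \<alpha> \<le> k}" "\<lambda>\<alpha>. Lp_norm p \<Omega> (weak_deriv \<Omega> \<alpha> u)" c] assms(2)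
  by fastforce

lemma sobolev_norm_0:
  assumes "1 \<le> p" shows "sobolev_norm 0 p \<Omega> u = Lp_norm p \<Omega> u"
proof -
  have "{\<alpha>. mi_order \<alpha> \<le> 0} = {\<lambda>_. 0}" by (auto simp: mi_order_eq_0)
  moreover have "real_of_ereal p \<noteq> 0" if "p \<noteq> \<infinity>" using that assms by (cases p) auto
  ultimately show ?thesis
    by (simp add: sobolev_norm_def Lp_norm_family_def weak_deriv_def mi_order_eq_0 powr_powr)
qed

lemma sobolev_seminorm_le_norm:
  fixes u :: "real^'n \<Rightarrow> real"
  assumes "1 \<le> p"
  shows "sobolev_seminorm k p \<Omega> u \<le> real (card {\<alpha> :: 'n \<Rightarrow> nat. mi_order \<alpha> = k}) * sobolev_norm k p \<Omega> u"
proof -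
  let ?A = "{\<alpha> :: 'n \<Rightarrow> nat. mi_order \<alpha> = k}"
  obtain i :: 'n where True by blast
  have "(\<lambda>j. if j = i then k else 0) \<in> ?A" by (simp add: mi_order_def)
  then have ne: "?A \<noteq> {}" by blast
  have fin: "finite ?A" by (rule finite_subset[OF _ finite_multi_indices[of k]]) auto
  have "sobolev_seminorm k p \<Omega> u \<le> (\<Sum>\<alpha>\<in>?A. Lp_norm p \<Omega> (weak_deriv \<Omega> \<alpha> u))"
    unfolding sobolev_seminorm_def by (rule Lp_norm_family_le_sum[OF fin ne assms])
  also have "\<dots> \<le> (\<Sum>\<alpha>\<in>?A. sobolev_norm k p \<Omega> u)"
    by (intro sum_mono Lp_norm_le_sobolev_norm assms) auto
  finally show ?thesis by simp
qed

lemma sobolev_lincomb: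
  fixes u v :: "real^'n \<Rightarrow> real"
  assumes \<Omega>: "open \<Omega>" and p: "1 \<le> p" and u: "u \<in> sobolev k p \<Omega>" and v: "v \<in> sobolev k p \<Omega>"
  shows "(\<lambda>x. a * u x + b * v x) \<in> sobolev k p \<Omega>"
    and "sobolev_norm k p \<Omega> (\<lambda>x. a * u x + b * v x) \<le>
      real (card {\<alpha> :: 'n \<Rightarrow> nat. mi_order \<alpha> \<le> k}) *
        (2 * (\<bar>a\<bar> * sobolev_norm k p \<Omega> u + \<bar>b\<bar> * sobolev_norm k p \<Omega> v))"
proof -
  let ?w = "\<lambda>x. a * u x + b * v x"
  let ?w' = "\<lambda>\<alpha> x. a * weak_deriv \<Omega> \<alpha> u x + b * weak_deriv \<Omega> \<alpha> v x"
  have d: "is_weak_deriv \<Omega> \<alpha> ?w (?w' \<alpha>)" "?w' \<alpha> \<in> Lp_space p \<Omega>" if "mi_order \<alpha> \<le> k" for \<alpha>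
    using is_weak_deriv_lincomb[OF \<Omega>] Lp_lincomb(1)[OF p] sobolev_weak_deriv[OF \<Omega> u that]
      sobolev_weak_deriv[OF \<Omega> v that] by auto
  have "?w \<in> Lp_space p \<Omega>" using Lp_lincomb(1)[OF p] u v by (auto simp: sobolev_def)
  then show "?w \<in> sobolev k p \<Omega>" using d by (auto simp: sobolev_def)
  show "sobolev_norm k p \<Omega> ?w \<le> real (card {\<alpha> :: 'n \<Rightarrow> nat. mi_order \<alpha> \<le> k}) *
        (2 * (\<bar>a\<bar> * sobolev_norm k p \<Omega> u + \<bar>b\<bar> * sobolev_norm k p \<Omega> v))"
  proof (rule sobolev_norm_le_bound[OF p])
    fix \<alpha> :: "'n \<Rightarrow> nat" assume \<alpha>: "mi_order \<alpha> \<le> k"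
    have "Lp_norm p \<Omega> (weak_deriv \<Omega> \<alpha> ?w) = Lp_norm p \<Omega> (?w' \<alpha>)"
      by (rule Lp_norm_weak_deriv(2)[OF \<Omega> d[OF \<alpha>]])
    also have "\<dots> \<le> 2 * (\<bar>a\<bar> * Lp_norm p \<Omega> (weak_deriv \<Omega> \<alpha> u) + \<bar>b\<bar> * Lp_norm p \<Omega> (weak_deriv \<Omega> \<alpha> v))"
      by (rule Lp_lincomb(2)[OF p sobolev_weak_deriv(2)[OF \<Omega> u \<alpha>] sobolev_weak_deriv(2)[OF \<Omega> v \<alpha>]])
    also have "\<dots> \<le> 2 * (\<bar>a\<bar> * sobolev_norm k p \<Omega> u + \<bar>b\<bar> * sobolev_norm k p \<Omega> v)"
      by (intro mult_left_mono add_mono Lp_norm_le_sobolev_norm \<alpha> p) auto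
    finally show "Lp_norm p \<Omega> (weak_deriv \<Omega> \<alpha> ?w) \<le> 2 * (\<bar>a\<bar> * sobolev_norm k p \<Omega> u + \<bar>b\<bar> * sobolev_norm k p \<Omega> v)" .
  qed
qed

text \<open>Up to null sets the derivatives on \<open>R\<close> are those on
  \<open>\<Omega>\<close>, and Hoelder's inequality on \<open>R\<close> converts the measure of
  \<open>R\<close> into a factor. The local continuity (B2) is exploited through this bound, with
  \<open>p = 2\<close>.\<close>

lemma sobolev_norm_restrict:
  fixes u :: "real^'n \<Rightarrow> real" and p :: real
  assumes \<Omega>: "open \<Omega>" and R: "open R" "R \<subseteq> \<Omega>" "bounded R"
    and p: "1 \<le> p" "ereal p \<le> r" and u: "u \<in> sobolev k r \<Omega>"
  shows "sobolev_norm k (ereal p) R u \<le> real (card {\<alpha> :: 'n \<Rightarrow> nat. mi_order \<alpha> \<le> k}) *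
      (measure lebesgue R powr (1 / p - real_of_ereal (1 / r)) * sobolev_norm k r \<Omega> u)"
proof (rule sobolev_norm_le_bound)
  fix \<alpha> :: "'n \<Rightarrow> nat" assume \<alpha>: "mi_order \<alpha> \<le> k"
  have s: "\<Omega> \<in> sets lebesgue" "R \<in> sets lebesgue" using \<Omega> R by auto
  have lm: "R \<in> lmeasurable" using R by (intro lmeasurable_open)
  have r: "1 \<le> r" using p by (metis dual_order.trans ereal_less_eq(3) one_ereal_def)
  let ?v = "weak_deriv \<Omega> \<alpha> u"
  note w = sobolev_weak_deriv[OF \<Omega> u \<alpha>]
  have v: "?v \<in> Lp_space r R" "Lp_norm r R ?v \<le> Lp_norm r \<Omega> ?v"
    by (rule Lp_subset[OF r w(2) R(2) s])+
  note m = Lp_mono_exponent[OF p v(1) lm]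
  have "Lp_norm (ereal p) R (weak_deriv R \<alpha> u) = Lp_norm (ereal p) R ?v"
    by (rule Lp_norm_weak_deriv(2)[OF R(1) is_weak_deriv_restrict[OF \<Omega> w(1) R(1,2)] m(1)])
  also have "\<dots> \<le> measure lebesgue R powr (1 / p - real_of_ereal (1 / r)) * Lp_norm r R ?v" by (rule m(2))
  also have "\<dots> \<le> measure lebesgue R powr (1 / p - real_of_ereal (1 / r)) * sobolev_norm k r \<Omega> u"
    by (intro mult_left_mono order_trans[OF v(2)] Lp_norm_le_sobolev_norm \<alpha> r) auto
  finally show "Lp_norm (ereal p) R (weak_deriv R \<alpha> u) \<le> \<dots>" .
qed (use p in \<open>simp add: one_ereal_def\<close>)

lemma sobolev_norm_embedding:
  fixes \<Omega> :: "(real^'n) set"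
  assumes \<Omega>: "open \<Omega>" "bounded \<Omega>" and p: "1 \<le> p" "p \<le> r"
  shows "\<exists>C>0. \<forall>u\<in>sobolev k r \<Omega>. u \<in> sobolev k p \<Omega> \<and> sobolev_norm k p \<Omega> u \<le> C * sobolev_norm k r \<Omega> u"
proof -
  have lm: "\<Omega> \<in> lmeasurable" using \<Omega> by (intro lmeasurable_open)
  have r: "1 \<le> r" using p by simp
  obtain C where C0: "C > 0" "\<forall>f\<in>Lp_space r \<Omega>. f \<in> Lp_space p \<Omega> \<and> Lp_norm p \<Omega> f \<le> C * Lp_norm r \<Omega> f"
    using Lp_embedding[OF p lm] by (elim exE conjE)
  have C: "C > 0" "\<And>f. f \<in> Lp_space r \<Omega> \<Longrightarrow> f \<in> Lp_space p \<Omega>"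
    "\<And>f. f \<in> Lp_space r \<Omega> \<Longrightarrow> Lp_norm p \<Omega> f \<le> C * Lp_norm r \<Omega> f"
    using C0 by simp_all
  define N where "N = real (card {\<alpha> :: 'n \<Rightarrow> nat. mi_order \<alpha> \<le> k})"
  have "u \<in> sobolev k p \<Omega> \<and> sobolev_norm k p \<Omega> u \<le> ((N + 1) * C) * sobolev_norm k r \<Omega> u"
    if u: "u \<in> sobolev k r \<Omega>" for u
  proof
    show "u \<in> sobolev k p \<Omega>" using u C(2) unfolding sobolev_def by blast
    have "sobolev_norm k p \<Omega> u \<le> N * (C * sobolev_norm k r \<Omega> u)"
      unfolding N_def
    proof (rule sobolev_norm_le_bound[OF p(1)])
      fix \<alpha> :: "'n \<Rightarrow> nat" assume \<alpha>: "mi_order \<alpha> \<le> k"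
      have "Lp_norm p \<Omega> (weak_deriv \<Omega> \<alpha> u) \<le> C * Lp_norm r \<Omega> (weak_deriv \<Omega> \<alpha> u)"
        by (rule C(3)[OF sobolev_weak_deriv(2)[OF \<Omega>(1) u \<alpha>]])
      also have "\<dots> \<le> C * sobolev_norm k r \<Omega> u"
        using C(1) by (intro mult_left_mono Lp_norm_le_sobolev_norm \<alpha> r) auto
      finally show "Lp_norm p \<Omega> (weak_deriv \<Omega> \<alpha> u) \<le> C * sobolev_norm k r \<Omega> u" .
    qed
    also have "\<dots> \<le> ((N + 1) * C) * sobolev_norm k r \<Omega> u"
      using C(1) by (simp add: algebra_simps)
    finally show "sobolev_norm k p \<Omega> u \<le> ((N + 1) * C) * sobolev_norm k r \<Omega> u" .
  qed
  moreover have "(N + 1) * C > 0" using C(1) by (simp add: N_def add_nonneg_pos)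
  ultimately show ?thesis by blast
qed

section \<open>Potentials\<close>

lemma nn_integral_powr_interval:
  fixes \<alpha> c :: real
  assumes "-1 < \<alpha>" "0 \<le> c"
  shows "(\<integral>\<^sup>+t. ennreal (t powr \<alpha>) * indicator {0<..<c} t \<partial>lborel) = ennreal (c powr (\<alpha> + 1) / (\<alpha> + 1))"
proof -
  have "((\<lambda>x. if x \<in> {0..c} then x powr \<alpha> else 0) has_integral c powr (\<alpha> + 1) / (\<alpha> + 1)) UNIV"
    using has_integral_powr_from_0[OF assms] by (simp only: has_integral_restrict_UNIV)
  then have "(\<integral>\<^sup>+t. ennreal (if t \<in> {0..c} then t powr \<alpha> else 0) \<partial>lborel) = ennreal (c powr (\<alpha> + 1) / (\<alpha> + 1))"
    by (intro nn_integral_has_integral_lborel) auto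
  also have "(\<integral>\<^sup>+t. ennreal (if t \<in> {0..c} then t powr \<alpha> else 0) \<partial>lborel) =
     (\<integral>\<^sup>+t. ennreal (t powr \<alpha>) * indicator {0<..<c} t \<partial>lborel)"
  proof (rule nn_integral_cong_AE)
    have "AE t in lborel. t \<noteq> 0 \<and> t \<noteq> c" using AE_lborel_singleton[of 0] AE_lborel_singleton[of c] by simp
    then show "AE t in lborel. ennreal (if t \<in> {0..c} then t powr \<alpha> else 0) = ennreal (t powr \<alpha>) * indicator {0<..<c} t"
      by eventually_elim (auto simp: indicator_def)
  qed
  finally show ?thesis .
qed

lemma emeasure_cball_ennreal:
  fixes z :: "'a::euclidean_space"
  assumes "0 \<le> r"
  shows "emeasure lborel (cball z r) = ennreal (unit_ball_vol (real DIM('a)) * r ^ DIM('a))"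
  using assms by (rule emeasure_cball)

text \<open>Tonelli's theorem: \<open>y\<close> lies in the ball around \<open>x + v\<close> exactly
  if \<open>x\<close> lies in the ball of the same radius around \<open>y - v\<close>, so the inner
  integral over \<open>x\<close> is the volume of a ball.\<close>

lemma nn_integral_ball_average:
  fixes v :: "'a::euclidean_space"
  assumes [measurable]: "F \<in> borel_measurable borel" and r: "0 \<le> r"
  shows "(\<integral>\<^sup>+x. (\<integral>\<^sup>+y. F y * indicator (cball (x + v) r) y \<partial>lborel) \<partial>lborel) =
    ennreal (unit_ball_vol (real DIM('a)) * r ^ DIM('a)) * (\<integral>\<^sup>+y. F y \<partial>lborel)"
proof -
  have ind: "indicator (cball (x + v) r) y = (if dist (x + v) y \<le> r then 1 else 0 :: ennreal)" for x y
    by (auto simp: indicator_def)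
  have m: "(\<lambda>(x, y). F y * indicator (cball (x + v) r) y) \<in> borel_measurable (lborel \<Otimes>\<^sub>M lborel)"
    unfolding ind by measurable
  have "(\<integral>\<^sup>+x. (\<integral>\<^sup>+y. F y * indicator (cball (x + v) r) y \<partial>lborel) \<partial>lborel) =
    (\<integral>\<^sup>+y. (\<integral>\<^sup>+x. F y * indicator (cball (x + v) r) y \<partial>lborel) \<partial>lborel)"
    using lborel_pair.Fubini'[OF m] by simp
  also have "\<dots> = (\<integral>\<^sup>+y. F y * ennreal (unit_ball_vol (real DIM('a)) * r ^ DIM('a)) \<partial>lborel)"
  proof (rule nn_integral_cong)
    fix y :: 'a
    have "indicator (cball (x + v) r) y = (indicator (cball (y - v) r) x :: ennreal)" for x
    proof -
      have "dist (x + v) y = dist (y - v) x" by (simp add: dist_norm norm_minus_commute algebra_simps)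
      then show ?thesis by (simp add: indicator_def)
    qed
    then have "(\<integral>\<^sup>+x. F y * indicator (cball (x + v) r) y \<partial>lborel) = (\<integral>\<^sup>+x. F y * indicator (cball (y - v) r) x \<partial>lborel)"
      by simp
    also have "\<dots> = F y * emeasure lborel (cball (y - v) r)" by (rule nn_integral_cmult_indicator) simp
    finally show "(\<integral>\<^sup>+x. F y * indicator (cball (x + v) r) y \<partial>lborel) = F y * ennreal (unit_ball_vol (real DIM('a)) * r ^ DIM('a))"
      by (simp only: emeasure_cball_ennreal[OF r])
  qed
  also have "\<dots> = ennreal (unit_ball_vol (real DIM('a)) * r ^ DIM('a)) * (\<integral>\<^sup>+y. F y \<partial>lborel)"
    by (simp add: nn_integral_multc mult.commute)
  finally show ?thesis .
qed

text \<open>With the choice \<open>a = |B|\<^sup>-\<^sup>1\<^sup>/\<^sup>p\<close>, the pointwise bound \<open>f \<le> a\<^sup>1\<^sup>-\<^sup>p f\<^sup>p + a\<close> replaces Hoelder's inequality.\<close>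

lemma nn_integral_ball_le:
  fixes f :: "'a::euclidean_space \<Rightarrow> real"
  assumes [measurable]: "f \<in> borel_measurable borel" and f0: "\<And>x. 0 \<le> f x"
    and p: "1 \<le> p" and f1: "(\<integral>\<^sup>+x. ennreal (f x powr p) \<partial>lborel) \<le> 1" and r: "0 < r"
  shows "(\<integral>\<^sup>+y. ennreal (f y) * indicator (cball z r) y \<partial>lborel)
    \<le> ennreal (2 * (unit_ball_vol (real DIM('a)) * r ^ DIM('a)) powr (1 - 1 / p))"
proof -
  define m where "m = unit_ball_vol (real DIM('a)) * r ^ DIM('a)"
  have m: "m > 0" using r by (simp add: m_def)
  define a where "a = m powr (- 1 / p)"
  have a: "a > 0" using m by (simp add: a_def)
  have pt: "f y \<le> a powr (1 - p) * f y powr p + a" for y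
  proof (cases "f y \<le> a")
    case True
    then show ?thesis by (simp add: add_increasing)
  next
    case False
    then have fy: "f y > a" "f y > 0" using a by auto
    have "f y = f y powr (1 - p) * f y powr p" using fy by (simp flip: powr_add)
    also have "\<dots> \<le> a powr (1 - p) * f y powr p"
      using fy a p by (intro mult_right_mono powr_mono2') auto
    finally show ?thesis using a by simp
  qed
  have "(\<integral>\<^sup>+y. ennreal (f y) * indicator (cball z r) y \<partial>lborel) \<le>
    (\<integral>\<^sup>+y. ennreal (a powr (1 - p)) * ennreal (f y powr p) + ennreal a * indicator (cball z r) y \<partial>lborel)"
  proof (rule nn_integral_mono)
    fix y
    have "ennreal (f y) \<le> ennreal (a powr (1 - p)) * ennreal (f y powr p) + ennreal a"
      using ennreal_leI[OF pt[of y]] a by (simp add: ennreal_mult)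
    then show "ennreal (f y) * indicator (cball z r) y \<le>
        ennreal (a powr (1 - p)) * ennreal (f y powr p) + ennreal a * indicator (cball z r) y"
      by (auto simp: indicator_def)
  qed
  also have "\<dots> = ennreal (a powr (1 - p)) * (\<integral>\<^sup>+y. ennreal (f y powr p) \<partial>lborel) + ennreal a * ennreal m"
  proof -
    have "(\<integral>\<^sup>+y. ennreal a * indicator (cball z r) y \<partial>lborel) = ennreal a * emeasure lborel (cball z r)"
      by (rule nn_integral_cmult_indicator) simp
    also have "emeasure lborel (cball z r) = ennreal m"
      unfolding m_def by (rule emeasure_cball_ennreal) (use r in simp)
    finally have i: "(\<integral>\<^sup>+y. ennreal a * indicator (cball z r) y \<partial>lborel) = ennreal a * ennreal m" .
    have [measurable]: "cball z r \<in> sets borel" by simp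
    have "(\<integral>\<^sup>+y. ennreal (a powr (1 - p)) * ennreal (f y powr p) + ennreal a * indicator (cball z r) y \<partial>lborel) =
      (\<integral>\<^sup>+y. ennreal (a powr (1 - p)) * ennreal (f y powr p) \<partial>lborel) +
      (\<integral>\<^sup>+y. ennreal a * indicator (cball z r) y \<partial>lborel)"
      by (rule nn_integral_add) measurable
    also have "(\<integral>\<^sup>+y. ennreal (a powr (1 - p)) * ennreal (f y powr p) \<partial>lborel) =
      ennreal (a powr (1 - p)) * (\<integral>\<^sup>+y. ennreal (f y powr p) \<partial>lborel)"
      by (rule nn_integral_cmult) measurable
    finally show ?thesis unfolding i .
  qed
  also have "\<dots> \<le> ennreal (a powr (1 - p)) * 1 + ennreal a * ennreal m"
    by (intro add_mono mult_left_mono f1) auto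
  also have "\<dots> = ennreal (a powr (1 - p) + a * m)"
    using a m by (simp add: ennreal_mult)
  also have "a powr (1 - p) + a * m = 2 * m powr (1 - 1 / p)"
  proof -
    have "a powr (1 - p) = m powr (1 - 1 / p)"
    proof -
      have "- 1 / p * (1 - p) = 1 - 1 / p" using p by (simp add: field_simps)
      then show ?thesis unfolding a_def powr_powr by (rule arg_cong)
    qed
    moreover have "a * m = m powr (1 - 1 / p)" using m by (simp add: a_def powr_diff powr_minus divide_inverse)
    ultimately show ?thesis by simp
  qed
  finally show ?thesis by (simp add: m_def)
qed

text \<open>A discrete Riesz potential of order one: the scale s = \<open>l ^ k\<close> contributes
  s^(1 - d) times the integral over a ball of radius s R. The centres approach \<open>x\<close>
  along the direction \<open>c\<close>, so for a suitable cone all these balls stay inside the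
  domain.\<close>

definition ball_potential :: "real \<Rightarrow> 'a \<Rightarrow> real \<Rightarrow> ('a::euclidean_space \<Rightarrow> real) \<Rightarrow> 'a \<Rightarrow> ennreal" where
  "ball_potential l c R f x = (\<Sum>k. ennreal ((l ^ k) powr (1 - real DIM('a))) *
     (\<integral>\<^sup>+y. ennreal (f y) * indicator (cball (x + l ^ k *\<^sub>R c) (l ^ k * R)) y \<partial>lborel))"

lemma suminf_ennreal_le:
  fixes f :: "nat \<Rightarrow> ennreal"
  assumes "\<And>n. (\<Sum>k<n. f k) \<le> C"
  shows "(\<Sum>k. f k) \<le> C"
  using assms by (intro suminf_le_const) auto

text \<open>The terms grow with \<open>k\<close>, so the sum is comparable to the term of the
  smallest admissible scale; measured against that term it is a geometric sum with ratio
  \<open>l powr \<theta>\<close>.\<close>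

lemma sum_geometric_large_scales:
  fixes l \<theta> \<rho> :: real
  assumes l: "0 < l" "l < 1" and \<theta>: "0 < \<theta>" and \<rho>: "0 < \<rho>"
  shows "(\<Sum>k. if \<rho> \<le> l ^ k then ennreal ((l ^ k) powr (- \<theta>)) else 0) \<le> ennreal (\<rho> powr (- \<theta>) / (1 - l powr \<theta>))"
proof (rule suminf_ennreal_le)
  fix n
  define a where "a = l powr \<theta>"
  have a: "0 < a" "a < 1" using l \<theta> powr_less_mono2[of \<theta> l 1] by (auto simp: a_def)
  let ?A = "{k\<in>{..<n}. \<rho> \<le> l ^ k}"
  have "(\<Sum>k<n. if \<rho> \<le> l ^ k then ennreal ((l ^ k) powr (- \<theta>)) else 0) = (\<Sum>k\<in>?A. ennreal ((l ^ k) powr (- \<theta>)))"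
    by (rule sum.inter_filter[symmetric]) simp
  also have "\<dots> = ennreal (\<Sum>k\<in>?A. (l ^ k) powr (- \<theta>))" by (rule sum_ennreal) simp
  also have "\<dots> \<le> ennreal (\<rho> powr (- \<theta>) / (1 - a))"
  proof (rule ennreal_leI)
    show "(\<Sum>k\<in>?A. (l ^ k) powr (- \<theta>)) \<le> \<rho> powr (- \<theta>) / (1 - a)"
    proof (cases "?A = {}")
      case True
      then show ?thesis using a by (subst True) simp
    next
      case False
      \<comment> \<open>The last index whose scale is still at least \<open>\<rho>\<close>. The sum
        is extended to all \<open>k \<le> K\<close> and read backwards from
        \<open>K\<close>.\<close>
      define K where "K = Max ?A"
      have K: "K \<in> ?A" unfolding K_def by (rule Max_in) (use False in auto)
      have sub: "?A \<subseteq> {..K}" unfolding K_def by auto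
      have e: "(l ^ k) powr (- \<theta>) = inverse a ^ k" for k
      proof -
        have "(l ^ k) powr (- \<theta>) = (l powr real k) powr (- \<theta>)" using l by (simp add: powr_realpow)
        also have "\<dots> = (l powr (- \<theta>)) powr real k" by (simp add: powr_powr mult.commute)
        also have "\<dots> = inverse a ^ k" using l by (simp add: powr_realpow a_def powr_minus)
        finally show ?thesis .
      qed
      have "(\<Sum>k\<in>?A. (l ^ k) powr (- \<theta>)) \<le> (\<Sum>k\<le>K. (l ^ k) powr (- \<theta>))"
        by (rule sum_mono2[OF _ sub]) auto
      also have "\<dots> = (\<Sum>k\<le>K. inverse a ^ K * a ^ (K - k))"
      proof (rule sum.cong)
        fix k assume "k \<in> {..K}"
        then have "inverse a ^ K * a ^ (K - k) = inverse a ^ k * (inverse a ^ (K - k) * a ^ (K - k))"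
          by (simp flip: power_add)
        also have "inverse a ^ (K - k) * a ^ (K - k) = 1" using a by (simp flip: power_mult_distrib)
        finally show "(l ^ k) powr (- \<theta>) = inverse a ^ K * a ^ (K - k)" by (simp add: e)
      qed simp
      also have "\<dots> = inverse a ^ K * (\<Sum>k\<le>K. a ^ k)"
        by (simp add: sum_distrib_left) (rule sum.reindex_bij_witness[of _ "\<lambda>k. K - k" "\<lambda>k. K - k"]; simp)
      also have "\<dots> \<le> \<rho> powr (- \<theta>) * (1 / (1 - a))"
      proof (rule mult_mono)
        show "(\<Sum>k\<le>K. a ^ k) \<le> 1 / (1 - a)"
          using a sum_gp_basic[of a K] by (simp add: pos_le_divide_eq mult.commute)
        have "(l ^ K) powr (- \<theta>) \<le> \<rho> powr (- \<theta>)"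
          using K \<rho> \<theta> by (intro powr_mono2') auto
        then show "inverse a ^ K \<le> \<rho> powr (- \<theta>)" by (simp add: e)
      qed (use a in \<open>auto intro: sum_nonneg\<close>)
      finally show ?thesis by simp
    qed
  qed
  finally show "(\<Sum>k<n. if \<rho> \<le> l ^ k then ennreal ((l ^ k) powr (- \<theta>)) else 0) \<le> ennreal (\<rho> powr (- \<theta>) / (1 - l powr \<theta>))"
    by (simp add: a_def)
qed

text \<open>Below the threshold the first admissible scale dominates, and from it on the scales form
  a geometric progression.\<close>

lemma sum_geometric_small_scales:
  fixes l \<rho> :: real
  assumes l: "0 < l" "l < 1" and \<rho>: "0 < \<rho>"
  shows "(\<Sum>k. if l ^ k < \<rho> then ennreal (l ^ k) else 0) \<le> ennreal (\<rho> / (1 - l))"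
proof (rule suminf_ennreal_le)
  fix n
  let ?A = "{k\<in>{..<n}. l ^ k < \<rho>}"
  have "(\<Sum>k<n. if l ^ k < \<rho> then ennreal (l ^ k) else 0) = (\<Sum>k\<in>?A. ennreal (l ^ k))"
    by (rule sum.inter_filter[symmetric]) simp
  also have "\<dots> = ennreal (\<Sum>k\<in>?A. l ^ k)" by (rule sum_ennreal) (use l in simp)
  also have "\<dots> \<le> ennreal (\<rho> / (1 - l))"
  proof (rule ennreal_leI)
    show "(\<Sum>k\<in>?A. l ^ k) \<le> \<rho> / (1 - l)"
    proof (cases "?A = {}")
      case True
      then show ?thesis using l \<rho> by (subst True) simp
    next
      case False
      define K where "K = Min ?A"
      have K: "K \<in> ?A" unfolding K_def by (rule Min_in) (use False in auto)
      have sub: "?A \<subseteq> {K..<n}" unfolding K_def by auto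
      have "(\<Sum>k\<in>?A. l ^ k) \<le> (\<Sum>k\<in>{K..<n}. l ^ k)"
        by (rule sum_mono2[OF _ sub]) (use l in auto)
      also have "\<dots> = (\<Sum>j<n - K. l ^ (K + j))"
        by (rule sum.reindex_bij_witness[of _ "\<lambda>j. K + j" "\<lambda>k. k - K"]) auto
      also have "\<dots> = l ^ K * (\<Sum>j<n - K. l ^ j)" by (simp add: power_add sum_distrib_left)
      also have "\<dots> \<le> \<rho> * (1 / (1 - l))"
      proof (rule mult_mono)
        show "(\<Sum>j<n - K. l ^ j) \<le> 1 / (1 - l)"
          using l by (simp add: sum_gp_strict divide_right_mono)
        show "l ^ K \<le> \<rho>" using K by simp
      qed (use l \<rho> in \<open>auto intro: sum_nonneg\<close>)
      finally show ?thesis by simp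
    qed
  qed
  finally show "(\<Sum>k<n. if l ^ k < \<rho> then ennreal (l ^ k) else 0) \<le> ennreal (\<rho> / (1 - l))" .
qed

text \<open>Pointwise \<open>f\<close> is at most \<open>L\<close> plus its part above
  \<open>L\<close>; the constant only sees the volume of the ball.\<close>

lemma nn_integral_le_add_truncation:
  fixes f :: "'a::euclidean_space \<Rightarrow> real"
  assumes [measurable]: "f \<in> borel_measurable borel" and f0: "\<And>x. 0 \<le> f x" and L: "0 \<le> L" and r: "0 \<le> r"
  shows "(\<integral>\<^sup>+y. ennreal (f y) * indicator (cball z r) y \<partial>lborel) \<le>
    ennreal (L * (unit_ball_vol (real DIM('a)) * r ^ DIM('a))) +
    (\<integral>\<^sup>+y. ennreal (if L < f y then f y else 0) * indicator (cball z r) y \<partial>lborel)"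
proof -
  have [measurable]: "cball z r \<in> sets borel" by simp
  have "(\<integral>\<^sup>+y. ennreal (f y) * indicator (cball z r) y \<partial>lborel) \<le>
    (\<integral>\<^sup>+y. ennreal L * indicator (cball z r) y + ennreal (if L < f y then f y else 0) * indicator (cball z r) y \<partial>lborel)"
    using L by (intro nn_integral_mono) (auto simp: indicator_def not_less intro: ennreal_leI)
  also have "\<dots> = (\<integral>\<^sup>+y. ennreal L * indicator (cball z r) y \<partial>lborel) +
      (\<integral>\<^sup>+y. ennreal (if L < f y then f y else 0) * indicator (cball z r) y \<partial>lborel)"
    by (rule nn_integral_add) measurable
  also have "(\<integral>\<^sup>+y. ennreal L * indicator (cball z r) y \<partial>lborel) = ennreal L * emeasure lborel (cball z r)"
    by (rule nn_integral_cmult_indicator) simp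
  also have "ennreal L * emeasure lborel (cball z r) = ennreal (L * (unit_ball_vol (real DIM('a)) * r ^ DIM('a)))"
    using L r by (simp only: emeasure_cball_ennreal[OF r]) (simp add: ennreal_mult)
  finally show ?thesis .
qed

text \<open>Large scales are controlled by the norm of \<open>f\<close>, small scales by the truncation height \<open>L\<close>; what remains
  is integrable with a factor that is linear in the scale.\<close>

lemma ball_potential_split:
  fixes f :: "'a::euclidean_space \<Rightarrow> real" and c :: 'a
  assumes l: "0 < l" "l < 1" and R: "0 < R" and p: "1 < p" "p < real DIM('a)"
  defines "\<theta> \<equiv> real DIM('a) / p - 1" and "m \<equiv> unit_ball_vol (real DIM('a)) * R ^ DIM('a)"
  assumes fm [measurable]: "f \<in> borel_measurable borel" and f0: "\<And>x. 0 \<le> f x"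
    and f1: "(\<integral>\<^sup>+x. ennreal (f x powr p) \<partial>lborel) \<le> 1" and \<rho>: "0 < \<rho>" and L: "0 < L"
  obtains D where "D \<in> borel_measurable borel"
    "\<And>x. ball_potential l c R f x \<le> ennreal (2 * m powr (1 - 1 / p) * (\<rho> powr (- \<theta>) / (1 - l powr \<theta>))) +
        ennreal (m * L * (\<rho> / (1 - l))) + D x"
    "(\<integral>\<^sup>+x. D x \<partial>lborel) \<le> ennreal (m * (\<rho> / (1 - l))) * (\<integral>\<^sup>+y. ennreal (if L < f y then f y else 0) \<partial>lborel)"
proof -
  let ?d = "DIM('a)"
  have d: "real ?d > 0" by simp
  have \<theta>: "\<theta> > 0" using p by (simp add: \<theta>_def field_simps)
  have m: "m > 0" using R by (simp add: m_def)
  define g where "g y = (if L < f y then f y else 0)" for y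
  have gm [measurable]: "g \<in> borel_measurable borel" unfolding g_def by measurable
  define T where "T h k x = ennreal ((l ^ k) powr (1 - real ?d)) *
     (\<integral>\<^sup>+y. ennreal (h y) * indicator (cball (x + l ^ k *\<^sub>R c) (l ^ k * R)) y \<partial>lborel)" for h k x
  \<comment> \<open>Only scales below \<open>\<rho>\<close> combined with values of \<open>f\<close>
    above \<open>L\<close> enter the remainder; everything else is bounded by constants.\<close>
  define D where "D x = (\<Sum>k. if l ^ k < \<rho> then T g k x else 0)" for x
  have s: "0 < l ^ k" for k using l by simp
  have sR: "0 < l ^ k * R" for k by (rule mult_pos_pos[OF s R])
  have vol: "unit_ball_vol (real ?d) * (l ^ k * R) ^ ?d = m * (l ^ k) powr (real ?d)" for k
    using s[of k] by (simp add: m_def power_mult_distrib powr_realpow)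
  have ind: "indicator (cball (x + v) r) y = (if dist (x + v) y \<le> r then 1 else 0 :: ennreal)" for x v y :: 'a and r
    by (auto simp: indicator_def)
  have Tm [measurable]: "T g k \<in> borel_measurable borel" for k
    unfolding T_def ind by measurable
  have Dm: "D \<in> borel_measurable borel" unfolding D_def by measurable
  have tm: "T f k x \<le> (if \<rho> \<le> l ^ k then ennreal (2 * m powr (1 - 1 / p)) * ennreal ((l ^ k) powr (- \<theta>)) else 0)
      + (if l ^ k < \<rho> then ennreal (m * L) * ennreal (l ^ k) else 0) + (if l ^ k < \<rho> then T g k x else 0)" for k x
  proof (cases "\<rho> \<le> l ^ k")
    case True
    have "T f k x \<le> ennreal ((l ^ k) powr (1 - real ?d)) *
        ennreal (2 * (m * (l ^ k) powr (real ?d)) powr (1 - 1 / p))"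
      unfolding T_def by (rule mult_left_mono[OF nn_integral_ball_le[of f p "l ^ k * R" "x + l ^ k *\<^sub>R c", unfolded vol,
            OF fm f0 less_imp_le[OF p(1)] f1 sR]]) simp
    also have "\<dots> = ennreal (2 * m powr (1 - 1 / p) * (l ^ k) powr (- \<theta>))"
    proof -
      have "(l ^ k) powr (1 - real ?d) * (m * (l ^ k) powr (real ?d)) powr (1 - 1 / p) =
         m powr (1 - 1 / p) * ((l ^ k) powr (1 - real ?d) * (l ^ k) powr (real ?d * (1 - 1 / p)))"
        using m s[of k] by (simp add: powr_mult powr_powr)
      \<comment> \<open>The exponents add up to 1 - d + d (1 - 1/p) = 1 - d/p, which is
        \<open>- \<theta>\<close>.\<close>
      also have "(l ^ k) powr (1 - real ?d) * (l ^ k) powr (real ?d * (1 - 1 / p)) = (l ^ k) powr (- \<theta>)"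
        unfolding powr_add[symmetric] by (rule arg_cong) (use p in \<open>simp add: \<theta>_def field_simps\<close>)
      finally show ?thesis by (simp flip: ennreal_mult)
    qed
    finally show ?thesis using True m by (simp add: ennreal_mult)
  next
    case False
    have "T f k x \<le> ennreal ((l ^ k) powr (1 - real ?d)) * (ennreal (L * (m * (l ^ k) powr (real ?d))) +
        (\<integral>\<^sup>+y. ennreal (g y) * indicator (cball (x + l ^ k *\<^sub>R c) (l ^ k * R)) y \<partial>lborel))"
      unfolding T_def g_def by (rule mult_left_mono[OF nn_integral_le_add_truncation[of f L "l ^ k * R" "x + l ^ k *\<^sub>R c", unfolded vol,
            OF fm f0 less_imp_le[OF L] less_imp_le[OF sR]]]) simp
    also have "\<dots> = ennreal ((l ^ k) powr (1 - real ?d)) * ennreal (L * (m * (l ^ k) powr (real ?d))) + T g k x"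
      by (simp add: T_def distrib_left)
    also have "ennreal ((l ^ k) powr (1 - real ?d)) * ennreal (L * (m * (l ^ k) powr (real ?d))) = ennreal (m * L) * ennreal (l ^ k)"
    proof -
      have "(l ^ k) powr (1 - real ?d) * (l ^ k) powr (real ?d) = l ^ k"
        using s[of k] by (simp flip: powr_add)
      then have "(l ^ k) powr (1 - real ?d) * (L * (m * (l ^ k) powr (real ?d))) = m * L * l ^ k"
        by (simp add: mult_ac)
      then show ?thesis using m L s[of k] by (simp flip: ennreal_mult)
    qed
    finally show ?thesis using False by simp
  qed
  show thesis
  proof (rule that[OF Dm])
    fix x
    have "ball_potential l c R f x = (\<Sum>k. T f k x)" by (simp add: ball_potential_def T_def)
    also have "\<dots> \<le> (\<Sum>k. (if \<rho> \<le> l ^ k then ennreal (2 * m powr (1 - 1 / p)) * ennreal ((l ^ k) powr (- \<theta>)) else 0)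
      + (if l ^ k < \<rho> then ennreal (m * L) * ennreal (l ^ k) else 0) + (if l ^ k < \<rho> then T g k x else 0))"
      by (intro suminf_le tm) auto
    also have "\<dots> = (\<Sum>k. if \<rho> \<le> l ^ k then ennreal (2 * m powr (1 - 1 / p)) * ennreal ((l ^ k) powr (- \<theta>)) else 0)
      + (\<Sum>k. if l ^ k < \<rho> then ennreal (m * L) * ennreal (l ^ k) else 0) + D x"
      unfolding D_def by (simp only: suminf_add[OF summableI summableI])
    also have "(\<Sum>k. if \<rho> \<le> l ^ k then ennreal (2 * m powr (1 - 1 / p)) * ennreal ((l ^ k) powr (- \<theta>)) else 0) =
      ennreal (2 * m powr (1 - 1 / p)) * (\<Sum>k. if \<rho> \<le> l ^ k then ennreal ((l ^ k) powr (- \<theta>)) else 0)"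
      by (subst ennreal_suminf_cmult[symmetric]) (simp add: if_distrib cong: if_cong)
    also have "(\<Sum>k. if l ^ k < \<rho> then ennreal (m * L) * ennreal (l ^ k) else 0) =
      ennreal (m * L) * (\<Sum>k. if l ^ k < \<rho> then ennreal (l ^ k) else 0)"
      by (subst ennreal_suminf_cmult[symmetric]) (simp add: if_distrib cong: if_cong)
    also have "ennreal (2 * m powr (1 - 1 / p)) * (\<Sum>k. if \<rho> \<le> l ^ k then ennreal ((l ^ k) powr (- \<theta>)) else 0) +
        ennreal (m * L) * (\<Sum>k. if l ^ k < \<rho> then ennreal (l ^ k) else 0) + D x \<le>
      ennreal (2 * m powr (1 - 1 / p)) * ennreal (\<rho> powr (- \<theta>) / (1 - l powr \<theta>)) +
        ennreal (m * L) * ennreal (\<rho> / (1 - l)) + D x"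
      by (intro add_mono mult_left_mono sum_geometric_large_scales sum_geometric_small_scales l \<rho> \<theta>) auto
    also have "\<dots> = ennreal (2 * m powr (1 - 1 / p) * (\<rho> powr (- \<theta>) / (1 - l powr \<theta>))) +
        ennreal (m * L * (\<rho> / (1 - l))) + D x"
    proof -
      have "0 \<le> \<rho> powr (- \<theta>) / (1 - l powr \<theta>)" using l \<theta> powr_less_mono2[of \<theta> l 1] by simp
      then show ?thesis using m L l \<rho> by (simp flip: ennreal_mult)
    qed
    finally show "ball_potential l c R f x \<le> ennreal (2 * m powr (1 - 1 / p) * (\<rho> powr (- \<theta>) / (1 - l powr \<theta>))) +
        ennreal (m * L * (\<rho> / (1 - l))) + D x" .
  next
    \<comment> \<open>Integration over \<open>x\<close> turns the ball integrals into the total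
      integral times a volume proportional to s^d; against the weight s^(1 - d) one power of the
      scale s remains, which makes the sum over small scales converge.\<close>
    have Ti: "(\<integral>\<^sup>+x. T g k x \<partial>lborel) = ennreal m * ennreal (l ^ k) * (\<integral>\<^sup>+y. ennreal (g y) \<partial>lborel)" for k
    proof -
      have "(\<integral>\<^sup>+x. T g k x \<partial>lborel) = ennreal ((l ^ k) powr (1 - real ?d)) *
         (\<integral>\<^sup>+x. (\<integral>\<^sup>+y. ennreal (g y) * indicator (cball (x + l ^ k *\<^sub>R c) (l ^ k * R)) y \<partial>lborel) \<partial>lborel)"
        unfolding T_def ind by (rule nn_integral_cmult) measurable
      also have "\<dots> = ennreal ((l ^ k) powr (1 - real ?d)) * (ennreal (m * (l ^ k) powr (real ?d)) * (\<integral>\<^sup>+y. ennreal (g y) \<partial>lborel))"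
        by (subst nn_integral_ball_average[of "\<lambda>y. ennreal (g y)" "l ^ k * R" "l ^ k *\<^sub>R c", unfolded vol])
          (use less_imp_le[OF sR] in simp_all)
      also have "\<dots> = ennreal ((l ^ k) powr (1 - real ?d) * (m * (l ^ k) powr (real ?d))) * (\<integral>\<^sup>+y. ennreal (g y) \<partial>lborel)"
        using m by (subst ennreal_mult) (auto simp: mult.assoc)
      also have "(l ^ k) powr (1 - real ?d) * (m * (l ^ k) powr (real ?d)) = m * ((l ^ k) powr (1 - real ?d) * (l ^ k) powr (real ?d))"
        by simp
      also have "(l ^ k) powr (1 - real ?d) * (l ^ k) powr (real ?d) = l ^ k"
        using s[of k] by (simp flip: powr_add)
      finally show ?thesis using m s[of k] by (simp add: ennreal_mult)
    qed
    have "(\<integral>\<^sup>+x. D x \<partial>lborel) = (\<Sum>k. \<integral>\<^sup>+x. (if l ^ k < \<rho> then T g k x else 0) \<partial>lborel)"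
      unfolding D_def by (rule nn_integral_suminf) measurable
    also have "\<dots> = (\<Sum>k. ennreal m * (\<integral>\<^sup>+y. ennreal (g y) \<partial>lborel) * (if l ^ k < \<rho> then ennreal (l ^ k) else 0))"
      by (intro suminf_cong) (auto simp: Ti mult_ac)
    also have "\<dots> = ennreal m * (\<integral>\<^sup>+y. ennreal (g y) \<partial>lborel) * (\<Sum>k. if l ^ k < \<rho> then ennreal (l ^ k) else 0)"
      by (rule ennreal_suminf_cmult)
    also have "\<dots> \<le> ennreal m * (\<integral>\<^sup>+y. ennreal (g y) \<partial>lborel) * ennreal (\<rho> / (1 - l))"
      by (intro mult_left_mono sum_geometric_small_scales l \<rho>) auto
    also have "\<dots> = ennreal (m * (\<rho> / (1 - l))) * (\<integral>\<^sup>+y. ennreal (g y) \<partial>lborel)"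
      using m \<rho> l by (subst ennreal_mult) (auto simp: mult_ac)
    finally show "(\<integral>\<^sup>+x. D x \<partial>lborel) \<le> ennreal (m * (\<rho> / (1 - l))) * (\<integral>\<^sup>+y. ennreal (if L < f y then f y else 0) \<partial>lborel)"
      by (simp only: g_def)
  qed
qed

text \<open>Above the dimension the contribution of a scale s is at most a multiple of s^(1 - d/p)
  with a positive exponent, so all scales together form one convergent geometric series.\<close>

lemma ball_potential_bounded:
  fixes f :: "'a::euclidean_space \<Rightarrow> real" and c :: 'a
  assumes l: "0 < l" "l < 1" and R: "0 < R" and p: "1 \<le> p" "real DIM('a) < p"
  shows "\<exists>C>0. \<forall>f\<in>borel_measurable borel. (\<forall>x. 0 \<le> f x) \<longrightarrow> (\<integral>\<^sup>+x. ennreal (f x powr p) \<partial>lborel) \<le> 1 \<longrightarrow>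
     (\<forall>x. ball_potential l c R f x \<le> ennreal C)"
proof -
  let ?d = "DIM('a)"
  define \<theta> where "\<theta> = 1 - real ?d / p"
  define m where "m = unit_ball_vol (real ?d) * R ^ ?d"
  have m: "m > 0" using R by (simp add: m_def)
  have \<theta>: "\<theta> > 0" using p by (simp add: \<theta>_def field_simps)
  define a where "a = l powr \<theta>"
  have a: "0 < a" "a < 1" using l \<theta> powr_less_mono2[of \<theta> l 1] by (auto simp: a_def)
  define C where "C = 2 * m powr (1 - 1 / p) / (1 - a)"
  have C: "C > 0" using m a by (simp add: C_def)
  have s: "0 < l ^ k" for k using l by simp
  have sR: "0 < l ^ k * R" for k by (rule mult_pos_pos[OF s R])
  have vol: "unit_ball_vol (real ?d) * (l ^ k * R) ^ ?d = m * (l ^ k) powr (real ?d)" for k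
    using s[of k] by (simp add: m_def power_mult_distrib powr_realpow)
  have "ball_potential l c R f x \<le> ennreal C"
    if f: "f \<in> borel_measurable borel" "\<forall>x. 0 \<le> f x" "(\<integral>\<^sup>+x. ennreal (f x powr p) \<partial>lborel) \<le> 1" for f :: "'a \<Rightarrow> real" and x
    unfolding ball_potential_def
  proof (rule suminf_ennreal_le)
    fix n
    have "ennreal ((l ^ k) powr (1 - real ?d)) *
       (\<integral>\<^sup>+y. ennreal (f y) * indicator (cball (x + l ^ k *\<^sub>R c) (l ^ k * R)) y \<partial>lborel) \<le>
       ennreal (2 * m powr (1 - 1 / p) * a ^ k)" for k
    proof -
      have "ennreal ((l ^ k) powr (1 - real ?d)) *
       (\<integral>\<^sup>+y. ennreal (f y) * indicator (cball (x + l ^ k *\<^sub>R c) (l ^ k * R)) y \<partial>lborel) \<le>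
        ennreal ((l ^ k) powr (1 - real ?d)) * ennreal (2 * (m * (l ^ k) powr (real ?d)) powr (1 - 1 / p))"
        by (rule mult_left_mono[OF nn_integral_ball_le[of f p "l ^ k * R" "x + l ^ k *\<^sub>R c", unfolded vol,
              OF f(1) _ p(1) f(3) sR]]) (use f(2) in auto)
      also have "\<dots> = ennreal ((l ^ k) powr (1 - real ?d) * (2 * (m * (l ^ k) powr (real ?d)) powr (1 - 1 / p)))"
        by (simp flip: ennreal_mult)
      also have "(l ^ k) powr (1 - real ?d) * (2 * (m * (l ^ k) powr (real ?d)) powr (1 - 1 / p)) =
         2 * m powr (1 - 1 / p) * ((l ^ k) powr (1 - real ?d) * (l ^ k) powr (real ?d * (1 - 1 / p)))"
        using m s[of k] by (simp add: powr_mult powr_powr)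
      also have "(l ^ k) powr (1 - real ?d) * (l ^ k) powr (real ?d * (1 - 1 / p)) = (l ^ k) powr \<theta>"
        unfolding powr_add[symmetric] by (rule arg_cong) (use p in \<open>simp add: \<theta>_def field_simps\<close>)
      also have "(l ^ k) powr \<theta> = a ^ k"
      proof -
        have "(l ^ k) powr \<theta> = (l powr real k) powr \<theta>" using l by (simp add: powr_realpow)
        also have "\<dots> = (l powr \<theta>) powr real k" by (simp add: powr_powr mult.commute)
        finally show ?thesis using l by (simp add: powr_realpow a_def)
      qed
      finally show ?thesis .
    qed
    then have "(\<Sum>k<n. ennreal ((l ^ k) powr (1 - real ?d)) *
       (\<integral>\<^sup>+y. ennreal (f y) * indicator (cball (x + l ^ k *\<^sub>R c) (l ^ k * R)) y \<partial>lborel)) \<le>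
       (\<Sum>k<n. ennreal (2 * m powr (1 - 1 / p) * a ^ k))" by (rule sum_mono)
    also have "\<dots> = ennreal (\<Sum>k<n. 2 * m powr (1 - 1 / p) * a ^ k)"
      by (rule sum_ennreal) (use a in simp)
    also have "\<dots> \<le> ennreal C"
    proof (rule ennreal_leI)
      have "(\<Sum>k<n. a ^ k) \<le> 1 / (1 - a)" using a by (simp add: sum_gp_strict divide_right_mono)
      then have "2 * m powr (1 - 1 / p) * (\<Sum>k<n. a ^ k) \<le> 2 * m powr (1 - 1 / p) * (1 / (1 - a))"
        by (intro mult_left_mono) auto
      then show "(\<Sum>k<n. 2 * m powr (1 - 1 / p) * a ^ k) \<le> C" by (simp add: C_def sum_distrib_left)
    qed
    finally show "(\<Sum>k<n. ennreal ((l ^ k) powr (1 - real ?d)) *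
       (\<integral>\<^sup>+y. ennreal (f y) * indicator (cball (x + l ^ k *\<^sub>R c) (l ^ k * R)) y \<partial>lborel)) \<le> ennreal C" .
  qed
  then show ?thesis using C by (intro exI[of _ C]) auto
qed

text \<open>Layer-cake integration: at height \<open>t\<close> the scale \<open>\<rho> t\<close> and the truncation height \<open>L t\<close> are chosen so that the
  first two terms of the splitting stay below \<open>t / 3\<close>.\<close>

lemma ball_potential_strong_type:
  fixes c :: "'a::euclidean_space"
  assumes l: "0 < l" "l < 1" and R: "0 < R" and p: "1 < p" "p < real DIM('a)"
  defines "q \<equiv> real DIM('a) * p / (real DIM('a) - p)"
  shows "\<exists>C>0. \<forall>f\<in>borel_measurable borel. \<forall>w\<in>borel_measurable borel.
     (\<forall>x. 0 \<le> f x) \<longrightarrow> (\<forall>x. 0 \<le> w x) \<longrightarrow> (\<integral>\<^sup>+x. ennreal (f x powr p) \<partial>lborel) \<le> 1 \<longrightarrow>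
     (AE x in lborel. ennreal (w x) \<le> ball_potential l c R f x) \<longrightarrow>
     (\<integral>\<^sup>+x. ennreal (w x powr q) \<partial>lborel) \<le> ennreal C"
proof -
  let ?d = "real DIM('a)"
  define \<theta> where "\<theta> = ?d / p - 1"
  define m where "m = unit_ball_vol ?d * R ^ DIM('a)"
  have \<theta>: "\<theta> > 0" using p by (simp add: \<theta>_def field_simps)
  have m: "m > 0" using R by (simp add: m_def)
  define c1 where "c1 = 2 * m powr (1 - 1 / p) / (1 - l powr \<theta>)"
  define c2 where "c2 = m / (1 - l)"
  have "l powr \<theta> < 1" using l \<theta> powr_less_mono2[of \<theta> l 1] by simp
  then have c: "c1 > 0" "c2 > 0" using m l by (auto simp: c1_def c2_def)
  \<comment> \<open>The scale is solved from the large-scale term alone; with this scale the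
    truncation height is then solved from the small-scale term.\<close>
  define \<rho> where "\<rho> t = (t / (3 * c1)) powr (- 1 / \<theta>)" for t
  define L where "L t = t / (3 * c2 * \<rho> t)" for t
  define a1 where "a1 = (3 * c1) powr (1 / \<theta>)"
  define a2 where "a2 = 1 / (3 * c2 * a1)"
  have a: "a1 > 0" "a2 > 0" using c by (auto simp: a1_def a2_def)
  have \<rho>: "\<rho> t > 0" "\<rho> t = a1 * t powr (- 1 / \<theta>)" "c1 * \<rho> t powr (- \<theta>) = t / 3" if "t > 0" for t
  proof -
    show "\<rho> t > 0" using that c by (simp add: \<rho>_def)
    show "\<rho> t = a1 * t powr (- 1 / \<theta>)"
    proof -
      have "(3 * c1) powr (- 1 / \<theta>) = inverse a1"
        unfolding a1_def powr_minus[symmetric] by simp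
      moreover have "\<rho> t = t powr (- 1 / \<theta>) / (3 * c1) powr (- 1 / \<theta>)"
        unfolding \<rho>_def by (rule powr_divide)
      ultimately show ?thesis by (simp add: divide_inverse)
    qed
    have "- 1 / \<theta> * - \<theta> = 1" using \<theta> by simp
    then have "\<rho> t powr (- \<theta>) = t / (3 * c1)" using that c by (simp add: \<rho>_def powr_powr)
    then show "c1 * \<rho> t powr (- \<theta>) = t / 3" using c by simp
  qed
  have L: "L t > 0" "L t = a2 * t powr (1 + 1 / \<theta>)" "c2 * L t * \<rho> t = t / 3" if "t > 0" for t
  proof -
    show "L t > 0" using that c \<rho>(1)[OF that] by (simp add: L_def)
    show "L t = a2 * t powr (1 + 1 / \<theta>)"
    proof -
      have e1: "t powr (1 + 1 / \<theta>) = t * t powr (1 / \<theta>)" using that by (simp add: powr_add)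
      have "- 1 / \<theta> = - (1 / \<theta>)" by simp
      then have e2: "t powr (- 1 / \<theta>) = inverse (t powr (1 / \<theta>))" by (simp only: powr_minus)
      have "t / (3 * c2 * (a1 * inverse P)) = 1 / (3 * c2 * a1) * (t * P)" for P :: real
        by (simp add: field_simps)
      then show ?thesis unfolding L_def \<rho>(2)[OF that] a2_def e1 e2 .
    qed
    show "c2 * L t * \<rho> t = t / 3" using that c \<rho>(1)[OF that] by (simp add: L_def)
  qed
  \<comment> \<open>The layer-cake weight contributes t^(q - 1), the scale t^(-1/\<theta>) and
    Markov's inequality 1/t, in total t^(e - 1). The critical \<open>q\<close> is the value with
    \<open>e / (1 + 1 / \<theta>) = p - 1\<close>: integration up to the level where the truncation
    height reaches \<open>f y\<close> gives f^(p - 1), and the remaining factor \<open>f y\<close>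
    completes the p-th power.\<close>
  define e where "e = q - 1 - 1 / \<theta>"
  have \<theta>': "1 / \<theta> = p / (?d - p)" using p by (simp add: \<theta>_def field_simps)
  have e: "e > 0" "e / (1 + 1 / \<theta>) = p - 1"
  proof -
    have "x / y - 1 - z / y = (x - y - z) / y" if "y \<noteq> 0" for x y z :: real
      using that by (simp add: field_simps)
    then have "e = (?d * p - (?d - p) - p) / (?d - p)"
      unfolding e_def q_def \<theta>' using p by simp
    also have "?d * p - (?d - p) - p = ?d * (p - 1)" by (simp add: algebra_simps)
    finally have e': "e = ?d * (p - 1) / (?d - p)" .
    have t': "1 + 1 / \<theta> = ?d / (?d - p)" using p by (simp add: \<theta>' field_simps)
    show "e > 0" unfolding e' using p by simp
    show "e / (1 + 1 / \<theta>) = p - 1" unfolding e' t' using p by simp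
  qed
  have q: "q > 0" using p by (simp add: q_def)
  define K where "K = 3 * c2 * a1 * q"
  have K: "K > 0" using c a q by (simp add: K_def)
  define C where "C = K * a2 powr (1 - p) / e"
  have C: "C > 0" using K a e by (simp add: C_def)
  \<comment> \<open>The real function \<open>w\<close> below the potential stands in for the
    potential itself, whose extended values may be infinite and do not admit
    \<open>powr\<close>.\<close>
  have "(\<integral>\<^sup>+x. ennreal (w x powr q) \<partial>lborel) \<le> ennreal C"
    if fm [measurable]: "f \<in> borel_measurable borel" and wm [measurable]: "w \<in> borel_measurable borel"
      and f0: "\<And>x. 0 \<le> f x" and w0: "\<And>x. 0 \<le> w x" and f1: "(\<integral>\<^sup>+x. ennreal (f x powr p) \<partial>lborel) \<le> 1"
      and wf: "AE x in lborel. ennreal (w x) \<le> ball_potential l c R f x" for f w :: "'a \<Rightarrow> real"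
  proof -
    have level: "emeasure lborel {x. t < w x} \<le>
        ennreal (3 * c2 * \<rho> t / t) * (\<integral>\<^sup>+y. ennreal (if L t < f y then f y else 0) \<partial>lborel)" if t: "t > 0" for t
    proof -
      obtain D where D: "D \<in> borel_measurable borel"
        "\<And>x. ball_potential l c R f x \<le> ennreal (2 * m powr (1 - 1 / p) * (\<rho> t powr (- \<theta>) / (1 - l powr \<theta>))) +
          ennreal (m * L t * (\<rho> t / (1 - l))) + D x"
        "(\<integral>\<^sup>+x. D x \<partial>lborel) \<le> ennreal (m * (\<rho> t / (1 - l))) * (\<integral>\<^sup>+y. ennreal (if L t < f y then f y else 0) \<partial>lborel)"
        by (rule ball_potential_split[OF l R p fm f0 f1 \<rho>(1)[OF t] L(1)[OF t], of c])
          (rule that[unfolded \<theta>_def m_def])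
      have D2: "ball_potential l c R f x \<le> ennreal (t / 3) + ennreal (t / 3) + D x" for x
      proof -
        have e1: "2 * m powr (1 - 1 / p) * (\<rho> t powr (- \<theta>) / (1 - l powr \<theta>)) = t / 3"
          using \<rho>(3)[OF t] by (simp add: c1_def)
        have e2: "m * L t * (\<rho> t / (1 - l)) = t / 3" using L(3)[OF t] by (simp add: c2_def)
        show ?thesis using D(2)[of x] unfolding e1 e2 .
      qed
      have [measurable]: "D \<in> borel_measurable lborel" using D(1) by simp
      have "emeasure lborel {x. t < w x} \<le> emeasure lborel {x\<in>UNIV. 1 \<le> ennreal (3 / t) * D x}"
      proof (rule emeasure_mono_AE)
        show "AE x in lborel. x \<in> {x. t < w x} \<longrightarrow> x \<in> {x\<in>UNIV. 1 \<le> ennreal (3 / t) * D x}"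
          using wf
        proof eventually_elim
          case (elim x)
          \<comment> \<open>Two thirds of the level are used up by the constant terms, so the
            remainder accounts for at least \<open>t / 3\<close> wherever \<open>w\<close> exceeds
            \<open>t\<close>; Markov's inequality measures this set.\<close>
          have "1 \<le> ennreal (3 / t) * D x" if "t < w x"
          proof (cases "D x")
            case (real r)
            have "ennreal (w x) \<le> ennreal (t / 3) + ennreal (t / 3) + ennreal r"
              using elim D2[of x] real(2) by (auto intro: order_trans)
            also have "\<dots> = ennreal (t / 3 + t / 3 + r)"
            proof -
              have n: "0 \<le> t / 3" using t by simp
              show ?thesis by (simp only: ennreal_plus n real(1) add_nonneg_nonneg)
            qed
            finally have "w x \<le> t / 3 + t / 3 + r" using t real(1) by (subst (asm) ennreal_le_iff) auto
            then have "1 \<le> 3 / t * r" using that t by (simp add: field_simps)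
            then have "ennreal 1 \<le> ennreal (3 / t * r)" by (rule ennreal_leI)
            also have "ennreal (3 / t * r) = ennreal (3 / t) * ennreal r"
              by (rule ennreal_mult) (use t real in auto)
            finally show ?thesis unfolding real(2) by (simp only: ennreal_1)
          next
            case top
            then show ?thesis using t by (simp add: ennreal_mult_top)
          qed
          then show ?case by simp
        qed
        show "{x\<in>UNIV. 1 \<le> ennreal (3 / t) * D x} \<in> sets lborel" by measurable
      qed
      also have "\<dots> \<le> ennreal (3 / t) * (\<integral>\<^sup>+x. D x * indicator UNIV x \<partial>lborel)"
        by (rule nn_integral_Markov_inequality) auto
      also have "\<dots> \<le> ennreal (3 / t) * (ennreal (m * (\<rho> t / (1 - l))) * (\<integral>\<^sup>+y. ennreal (if L t < f y then f y else 0) \<partial>lborel))"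
        using D(3) by (intro mult_left_mono) auto
      also have "\<dots> = ennreal (3 * c2 * \<rho> t / t) * (\<integral>\<^sup>+y. ennreal (if L t < f y then f y else 0) \<partial>lborel)"
      proof -
        have "ennreal (3 / t) * ennreal (m * (\<rho> t / (1 - l))) = ennreal (3 * c2 * \<rho> t / t)"
          using t m \<rho>(1)[OF t] l by (subst ennreal_mult[symmetric]) (auto simp: c2_def mult_ac)
        then show ?thesis by (simp add: mult.assoc[symmetric])
      qed
      finally show ?thesis .
    qed
    have lw: "ennreal (w x powr q) = (\<integral>\<^sup>+t. ennreal (q * t powr (q - 1)) * (if 0 < t \<and> t < w x then 1 else 0) \<partial>lborel)" for x
    proof -
      have "ennreal (w x powr q) = ennreal q * ennreal (w x powr (q - 1 + 1) / (q - 1 + 1))"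
        using q by (simp flip: ennreal_mult)
      also have "\<dots> = ennreal q * (\<integral>\<^sup>+t. ennreal (t powr (q - 1)) * indicator {0<..<w x} t \<partial>lborel)"
        using q w0 by (subst nn_integral_powr_interval) auto
      also have "\<dots> = (\<integral>\<^sup>+t. ennreal q * (ennreal (t powr (q - 1)) * indicator {0<..<w x} t) \<partial>lborel)"
        by (rule nn_integral_cmult[symmetric]) measurable
      also have "\<dots> = (\<integral>\<^sup>+t. ennreal (q * t powr (q - 1)) * (if 0 < t \<and> t < w x then 1 else 0) \<partial>lborel)"
        using q by (intro nn_integral_cong) (auto simp: indicator_def ennreal_mult)
      finally show ?thesis .
    qed
    have "(\<integral>\<^sup>+x. ennreal (w x powr q) \<partial>lborel) =
      (\<integral>\<^sup>+x. (\<integral>\<^sup>+t. ennreal (q * t powr (q - 1)) * (if 0 < t \<and> t < w x then 1 else 0) \<partial>lborel) \<partial>lborel)"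
      by (simp only: lw)
    also have "\<dots> = (\<integral>\<^sup>+t. (\<integral>\<^sup>+x. ennreal (q * t powr (q - 1)) * (if 0 < t \<and> t < w x then 1 else 0) \<partial>lborel) \<partial>lborel)"
      by (rule lborel_pair.Fubini') measurable
    also have "\<dots> \<le> (\<integral>\<^sup>+t. (\<integral>\<^sup>+y. ennreal (K * t powr (e - 1)) * (if 0 < t \<and> a2 * t powr (1 + 1 / \<theta>) < f y then ennreal (f y) else 0) \<partial>lborel) \<partial>lborel)"
    proof (rule nn_integral_mono)
      fix t :: real
      show "(\<integral>\<^sup>+x. ennreal (q * t powr (q - 1)) * (if 0 < t \<and> t < w x then 1 else 0) \<partial>lborel) \<le>
        (\<integral>\<^sup>+y. ennreal (K * t powr (e - 1)) * (if 0 < t \<and> a2 * t powr (1 + 1 / \<theta>) < f y then ennreal (f y) else 0) \<partial>lborel)"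
      proof (cases "0 < t")
        case t: True
        have "(\<integral>\<^sup>+x. ennreal (q * t powr (q - 1)) * (if 0 < t \<and> t < w x then 1 else 0) \<partial>lborel) =
          (\<integral>\<^sup>+x. ennreal (q * t powr (q - 1)) * indicator {x. t < w x} x \<partial>lborel)"
          using t by (intro nn_integral_cong) (auto simp: indicator_def)
        also have "\<dots> = ennreal (q * t powr (q - 1)) * emeasure lborel {x. t < w x}"
          by (rule nn_integral_cmult_indicator) measurable
        also have "\<dots> \<le> ennreal (q * t powr (q - 1)) * (ennreal (3 * c2 * \<rho> t / t) * (\<integral>\<^sup>+y. ennreal (if L t < f y then f y else 0) \<partial>lborel))"
          by (intro mult_left_mono level t) simp
        also have "\<dots> = ennreal (K * t powr (e - 1)) * (\<integral>\<^sup>+y. ennreal (if L t < f y then f y else 0) \<partial>lborel)"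
        proof -
          have "t powr (q - 1) * t powr (- 1 / \<theta>) / t = t powr (e - 1)"
          proof -
            have "t powr (q - 1) * t powr (- 1 / \<theta>) * t powr (-1) = t powr (e - 1)"
              unfolding powr_add[symmetric] e_def by (rule arg_cong) simp
            then show ?thesis using t by (simp add: powr_minus divide_inverse)
          qed
          moreover have "q * A * (3 * c2 * (a1 * B) / t) = K * (A * B / t)" for A B
            by (simp add: K_def)
          ultimately have "q * t powr (q - 1) * (3 * c2 * \<rho> t / t) = K * t powr (e - 1)"
            unfolding \<rho>(2)[OF t] by (simp only:)
          then have "ennreal (q * t powr (q - 1)) * ennreal (3 * c2 * \<rho> t / t) = ennreal (K * t powr (e - 1))"
            using t q c \<rho>(1)[OF t] by (subst ennreal_mult[symmetric]) auto
          then show ?thesis by (simp add: mult.assoc[symmetric])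
        qed
        also have "\<dots> = (\<integral>\<^sup>+y. ennreal (K * t powr (e - 1)) * ennreal (if L t < f y then f y else 0) \<partial>lborel)"
          by (rule nn_integral_cmult[symmetric]) measurable
        also have "\<dots> = (\<integral>\<^sup>+y. ennreal (K * t powr (e - 1)) * (if 0 < t \<and> a2 * t powr (1 + 1 / \<theta>) < f y then ennreal (f y) else 0) \<partial>lborel)"
          using t by (intro nn_integral_cong) (auto simp: L(2)[OF t])
        finally show ?thesis by simp
      qed simp
    qed
    \<comment> \<open>After a second exchange the inner integral runs, for fixed \<open>y\<close>,
      over the levels whose truncation height is below \<open>f y\<close>. Since the height
      increases with the level, these form an interval starting at 0.\<close>
    also have "\<dots> = (\<integral>\<^sup>+y. (\<integral>\<^sup>+t. ennreal (K * t powr (e - 1)) * (if 0 < t \<and> a2 * t powr (1 + 1 / \<theta>) < f y then ennreal (f y) else 0) \<partial>lborel) \<partial>lborel)"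
      by (rule lborel_pair.Fubini') measurable
    also have "\<dots> \<le> (\<integral>\<^sup>+y. ennreal C * ennreal (f y powr p) \<partial>lborel)"
    proof (rule nn_integral_mono)
      fix y
      define z where "z = (f y / a2) powr (1 / (1 + 1 / \<theta>))"
      have z0: "z \<ge> 0" by (simp add: z_def)
      have \<theta>1: "1 + 1 / \<theta> > 0" using \<theta> by (simp add: add_pos_pos)
      have zt: "t < z" if "0 < t" "a2 * t powr (1 + 1 / \<theta>) < f y" for t
      proof -
        have "t = (t powr (1 + 1 / \<theta>)) powr (1 / (1 + 1 / \<theta>))"
          using that \<theta>1 by (simp add: powr_powr)
        also have "\<dots> < z" unfolding z_def
          using that a \<theta>1 by (intro powr_less_mono2) (auto simp: field_simps)
        finally show ?thesis .
      qed
      have "(\<integral>\<^sup>+t. ennreal (K * t powr (e - 1)) * (if 0 < t \<and> a2 * t powr (1 + 1 / \<theta>) < f y then ennreal (f y) else 0) \<partial>lborel) \<le>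
        (\<integral>\<^sup>+t. ennreal (K * f y) * (ennreal (t powr (e - 1)) * indicator {0<..<z} t) \<partial>lborel)"
      proof (rule nn_integral_mono)
        fix t
        show "ennreal (K * t powr (e - 1)) * (if 0 < t \<and> a2 * t powr (1 + 1 / \<theta>) < f y then ennreal (f y) else 0)
            \<le> ennreal (K * f y) * (ennreal (t powr (e - 1)) * indicator {0<..<z} t)"
        proof (cases "0 < t \<and> a2 * t powr (1 + 1 / \<theta>) < f y")
          case True
          then show ?thesis using zt[of t] K f0 by (simp add: ennreal_mult mult_ac)
        next
          case False
          then have "(if 0 < t \<and> a2 * t powr (1 + 1 / \<theta>) < f y then ennreal (f y) else 0) = 0" by (rule if_not_P)
          then show ?thesis by simp
        qed
      qed
      also have "\<dots> = ennreal (K * f y) * (\<integral>\<^sup>+t. ennreal (t powr (e - 1)) * indicator {0<..<z} t \<partial>lborel)"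
        by (rule nn_integral_cmult) measurable
      also have "\<dots> = ennreal (K * f y) * ennreal (z powr e / e)"
        using nn_integral_powr_interval[of "e - 1" z] e z0 by simp
      also have "\<dots> = ennreal (C * f y powr p)"
      proof -
        have "z powr e = (f y / a2) powr (p - 1)"
          using e(2) by (simp add: z_def powr_powr)
        also have "\<dots> = f y powr (p - 1) * a2 powr (1 - p)"
          using f0 a by (simp add: powr_divide powr_diff)
        finally have "K * f y * (z powr e / e) = C * (f y * f y powr (p - 1))"
          by (simp add: C_def)
        also have "f y * f y powr (p - 1) = f y powr p"
          using f0[of y] p by (cases "f y = 0") (auto simp: powr_diff)
        finally show ?thesis using K f0 e z0 by (simp flip: ennreal_mult)
      qed
      also have "\<dots> = ennreal C * ennreal (f y powr p)" using C by (simp add: ennreal_mult)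
      finally show "(\<integral>\<^sup>+t. ennreal (K * t powr (e - 1)) * (if 0 < t \<and> a2 * t powr (1 + 1 / \<theta>) < f y then ennreal (f y) else 0) \<partial>lborel)
        \<le> ennreal C * ennreal (f y powr p)" .
    qed
    also have "\<dots> = ennreal C * (\<integral>\<^sup>+y. ennreal (f y powr p) \<partial>lborel)"
      by (rule nn_integral_cmult) measurable
    also have "\<dots> \<le> ennreal C * 1" by (intro mult_left_mono f1) simp
    finally show ?thesis by simp
  qed
  then show ?thesis using C by (intro exI[of _ C]) auto
qed

section \<open>Averages over small cubes\<close>

lemma integral_lborel_prod:
  fixes f :: "'a::euclidean_space \<Rightarrow> real \<Rightarrow> real"
  assumes f: "\<And>b. b \<in> Basis \<Longrightarrow> integrable lborel (f b)"
  shows "(\<integral>x. (\<Prod>b\<in>Basis. f b (x \<bullet> b)) \<partial>lborel) = (\<Prod>b\<in>Basis. \<integral>t. f b t \<partial>lborel)"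
proof -
  interpret product_sigma_finite "\<lambda>_::'a. lborel :: real measure" ..
  have m [measurable]: "f b \<in> borel_measurable borel" if "b \<in> Basis" for b
    using borel_measurable_integrable[OF f[OF that]] by simp
  have "(\<integral>x. (\<Prod>b\<in>Basis. f b (x \<bullet> b)) \<partial>lborel) =
    (\<integral>y. (\<Prod>b\<in>Basis. f b ((\<Sum>b\<in>Basis. y b *\<^sub>R b) \<bullet> b)) \<partial>(\<Pi>\<^sub>M b\<in>Basis. lborel))"
    by (subst lborel_eq, rule integral_distr) measurable
  also have "\<dots> = (\<integral>y. (\<Prod>b\<in>Basis. f b (y b)) \<partial>(\<Pi>\<^sub>M b\<in>Basis. lborel))"
    by (intro Bochner_Integration.integral_cong prod.cong) (simp_all add: inner_sum_left_Basis)
  also have "\<dots> = (\<Prod>b\<in>Basis. \<integral>t. f b t \<partial>lborel)"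
    by (rule product_integral_prod) (use f in auto)
  finally show ?thesis .
qed

lemma integral_cart_prod:
  fixes g :: "'n::finite \<Rightarrow> real \<Rightarrow> real"
  assumes g: "\<And>j. integrable lborel (g j)"
  shows "(\<integral>x. (\<Prod>j\<in>UNIV. g j ((x :: real^'n) $ j)) \<partial>lborel) = (\<Prod>j\<in>UNIV. \<integral>t. g j t \<partial>lborel)"
proof -
  \<comment> \<open>Inverts the map from indices to basis vectors; it is injective, so the choice is
    unique and the product over the basis is the product over coordinates.\<close>
  define f where "f b = g (SOME j. b = axis j (1::real))" for b :: "real^'n"
  have fa: "f (axis j 1) = g j" for j by (simp add: f_def axis_eq_axis)
  have B: "Basis = range (\<lambda>j. axis j (1::real) :: real^'n)" by (auto simp: Basis_vec_def)
  have inj: "inj (\<lambda>j. axis j (1::real) :: real^'n)" by (auto simp: inj_def axis_eq_axis)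
  have p: "(\<Prod>b\<in>Basis. h b) = (\<Prod>j\<in>UNIV. h (axis j 1))" for h :: "real^'n \<Rightarrow> real"
    unfolding B by (simp add: prod.reindex[OF inj])
  have "(\<integral>x. (\<Prod>b\<in>Basis. f b (x \<bullet> b)) \<partial>lborel) = (\<Prod>b\<in>Basis. \<integral>t. f b t \<partial>lborel)"
    by (rule integral_lborel_prod) (auto simp: B fa g)
  then show ?thesis by (simp only: p fa cart_eq_inner_axis[symmetric])
qed

lemma integrable_mult_bounded:
  fixes u f :: "'a \<Rightarrow> real"
  assumes u: "integrable M u" and f: "f \<in> borel_measurable M" and B: "\<And>x. \<bar>f x\<bar> \<le> B"
  shows "integrable M (\<lambda>x. u x * f x)"
proof (rule Bochner_Integration.integrable_bound)
  show "integrable M (\<lambda>x. B * u x)" using u by simp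
  show "(\<lambda>x. u x * f x) \<in> borel_measurable M" using borel_measurable_integrable[OF u] f by simp
  have "0 \<le> B" using B order_trans[OF abs_ge_zero] by blast
  then have "norm (u x * f x) \<le> norm (B * u x)" for x
    using mult_left_mono[OF B[of x] abs_ge_zero[of "u x"]] by (simp add: abs_mult mult.commute)
  then show "AE x in M. norm (u x * f x) \<le> norm (B * u x)" by simp
qed

text \<open>Fixes a single step together with its derivative: kernels are built from
  \<open>b\<close>, test functions from \<open>\<beta>\<close> and \<open>b\<close>, and their
  interplay relies on \<open>b\<close> being exactly the derivative of
  \<open>\<beta>\<close>.\<close>

locale smooth_step =
  fixes \<beta> b :: "real \<Rightarrow> real" and C0 :: real
  assumes Ck_\<beta>: "\<And>n. Ck_real n \<beta>" and Ck_b: "\<And>n. Ck_real n b"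
    and deriv_\<beta>: "\<And>t. (\<beta> has_real_derivative b t) (at t)"
    and \<beta>_0: "\<And>t. t \<le> -1 \<Longrightarrow> \<beta> t = 0" and \<beta>_1: "\<And>t. 1 \<le> t \<Longrightarrow> \<beta> t = 1"
    and \<beta>_nonneg: "\<And>t. 0 \<le> \<beta> t" and \<beta>_le: "\<And>t. \<beta> t \<le> 1"
    and b_0: "\<And>t. 1 < \<bar>t\<bar> \<Longrightarrow> b t = 0" and b_le: "\<And>t. \<bar>b t\<bar> \<le> C0" and C0: "0 < C0"
begin

text \<open>This is the derivative of the rescaled step
  \<open>\<lambda>t. \<beta> ((t - a) / r)\<close>. The sign of \<open>b\<close> is left open, so
  estimates go through the bound \<open>C0 / r\<close> and the support.\<close>

definition kern :: "real \<Rightarrow> real \<Rightarrow> real \<Rightarrow> real" where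
  "kern a r t = b ((t - a) / r) / r"

definition cube_kern :: "real^'n \<Rightarrow> real \<Rightarrow> real^'n \<Rightarrow> real" where
  "cube_kern a r z = (\<Prod>j\<in>UNIV. kern (a $ j) r (z $ j))"

lemma isCont_b: "isCont b t"
proof -
  obtain b' where "\<And>x. (b has_real_derivative b' x) (at x)" using Ck_b[of "Suc 0"] by auto
  then show ?thesis by (rule DERIV_isCont)
qed

lemma continuous_on_b [continuous_intros]: "continuous_on A f \<Longrightarrow> continuous_on A (\<lambda>x. b (f x))"
  by (rule continuous_on_compose2[of UNIV b]) (auto intro: continuous_at_imp_continuous_on isCont_b)

lemma borel_measurable_b [measurable]: "b \<in> borel_measurable borel"
  by (rule borel_measurable_continuous_onI) (rule continuous_at_imp_continuous_on, simp add: isCont_b)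

lemma Ck_kern: "Ck_real n (kern a r)"
proof -
  have e: "kern a r = (\<lambda>t. b (inverse r * t + (- a * inverse r)) * inverse r)"
    by (simp add: kern_def fun_eq_iff divide_inverse algebra_simps)
  show ?thesis unfolding e by (intro Ck_real_mult Ck_real_const Ck_real_affine Ck_b)
qed

lemma Ck_step: "Ck_real n (\<lambda>t. \<beta> ((t - a) / r))"
proof -
  have e: "(\<lambda>t. \<beta> ((t - a) / r)) = (\<lambda>t. \<beta> (inverse r * t + (- a * inverse r)))"
    by (simp add: fun_eq_iff divide_inverse algebra_simps)
  show ?thesis unfolding e by (intro Ck_real_affine Ck_\<beta>)
qed

lemma kern_le: "0 < r \<Longrightarrow> \<bar>kern a r t\<bar> \<le> C0 / r"
  using b_le by (simp add: kern_def divide_right_mono)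

lemma kern_eq_0: "0 < r \<Longrightarrow> r < \<bar>t - a\<bar> \<Longrightarrow> kern a r t = 0"
  by (simp add: kern_def b_0)

lemma DERIV_step: "((\<lambda>t. \<beta> ((t - a) / r)) has_real_derivative kern a r t) (at t)"
proof -
  have "((\<lambda>t. (t - a) / r) has_real_derivative 1 / r) (at t)"
    by (auto intro!: derivative_eq_intros simp: divide_inverse)
  from DERIV_chain2[OF deriv_\<beta> this] show ?thesis by (simp add: kern_def)
qed

text \<open>Fundamental theorem of calculus: the integral over the interval carrying the kernel is
  the increment \<open>\<beta> 1 - \<beta> (-1)\<close> of the step.\<close>

lemma kern_integral:
  assumes r: "0 < r"
  shows "integrable lborel (kern a r)" and "(\<integral>t. kern a r t \<partial>lborel) = 1"
proof -
  have "has_bochner_integral lborel (\<lambda>x. kern a r x * indicator {a - r..a + r} x)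
      (\<beta> ((a + r - a) / r) - \<beta> ((a - r - a) / r))"
  proof (rule has_bochner_integral_FTC_Icc_real)
    show "a - r \<le> a + r" using r by simp
    show "((\<lambda>t. \<beta> ((t - a) / r)) has_real_derivative kern a r t) (at t)" for t by (rule DERIV_step)
    obtain k' where "\<And>x. (kern a r has_real_derivative k' x) (at x)"
      using Ck_kern[of "Suc 0" a r] by auto
    then show "isCont (kern a r) t" for t by (rule DERIV_isCont)
  qed
  moreover have "kern a r x * indicator {a - r..a + r} x = kern a r x" for x
    using kern_eq_0[OF r, of x a] by (cases "\<bar>x - a\<bar> \<le> r") (auto simp: abs_le_iff not_le)
  ultimately have "has_bochner_integral lborel (kern a r) 1"
    using r \<beta>_0[of "-1"] \<beta>_1[of 1] by simp
  then show "integrable lborel (kern a r)" and "(\<integral>t. kern a r t \<partial>lborel) = 1"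
    by (auto simp: has_bochner_integral_iff)
qed

text \<open>The cube lies in a ball whose radius is larger by the factor d, since the Euclidean norm
  is at most the sum of the coordinates. Balls are the sets over which the potential
  integrates.\<close>

lemma cube_kern_le:
  fixes a :: "real^'n"
  assumes r: "0 < r"
  shows "\<bar>cube_kern a r z\<bar> \<le> (C0 / r) ^ CARD('n) * indicator (cball a (r * CARD('n))) z"
proof (cases "\<forall>j. \<bar>z $ j - a $ j\<bar> \<le> r")
  case True
  have "norm (z - a) \<le> (\<Sum>j\<in>UNIV. \<bar>(z - a) $ j\<bar>)" by (rule norm_le_l1_cart)
  also have "\<dots> \<le> (\<Sum>j\<in>(UNIV::'n set). r)" by (intro sum_mono) (use True in simp)
  finally have "z \<in> cball a (r * CARD('n))" by (simp add: dist_norm norm_minus_commute mult.commute)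
  moreover have "\<bar>cube_kern a r z\<bar> \<le> (\<Prod>j\<in>(UNIV::'n set). C0 / r)"
    unfolding cube_kern_def abs_prod by (intro prod_mono) (use kern_le[OF r] in auto)
  ultimately show ?thesis by simp
next
  case False
  then obtain j where "r < \<bar>z $ j - a $ j\<bar>" by (auto simp: not_le)
  then have "kern (a $ j) r (z $ j) = 0" by (rule kern_eq_0[OF r])
  then have "cube_kern a r z = 0" unfolding cube_kern_def by (intro prod_zero) auto
  then show ?thesis using C0 r by simp
qed

lemma borel_measurable_kern [measurable]: "kern a r \<in> borel_measurable borel"
  unfolding kern_def by measurable

lemma borel_measurable_vec_nth [measurable]: "(\<lambda>z::real^'n. z $ j) \<in> borel_measurable borel"
  by (rule borel_measurable_continuous_onI) (intro continuous_intros)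

lemma borel_measurable_cube_kern [measurable]: "cube_kern (a :: real^'n) r \<in> borel_measurable borel"
  unfolding cube_kern_def by measurable

lemma cube_kern_integral: "0 < r \<Longrightarrow> (\<integral>z. cube_kern (a :: real^'n) r z \<partial>lborel) = 1"
  unfolding cube_kern_def by (subst integral_cart_prod) (simp_all add: kern_integral)

lemma cube_kern_bounded:
  fixes a :: "real^'n"
  assumes r: "0 < r" shows "\<bar>cube_kern a r z\<bar> \<le> (C0 / r) ^ CARD('n)"
  using cube_kern_le[OF r, of a z] C0 r by (auto simp: indicator_def split: if_splits intro: order_trans)

text \<open>The kernel is moved from one cube to the other one coordinate at a time: each step changes it by a partial
  derivative of a test function, since in one variable the difference of two kernels is the derivative of
  a difference of two step functions.\<close>

lemma cube_kern_change:
  fixes u :: "real^'n \<Rightarrow> real" and D :: "'n \<Rightarrow> real^'n \<Rightarrow> real"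
  assumes u: "integrable lborel u" and D: "\<And>i. integrable lborel (D i)"
    and deriv: "\<And>i \<phi>. test_fun \<Omega> \<phi> \<Longrightarrow> (\<integral>x. u x * partial i \<phi> x \<partial>lborel) = - (\<integral>x. D i x * \<phi> x \<partial>lborel)"
    and \<kappa>: "0 < \<kappa>" and P: "0 < P" and AP: "cball A P \<subseteq> \<Omega>"
    and a: "\<And>j. \<bar>a $ j - A $ j\<bar> + r \<le> P / CARD('n)" "\<kappa> * P \<le> r"
    and a': "\<And>j. \<bar>a' $ j - A $ j\<bar> + r' \<le> P / CARD('n)" "\<kappa> * P \<le> r'"
  shows "\<bar>(\<integral>z. u z * cube_kern a r z \<partial>lborel) - (\<integral>z. u z * cube_kern a' r' z \<partial>lborel)\<bar> \<le>
    CARD('n) * ((C0 / (\<kappa> * P)) ^ (CARD('n) - 1) *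
      (\<integral>z. (\<Sum>i\<in>UNIV. \<bar>D i z\<bar>) * indicator (cball A P) z \<partial>lborel))"
proof -
  define J where "J = (\<integral>z. (\<Sum>i\<in>UNIV. \<bar>D i z\<bar>) * indicator (cball A P) z \<partial>lborel)"
  \<comment> \<open>One factor fewer than the dimension: in each move the \<open>i\<close>-th factor
    is a difference of two steps, bounded by 1, instead of a kernel of size 1/P. The saved power
    produces the weight s^(1 - d) of the potential.\<close>
  define M where "M = (C0 / (\<kappa> * P)) ^ (CARD('n) - 1)"
  have kP: "0 < \<kappa> * P" using \<kappa> P by simp
  have r: "0 < r" "0 < r'" using kP a(2) a'(2) by linarith+
  have M: "0 \<le> M" using C0 kP by (simp add: M_def)
  define G where "G I j = (if j \<in> I then kern (a' $ j) r' else kern (a $ j) r)" for I j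
  define K where "K I z = (\<Prod>j\<in>UNIV. G I j (z $ j))" for I and z :: "real^'n"
  have Gle: "\<bar>G I j t\<bar> \<le> C0 / (\<kappa> * P)" for I j t
  proof -
    have "C0 / r \<le> C0 / (\<kappa> * P)" "C0 / r' \<le> C0 / (\<kappa> * P)"
      using kP a(2) a'(2) C0 by (auto intro!: divide_left_mono mult_pos_pos r)
    then show ?thesis
      using kern_le[OF r(1), of "a $ j" t] kern_le[OF r(2), of "a' $ j" t] by (auto simp: G_def)
  qed
  have Gm [measurable]: "G I j \<in> borel_measurable borel" for I j by (simp add: G_def)
  have Km [measurable]: "K I \<in> borel_measurable borel" for I unfolding K_def by measurable
  have Kle: "\<bar>K I z\<bar> \<le> (C0 / (\<kappa> * P)) ^ CARD('n)" for I z
  proof -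
    have "\<bar>K I z\<bar> \<le> (\<Prod>j\<in>(UNIV::'n set). C0 / (\<kappa> * P))"
      unfolding K_def abs_prod by (intro prod_mono) (use Gle in auto)
    then show ?thesis by simp
  qed
  have uK: "integrable lborel (\<lambda>z. u z * K I z)" for I
    by (rule integrable_mult_bounded[OF u _ Kle]) simp
  have step: "\<bar>(\<integral>z. u z * K I z \<partial>lborel) - (\<integral>z. u z * K (insert i I) z \<partial>lborel)\<bar> \<le> M * J" if i: "i \<notin> I" for i I
  proof -
    define H where "H j = (if j = i then (\<lambda>t. \<beta> ((t - a $ i) / r) + (-1) * \<beta> ((t - a' $ i) / r')) else G I j)" for j
    define H' where "H' j t = (if j = i then kern (a $ i) r t - kern (a' $ i) r' t else deriv (H j) t)" for j t
    define \<Phi> where "\<Phi> z = (\<Prod>j\<in>UNIV. H j (z $ j))" for z :: "real^'n"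
    have HC: "Ck_real n (H j)" for n j
    proof (cases "j = i")
      case True
      have "Ck_real n (\<lambda>t. \<beta> ((t - a $ i) / r) + (-1) * \<beta> ((t - a' $ i) / r'))"
        by (intro Ck_real_add Ck_real_mult Ck_real_const Ck_step)
      then show ?thesis unfolding H_def if_P[OF True] .
    next
      case False
      then show ?thesis by (simp add: H_def G_def Ck_kern)
    qed
    have HD: "(H j has_real_derivative H' j t) (at t)" for j t
    proof (cases "j = i")
      case True
      have "((\<lambda>t. \<beta> ((t - a $ i) / r) - \<beta> ((t - a' $ i) / r')) has_real_derivative kern (a $ i) r t - kern (a' $ i) r' t) (at t)"
        by (intro DERIV_diff DERIV_step)
      then show ?thesis using True by (simp add: H_def H'_def)
    next
      case False
      obtain h where h: "\<And>x. (H j has_real_derivative h x) (at x)" using HC[of "Suc 0" j] by auto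
      show ?thesis using False h[of t] DERIV_imp_deriv[OF h[of t]] by (simp add: H'_def)
    qed
    have z0: "\<Phi> z = 0" if z: "z \<notin> cball A P" for z
    proof -
      have "\<exists>j. P / CARD('n) < \<bar>z $ j - A $ j\<bar>"
      proof (rule ccontr)
        assume "\<not> ?thesis"
        then have le: "\<bar>(z - A) $ j\<bar> \<le> P / CARD('n)" for j by (simp add: not_less)
        have "norm (z - A) \<le> (\<Sum>j\<in>UNIV. \<bar>(z - A) $ j\<bar>)" by (rule norm_le_l1_cart)
        also have "\<dots> \<le> (\<Sum>j\<in>(UNIV::'n set). P / CARD('n))" by (rule sum_mono[OF le])
        finally show False using z by (simp add: dist_norm norm_minus_commute)
      qed
      then obtain j where j: "P / CARD('n) < \<bar>z $ j - A $ j\<bar>" ..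
      have j1: "r < \<bar>z $ j - a $ j\<bar>" using a(1)[of j] j by linarith
      have j2: "r' < \<bar>z $ j - a' $ j\<bar>" using a'(1)[of j] j by linarith
      have "H j (z $ j) = 0"
      proof (cases "j = i")
        case False
        then show ?thesis using kern_eq_0[OF r(1) j1] kern_eq_0[OF r(2) j2] by (simp add: H_def G_def)
      next
        case True
        \<comment> \<open>A single step equals 1 far to the right, so compact support comes from the
          difference: beyond the bound on this coordinate both steps have reached the same constant,
          1 on the right and 0 on the left.\<close>
        consider "z $ j > A $ j" | "z $ j < A $ j" 
        proof -
          have "0 < P / CARD('n)" using P by simp
          then have "z $ j \<noteq> A $ j" using j by auto
          then show thesis using that by (auto simp: neq_iff)
        qed
        then show ?thesis
        proof cases
          case 1
          then have "r \<le> z $ j - a $ j" "r' \<le> z $ j - a' $ j"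
            using a(1)[of j] a'(1)[of j] j by linarith+
          then show ?thesis using True r by (simp add: H_def \<beta>_1)
        next
          case 2
          then have "z $ j - a $ j \<le> - r" "z $ j - a' $ j \<le> - r'"
            using a(1)[of j] a'(1)[of j] j by linarith+
          then have "(z $ j - a $ j) / r \<le> -1" "(z $ j - a' $ j) / r' \<le> -1"
            using r by (auto simp: pos_divide_le_eq)
          then show ?thesis using True by (simp add: H_def \<beta>_0)
        qed
      qed
      then show ?thesis unfolding \<Phi>_def by (intro prod_zero) auto
    qed
    have tf: "test_fun \<Omega> \<Phi>"
      unfolding test_fun_def
    proof (intro conjI exI[of _ "cball A P"])
      show "smooth_fun \<Phi>" unfolding \<Phi>_def by (rule smooth_fun_product[OF HC])
    qed (use AP z0 in auto)
    have "\<Phi> z = H i (z $ i) * (\<Prod>j\<in>UNIV - {i}. G I j (z $ j))" for z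
      unfolding \<Phi>_def by (subst prod.remove[of UNIV i]) (auto simp: H_def)
    moreover have "\<bar>H i t\<bar> \<le> 1" for t
      using \<beta>_nonneg[of "(t - a $ i) / r"] \<beta>_le[of "(t - a $ i) / r"]
        \<beta>_nonneg[of "(t - a' $ i) / r'"] \<beta>_le[of "(t - a' $ i) / r'"]
      by (simp add: H_def abs_le_iff)
    moreover have "\<bar>\<Prod>j\<in>UNIV - {i}. G I j (z $ j)\<bar> \<le> M" for z
    proof -
      have "\<bar>\<Prod>j\<in>UNIV - {i}. G I j (z $ j)\<bar> \<le> (\<Prod>j\<in>UNIV - {i}. C0 / (\<kappa> * P))"
        unfolding abs_prod by (intro prod_mono) (use Gle in auto)
      then show ?thesis by (simp add: M_def)
    qed
    ultimately have "\<bar>\<Phi> z\<bar> \<le> 1 * M" for z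
      by (simp only: abs_mult) (intro mult_mono, auto)
    then have \<Phi>le: "\<bar>\<Phi> z\<bar> \<le> M * indicator (cball A P) z" for z
      using z0[of z] by (cases "z \<in> cball A P") auto
    have "K I z - K (insert i I) z = partial i \<Phi> z" for z
    proof -
      have "K I z = kern (a $ i) r (z $ i) * (\<Prod>j\<in>UNIV - {i}. G I j (z $ j))"
        unfolding K_def using i by (subst prod.remove[of UNIV i]) (auto simp: G_def)
      moreover have "K (insert i I) z = kern (a' $ i) r' (z $ i) * (\<Prod>j\<in>UNIV - {i}. G I j (z $ j))"
        unfolding K_def by (subst prod.remove[of UNIV i]) (auto simp: G_def intro!: prod.cong)
      moreover have "partial i \<Phi> z = H' i (z $ i) * (\<Prod>j\<in>UNIV - {i}. H j (z $ j))"
        unfolding \<Phi>_def by (rule partial_product[OF HD])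
      moreover have "(\<Prod>j\<in>UNIV - {i}. H j (z $ j)) = (\<Prod>j\<in>UNIV - {i}. G I j (z $ j))"
        by (rule prod.cong) (auto simp: H_def)
      ultimately show ?thesis by (simp add: H'_def left_diff_distrib)
    qed
    then have "(\<integral>z. u z * partial i \<Phi> z \<partial>lborel) = (\<integral>z. u z * K I z - u z * K (insert i I) z \<partial>lborel)"
      by (simp flip: right_diff_distrib)
    then have "(\<integral>z. u z * K I z \<partial>lborel) - (\<integral>z. u z * K (insert i I) z \<partial>lborel) = - (\<integral>z. D i z * \<Phi> z \<partial>lborel)"
      using deriv[OF tf, of i] uK by simp
    moreover have "\<bar>\<integral>z. D i z * \<Phi> z \<partial>lborel\<bar> \<le> (\<integral>z. M * ((\<Sum>i\<in>UNIV. \<bar>D i z\<bar>) * indicator (cball A P) z) \<partial>lborel)"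
    proof (rule integral_abs_bound_integral)
      have "\<Phi> \<in> borel_measurable borel"
        by (rule borel_measurable_continuous_onI[OF continuous_on_test_fun[OF tf]])
      then show "integrable lborel (\<lambda>z. D i z * \<Phi> z)"
      proof (intro integrable_mult_bounded[OF D, where B=M])
        show "\<bar>\<Phi> z\<bar> \<le> M" for z using \<Phi>le[of z] M by (cases "z \<in> cball A P") auto
      qed simp
      show "integrable lborel (\<lambda>z. M * ((\<Sum>i\<in>UNIV. \<bar>D i z\<bar>) * indicator (cball A P) z))"
        using D by (intro integrable_mult_right integrable_real_mult_indicator) auto
      fix z
      have "\<bar>D i z * \<Phi> z\<bar> \<le> \<bar>D i z\<bar> * (M * indicator (cball A P) z)"
        unfolding abs_mult by (intro mult_left_mono \<Phi>le) simp
      also have "\<dots> \<le> (\<Sum>i\<in>UNIV. \<bar>D i z\<bar>) * (M * indicator (cball A P) z)"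
        by (intro mult_right_mono member_le_sum) (use M in auto)
      finally show "\<bar>D i z * \<Phi> z\<bar> \<le> M * ((\<Sum>i\<in>UNIV. \<bar>D i z\<bar>) * indicator (cball A P) z)" by (simp add: mult_ac)
    qed
    ultimately show ?thesis by (simp add: J_def)
  qed
  have J: "0 \<le> J" unfolding J_def by (intro integral_nonneg_AE) (auto intro: sum_nonneg)
  have "\<bar>(\<integral>z. u z * K {} z \<partial>lborel) - (\<integral>z. u z * K I z \<partial>lborel)\<bar> \<le> card I * (M * J)" if "finite I" for I
    using that
  proof (induction I rule: finite_induct)
    case (insert i I)
    have "\<bar>(\<integral>z. u z * K {} z \<partial>lborel) - (\<integral>z. u z * K (insert i I) z \<partial>lborel)\<bar> \<le> card I * (M * J) + M * J"
      using insert.IH step[OF insert.hyps(2)] by linarith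
    then show ?case using insert.hyps by (simp add: algebra_simps)
  qed simp
  from this[of UNIV] show ?thesis by (simp add: K_def G_def cube_kern_def M_def J_def)
qed

section \<open>Cube averages as operators on L^1\<close>

lemma cube_kern_average_le:
  fixes c x :: "real^'n"
  assumes h: "integrable lborel h" and r: "0 < r" and s: "0 < s"
  shows "ennreal \<bar>\<integral>z. h z * cube_kern (x + s *\<^sub>R c) (s * r) z \<partial>lborel\<bar> \<le>
    ennreal ((C0 / (s * r)) ^ CARD('n)) *
      (\<integral>\<^sup>+z. ennreal \<bar>h z\<bar> * indicator (cball (x + s *\<^sub>R c) (s * r * CARD('n))) z \<partial>lborel)"
proof -
  have sr: "0 < s * r" using r s by simp
  have hm [measurable]: "h \<in> borel_measurable borel" using borel_measurable_integrable[OF h] by simp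
  have [measurable]: "cball (x + s *\<^sub>R c) (s * r * CARD('n)) \<in> sets borel" by simp
  have i: "integrable lborel (\<lambda>z. h z * cube_kern (x + s *\<^sub>R c) (s * r) z)"
    by (rule integrable_mult_bounded[OF h _ cube_kern_bounded[OF sr]]) simp
  have "ennreal \<bar>\<integral>z. h z * cube_kern (x + s *\<^sub>R c) (s * r) z \<partial>lborel\<bar> \<le>
      (\<integral>\<^sup>+z. ennreal \<bar>h z * cube_kern (x + s *\<^sub>R c) (s * r) z\<bar> \<partial>lborel)"
    using integral_norm_bound_ennreal[OF i] by simp
  also have "\<dots> \<le> (\<integral>\<^sup>+z. ennreal ((C0 / (s * r)) ^ CARD('n)) * (ennreal \<bar>h z\<bar> * indicator (cball (x + s *\<^sub>R c) (s * r * CARD('n))) z) \<partial>lborel)"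
  proof (rule nn_integral_mono)
    fix z
    have "\<bar>h z * cube_kern (x + s *\<^sub>R c) (s * r) z\<bar> \<le>
        \<bar>h z\<bar> * ((C0 / (s * r)) ^ CARD('n) * indicator (cball (x + s *\<^sub>R c) (s * r * CARD('n))) z)"
      unfolding abs_mult by (intro mult_left_mono cube_kern_le sr) simp
    then have "ennreal \<bar>h z * cube_kern (x + s *\<^sub>R c) (s * r) z\<bar> \<le>
        ennreal (\<bar>h z\<bar> * ((C0 / (s * r)) ^ CARD('n) * indicator (cball (x + s *\<^sub>R c) (s * r * CARD('n))) z))"
      by (rule ennreal_leI)
    also have "\<dots> = ennreal ((C0 / (s * r)) ^ CARD('n)) * (ennreal \<bar>h z\<bar> * indicator (cball (x + s *\<^sub>R c) (s * r * CARD('n))) z)"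
      using C0 sr by (cases "z \<in> cball (x + s *\<^sub>R c) (s * r * CARD('n))") (simp_all add: ennreal_mult mult.commute)
    finally show "ennreal \<bar>h z * cube_kern (x + s *\<^sub>R c) (s * r) z\<bar> \<le> \<dots>" .
  qed
  also have "\<dots> = ennreal ((C0 / (s * r)) ^ CARD('n)) *
      (\<integral>\<^sup>+z. ennreal \<bar>h z\<bar> * indicator (cball (x + s *\<^sub>R c) (s * r * CARD('n))) z \<partial>lborel)"
    by (rule nn_integral_cmult) measurable
  finally show ?thesis .
qed

lemma borel_measurable_cube_kern_average:
  fixes c :: "real^'n"
  assumes [measurable]: "h \<in> borel_measurable borel"
  shows "(\<lambda>x. \<integral>z. h z * cube_kern (x + s *\<^sub>R c) (s * r) z \<partial>lborel) \<in> borel_measurable borel"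
proof -
  have "(\<lambda>(x, z). h z * cube_kern (x + s *\<^sub>R c) (s * r) z) \<in> borel_measurable (borel \<Otimes>\<^sub>M lborel)"
    unfolding cube_kern_def kern_def by measurable
  then show ?thesis by (rule lborel.borel_measurable_lebesgue_integral)
qed

text \<open>The height of the kernel and the volume of the ball carrying it scale inversely, so the
  bound does not depend on \<open>s\<close>; this uniformity permits approximation by nicer
  functions.\<close>

lemma cube_kern_average_L1_le:
  fixes c :: "real^'n"
  assumes h: "integrable lborel h" and r: "0 < r" and s: "0 < s"
  shows "(\<integral>\<^sup>+x. ennreal \<bar>\<integral>z. h z * cube_kern (x + s *\<^sub>R c) (s * r) z \<partial>lborel\<bar> \<partial>lborel) \<le>
    ennreal (C0 ^ CARD('n) * unit_ball_vol CARD('n) * CARD('n) ^ CARD('n)) * (\<integral>\<^sup>+z. ennreal \<bar>h z\<bar> \<partial>lborel)"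
proof -
  let ?N = "CARD('n)"
  have hm [measurable]: "h \<in> borel_measurable borel" using borel_measurable_integrable[OF h] by simp
  have srN: "0 \<le> s * r * ?N" using r s by simp
  have ind: "indicator (cball (x + v) R) y = (if dist (x + v) y \<le> R then 1 else 0 :: ennreal)" for x v y :: "real^'n" and R
    by (auto simp: indicator_def)
  have "(\<integral>\<^sup>+x. ennreal \<bar>\<integral>z. h z * cube_kern (x + s *\<^sub>R c) (s * r) z \<partial>lborel\<bar> \<partial>lborel) \<le>
    (\<integral>\<^sup>+x. ennreal ((C0 / (s * r)) ^ ?N) *
      (\<integral>\<^sup>+z. ennreal \<bar>h z\<bar> * indicator (cball (x + s *\<^sub>R c) (s * r * ?N)) z \<partial>lborel) \<partial>lborel)"
    by (rule nn_integral_mono[OF cube_kern_average_le[OF h r s]])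
  also have "\<dots> = ennreal ((C0 / (s * r)) ^ ?N) *
      (\<integral>\<^sup>+x. (\<integral>\<^sup>+z. ennreal \<bar>h z\<bar> * indicator (cball (x + s *\<^sub>R c) (s * r * ?N)) z \<partial>lborel) \<partial>lborel)"
    unfolding ind by (rule nn_integral_cmult) measurable
  also have "(\<integral>\<^sup>+x. (\<integral>\<^sup>+z. ennreal \<bar>h z\<bar> * indicator (cball (x + s *\<^sub>R c) (s * r * ?N)) z \<partial>lborel) \<partial>lborel) =
     ennreal (unit_ball_vol (real DIM(real^'n)) * (s * r * ?N) ^ DIM(real^'n)) * (\<integral>\<^sup>+z. ennreal \<bar>h z\<bar> \<partial>lborel)"
    by (rule nn_integral_ball_average[OF _ srN]) measurable
  also have "ennreal ((C0 / (s * r)) ^ ?N) * (ennreal (unit_ball_vol (real DIM(real^'n)) * (s * r * ?N) ^ DIM(real^'n)) * (\<integral>\<^sup>+z. ennreal \<bar>h z\<bar> \<partial>lborel)) =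
    ennreal ((C0 / (s * r)) ^ ?N * (unit_ball_vol ?N * (s * r * ?N) ^ ?N)) * (\<integral>\<^sup>+z. ennreal \<bar>h z\<bar> \<partial>lborel)"
    using C0 r s by (subst ennreal_mult[of "(C0 / (s * r)) ^ ?N"]) (auto simp: mult.assoc)
  also have "(C0 / (s * r)) ^ ?N * (unit_ball_vol ?N * (s * r * ?N) ^ ?N) = C0 ^ ?N * unit_ball_vol ?N * ?N ^ ?N"
    using r s by (simp add: power_divide power_mult_distrib)
  finally show ?thesis .
qed

end

text \<open>Clipping at height and radius \<open>m\<close> provides integrable majorants. A
  measurable function is an almost everywhere limit of continuous ones, and after clipping and
  cutting these off dominated convergence makes the limit one in L^1.\<close>

lemma L1_approx_continuous:
  fixes u :: "'a::euclidean_space \<Rightarrow> real"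
  assumes u: "integrable lborel u" and e: "0 < e"
  obtains g B where "continuous_on UNIV g" "\<And>x. B < norm x \<Longrightarrow> g x = 0" "integrable lborel g" "0 < B"
    "(\<integral>\<^sup>+x. ennreal \<bar>u x - g x\<bar> \<partial>lborel) < ennreal e"
proof -
  have um [measurable]: "u \<in> borel_measurable borel" using borel_measurable_integrable[OF u] by simp
  define v where "v m x = (if norm x \<le> real m then max (- real m) (min (real m) (u x)) else 0)" for m :: nat and x
  have vm [measurable]: "v m \<in> borel_measurable borel" for m unfolding v_def by measurable
  have "(\<lambda>m. \<integral>\<^sup>+x. ennreal (norm (u x - v m x)) \<partial>lborel) \<longlonglongrightarrow> 0"
  proof (rule nn_integral_dominated_convergence_norm[where w="\<lambda>x. \<bar>u x\<bar>"])
    show "AE x in lborel. norm (v j x) \<le> \<bar>u x\<bar>" for j by (auto simp: v_def)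
    show "(\<integral>\<^sup>+x. ennreal \<bar>u x\<bar> \<partial>lborel) < \<infinity>" using u by (simp add: integrable_iff_bounded)
    show "AE x in lborel. (\<lambda>m. v m x) \<longlonglongrightarrow> u x"
    proof (rule AE_I2)
      fix x
      obtain m0 :: nat where m0: "norm x + \<bar>u x\<bar> \<le> real m0" using real_arch_simple by blast
      have "v m x = u x" if "m0 \<le> m" for m
      proof -
        have "real m0 \<le> real m" using that by simp
        then have "norm x \<le> real m" "\<bar>u x\<bar> \<le> real m" using m0 norm_ge_zero[of x] abs_ge_zero[of "u x"] by linarith+
        then show ?thesis by (auto simp: v_def abs_le_iff)
      qed
      then show "(\<lambda>m. v m x) \<longlonglongrightarrow> u x"
        by (intro tendsto_eventually eventually_sequentiallyI[of m0])
    qed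
  qed measurable
  then have "\<forall>\<^sub>F m in sequentially. (\<integral>\<^sup>+x. ennreal (norm (u x - v m x)) \<partial>lborel) < ennreal (e / 2)"
    by (rule order_tendstoD(2)) (use e in simp)
  then obtain m where m: "(\<integral>\<^sup>+x. ennreal (norm (u x - v m x)) \<partial>lborel) < ennreal (e / 2)"
    by (auto simp: eventually_sequentially)
  have "v m \<in> borel_measurable lebesgue" by (rule measurable_completion) simp
  then have "v m measurable_on UNIV" by (rule lebesgue_measurable_imp_measurable_on) simp
  \<comment> \<open>The approximants \<open>G\<close> are continuous but neither bounded nor
    integrable; \<open>H\<close> repairs both by a cutoff in space and a clipping of values.\<close>
  then obtain N G where N: "negligible N" "\<And>n. continuous_on UNIV (G n)" "\<And>x. x \<notin> N \<Longrightarrow> (\<lambda>n. G n x) \<longlonglongrightarrow> v m x"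
    unfolding measurable_on_def by auto
  define ctf where "ctf x = max 0 (min 1 (real m + 1 - norm x))" for x :: 'a
  define H where "H n x = ctf x * max (- real m) (min (real m) (G n x))" for n x
  have Hc: "continuous_on UNIV (H n)" for n
    unfolding H_def ctf_def by (intro continuous_intros N)
  have Hm [measurable]: "H n \<in> borel_measurable borel" for n by (rule borel_measurable_continuous_onI[OF Hc])
  have H0: "H n x = 0" if "real m + 1 < norm x" for n x using that by (simp add: H_def ctf_def)
  have Hle: "\<bar>H n x\<bar> \<le> real m * indicator (cball 0 (real m + 1)) x" for n x
  proof (cases "norm x \<le> real m + 1")
    case True
    have "\<bar>H n x\<bar> = \<bar>ctf x\<bar> * \<bar>max (- real m) (min (real m) (G n x))\<bar>" by (simp add: H_def abs_mult)
    also have "\<dots> \<le> 1 * real m" by (intro mult_mono) (auto simp: ctf_def)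
    finally show ?thesis using True by simp
  next
    case False
    then show ?thesis using H0[of x n] by simp
  qed
  have fin: "integrable lborel (\<lambda>x. real m * indicator (cball 0 (real m + 1)) x :: real)"
    by (intro integrable_mult_right integrable_real_indicator) (auto simp: emeasure_cball less_top)
  have [measurable]: "cball (0 :: 'a) (real m + 1) \<in> sets borel" by simp
  have "(\<lambda>n. \<integral>\<^sup>+x. ennreal (norm (v m x - H n x)) \<partial>lborel) \<longlonglongrightarrow> 0"
  proof (rule nn_integral_dominated_convergence_norm[where w="\<lambda>x. real m * indicator (cball 0 (real m + 1)) x"])
    show "AE x in lborel. norm (H j x) \<le> real m * indicator (cball 0 (real m + 1)) x" for j using Hle by simp
    show "(\<integral>\<^sup>+x. ennreal (real m * indicator (cball 0 (real m + 1)) x) \<partial>lborel) < \<infinity>"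
      using conjunct1[OF conjunct2[OF iffD1[OF real_integrable_def fin]]]
      unfolding infinity_ennreal_def less_top .
    have "AE x in lebesgue. x \<notin> N" using N(1) by (intro AE_not_in) (simp add: negligible_iff_null_sets)
    then have "AE x in lborel. x \<notin> N" by (simp add: AE_completion_iff)
    then show "AE x in lborel. (\<lambda>n. H n x) \<longlonglongrightarrow> v m x"
    proof eventually_elim
      case (elim x)
      have "(\<lambda>n. H n x) \<longlonglongrightarrow> ctf x * max (- real m) (min (real m) (v m x))"
        unfolding H_def by (intro tendsto_intros N(3) elim)
      \<comment> \<open>The cutoff equals 1 where \<open>norm x \<le> real m\<close>, and elsewhere
        \<open>v m\<close> vanishes; its values are already clipped.\<close>
      also have "ctf x * max (- real m) (min (real m) (v m x)) = v m x"
        by (auto simp: ctf_def v_def)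
      finally show ?case .
    qed
  qed measurable
  then have "\<forall>\<^sub>F n in sequentially. (\<integral>\<^sup>+x. ennreal (norm (v m x - H n x)) \<partial>lborel) < ennreal (e / 2)"
    by (rule order_tendstoD(2)) (use e in simp)
  then obtain n where n: "(\<integral>\<^sup>+x. ennreal (norm (v m x - H n x)) \<partial>lborel) < ennreal (e / 2)"
    by (auto simp: eventually_sequentially)
  show thesis
  proof (rule that[OF Hc[of n] H0])
    show "0 < real m + 1" by linarith
    show "integrable lborel (H n)"
      by (rule Bochner_Integration.integrable_bound[OF fin]) (use Hle in \<open>auto intro: order_trans[OF _ abs_ge_self]\<close>)
    have "(\<integral>\<^sup>+x. ennreal \<bar>u x - H n x\<bar> \<partial>lborel) \<le> (\<integral>\<^sup>+x. ennreal (norm (u x - v m x)) + ennreal (norm (v m x - H n x)) \<partial>lborel)"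
      by (intro nn_integral_mono) (simp flip: ennreal_plus add: ennreal_leI)
    also have "\<dots> = (\<integral>\<^sup>+x. ennreal (norm (u x - v m x)) \<partial>lborel) + (\<integral>\<^sup>+x. ennreal (norm (v m x - H n x)) \<partial>lborel)"
      by (rule nn_integral_add) measurable
    also have "\<dots> < ennreal (e / 2) + ennreal (e / 2)" by (rule add_strict_mono[OF m n])
    also have "\<dots> = ennreal e" using e by (simp flip: ennreal_plus)
    finally show "(\<integral>\<^sup>+x. ennreal \<bar>u x - H n x\<bar> \<partial>lborel) < ennreal e" .
  qed
qed

context smooth_step
begin

text \<open>The kernel has integral 1, so the deviation is the average of \<open>g x - g z\<close>,
  and \<open>z\<close> ranges only over points within the reach of the kernel.\<close>

lemma cube_kern_average_uniform:
  fixes c :: "real^'n" and r s w :: real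
  assumes g: "integrable lborel g" and r: "0 < r" and s: "0 < s"
    and w: "\<And>x z. dist x z \<le> s * (norm c + r * CARD('n)) \<Longrightarrow> \<bar>g x - g z\<bar> \<le> w"
  shows "\<bar>g x - (\<integral>z. g z * cube_kern (x + s *\<^sub>R c) (s * r) z \<partial>lborel)\<bar> \<le>
    C0 ^ CARD('n) * unit_ball_vol CARD('n) * CARD('n) ^ CARD('n) * w"
proof -
  let ?N = "CARD('n)" and ?k = "cube_kern (x + s *\<^sub>R c) (s * r)" and ?B = "cball (x + s *\<^sub>R c) (s * r * CARD('n))"
  have sr: "0 < s * r" using r s by simp
  have w0: "0 \<le> w" using w[of x x] r s by (simp add: add_nonneg_nonneg)
  have ig: "integrable lborel (\<lambda>z. g z * ?k z)"
    by (rule integrable_mult_bounded[OF g _ cube_kern_bounded[OF sr]]) simp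
  have iB: "integrable lborel (indicator ?B :: real^'n \<Rightarrow> real)"
    by (intro integrable_real_indicator) (use sr in \<open>auto simp: emeasure_cball less_top\<close>)
  have ik: "integrable lborel ?k"
    by (rule Bochner_Integration.integrable_bound[of _ "\<lambda>z. (C0 / (s * r)) ^ ?N * indicator ?B z"])
      (use iB cube_kern_le[OF sr] in \<open>auto intro: order_trans[OF _ abs_ge_self]\<close>)
  have eq: "g x - (\<integral>z. g z * ?k z \<partial>lborel) = (\<integral>z. g x * ?k z - g z * ?k z \<partial>lborel)"
    using ig ik cube_kern_integral[OF sr, of "x + s *\<^sub>R c"] by simp
  have "\<bar>g x - (\<integral>z. g z * ?k z \<partial>lborel)\<bar> \<le> (\<integral>z. w * (C0 / (s * r)) ^ ?N * indicator ?B z \<partial>lborel)"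
    unfolding eq
  proof (rule integral_abs_bound_integral)
    show "integrable lborel (\<lambda>z. g x * ?k z - g z * ?k z)" using ig ik by simp
    show "integrable lborel (\<lambda>z. w * (C0 / (s * r)) ^ ?N * indicator ?B z)" using iB by simp
    fix z
    show "\<bar>g x * ?k z - g z * ?k z\<bar> \<le> w * (C0 / (s * r)) ^ ?N * indicator ?B z"
    proof (cases "z \<in> ?B")
      case True
      have "dist x z \<le> dist x (x + s *\<^sub>R c) + dist (x + s *\<^sub>R c) z" by (rule dist_triangle)
      also have "\<dots> \<le> s * norm c + s * r * ?N" using True s by (simp add: dist_norm)
      finally have "\<bar>g x - g z\<bar> \<le> w" by (intro w) (simp add: algebra_simps)
      then have "\<bar>g x - g z\<bar> * \<bar>?k z\<bar> \<le> w * (C0 / (s * r)) ^ ?N"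
        using cube_kern_bounded[OF sr, of "x + s *\<^sub>R c" z] w0 by (intro mult_mono) auto
      then show ?thesis using True by (simp add: left_diff_distrib[symmetric] abs_mult)
    next
      case False
      then have "?k z = 0" using cube_kern_le[OF sr, of "x + s *\<^sub>R c" z] by simp
      then show ?thesis using w0 C0 sr by simp
    qed
  qed
  also have "\<dots> = w * (C0 / (s * r)) ^ ?N * measure lborel ?B"
    by (simp only: integral_mult_right_zero Bochner_Integration.integral_indicator space_lborel space_borel Int_UNIV_right)
  also have "measure lborel ?B = unit_ball_vol ?N * (s * r * ?N) ^ ?N"
  proof -
    have "0 \<le> s * r * ?N" using sr by simp
    from content_cball[OF this, of "x + s *\<^sub>R c"] show ?thesis
      by (simp only: DIM_cart DIM_real mult_1_right)
  qed
  also have "w * (C0 / (s * r)) ^ ?N * (unit_ball_vol ?N * (s * r * ?N) ^ ?N) = C0 ^ ?N * unit_ball_vol ?N * ?N ^ ?N * w"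
    using r s by (simp add: power_divide power_mult_distrib)
  finally show ?thesis .
qed

text \<open>The averages are bounded on L^1 uniformly in the scale, so \<open>u\<close> may be
  replaced by a continuous function with bounded support, for which uniform continuity applies. This
  takes the place of Lebesgue's differentiation theorem.\<close>

lemma cube_kern_average_L1:
  fixes c :: "real^'n" and r l e :: real
  assumes u: "integrable lborel u" and r: "0 < r" and l: "0 < l" "l < 1" and e: "0 < e"
  shows "\<exists>k. (\<integral>\<^sup>+x. ennreal \<bar>u x - (\<integral>z. u z * cube_kern (x + l ^ k *\<^sub>R c) (l ^ k * r) z \<partial>lborel)\<bar> \<partial>lborel) < ennreal e"
proof -
  let ?N = "CARD('n)"
  define M where "M = C0 ^ ?N * unit_ball_vol ?N * ?N ^ ?N"
  have M: "0 < M" using C0 by (simp add: M_def)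
  \<comment> \<open>Half of \<open>e\<close> pays for replacing \<open>u\<close> by
    \<open>g\<close>, once directly and once under the average, which costs the factor
    \<open>1 + M\<close>. The other half, through \<open>w\<close>, pays for the oscillation of
    \<open>g\<close> on a ball of volume \<open>V\<close>.\<close>
  define e1 where "e1 = e / (2 * (1 + M))"
  have e1: "0 < e1" using e M by (simp add: e1_def)
  obtain g B where g: "continuous_on UNIV g" "\<And>x. B < norm x \<Longrightarrow> g x = 0" "integrable lborel g" "0 < B"
    "(\<integral>\<^sup>+x. ennreal \<bar>u x - g x\<bar> \<partial>lborel) < ennreal e1"
    by (rule L1_approx_continuous[OF u e1]) (rule that)
  define V where "V = unit_ball_vol ?N * (B + 2) ^ ?N"
  have V: "0 < V" using g(4) by (simp add: V_def)
  define w where "w = e / (2 * M * V)"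
  have w: "0 < w" using e M V by (simp add: w_def)
  have "uniformly_continuous_on (cball 0 (B + 2)) g"
    by (rule compact_uniformly_continuous[OF continuous_on_subset[OF g(1)]]) auto
  then obtain d where d: "0 < d" "\<And>x z. x \<in> cball 0 (B + 2) \<Longrightarrow> z \<in> cball 0 (B + 2) \<Longrightarrow> dist x z < d \<Longrightarrow> dist (g x) (g z) < w"
    using w unfolding uniformly_continuous_on_def by (metis dist_commute)
  define b' where "b' = norm c + r * ?N + 1"
  have b': "0 < b'" using r by (simp add: b'_def add_nonneg_pos)
  obtain k where k: "l ^ k < min d 1 / b'"
    using real_arch_pow_inv[of "min d 1 / b'" l] d(1) b' l by auto
  define s where "s = l ^ k"
  have s: "0 < s" using l by (simp add: s_def)
  have sb: "s * (norm c + r * ?N) < min d 1"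
  proof -
    have "s * (norm c + r * ?N) \<le> s * b'" using s by (simp add: b'_def)
    also have "\<dots> < min d 1" using k b' by (simp add: s_def pos_less_divide_eq)
    finally show ?thesis .
  qed
  define A where "A h x = (\<integral>z. h z * cube_kern (x + s *\<^sub>R c) (s * r) z \<partial>lborel)" for h x
  have um [measurable]: "u \<in> borel_measurable borel" and gm [measurable]: "g \<in> borel_measurable borel"
    using borel_measurable_integrable[OF u] borel_measurable_integrable[OF g(3)] by simp_all
  have Am [measurable]: "A h \<in> borel_measurable borel" if "h \<in> borel_measurable borel" for h
    unfolding A_def by (rule borel_measurable_cube_kern_average[OF that])
  have sr: "0 < s * r" using r s by simp
  have ug: "integrable lborel (\<lambda>x. g x - u x)" using u g(3) by simp
  have Aug: "A (\<lambda>x. g x - u x) x = A g x - A u x" for x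
  proof -
    have i: "integrable lborel (\<lambda>z. h z * cube_kern (x + s *\<^sub>R c) (s * r) z)" if "integrable lborel h" for h
      by (rule integrable_mult_bounded[OF that _ cube_kern_bounded[OF sr]]) simp
    show ?thesis unfolding A_def using i[OF u] i[OF g(3)] by (simp add: left_diff_distrib)
  qed
  have gA: "\<bar>g x - A g x\<bar> \<le> M * w * indicator (cball 0 (B + 2)) x" for x
  proof (cases "norm x \<le> B + 1")
    case True
    define g' where "g' z = (if dist x z \<le> s * (norm c + r * ?N) then g z else g x)" for z
    have "\<bar>g y - g z\<bar> \<le> w" if "dist y z \<le> s * (norm c + r * ?N)" for y z
    proof (cases "norm y \<le> B + 1")
      case True
      have "dist y z < min d 1" using that sb by simp
      moreover have "norm z \<le> norm y + dist y z" using norm_triangle_sub[of z y] by (simp add: dist_norm norm_minus_commute)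
      ultimately have "dist (g y) (g z) < w" using True by (intro d(2)) auto
      then show ?thesis by (simp add: dist_real_def)
    next
      case False
      have "dist y z < 1" using that sb by simp
      moreover have "norm y \<le> norm z + dist y z" using norm_triangle_sub[of y z] by (simp add: dist_norm)
      ultimately have "g y = 0" "g z = 0" using False by (auto intro!: g(2))
      then show ?thesis using w by simp
    qed
    from cube_kern_average_uniform[OF g(3) r s this, where c=c] show ?thesis
      using True by (simp add: A_def M_def)
  next
    case False
    have gx: "g x = 0" using False by (intro g(2)) simp
    \<comment> \<open>The kernel reaches less than distance 1 from \<open>x\<close>, hence not into
      the ball of radius \<open>B\<close> outside which \<open>g\<close> vanishes.\<close>
    have zz: "g z * cube_kern (x + s *\<^sub>R c) (s * r) z = 0" for z
    proof (cases "z \<in> cball (x + s *\<^sub>R c) (s * r * ?N)")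
      case True
      have "dist x z \<le> dist x (x + s *\<^sub>R c) + dist (x + s *\<^sub>R c) z" by (rule dist_triangle)
      also have "\<dots> \<le> s * norm c + s * r * ?N" using True s by (simp add: dist_norm)
      also have "\<dots> < 1" using sb by (simp add: algebra_simps)
      finally have "norm x < norm z + 1" using norm_triangle_sub[of x z] by (simp add: dist_norm)
      then show ?thesis using False g(2)[of z] by simp
    next
      case False
      then show ?thesis using cube_kern_le[OF sr, of "x + s *\<^sub>R c" z] by simp
    qed
    have "A g x = 0" unfolding A_def zz by simp
    then show ?thesis using gx M w by simp
  qed
  have [measurable]: "cball (0 :: real^'n) (B + 2) \<in> sets borel" by simp
  have [measurable]: "A (\<lambda>x. g x - u x) \<in> borel_measurable borel" by (rule Am) measurable
  define I1 where "I1 = (\<integral>\<^sup>+x. ennreal \<bar>u x - g x\<bar> \<partial>lborel)"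
  define I2 where "I2 = (\<integral>\<^sup>+x. ennreal (M * w) * indicator (cball (0 :: real^'n) (B + 2)) x \<partial>lborel)"
  define I3 where "I3 = (\<integral>\<^sup>+x. ennreal \<bar>A (\<lambda>x. g x - u x) x\<bar> \<partial>lborel)"
  have I3: "I3 \<le> ennreal M * I1"
    using cube_kern_average_L1_le[OF ug r s, of c] unfolding I3_def A_def M_def I1_def
    by (simp only: abs_minus_commute)
  have I2: "I2 = ennreal (M * w * V)"
  proof -
    have "I2 = ennreal (M * w) * emeasure lborel (cball (0 :: real^'n) (B + 2))"
      unfolding I2_def by (rule nn_integral_cmult_indicator) simp
    moreover have "emeasure lborel (cball (0 :: real^'n) (B + 2)) = ennreal V"
      using g(4) emeasure_cball[of "B + 2" "0 :: real^'n"] by (simp add: V_def)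
    ultimately show ?thesis using M w V by (simp add: ennreal_mult)
  qed
  have "(\<integral>\<^sup>+x. ennreal \<bar>u x - A u x\<bar> \<partial>lborel) \<le>
    (\<integral>\<^sup>+x. ennreal \<bar>u x - g x\<bar> + (ennreal (M * w) * indicator (cball 0 (B + 2)) x + ennreal \<bar>A (\<lambda>x. g x - u x) x\<bar>) \<partial>lborel)"
  proof (rule nn_integral_mono)
    fix x
    have "\<bar>u x - A u x\<bar> \<le> \<bar>u x - g x\<bar> + (M * w * indicator (cball 0 (B + 2)) x + \<bar>A (\<lambda>x. g x - u x) x\<bar>)"
      using gA[of x] unfolding Aug by linarith
    then have "ennreal \<bar>u x - A u x\<bar> \<le> ennreal (\<bar>u x - g x\<bar> + (M * w * indicator (cball 0 (B + 2)) x + \<bar>A (\<lambda>x. g x - u x) x\<bar>))"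
      by (rule ennreal_leI)
    also have "\<dots> = ennreal \<bar>u x - g x\<bar> + (ennreal (M * w * indicator (cball 0 (B + 2)) x) + ennreal \<bar>A (\<lambda>x. g x - u x) x\<bar>)"
      using M w by (subst ennreal_plus; (subst ennreal_plus)?) auto
    also have "ennreal (M * w * indicator (cball 0 (B + 2)) x) = ennreal (M * w) * indicator (cball 0 (B + 2)) x"
      by (simp add: indicator_def)
    finally show "ennreal \<bar>u x - A u x\<bar> \<le> ennreal \<bar>u x - g x\<bar> + (ennreal (M * w) * indicator (cball 0 (B + 2)) x + ennreal \<bar>A (\<lambda>x. g x - u x) x\<bar>)" .
  qed
  also have "\<dots> = I1 + (I2 + I3)"
  proof -
    have e1: "(\<integral>\<^sup>+x. ennreal (M * w) * indicator (cball 0 (B + 2)) x + ennreal \<bar>A (\<lambda>x. g x - u x) x\<bar> \<partial>lborel) = I2 + I3"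
      unfolding I2_def I3_def by (rule nn_integral_add) measurable
    have e2: "(\<integral>\<^sup>+x. ennreal \<bar>u x - g x\<bar> + (ennreal (M * w) * indicator (cball 0 (B + 2)) x + ennreal \<bar>A (\<lambda>x. g x - u x) x\<bar>) \<partial>lborel) =
      I1 + (\<integral>\<^sup>+x. ennreal (M * w) * indicator (cball 0 (B + 2)) x + ennreal \<bar>A (\<lambda>x. g x - u x) x\<bar> \<partial>lborel)"
      unfolding I1_def by (rule nn_integral_add) measurable
    show ?thesis unfolding e2 e1 ..
  qed
  also have "\<dots> \<le> I1 + (ennreal (M * w * V) + ennreal M * I1)"
    by (intro add_mono order_refl I3 eq_refl I2)
  also have "\<dots> = ennreal (1 + M) * I1 + ennreal (M * w * V)"
  proof -
    have "ennreal (1 + M) = 1 + ennreal M" using M by (simp add: ennreal_plus)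
    then show ?thesis by (simp only: distrib_right mult_1_left add_ac)
  qed
  also have "\<dots> < ennreal (1 + M) * ennreal e1 + ennreal (M * w * V)"
  proof -
    have "ennreal (1 + M) * I1 < ennreal (1 + M) * ennreal e1"
      unfolding I1_def
    proof (rule ennreal_mult_strict_left_mono[OF g(5)])
      show "0 < ennreal (1 + M)" unfolding ennreal_less_zero_iff using M by linarith
    qed simp
    then show ?thesis
      unfolding add.commute[of _ "ennreal (M * w * V)"] ennreal_add_left_cancel_less by simp
  qed
  also have "\<dots> = ennreal e"
  proof -
    have h: "ennreal (1 + M) * ennreal e1 = ennreal (e / 2)"
    proof -
      have "ennreal (1 + M) * ennreal e1 = ennreal ((1 + M) * e1)"
        by (rule ennreal_mult[symmetric]) (use M e1 in linarith)+
      also have "(1 + M) * e1 = e / 2"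
      proof -
        have gen: "y * (e / (2 * y)) = e / 2" if "y \<noteq> 0" for y :: real using that by simp
        show ?thesis unfolding e1_def by (rule gen) (use M in linarith)
      qed
      finally show ?thesis .
    qed
    have w': "M * w * V = e / 2" using M V by (simp add: w_def)
    have "ennreal (e / 2) + ennreal (e / 2) = ennreal (e / 2 + e / 2)"
      by (rule ennreal_plus[symmetric]) (use e in auto)
    then show ?thesis unfolding h w' by simp
  qed
  finally show ?thesis unfolding A_def s_def by (intro exI[of _ k])
qed

end

lemma borel_measurable_ball_potential [measurable]:
  assumes [measurable]: "f \<in> borel_measurable borel"
  shows "ball_potential l c R f \<in> borel_measurable borel"
proof -
  have ind: "indicator (cball (x + v) r) y = (if dist (x + v) y \<le> r then 1 else 0 :: ennreal)" for x v y :: 'a and r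
    by (auto simp: indicator_def)
  show ?thesis unfolding ball_potential_def ind by measurable
qed

definition weak_gradient :: "(real^'n) set \<Rightarrow> (real^'n \<Rightarrow> real) \<Rightarrow> ('n \<Rightarrow> real^'n \<Rightarrow> real) \<Rightarrow> bool" where
  "weak_gradient \<Omega> u D \<longleftrightarrow> integrable lborel u \<and> (\<forall>i. integrable lborel (D i)) \<and>
     (\<forall>i \<phi>. test_fun \<Omega> \<phi> \<longrightarrow> (\<integral>x. u x * partial i \<phi> x \<partial>lborel) = - (\<integral>x. D i x * \<phi> x \<partial>lborel))"

lemma weak_gradient_cmult:
  assumes "weak_gradient \<Omega> u D"
  shows "weak_gradient \<Omega> (\<lambda>x. a * u x) (\<lambda>i x. a * D i x)"
  using assms by (simp add: weak_gradient_def mult.assoc)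

context smooth_step
begin

text \<open>Telescoping over the scales: two consecutive cubes lie in the ball of the cone at the
  larger scale s, so \<open>cube_kern_change\<close> bounds their difference by s^(1 - d) times the
  integral of the gradient over that ball, a term of the potential. The first average is bounded by
  the L^1 norm.\<close>

lemma cube_kern_average_le_potential:
  fixes u :: "real^'n \<Rightarrow> real" and D :: "'n \<Rightarrow> real^'n \<Rightarrow> real"
  assumes u: "integrable lborel u" and D: "\<And>i. integrable lborel (D i)"
    and deriv: "\<And>i \<phi>. test_fun \<Omega> \<phi> \<Longrightarrow> (\<integral>x. u x * partial i \<phi> x \<partial>lborel) = - (\<integral>x. D i x * \<phi> x \<partial>lborel)"
    and \<rho>: "0 < \<rho>" and l: "0 < l" "l < 1" and lc: "(1 - l) * norm c \<le> \<rho> / (2 * CARD('n))"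
    and cone: "\<And>s. 0 < s \<Longrightarrow> s \<le> 1 \<Longrightarrow> cball (x + s *\<^sub>R c) (s * \<rho>) \<subseteq> \<Omega>"
  shows "ennreal \<bar>\<integral>z. u z * cube_kern (x + l ^ k *\<^sub>R c) (l ^ k * (\<rho> / (2 * CARD('n)))) z \<partial>lborel\<bar> \<le>
    ennreal ((C0 / (\<rho> / (2 * CARD('n)))) ^ CARD('n) * (\<integral>z. \<bar>u z\<bar> \<partial>lborel)) +
    ennreal (CARD('n) * (C0 / (l / (2 * CARD('n)) * \<rho>)) ^ (CARD('n) - 1)) *
      ball_potential l c \<rho> (\<lambda>z. \<Sum>i\<in>UNIV. \<bar>D i z\<bar>) x"
proof -
  let ?N = "CARD('n)"
  \<comment> \<open>Half of the room \<open>\<rho> / d\<close> per coordinate is for the cube; the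
    other half is for the shift of the centre to the next scale, which is at most
    \<open>s * r\<close> by the hypothesis on \<open>l\<close>.\<close>
  define r where "r = \<rho> / (2 * ?N)"
  have r: "0 < r" using \<rho> by (simp add: r_def)
  \<comment> \<open>Chosen so that \<open>\<kappa> * (s * \<rho>)\<close> is the half side of the
    smaller of the two cubes.\<close>
  define \<kappa> where "\<kappa> = l / (2 * ?N)"
  have \<kappa>: "0 < \<kappa>" using l by (simp add: \<kappa>_def)
  define A where "A k = (\<integral>z. u z * cube_kern (x + l ^ k *\<^sub>R c) (l ^ k * r) z \<partial>lborel)" for k :: nat
  define F where "F z = (\<Sum>i\<in>UNIV. \<bar>D i z\<bar>)" for z
  have F: "integrable lborel F" unfolding F_def using D by simp
  have F0: "0 \<le> F z" for z by (simp add: F_def sum_nonneg)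
  define t where "t k = ennreal ((l ^ k) powr (1 - real DIM(real^'n))) *
     (\<integral>\<^sup>+y. ennreal (F y) * indicator (cball (x + l ^ k *\<^sub>R c) (l ^ k * \<rho>)) y \<partial>lborel)" for k :: nat
  define C1 where "C1 = real ?N * (C0 / (\<kappa> * \<rho>)) ^ (?N - 1)"
  have C1: "0 \<le> C1" using C0 \<kappa> \<rho> by (simp add: C1_def)
  define C2 where "C2 = (C0 / r) ^ ?N"
  have C2: "0 \<le> C2" using C0 r by (simp add: C2_def)
  have N0: "0 < real ?N" by simp
  have step: "ennreal \<bar>A k - A (Suc k)\<bar> \<le> ennreal C1 * t k" for k
  proof -
    define s where "s = l ^ k"
    have s: "0 < s" "s \<le> 1" using l by (auto simp: s_def power_le_one)
    define J where "J = (\<integral>z. F z * indicator (cball (x + s *\<^sub>R c) (s * \<rho>)) z \<partial>lborel)"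
    have half: "s * r + s * r = s * \<rho> / ?N" by (simp add: r_def)
    have "\<bar>(\<integral>z. u z * cube_kern (x + s *\<^sub>R c) (s * r) z \<partial>lborel) - (\<integral>z. u z * cube_kern (x + (s * l) *\<^sub>R c) (s * l * r) z \<partial>lborel)\<bar> \<le>
      ?N * ((C0 / (\<kappa> * (s * \<rho>))) ^ (?N - 1) * (\<integral>z. (\<Sum>i\<in>UNIV. \<bar>D i z\<bar>) * indicator (cball (x + s *\<^sub>R c) (s * \<rho>)) z \<partial>lborel))"
    proof (rule cube_kern_change[OF u D deriv \<kappa>])
      show "0 < s * \<rho>" using s \<rho> by simp
      show "cball (x + s *\<^sub>R c) (s * \<rho>) \<subseteq> \<Omega>" by (rule cone[OF s])
      have sr: "0 \<le> s * r" using s r by simp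
      show "\<bar>(x + s *\<^sub>R c) $ j - (x + s *\<^sub>R c) $ j\<bar> + s * r \<le> s * \<rho> / ?N" for j
      proof -
        have "\<bar>y - y\<bar> = 0" for y :: real by simp
        then show ?thesis using half sr by linarith
      qed
      have ke: "\<kappa> * (s * \<rho>) = l * (s * r)" by (simp add: \<kappa>_def r_def)
      have lsr: "l * (s * r) \<le> s * r" using l sr mult_right_mono[of l 1 "s * r"] by simp
      show "\<kappa> * (s * \<rho>) \<le> s * r" unfolding ke by (rule lsr)
      show "\<kappa> * (s * \<rho>) \<le> s * l * r" unfolding ke by (simp add: mult_ac)
      show "\<bar>(x + (s * l) *\<^sub>R c) $ j - (x + s *\<^sub>R c) $ j\<bar> + s * l * r \<le> s * \<rho> / ?N" for j
      proof -
        have "(x + (s * l) *\<^sub>R c) $ j - (x + s *\<^sub>R c) $ j = - (s * ((1 - l) * c $ j))" by (simp add: algebra_simps)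
        then have "\<bar>(x + (s * l) *\<^sub>R c) $ j - (x + s *\<^sub>R c) $ j\<bar> = s * ((1 - l) * \<bar>c $ j\<bar>)"
          using s l by (simp add: abs_mult)
        also have "\<dots> \<le> s * ((1 - l) * norm c)"
          using s l component_le_norm_cart[of c j] by (intro mult_left_mono) auto
        also have "\<dots> \<le> s * r" using lc s by (intro mult_left_mono) (auto simp: r_def)
        finally have "\<bar>(x + (s * l) *\<^sub>R c) $ j - (x + s *\<^sub>R c) $ j\<bar> \<le> s * r" .
        moreover have "s * l * r \<le> s * r" using lsr by (simp only: mult_ac)
        ultimately show ?thesis using half by linarith
      qed
    qed
    then have "\<bar>A k - A (Suc k)\<bar> \<le> ?N * ((C0 / (\<kappa> * (s * \<rho>))) ^ (?N - 1) * J)"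
      by (simp add: A_def J_def F_def s_def mult_ac)
    also have "(C0 / (\<kappa> * (s * \<rho>))) ^ (?N - 1) = (C0 / (\<kappa> * \<rho>)) ^ (?N - 1) * s powr (1 - real ?N)"
    proof -
      have "C0 / (\<kappa> * (s * \<rho>)) = C0 / (\<kappa> * \<rho>) * inverse s" by (simp add: divide_inverse mult_ac)
      moreover have "inverse s ^ (?N - 1) = s powr (1 - real ?N)"
      proof -
        have "s powr (1 - real ?N) = s powr (- real (?N - 1))" by (rule arg_cong) (simp add: of_nat_diff)
        also have "\<dots> = inverse (s ^ (?N - 1))" by (simp only: powr_minus powr_realpow[OF s(1)])
        finally show ?thesis by (simp only: power_inverse)
      qed
      ultimately show ?thesis by (simp only: power_mult_distrib)
    qed
    finally have "\<bar>A k - A (Suc k)\<bar> \<le> C1 * (s powr (1 - real ?N) * J)" by (simp add: C1_def mult_ac)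
    then have "ennreal \<bar>A k - A (Suc k)\<bar> \<le> ennreal (C1 * (s powr (1 - real ?N) * J))" by (rule ennreal_leI)
    also have "\<dots> = ennreal C1 * (ennreal (s powr (1 - real ?N)) * ennreal J)"
    proof -
      have "0 \<le> J" unfolding J_def using F0 by (intro integral_nonneg_AE) auto
      then show ?thesis using C1 by (simp add: ennreal_mult)
    qed
    also have "ennreal J = (\<integral>\<^sup>+y. ennreal (F y) * indicator (cball (x + s *\<^sub>R c) (s * \<rho>)) y \<partial>lborel)"
    proof -
      have "(\<integral>\<^sup>+y. ennreal (F y * indicator (cball (x + s *\<^sub>R c) (s * \<rho>)) y) \<partial>lborel) = ennreal J"
        unfolding J_def using F0 by (intro nn_integral_eq_integral integrable_real_mult_indicator F) auto
      moreover have "ennreal (F y * indicator (cball (x + s *\<^sub>R c) (s * \<rho>)) y) = ennreal (F y) * indicator (cball (x + s *\<^sub>R c) (s * \<rho>)) y" for y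
        by (simp add: indicator_def)
      ultimately show ?thesis by (simp only:)
    qed
    finally show ?thesis by (simp only: t_def s_def DIM_cart DIM_real mult_1_right)
  qed
  have zero: "ennreal \<bar>A 0\<bar> \<le> ennreal (C2 * (\<integral>z. \<bar>u z\<bar> \<partial>lborel))"
  proof (rule ennreal_leI)
    have "\<bar>A 0\<bar> \<le> (\<integral>z. C2 * \<bar>u z\<bar> \<partial>lborel)"
      unfolding A_def
    proof (rule integral_abs_bound_integral)
      have r1: "0 < l ^ 0 * r" using r by simp
      show "integrable lborel (\<lambda>z. u z * cube_kern (x + l ^ 0 *\<^sub>R c) (l ^ 0 * r) z)"
        by (rule integrable_mult_bounded[OF u _ cube_kern_bounded[OF r1]]) simp
      show "integrable lborel (\<lambda>z. C2 * \<bar>u z\<bar>)" using u by simp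
      show "\<bar>u z * cube_kern (x + l ^ 0 *\<^sub>R c) (l ^ 0 * r) z\<bar> \<le> C2 * \<bar>u z\<bar>" for z
        using mult_left_mono[OF cube_kern_bounded[OF r1, of "x + l ^ 0 *\<^sub>R c" z] abs_ge_zero[of "u z"]]
        by (simp add: abs_mult C2_def mult.commute)
    qed
    then show "\<bar>A 0\<bar> \<le> C2 * (\<integral>z. \<bar>u z\<bar> \<partial>lborel)" by simp
  qed
  have "ennreal \<bar>A k\<bar> \<le> ennreal (C2 * (\<integral>z. \<bar>u z\<bar> \<partial>lborel)) + ennreal C1 * (\<Sum>j<k. t j)"
  proof (induction k)
    case (Suc k)
    have "ennreal \<bar>A (Suc k)\<bar> \<le> ennreal (\<bar>A k\<bar> + \<bar>A k - A (Suc k)\<bar>)" by (rule ennreal_leI) linarith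
    also have "\<dots> = ennreal \<bar>A k\<bar> + ennreal \<bar>A k - A (Suc k)\<bar>" by (rule ennreal_plus) auto
    also have "\<dots> \<le> (ennreal (C2 * (\<integral>z. \<bar>u z\<bar> \<partial>lborel)) + ennreal C1 * (\<Sum>j<k. t j)) + ennreal C1 * t k"
      by (rule add_mono[OF Suc step])
    also have "\<dots> = ennreal (C2 * (\<integral>z. \<bar>u z\<bar> \<partial>lborel)) + ennreal C1 * (\<Sum>j<Suc k. t j)"
      by (simp add: distrib_left add.assoc)
    finally show ?case .
  qed (use zero in simp)
  also have "ennreal (C2 * (\<integral>z. \<bar>u z\<bar> \<partial>lborel)) + ennreal C1 * (\<Sum>j<k. t j) \<le>
      ennreal (C2 * (\<integral>z. \<bar>u z\<bar> \<partial>lborel)) + ennreal C1 * (\<Sum>j. t j)"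
    by (intro add_left_mono mult_left_mono sum_le_suminf) auto
  finally show ?thesis
    by (simp only: A_def r_def C2_def C1_def \<kappa>_def t_def F_def ball_potential_def)
qed

text \<open>All averages obey one and the same bound \<open>H\<close> on \<open>E\<close>, and some
  of them are arbitrarily close to \<open>u\<close> in L^1. Hence the excess of
  \<open>\<bar>u x\<bar>\<close> over \<open>H x\<close> on \<open>E\<close> has integral zero. The
  constants depend on the cone but not on \<open>u\<close> or \<open>D\<close>.\<close>

lemma pointwise_bound:
  fixes c :: "real^'n"
  assumes E: "E \<in> sets borel" and \<rho>: "0 < \<rho>"
    and cone: "\<forall>x\<in>E. \<forall>s. 0 < s \<longrightarrow> s \<le> 1 \<longrightarrow> cball (x + s *\<^sub>R c) (s * \<rho>) \<subseteq> \<Omega>"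
  shows "\<exists>l C. 0 < l \<and> l < 1 \<and> 0 < C \<and> (\<forall>u D. weak_gradient \<Omega> u D \<longrightarrow>
      (AE x in lborel. x \<in> E \<longrightarrow> ennreal \<bar>u x\<bar> \<le> ennreal (C * (\<integral>z. \<bar>u z\<bar> \<partial>lborel)) +
        ennreal C * ball_potential l c \<rho> (\<lambda>z. \<Sum>i\<in>UNIV. \<bar>D i z\<bar>) x))"
proof -
  let ?N = "CARD('n)"
  define r where "r = \<rho> / (2 * ?N)"
  have r: "0 < r" using \<rho> by (simp add: r_def)
  \<comment> \<open>Close enough to 1 that consecutive centres differ by at most the half side of
    the cube. Adding 1 to the norm covers \<open>c = 0\<close>, and the maximum with 1/2 keeps
    \<open>l\<close> positive.\<close>
  define l where "l = max (1 / 2) (1 - r / (norm c + 1))"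
  have nc: "0 < norm c + 1" using norm_ge_zero[of c] by linarith
  have l: "0 < l" "l < 1" using r nc by (auto simp: l_def)
  have lc: "(1 - l) * norm c \<le> \<rho> / (2 * ?N)"
  proof -
    have "1 - l \<le> r / (norm c + 1)" by (auto simp: l_def)
    then have "(1 - l) * norm c \<le> r / (norm c + 1) * (norm c + 1)"
      using l nc r by (intro mult_mono) auto
    then show ?thesis using nc by (simp add: r_def)
  qed
  define C2 where "C2 = (C0 / (\<rho> / (2 * ?N))) ^ ?N"
  define C1 where "C1 = real ?N * (C0 / (l / (2 * ?N) * \<rho>)) ^ (?N - 1)"
  have C12: "0 < C1" "0 < C2" using C0 l \<rho> by (auto simp: C1_def C2_def)
  define C where "C = C1 + C2"
  show ?thesis
  proof (rule exI[of _ l], rule exI[of _ C], intro conjI allI impI l)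
    show "0 < C" using C12 by (simp add: C_def)
    fix u :: "real^'n \<Rightarrow> real" and D :: "'n \<Rightarrow> real^'n \<Rightarrow> real"
    assume uD: "weak_gradient \<Omega> u D"
    have u: "integrable lborel u" and D: "\<And>i. integrable lborel (D i)"
      and deriv: "\<And>i \<phi>. test_fun \<Omega> \<phi> \<Longrightarrow> (\<integral>x. u x * partial i \<phi> x \<partial>lborel) = - (\<integral>x. D i x * \<phi> x \<partial>lborel)"
      using uD by (simp_all add: weak_gradient_def)
    define H where "H x = ennreal (C * (\<integral>z. \<bar>u z\<bar> \<partial>lborel)) + ennreal C * ball_potential l c \<rho> (\<lambda>z. \<Sum>i\<in>UNIV. \<bar>D i z\<bar>) x" for x
    have um [measurable]: "u \<in> borel_measurable borel" using borel_measurable_integrable[OF u] by simp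
    have Dm: "(\<lambda>z. \<Sum>i\<in>UNIV. \<bar>D i z\<bar>) \<in> borel_measurable borel"
    proof -
      have [measurable]: "D i \<in> borel_measurable borel" for i using borel_measurable_integrable[OF D] by simp
      show ?thesis by measurable
    qed
    note [measurable] = borel_measurable_ball_potential[OF Dm]
    have Hm [measurable]: "H \<in> borel_measurable borel" unfolding H_def by measurable
    define A where "A k x = (\<integral>z. u z * cube_kern (x + l ^ k *\<^sub>R c) (l ^ k * r) z \<partial>lborel)" for k x
    have AH: "ennreal \<bar>A k x\<bar> \<le> H x" if x: "x \<in> E" for k x
    proof -
      have "ennreal \<bar>A k x\<bar> \<le> ennreal (C2 * (\<integral>z. \<bar>u z\<bar> \<partial>lborel)) + ennreal C1 * ball_potential l c \<rho> (\<lambda>z. \<Sum>i\<in>UNIV. \<bar>D i z\<bar>) x"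
        unfolding A_def r_def C1_def C2_def
        by (rule cube_kern_average_le_potential[OF u D deriv \<rho> l lc cone[rule_format, OF x]])
      also have "\<dots> \<le> H x"
        unfolding H_def
      proof (intro add_mono mult_right_mono ennreal_leI)
        show "0 \<le> (\<integral>z. \<bar>u z\<bar> \<partial>lborel)" by simp
      qed (use C12 in \<open>auto simp: C_def\<close>)
      finally show ?thesis .
    qed
    have [measurable]: "E \<in> sets borel" by (rule E)
    \<comment> \<open>Subtraction of extended nonnegative numbers is truncated, so only the excess
      over \<open>H\<close> counts; points where \<open>H\<close> is infinite contribute 0.\<close>
    define Z where "Z = (\<integral>\<^sup>+x. (ennreal \<bar>u x\<bar> - H x) * indicator E x \<partial>lborel)"
    have Ze: "Z \<le> ennreal e" if e: "0 < e" for e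
    proof -
      obtain k where k: "(\<integral>\<^sup>+x. ennreal \<bar>u x - A k x\<bar> \<partial>lborel) < ennreal e"
        unfolding A_def using cube_kern_average_L1[OF u r l e, of c] by (elim exE)
      have "Z \<le> (\<integral>\<^sup>+x. ennreal \<bar>u x - A k x\<bar> \<partial>lborel)"
        unfolding Z_def
      proof (rule nn_integral_mono)
        fix x
        show "(ennreal \<bar>u x\<bar> - H x) * indicator E x \<le> ennreal \<bar>u x - A k x\<bar>"
        proof (cases "x \<in> E")
          case True
          have "ennreal \<bar>u x\<bar> \<le> ennreal (\<bar>A k x\<bar> + \<bar>u x - A k x\<bar>)" by (rule ennreal_leI) linarith
          also have "\<dots> = ennreal \<bar>A k x\<bar> + ennreal \<bar>u x - A k x\<bar>" by (rule ennreal_plus) auto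
          also have "\<dots> \<le> H x + ennreal \<bar>u x - A k x\<bar>" by (rule add_right_mono[OF AH[OF True]])
          finally have "ennreal \<bar>u x\<bar> - H x \<le> ennreal \<bar>u x - A k x\<bar>" by (simp add: ennreal_minus_le_iff)
          then show ?thesis using True by simp
        qed simp
      qed
      then show ?thesis using k by simp
    qed
    have "Z \<le> 0"
    proof (rule ennreal_le_epsilon)
      fix e :: real assume "0 < e"
      from Ze[OF this] show "Z \<le> 0 + ennreal e" by simp
    qed
    then have "AE x in lborel. (ennreal \<bar>u x\<bar> - H x) * indicator E x = 0"
      unfolding Z_def by (subst (asm) le_zero_eq, subst (asm) nn_integral_0_iff_AE) measurable
    then show "AE x in lborel. x \<in> E \<longrightarrow> ennreal \<bar>u x\<bar> \<le> ennreal (C * (\<integral>z. \<bar>u z\<bar> \<partial>lborel)) +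
        ennreal C * ball_potential l c \<rho> (\<lambda>z. \<Sum>i\<in>UNIV. \<bar>D i z\<bar>) x"
    proof eventually_elim
      case (elim x)
      show ?case
      proof
        assume "x \<in> E"
        then have "\<not> 0 < ennreal \<bar>u x\<bar> - H x" using elim by simp
        then have "\<not> H x < ennreal \<bar>u x\<bar>" using diff_gr0_ennreal by blast
        then show "ennreal \<bar>u x\<bar> \<le> ennreal (C * (\<integral>z. \<bar>u z\<bar> \<partial>lborel)) +
            ennreal C * ball_potential l c \<rho> (\<lambda>z. \<Sum>i\<in>UNIV. \<bar>D i z\<bar>) x"
          unfolding H_def not_less .
      qed
    qed
  qed
qed

end

section \<open>Sobolev embeddings on Lipschitz domains\<close>

context smooth_step
begin

text \<open>The pointwise bound transfers the integrability of the potential to \<open>u\<close>;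
  boundedness of \<open>E\<close> makes the constant stemming from the L^1 norm integrable. The data
  are normalised here, and homogeneity restores the norms later.\<close>

lemma local_embedding:
  fixes c :: "real^'n" and p :: real
  assumes E: "E \<in> sets borel" "bounded E" and \<rho>: "0 < \<rho>"
    and cone: "\<forall>x\<in>E. \<forall>s. 0 < s \<longrightarrow> s \<le> 1 \<longrightarrow> cball (x + s *\<^sub>R c) (s * \<rho>) \<subseteq> \<Omega>"
    and p: "1 < p" "p < CARD('n)"
  defines "q \<equiv> CARD('n) * p / (CARD('n) - p)"
  shows "\<exists>C>0. \<forall>u D. weak_gradient \<Omega> u D \<longrightarrow> (\<integral>z. \<bar>u z\<bar> \<partial>lborel) \<le> 1 \<longrightarrow>
     (\<integral>\<^sup>+z. ennreal ((\<Sum>i\<in>UNIV. \<bar>D i z\<bar>) powr p) \<partial>lborel) \<le> 1 \<longrightarrow>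
     (\<integral>\<^sup>+x. ennreal (\<bar>u x\<bar> powr q) * indicator E x \<partial>lborel) \<le> ennreal C"
proof -
  obtain l C where lC: "0 < l" "l < 1" "0 < C"
    "\<forall>u D. weak_gradient \<Omega> u D \<longrightarrow>
      (AE x in lborel. x \<in> E \<longrightarrow> ennreal \<bar>u x\<bar> \<le> ennreal (C * (\<integral>z. \<bar>u z\<bar> \<partial>lborel)) +
        ennreal C * ball_potential l c \<rho> (\<lambda>z. \<Sum>i\<in>UNIV. \<bar>D i z\<bar>) x)"
    using pointwise_bound[OF E(1) \<rho> cone] by (elim exE conjE)
  have pN: "p < real DIM(real^'n)" using p by simp
  obtain C' where C': "0 < C'" "\<forall>f\<in>borel_measurable borel. \<forall>w\<in>borel_measurable borel.
     (\<forall>x. 0 \<le> f x) \<longrightarrow> (\<forall>x. 0 \<le> w x) \<longrightarrow> (\<integral>\<^sup>+x. ennreal (f x powr p) \<partial>lborel) \<le> 1 \<longrightarrow>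
     (AE x in lborel. ennreal (w x) \<le> ball_potential l c \<rho> f x) \<longrightarrow>
     (\<integral>\<^sup>+x. ennreal (w x powr (real DIM(real^'n) * p / (real DIM(real^'n) - p))) \<partial>lborel) \<le> ennreal C'"
    using ball_potential_strong_type[OF lC(1,2) \<rho> p(1) pN, of c] by (elim exE conjE)
  have qD: "real DIM(real^'n) * p / (real DIM(real^'n) - p) = q" by (simp add: q_def)
  have q: "q > 0" using p by (simp add: q_def)
  have Ef: "emeasure lborel E < \<infinity>" using E(2) by (rule emeasure_bounded_finite)
  define m where "m = measure lborel E"
  have m: "emeasure lborel E = ennreal m" unfolding m_def using Ef by (intro emeasure_eq_ennreal_measure) auto
  define K where "K = (2 * C) powr q * (C' + m) + 1"
  have Kpos: "K > 0" using C' by (simp add: K_def m_def add_nonneg_pos)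
  have [measurable]: "E \<in> sets borel" by (rule E(1))
  have "(\<integral>\<^sup>+x. ennreal (\<bar>u x\<bar> powr q) * indicator E x \<partial>lborel) \<le> ennreal K"
    if uD: "weak_gradient \<Omega> u D" and u1: "(\<integral>z. \<bar>u z\<bar> \<partial>lborel) \<le> 1"
      and D1: "(\<integral>\<^sup>+z. ennreal ((\<Sum>i\<in>UNIV. \<bar>D i z\<bar>) powr p) \<partial>lborel) \<le> 1" for u D
  proof -
    have u: "integrable lborel u" and D: "\<And>i. integrable lborel (D i)"
      using uD by (simp_all add: weak_gradient_def)
    have um [measurable]: "u \<in> borel_measurable borel" using borel_measurable_integrable[OF u] by simp
    have Dm [measurable]: "D i \<in> borel_measurable borel" for i using borel_measurable_integrable[OF D] by simp
    define f where "f z = (\<Sum>i\<in>UNIV. \<bar>D i z\<bar>)" for z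
    have fm: "f \<in> borel_measurable borel" unfolding f_def by measurable
    \<comment> \<open>Dividing by \<open>C\<close> and subtracting 1 absorbs the constant term of
      the pointwise bound, so that \<open>w\<close> lies below the potential itself.\<close>
    define w where "w x = (if x \<in> E then max 0 (\<bar>u x\<bar> / C - 1) else 0)" for x
    have wm [measurable]: "w \<in> borel_measurable borel" unfolding w_def by measurable
    have "AE x in lborel. ennreal (w x) \<le> ball_potential l c \<rho> f x"
      using lC(4)[rule_format, OF uD]
    proof eventually_elim
      case (elim x)
      show ?case
      proof (cases "x \<in> E \<and> ball_potential l c \<rho> f x \<noteq> \<infinity>")
        case True
        then obtain b where b: "0 \<le> b" "ball_potential l c \<rho> f x = ennreal b"
          by (cases "ball_potential l c \<rho> f x") auto
        have "ennreal \<bar>u x\<bar> \<le> ennreal (C * (\<integral>z. \<bar>u z\<bar> \<partial>lborel)) + ennreal C * ennreal b"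
          using elim True b(2) by (simp add: f_def[abs_def])
        also have "\<dots> \<le> ennreal C + ennreal C * ennreal b"
          using u1 lC(3) by (intro add_right_mono ennreal_leI) simp
        also have "\<dots> = ennreal (C + C * b)" using lC(3) b(1) by (simp add: ennreal_mult)
        finally have "\<bar>u x\<bar> \<le> C + C * b" using lC(3) b(1) by (subst (asm) ennreal_le_iff) auto
        then have "\<bar>u x\<bar> / C \<le> (C + C * b) / C" using lC(3) by (intro divide_right_mono) auto
        also have "(C + C * b) / C = 1 + b" using lC(3) by (simp add: add_divide_distrib)
        finally have "w x \<le> b" using b(1) by (simp add: w_def)
        then show ?thesis unfolding b(2) by (rule ennreal_leI)
      next
        case False
        then show ?thesis by (auto simp: w_def)
      qed
    qed
    then have W: "(\<integral>\<^sup>+x. ennreal (w x powr q) \<partial>lborel) \<le> ennreal C'"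
      using C'(2)[unfolded qD, rule_format, of f w] fm wm D1 by (simp add: f_def[abs_def] sum_nonneg w_def[abs_def])
    have pt: "ennreal (\<bar>u x\<bar> powr q) * indicator E x \<le> ennreal ((2 * C) powr q) * (ennreal (w x powr q) + indicator E x)" for x
    proof (cases "x \<in> E")
      case True
      have "\<bar>u x\<bar> / C \<le> w x + 1" using True by (simp add: w_def)
      then have "\<bar>u x\<bar> \<le> C * (w x + 1)" using lC(3) by (simp add: pos_divide_le_eq mult.commute)
      then have "\<bar>u x\<bar> powr q \<le> (C * (w x + 1)) powr q" using q by (intro powr_mono2) auto
      also have "\<dots> = C powr q * \<bar>w x + 1\<bar> powr q"
        using lC(3) by (simp add: powr_mult w_def)
      also have "\<dots> \<le> C powr q * (2 powr q * (\<bar>w x\<bar> powr q + \<bar>1\<bar> powr q))"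
        using q by (intro mult_left_mono powr_add_le_max) auto
      also have "\<dots> = (2 * C) powr q * (w x powr q + 1)"
        using lC(3) by (simp add: powr_mult w_def mult_ac)
      finally have "ennreal (\<bar>u x\<bar> powr q) \<le> ennreal ((2 * C) powr q * (w x powr q + 1))" by (rule ennreal_leI)
      also have "\<dots> = ennreal ((2 * C) powr q) * (ennreal (w x powr q) + 1)" by (simp add: ennreal_mult)
      finally show ?thesis using True by simp
    qed simp
    have "(\<integral>\<^sup>+x. ennreal (\<bar>u x\<bar> powr q) * indicator E x \<partial>lborel) \<le>
       (\<integral>\<^sup>+x. ennreal ((2 * C) powr q) * (ennreal (w x powr q) + indicator E x) \<partial>lborel)"
      by (rule nn_integral_mono[OF pt])
    also have "\<dots> = ennreal ((2 * C) powr q) * (\<integral>\<^sup>+x. ennreal (w x powr q) + indicator E x \<partial>lborel)"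
      by (rule nn_integral_cmult) measurable
    also have "(\<integral>\<^sup>+x. ennreal (w x powr q) + indicator E x \<partial>lborel) = (\<integral>\<^sup>+x. ennreal (w x powr q) \<partial>lborel) + ennreal m"
      by (subst nn_integral_add) (measurable, simp add: m)
    also have "ennreal ((2 * C) powr q) * ((\<integral>\<^sup>+x. ennreal (w x powr q) \<partial>lborel) + ennreal m) \<le>
        ennreal ((2 * C) powr q) * (ennreal C' + ennreal m)"
      by (intro mult_left_mono add_right_mono W) simp
    also have "\<dots> = ennreal ((2 * C) powr q * (C' + m))"
      using C'(1) by (simp add: ennreal_mult m_def)
    also have "\<dots> \<le> ennreal K" by (rule ennreal_leI) (simp add: K_def)
    finally show ?thesis .
  qed
  then show ?thesis using Kpos by (intro exI[of _ K]) blast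
qed

lemma local_embedding_infinity:
  fixes c :: "real^'n" and p :: real
  assumes E: "E \<in> sets borel" and \<rho>: "0 < \<rho>"
    and cone: "\<forall>x\<in>E. \<forall>s. 0 < s \<longrightarrow> s \<le> 1 \<longrightarrow> cball (x + s *\<^sub>R c) (s * \<rho>) \<subseteq> \<Omega>"
    and p: "1 \<le> p" "CARD('n) < p"
  shows "\<exists>C>0. \<forall>u D. weak_gradient \<Omega> u D \<longrightarrow> (\<integral>z. \<bar>u z\<bar> \<partial>lborel) \<le> 1 \<longrightarrow>
     (\<integral>\<^sup>+z. ennreal ((\<Sum>i\<in>UNIV. \<bar>D i z\<bar>) powr p) \<partial>lborel) \<le> 1 \<longrightarrow>
     (AE x in lborel. x \<in> E \<longrightarrow> \<bar>u x\<bar> \<le> C)"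
proof -
  obtain l C where lC: "0 < l" "l < 1" "0 < C"
    "\<forall>u D. weak_gradient \<Omega> u D \<longrightarrow>
      (AE x in lborel. x \<in> E \<longrightarrow> ennreal \<bar>u x\<bar> \<le> ennreal (C * (\<integral>z. \<bar>u z\<bar> \<partial>lborel)) +
        ennreal C * ball_potential l c \<rho> (\<lambda>z. \<Sum>i\<in>UNIV. \<bar>D i z\<bar>) x)"
    using pointwise_bound[OF E \<rho> cone] by (elim exE conjE)
  have pN: "real DIM(real^'n) < p" using p by simp
  obtain C' where C': "0 < C'" "\<forall>f\<in>borel_measurable borel. (\<forall>x. 0 \<le> f x) \<longrightarrow>
     (\<integral>\<^sup>+x. ennreal (f x powr p) \<partial>lborel) \<le> 1 \<longrightarrow> (\<forall>x. ball_potential l c \<rho> f x \<le> ennreal C')"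
    using ball_potential_bounded[OF lC(1,2) \<rho> p(1) pN, of c] by (elim exE conjE)
  have "AE x in lborel. x \<in> E \<longrightarrow> \<bar>u x\<bar> \<le> C + C * C'"
    if uD: "weak_gradient \<Omega> u D" and u1: "(\<integral>z. \<bar>u z\<bar> \<partial>lborel) \<le> 1"
      and D1: "(\<integral>\<^sup>+z. ennreal ((\<Sum>i\<in>UNIV. \<bar>D i z\<bar>) powr p) \<partial>lborel) \<le> 1" for u D
  proof -
    have u: "integrable lborel u" and D: "\<And>i. integrable lborel (D i)"
      using uD by (simp_all add: weak_gradient_def)
    have Dm [measurable]: "D i \<in> borel_measurable borel" for i using borel_measurable_integrable[OF D] by simp
    have fm: "(\<lambda>z. \<Sum>i\<in>UNIV. \<bar>D i z\<bar>) \<in> borel_measurable borel" by measurable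
    have b: "ball_potential l c \<rho> (\<lambda>z. \<Sum>i\<in>UNIV. \<bar>D i z\<bar>) x \<le> ennreal C'" for x
      using C'(2)[rule_format, OF fm _ D1] by (simp add: sum_nonneg)
    show ?thesis
      using lC(4)[rule_format, OF uD]
    proof eventually_elim
      case (elim x)
      show ?case
      proof
        assume "x \<in> E"
        then have "ennreal \<bar>u x\<bar> \<le> ennreal (C * (\<integral>z. \<bar>u z\<bar> \<partial>lborel)) + ennreal C * ball_potential l c \<rho> (\<lambda>z. \<Sum>i\<in>UNIV. \<bar>D i z\<bar>) x"
          using elim by blast
        also have "\<dots> \<le> ennreal C + ennreal C * ennreal C'"
          using u1 lC(3) by (intro add_mono mult_left_mono ennreal_leI b) auto
        also have "\<dots> = ennreal (C + C * C')" using lC(3) C'(1) by (simp add: ennreal_mult)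
        finally show "\<bar>u x\<bar> \<le> C + C * C'" using lC(3) C'(1) by (subst (asm) ennreal_le_iff) auto
      qed
    qed
  qed
  moreover have "C + C * C' > 0" using lC(3) C'(1) by (simp add: add_pos_pos)
  ultimately show ?thesis by (intro exI[of _ "C + C * C'"]) blast
qed

end

text \<open>The balls of radius \<open>s * \<rho>\<close> around \<open>x + s *\<^sub>R c\<close>
  sweep out a truncated cone with vertex \<open>x\<close>. Direction and opening are common to all
  points of \<open>\<Omega> \<inter> W\<close>; the triple keeps them attached to \<open>W\<close>
  when a finite subcover is selected.\<close>

definition cone_at :: "'a::euclidean_space set \<Rightarrow> 'a set \<times> 'a \<times> real \<Rightarrow> bool" where
  "cone_at \<Omega> = (\<lambda>(W, c, \<rho>). open W \<and> 0 < \<rho> \<and>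
     (\<forall>x\<in>\<Omega> \<inter> W. \<forall>s. 0 < s \<longrightarrow> s \<le> 1 \<longrightarrow> cball (x + s *\<^sub>R c) (s * \<rho>) \<subseteq> \<Omega>))"

text \<open>At interior points the direction \<open>c = 0\<close> serves, and the cone degenerates
  to concentric balls.\<close>

lemma cone_at_interior:
  assumes \<Omega>: "open \<Omega>" "x \<in> \<Omega>"
  shows "\<exists>W c \<rho>. x \<in> W \<and> cone_at \<Omega> (W, c, \<rho>)"
proof -
  obtain e where e: "0 < e" "ball x e \<subseteq> \<Omega>" using \<Omega> openE by blast
  have "cball (y + s *\<^sub>R 0) (s * (e / 4)) \<subseteq> \<Omega>" if y: "y \<in> ball x (e / 2)" and s: "0 < s" "s \<le> 1" for y s
  proof
    fix z assume z: "z \<in> cball (y + s *\<^sub>R 0) (s * (e / 4))"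
    have "s * (e / 4) \<le> 1 * (e / 4)" using s e by (intro mult_right_mono) auto
    then have "dist y z \<le> e / 4" using z by simp
    then have "dist x z < e" using y dist_triangle[of x z y] e(1) by simp
    then show "z \<in> \<Omega>" using e(2) by auto
  qed
  then have "cone_at \<Omega> (ball x (e / 2), 0, e / 4)" using e(1) by (simp add: cone_at_def)
  moreover have "x \<in> ball x (e / 2)" using e(1) by simp
  ultimately show ?thesis by blast
qed

text \<open>Moving by \<open>s * t\<close> along \<open>n\<close> raises the point above the graph
  by that amount. A further displacement of length \<open>s * \<rho>\<close> costs at most
  \<open>s * \<rho>\<close> in height and moves the foot point by at most twice that, which costs
  \<open>2 * L * s * \<rho>\<close>; \<open>\<rho>\<close> is chosen to keep the total cost within
  \<open>s * t\<close>.\<close>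

lemma cone_at_frontier:
  fixes \<Omega> :: "'a::euclidean_space set"
  assumes U: "open U" "x \<in> U" and n: "norm n = 1" and g: "L-lipschitz_on {y. y \<bullet> n = 0} g"
    and graph: "\<Omega> \<inter> U = {y \<in> U. y \<bullet> n > g (y - (y \<bullet> n) *\<^sub>R n)}"
  shows "\<exists>W c \<rho>. x \<in> W \<and> cone_at \<Omega> (W, c, \<rho>)"
proof -
  have L: "0 \<le> L" using g by (rule lipschitz_on_nonneg)
  have nn: "n \<bullet> n = 1" using n by (simp add: norm_eq_1)
  obtain e where e: "0 < e" "ball x e \<subseteq> U" using U openE by blast
  \<comment> \<open>With \<open>\<rho> \<le> t\<close> the displaced point is within
    \<open>2 * t = e / 2\<close> of \<open>y\<close>, hence still in the ball of radius
    \<open>e\<close> where the graph description holds.\<close>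
  define t where "t = e / 4"
  define \<rho> where "\<rho> = t / (2 * (L + 1))"
  have t: "0 < t" using e by (simp add: t_def)
  have \<rho>: "0 < \<rho>" "\<rho> \<le> t" "(2 * L + 1) * \<rho> \<le> t"
  proof -
    show "0 < \<rho>" using t L by (simp add: \<rho>_def)
    then have "0 \<le> L * \<rho>" using L by simp
    moreover have "\<rho> * (2 * (L + 1)) = t" using L by (simp add: \<rho>_def)
    ultimately show "\<rho> \<le> t" "(2 * L + 1) * \<rho> \<le> t" using \<open>0 < \<rho>\<close> by (auto simp: algebra_simps)
  qed
  have "cball (y + s *\<^sub>R (t *\<^sub>R n)) (s * \<rho>) \<subseteq> \<Omega>"
    if y: "y \<in> \<Omega>" "y \<in> ball x (e / 2)" and s: "0 < s" "s \<le> 1" for y s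
  proof
    fix z assume z: "z \<in> cball (y + s *\<^sub>R (t *\<^sub>R n)) (s * \<rho>)"
    define v where "v = z - y - (s * t) *\<^sub>R n"
    have zv: "z = y + (s * t) *\<^sub>R n + v" by (simp add: v_def)
    have v: "norm v \<le> s * \<rho>" using z by (simp add: v_def dist_norm norm_minus_commute algebra_simps)
    have st: "s * t \<le> t" "s * \<rho> \<le> t"
    proof -
      show "s * t \<le> t" using s t mult_right_mono[of s 1 t] by simp
      have "s * \<rho> \<le> \<rho>" using s \<rho>(1) mult_right_mono[of s 1 \<rho>] by simp
      then show "s * \<rho> \<le> t" using \<rho>(2) by linarith
    qed
    have "dist y z = norm ((s * t) *\<^sub>R n + v)"
    proof -
      have "z - y = (s * t) *\<^sub>R n + v" by (simp add: zv)
      then show ?thesis unfolding dist_norm norm_minus_commute[of y z] by (rule arg_cong)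
    qed
    also have "\<dots> \<le> s * t + norm v" using norm_triangle_ineq[of "(s * t) *\<^sub>R n" v] s t n by simp
    also have "\<dots> \<le> e / 2"
    proof -
      have "t + t = e / 2" by (simp add: t_def)
      then show ?thesis using v st by linarith
    qed
    finally have "dist x z < e" using y(2) dist_triangle[of x z y] by simp
    then have zU: "z \<in> U" using e(2) by auto
    have yU: "y \<in> U" using y(2) e by auto
    then have gy: "y \<bullet> n > g (y - (y \<bullet> n) *\<^sub>R n)" using y(1) graph by blast
    define py where "py = y - (y \<bullet> n) *\<^sub>R n"
    define pz where "pz = z - (z \<bullet> n) *\<^sub>R n"
    have in0: "py \<in> {y. y \<bullet> n = 0}" "pz \<in> {y. y \<bullet> n = 0}"
      by (auto simp: py_def pz_def inner_diff_left nn)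
    have vn: "\<bar>v \<bullet> n\<bar> \<le> norm v" using Cauchy_Schwarz_ineq2[of v n] n by simp
    have "z \<bullet> n = y \<bullet> n + s * t + v \<bullet> n" by (simp add: zv inner_add_left nn)
    then have "pz - py = v - (v \<bullet> n) *\<^sub>R n" by (simp add: py_def pz_def zv scaleR_add_left)
    then have "dist pz py \<le> norm v + norm ((v \<bullet> n) *\<^sub>R n)"
      using norm_triangle_ineq4[of v "(v \<bullet> n) *\<^sub>R n"] by (simp add: dist_norm)
    also have "\<dots> \<le> 2 * (s * \<rho>)" using v vn n by simp
    finally have d: "dist pz py \<le> 2 * (s * \<rho>)" .
    have "\<bar>g pz - g py\<bar> \<le> L * dist pz py"
      using lipschitz_onD[OF g in0(2,1)] by (simp add: dist_real_def)
    also have "\<dots> \<le> L * (2 * (s * \<rho>))" by (rule mult_left_mono[OF d L])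
    finally have "g pz \<le> g py + s * (2 * L * \<rho>)" by (simp add: abs_le_iff algebra_simps)
    also have "\<dots> < y \<bullet> n + s * (2 * L * \<rho>)" using gy by (simp add: py_def)
    also have "\<dots> \<le> z \<bullet> n"
    proof -
      have "s * ((2 * L + 1) * \<rho>) \<le> s * t" using \<rho>(3) s by (intro mult_left_mono) auto
      then have "s * (2 * L * \<rho>) + s * \<rho> \<le> s * t" by (simp add: algebra_simps)
      then show ?thesis using \<open>z \<bullet> n = y \<bullet> n + s * t + v \<bullet> n\<close> v vn by linarith
    qed
    finally have "z \<in> \<Omega> \<inter> U" using zU unfolding graph pz_def by simp
    then show "z \<in> \<Omega>" by simp
  qed
  then have "cone_at \<Omega> (ball x (e / 2), t *\<^sub>R n, \<rho>)" using \<rho>(1) by (simp add: cone_at_def)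
  moreover have "x \<in> ball x (e / 2)" using e(1) by simp
  ultimately show ?thesis by blast
qed

text \<open>Compactness is that of the closure, so the points of the frontier have to be covered as
  well; this is where the Lipschitz graphs enter.\<close>

lemma lipschitz_domain_cones:
  fixes \<Omega> :: "'a::euclidean_space set"
  assumes \<Omega>: "lipschitz_domain \<Omega>" "bounded \<Omega>"
  obtains S where "finite S" "\<And>T. T \<in> S \<Longrightarrow> cone_at \<Omega> T" "\<Omega> \<subseteq> (\<Union>T\<in>S. fst T)"
proof -
  have op: "open \<Omega>" using \<Omega>(1) by (simp add: lipschitz_domain_def)
  have ex: "\<exists>T. x \<in> fst T \<and> cone_at \<Omega> T" if x: "x \<in> closure \<Omega>" for x
  proof (cases "x \<in> \<Omega>")
    case True
    show ?thesis using cone_at_interior[OF op True] by auto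
  next
    case False
    then have "x \<in> frontier \<Omega>" using x op by (simp add: frontier_def interior_open)
    then obtain U n g L where "open U" "x \<in> U" "norm n = 1" "L-lipschitz_on {y. y \<bullet> n = 0} g"
      "\<Omega> \<inter> U = {y \<in> U. y \<bullet> n > g (y - (y \<bullet> n) *\<^sub>R n)}"
      using \<Omega>(1) unfolding lipschitz_domain_def by blast
    from cone_at_frontier[OF this] show ?thesis by auto
  qed
  define \<T> where "\<T> = {T. cone_at \<Omega> T}"
  have "compact (closure \<Omega>)" using \<Omega>(2) by (simp add: compact_closure)
  moreover have "\<And>T. T \<in> \<T> \<Longrightarrow> open (fst T)" by (auto simp: \<T>_def cone_at_def split: prod.splits)
  moreover have "closure \<Omega> \<subseteq> (\<Union>T\<in>\<T>. fst T)" using ex unfolding \<T>_def by blast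
  ultimately obtain S where S: "S \<subseteq> \<T>" "finite S" "closure \<Omega> \<subseteq> (\<Union>T\<in>S. fst T)"
    by (rule compactE_image)
  show thesis
    by (rule that[OF S(2)]) (use S closure_subset[of \<Omega>] in \<open>auto simp: \<T>_def\<close>)
qed

section \<open>From single cones to the whole domain\<close>

lemma global_embedding:
  fixes \<Omega> :: "(real^'n) set" and p :: real
  assumes \<Omega>: "lipschitz_domain \<Omega>" "bounded \<Omega>" and p: "1 < p" "p < CARD('n)"
  defines "q \<equiv> CARD('n) * p / (CARD('n) - p)"
  shows "\<exists>C>0. \<forall>u D. weak_gradient \<Omega> u D \<longrightarrow> (\<integral>z. \<bar>u z\<bar> \<partial>lborel) \<le> 1 \<longrightarrow>
     (\<integral>\<^sup>+z. ennreal ((\<Sum>i\<in>UNIV. \<bar>D i z\<bar>) powr p) \<partial>lborel) \<le> 1 \<longrightarrow>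
     (\<integral>\<^sup>+x. ennreal (\<bar>u x\<bar> powr q) * indicator \<Omega> x \<partial>lborel) \<le> ennreal C"
proof -
  have op: "open \<Omega>" using \<Omega>(1) by (simp add: lipschitz_domain_def)
  obtain \<beta> b :: "real \<Rightarrow> real" and C0 :: real where "smooth_step \<beta> b C0"
    by (rule smooth_step_exists) (rule that, unfold_locales)
  then interpret smooth_step \<beta> b C0 .
  obtain S where S: "finite S" "\<And>T. T \<in> S \<Longrightarrow> cone_at \<Omega> T" "\<Omega> \<subseteq> (\<Union>T\<in>S. fst T)"
    by (rule lipschitz_domain_cones[OF \<Omega>]) (rule that)
  have "\<exists>C>0. \<forall>u D. weak_gradient \<Omega> u D \<longrightarrow> (\<integral>z. \<bar>u z\<bar> \<partial>lborel) \<le> 1 \<longrightarrow>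
     (\<integral>\<^sup>+z. ennreal ((\<Sum>i\<in>UNIV. \<bar>D i z\<bar>) powr p) \<partial>lborel) \<le> 1 \<longrightarrow>
     (\<integral>\<^sup>+x. ennreal (\<bar>u x\<bar> powr q) * indicator (\<Omega> \<inter> fst T) x \<partial>lborel) \<le> ennreal C" if "T \<in> S" for T
  proof -
    obtain W c \<rho> where T: "T = (W, c, \<rho>)" by (cases T) auto
    have W: "open W" "0 < \<rho>" "\<forall>x\<in>\<Omega> \<inter> W. \<forall>s. 0 < s \<longrightarrow> s \<le> 1 \<longrightarrow> cball (x + s *\<^sub>R c) (s * \<rho>) \<subseteq> \<Omega>"
      using S(2)[OF that] unfolding T cone_at_def by auto
    have "\<Omega> \<inter> W \<in> sets borel" "bounded (\<Omega> \<inter> W)" using op W(1) \<Omega>(2) by (auto intro: bounded_subset)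
    from local_embedding[OF this W(2,3) p] show ?thesis unfolding T q_def fst_conv .
  qed
  then have "\<forall>T\<in>S. \<exists>C. 0 < C \<and> (\<forall>u D. weak_gradient \<Omega> u D \<longrightarrow> (\<integral>z. \<bar>u z\<bar> \<partial>lborel) \<le> 1 \<longrightarrow>
     (\<integral>\<^sup>+z. ennreal ((\<Sum>i\<in>UNIV. \<bar>D i z\<bar>) powr p) \<partial>lborel) \<le> 1 \<longrightarrow>
     (\<integral>\<^sup>+x. ennreal (\<bar>u x\<bar> powr q) * indicator (\<Omega> \<inter> fst T) x \<partial>lborel) \<le> ennreal C)" by simp
  from bchoice[OF this] obtain K where K: "\<forall>T\<in>S. 0 < K T \<and> (\<forall>u D. weak_gradient \<Omega> u D \<longrightarrow> (\<integral>z. \<bar>u z\<bar> \<partial>lborel) \<le> 1 \<longrightarrow>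
     (\<integral>\<^sup>+z. ennreal ((\<Sum>i\<in>UNIV. \<bar>D i z\<bar>) powr p) \<partial>lborel) \<le> 1 \<longrightarrow>
     (\<integral>\<^sup>+x. ennreal (\<bar>u x\<bar> powr q) * indicator (\<Omega> \<inter> fst T) x \<partial>lborel) \<le> ennreal (K T))" ..
  have Kpos: "\<And>T. T \<in> S \<Longrightarrow> 0 \<le> K T" using K less_imp_le by blast
  \<comment> \<open>The added 1 keeps the constant positive even if the cover is empty.\<close>
  have C: "0 < (\<Sum>T\<in>S. K T) + 1" using sum_nonneg[of S K] Kpos by (simp add: add_nonneg_pos)
  have "(\<integral>\<^sup>+x. ennreal (\<bar>u x\<bar> powr q) * indicator \<Omega> x \<partial>lborel) \<le> ennreal ((\<Sum>T\<in>S. K T) + 1)"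
    if uD: "weak_gradient \<Omega> u D" and u1: "(\<integral>z. \<bar>u z\<bar> \<partial>lborel) \<le> 1"
      and D1: "(\<integral>\<^sup>+z. ennreal ((\<Sum>i\<in>UNIV. \<bar>D i z\<bar>) powr p) \<partial>lborel) \<le> 1" for u D
  proof -
    have "integrable lborel u" using uD by (simp add: weak_gradient_def)
    from borel_measurable_integrable[OF this] have um [measurable]: "u \<in> borel_measurable borel" by simp
    have Wm: "\<Omega> \<inter> fst T \<in> sets borel" if "T \<in> S" for T
      using S(2)[OF that] op by (auto simp: cone_at_def split: prod.splits)
    have "(\<integral>\<^sup>+x. ennreal (\<bar>u x\<bar> powr q) * indicator \<Omega> x \<partial>lborel) \<le>
      (\<integral>\<^sup>+x. (\<Sum>T\<in>S. ennreal (\<bar>u x\<bar> powr q) * indicator (\<Omega> \<inter> fst T) x) \<partial>lborel)"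
    proof (rule nn_integral_mono)
      fix x
      show "ennreal (\<bar>u x\<bar> powr q) * indicator \<Omega> x \<le> (\<Sum>T\<in>S. ennreal (\<bar>u x\<bar> powr q) * indicator (\<Omega> \<inter> fst T) x)"
      proof (cases "x \<in> \<Omega>")
        case True
        then obtain T where T: "T \<in> S" "x \<in> fst T" using S(3) by blast
        have "ennreal (\<bar>u x\<bar> powr q) * indicator (\<Omega> \<inter> fst T) x \<le> (\<Sum>T\<in>S. ennreal (\<bar>u x\<bar> powr q) * indicator (\<Omega> \<inter> fst T) x)"
          by (rule member_le_sum[OF T(1)]) (use S(1) in auto)
        then show ?thesis using True T(2) by simp
      qed simp
    qed
    also have "\<dots> = (\<Sum>T\<in>S. \<integral>\<^sup>+x. ennreal (\<bar>u x\<bar> powr q) * indicator (\<Omega> \<inter> fst T) x \<partial>lborel)"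
    proof (rule nn_integral_sum)
      fix T assume "T \<in> S"
      note [measurable] = Wm[OF this]
      show "(\<lambda>x. ennreal (\<bar>u x\<bar> powr q) * indicator (\<Omega> \<inter> fst T) x) \<in> borel_measurable lborel" by measurable
    qed
    also have "\<dots> \<le> (\<Sum>T\<in>S. ennreal (K T))"
      using K uD u1 D1 by (intro sum_mono) simp
    also have "\<dots> = ennreal (\<Sum>T\<in>S. K T)" by (rule sum_ennreal) (use Kpos in simp)
    also have "\<dots> \<le> ennreal ((\<Sum>T\<in>S. K T) + 1)" by (rule ennreal_leI) simp
    finally show ?thesis .
  qed
  then show ?thesis using C by (intro exI[of _ "(\<Sum>T\<in>S. K T) + 1"]) blast
qed

lemma global_embedding_infinity:
  fixes \<Omega> :: "(real^'n) set" and p :: real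
  assumes \<Omega>: "lipschitz_domain \<Omega>" "bounded \<Omega>" and p: "1 \<le> p" "CARD('n) < p"
  shows "\<exists>C>0. \<forall>u D. weak_gradient \<Omega> u D \<longrightarrow> (\<integral>z. \<bar>u z\<bar> \<partial>lborel) \<le> 1 \<longrightarrow>
     (\<integral>\<^sup>+z. ennreal ((\<Sum>i\<in>UNIV. \<bar>D i z\<bar>) powr p) \<partial>lborel) \<le> 1 \<longrightarrow>
     (AE x in lborel. x \<in> \<Omega> \<longrightarrow> \<bar>u x\<bar> \<le> C)"
proof -
  have op: "open \<Omega>" using \<Omega>(1) by (simp add: lipschitz_domain_def)
  obtain \<beta> b :: "real \<Rightarrow> real" and C0 :: real where "smooth_step \<beta> b C0"
    by (rule smooth_step_exists) (rule that, unfold_locales)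
  then interpret smooth_step \<beta> b C0 .
  obtain S where S: "finite S" "\<And>T. T \<in> S \<Longrightarrow> cone_at \<Omega> T" "\<Omega> \<subseteq> (\<Union>T\<in>S. fst T)"
    by (rule lipschitz_domain_cones[OF \<Omega>]) (rule that)
  have "\<exists>C>0. \<forall>u D. weak_gradient \<Omega> u D \<longrightarrow> (\<integral>z. \<bar>u z\<bar> \<partial>lborel) \<le> 1 \<longrightarrow>
     (\<integral>\<^sup>+z. ennreal ((\<Sum>i\<in>UNIV. \<bar>D i z\<bar>) powr p) \<partial>lborel) \<le> 1 \<longrightarrow>
     (AE x in lborel. x \<in> \<Omega> \<inter> fst T \<longrightarrow> \<bar>u x\<bar> \<le> C)" if "T \<in> S" for T
  proof -
    obtain W c \<rho> where T: "T = (W, c, \<rho>)" by (cases T) auto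
    have W: "open W" "0 < \<rho>" "\<forall>x\<in>\<Omega> \<inter> W. \<forall>s. 0 < s \<longrightarrow> s \<le> 1 \<longrightarrow> cball (x + s *\<^sub>R c) (s * \<rho>) \<subseteq> \<Omega>"
      using S(2)[OF that] unfolding T cone_at_def by auto
    have "\<Omega> \<inter> W \<in> sets borel" using op W(1) by auto
    from local_embedding_infinity[OF this W(2,3) p] show ?thesis unfolding T fst_conv .
  qed
  then have "\<forall>T\<in>S. \<exists>C. 0 < C \<and> (\<forall>u D. weak_gradient \<Omega> u D \<longrightarrow> (\<integral>z. \<bar>u z\<bar> \<partial>lborel) \<le> 1 \<longrightarrow>
     (\<integral>\<^sup>+z. ennreal ((\<Sum>i\<in>UNIV. \<bar>D i z\<bar>) powr p) \<partial>lborel) \<le> 1 \<longrightarrow>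
     (AE x in lborel. x \<in> \<Omega> \<inter> fst T \<longrightarrow> \<bar>u x\<bar> \<le> C))" by simp
  from bchoice[OF this] obtain K where K: "\<forall>T\<in>S. 0 < K T \<and> (\<forall>u D. weak_gradient \<Omega> u D \<longrightarrow> (\<integral>z. \<bar>u z\<bar> \<partial>lborel) \<le> 1 \<longrightarrow>
     (\<integral>\<^sup>+z. ennreal ((\<Sum>i\<in>UNIV. \<bar>D i z\<bar>) powr p) \<partial>lborel) \<le> 1 \<longrightarrow>
     (AE x in lborel. x \<in> \<Omega> \<inter> fst T \<longrightarrow> \<bar>u x\<bar> \<le> K T))" ..
  have Kpos: "\<And>T. T \<in> S \<Longrightarrow> 0 \<le> K T" using K less_imp_le by blast
  have C: "0 < (\<Sum>T\<in>S. K T) + 1" using sum_nonneg[of S K] Kpos by (simp add: add_nonneg_pos)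
  have "AE x in lborel. x \<in> \<Omega> \<longrightarrow> \<bar>u x\<bar> \<le> (\<Sum>T\<in>S. K T) + 1"
    if uD: "weak_gradient \<Omega> u D" and u1: "(\<integral>z. \<bar>u z\<bar> \<partial>lborel) \<le> 1"
      and D1: "(\<integral>\<^sup>+z. ennreal ((\<Sum>i\<in>UNIV. \<bar>D i z\<bar>) powr p) \<partial>lborel) \<le> 1" for u D
  proof -
    have "AE x in lborel. \<forall>T\<in>S. x \<in> \<Omega> \<inter> fst T \<longrightarrow> \<bar>u x\<bar> \<le> K T"
      using K uD u1 D1 by (intro AE_finite_allI[OF S(1)]) simp
    then show ?thesis
    proof eventually_elim
      case (elim x)
      show ?case
      proof
        assume "x \<in> \<Omega>"
        then obtain T where T: "T \<in> S" "x \<in> \<Omega> \<inter> fst T" using S(3) by blast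
        then have "\<bar>u x\<bar> \<le> K T" using elim by blast
        also have "K T \<le> (\<Sum>T\<in>S. K T)" by (rule member_le_sum[OF T(1)]) (use Kpos S(1) in auto)
        finally show "\<bar>u x\<bar> \<le> (\<Sum>T\<in>S. K T) + 1" by simp
      qed
    qed
  qed
  then show ?thesis using C by (intro exI[of _ "(\<Sum>T\<in>S. K T) + 1"]) blast
qed

section \<open>Weak gradients on the domain and their Borel versions\<close>

definition unit_index :: "'n \<Rightarrow> 'n \<Rightarrow> nat" where
  "unit_index i = (\<lambda>j. if j = i then 1 else 0)"

lemma mi_order_unit_index [simp]: "mi_order (unit_index (i :: 'n::finite)) = 1"
  by (simp add: mi_order_def unit_index_def)

lemma mi_order_add: "mi_order (\<lambda>k. \<alpha> k + \<beta> k) = mi_order \<alpha> + mi_order (\<beta> :: 'n::finite \<Rightarrow> nat)"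
  by (simp add: mi_order_def sum.distrib)

lemma is_weak_deriv_unit_index:
  assumes "is_weak_deriv \<Omega> (unit_index i) u v" "test_fun \<Omega> \<phi>"
  shows "(\<integral>x. u x * partial i \<phi> x \<partial>lebesgue_on \<Omega>) = - (\<integral>x. v x * \<phi> x \<partial>lebesgue_on \<Omega>)"
proof -
  have "\<forall>j. count_list [i] j = unit_index i j" by (simp add: unit_index_def)
  from is_weak_derivD(3)[OF assms this] show ?thesis by simp
qed

lemma count_list_unit_index:
  assumes "\<forall>k. count_list js k = unit_index j k"
  shows "js = [j]"
proof (cases js)
  case Nil
  then show ?thesis using assms[rule_format, of j] by (simp add: unit_index_def)
next
  case (Cons k js')
  have "k = j" using assms[rule_format, of k] Cons by (simp add: unit_index_def split: if_splits)
  moreover have "js' = []"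
  proof (cases js')
    case (Cons m ms)
    then show ?thesis using assms[rule_format, of m] \<open>js = k # js'\<close> \<open>k = j\<close>
      by (simp add: unit_index_def split: if_splits)
  qed
  ultimately show ?thesis using Cons by simp
qed

text \<open>Both hypotheses are evaluated on the same derivative of a test function, once with
  \<open>partial j \<phi>\<close> as the test function. In this way a first-order embedding becomes
  applicable to derivatives of higher order.\<close>

lemma is_weak_deriv_shift:
  fixes u :: "real^'n \<Rightarrow> real"
  assumes v: "is_weak_deriv \<Omega> \<alpha> u v" and w: "is_weak_deriv \<Omega> (\<lambda>k. \<alpha> k + unit_index j k) u w"
  shows "is_weak_deriv \<Omega> (unit_index j) v w"
  unfolding is_weak_deriv_def
proof (intro conjI allI impI)
  show "locally_integrable \<Omega> v" "locally_integrable \<Omega> w"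
    using is_weak_derivD(2)[OF v] is_weak_derivD(2)[OF w] by auto
  fix \<phi> js assume *: "test_fun \<Omega> \<phi> \<and> (\<forall>i. count_list js i = unit_index j i)"
  then have js: "js = [j]" by (intro count_list_unit_index) blast
  have \<phi>: "test_fun \<Omega> \<phi>" using * ..
  obtain ks where ks: "\<forall>i. count_list ks i = \<alpha> i" using ex_count_list by blast
  have ksj: "\<forall>i. count_list (ks @ [j]) i = \<alpha> i + unit_index j i" using ks by (simp add: unit_index_def)
  have "(-1) ^ mi_order \<alpha> * (\<integral>x. v x * partial j \<phi> x \<partial>lebesgue_on \<Omega>) =
      (-1) ^ (mi_order \<alpha> + 1) * (\<integral>x. w x * \<phi> x \<partial>lebesgue_on \<Omega>)"
    using is_weak_derivD(3)[OF v test_fun_partial[OF \<phi>] ks, of j] is_weak_derivD(3)[OF w \<phi> ksj]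
    by (simp add: partials_snoc mi_order_add)
  then have "(-1) ^ mi_order \<alpha> * (\<integral>x. v x * partial j \<phi> x \<partial>lebesgue_on \<Omega>) =
      (-1) ^ mi_order \<alpha> * (- (\<integral>x. w x * \<phi> x \<partial>lebesgue_on \<Omega>))" by simp
  then have "(\<integral>x. v x * partial j \<phi> x \<partial>lebesgue_on \<Omega>) = - (\<integral>x. w x * \<phi> x \<partial>lebesgue_on \<Omega>)"
    by (subst (asm) mult_cancel_left) simp
  then show "(\<integral>x. v x * partials js \<phi> x \<partial>lebesgue_on \<Omega>) = (-1) ^ mi_order (unit_index j) * (\<integral>x. w x * \<phi> x \<partial>lebesgue_on \<Omega>)"
    by (simp add: js)
qed

lemma nn_integral_lebesgue_on_borel:
  fixes G :: "'a::euclidean_space \<Rightarrow> ennreal"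
  assumes [measurable]: "G \<in> borel_measurable borel" and \<Omega>: "open \<Omega>"
  shows "(\<integral>\<^sup>+x. G x \<partial>lebesgue_on \<Omega>) = (\<integral>\<^sup>+x. G x * indicator \<Omega> x \<partial>lborel)"
proof -
  have "(\<integral>\<^sup>+x. G x \<partial>lebesgue_on \<Omega>) = (\<integral>\<^sup>+x. G x * indicator \<Omega> x \<partial>lebesgue)"
    by (rule nn_integral_restrict_space) (use \<Omega> in simp)
  then show ?thesis by (simp only: nn_integral_completion)
qed

text \<open>The potential estimates work with Borel functions on the whole space; vanishing outside
  the domain turns integrals over the domain into integrals over the whole space.\<close>

lemma borel_version:
  fixes u :: "'a::euclidean_space \<Rightarrow> real"
  assumes u: "u \<in> borel_measurable (lebesgue_on \<Omega>)" and \<Omega>: "open \<Omega>"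
  shows "\<exists>U. U \<in> borel_measurable borel \<and> (\<forall>x. x \<notin> \<Omega> \<longrightarrow> U x = 0) \<and> (AE x in lebesgue_on \<Omega>. u x = U x)"
proof -
  have s: "\<Omega> \<in> sets lebesgue" using \<Omega> by auto
  have "(\<lambda>x. if x \<in> \<Omega> then u x else 0) \<in> borel_measurable lebesgue"
    using u s by (simp add: borel_measurable_if)
  from completion_ex_borel_measurable_real[OF this]
  obtain g where g: "g \<in> borel_measurable lborel" "AE x in lborel. (if x \<in> \<Omega> then u x else 0) = g x" by (elim bexE)
  have g' [measurable]: "g \<in> borel_measurable borel" using g(1) by simp
  have [measurable]: "\<Omega> \<in> sets borel" using \<Omega> by simp
  have "AE x in lebesgue. (if x \<in> \<Omega> then u x else 0) = g x" by (rule AE_completion[OF g(2)])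
  then have "AE x in lebesgue_on \<Omega>. u x = (if x \<in> \<Omega> then g x else 0)"
    using s by (subst AE_restrict_space_iff) (auto elim!: eventually_mono)
  moreover have "(\<lambda>x. if x \<in> \<Omega> then g x else 0) \<in> borel_measurable borel" by measurable
  ultimately show ?thesis by (intro exI[of _ "\<lambda>x. if x \<in> \<Omega> then g x else 0"]) simp
qed

lemma integral_lebesgue_on_borel:
  fixes f :: "'a::euclidean_space \<Rightarrow> real"
  assumes f: "f \<in> borel_measurable borel" and \<Omega>: "open \<Omega>" and z: "\<And>x. x \<notin> \<Omega> \<Longrightarrow> f x = 0"
  shows "(\<integral>x. f x \<partial>lebesgue_on \<Omega>) = (\<integral>x. f x \<partial>lborel)" "integrable (lebesgue_on \<Omega>) f \<longleftrightarrow> integrable lborel f"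
proof -
  have s: "\<Omega> \<inter> space lebesgue \<in> sets lebesgue" using \<Omega> by simp
  have e: "(\<lambda>x. indicator \<Omega> x *\<^sub>R f x) = f" using z by (auto simp: indicator_def fun_eq_iff)
  have "(\<integral>x. f x \<partial>lebesgue_on \<Omega>) = (\<integral>x. f x \<partial>lebesgue)"
    using integral_restrict_space[OF s, of f] unfolding e .
  also have "\<dots> = (\<integral>x. f x \<partial>lborel)" by (rule integral_completion) (use f in simp)
  finally show "(\<integral>x. f x \<partial>lebesgue_on \<Omega>) = (\<integral>x. f x \<partial>lborel)" .
  have "integrable (lebesgue_on \<Omega>) f \<longleftrightarrow> integrable lebesgue f"
    using integrable_restrict_space[OF s, of f] unfolding e .
  also have "\<dots> \<longleftrightarrow> integrable lborel f" by (rule integrable_completion) (use f in simp)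
  finally show "integrable (lebesgue_on \<Omega>) f \<longleftrightarrow> integrable lborel f" .
qed

lemma sum_powr_le:
  fixes a :: "'n::finite \<Rightarrow> real"
  assumes "0 \<le> p"
  shows "(\<Sum>i\<in>UNIV. \<bar>a i\<bar>) powr p \<le> (\<Sum>i\<in>UNIV. (CARD('n) * \<bar>a i\<bar>) powr p)"
proof -
  have "Max (range (\<lambda>i. \<bar>a i\<bar>)) \<in> range (\<lambda>i. \<bar>a i\<bar>)" by (rule Max_in) auto
  then obtain k where k: "Max (range (\<lambda>i. \<bar>a i\<bar>)) = \<bar>a k\<bar>" by (elim rangeE)
  have le: "\<bar>a i\<bar> \<le> \<bar>a k\<bar>" for i unfolding k[symmetric] by (rule Max_ge) auto
  have "(\<Sum>i\<in>UNIV. \<bar>a i\<bar>) \<le> (\<Sum>i\<in>(UNIV :: 'n set). \<bar>a k\<bar>)" by (rule sum_mono) (rule le)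
  then have "(\<Sum>i\<in>UNIV. \<bar>a i\<bar>) powr p \<le> (CARD('n) * \<bar>a k\<bar>) powr p"
    using assms by (intro powr_mono2) (auto simp: sum_nonneg)
  also have "\<dots> \<le> (\<Sum>i\<in>UNIV. (CARD('n) * \<bar>a i\<bar>) powr p)"
    by (rule member_le_sum[of k UNIV "\<lambda>i. (CARD('n) * \<bar>a i\<bar>) powr p"]) auto
  finally show ?thesis .
qed

text \<open>The counterpart of \<open>weak_gradient\<close> for functions given on the domain. The
  derivatives are arbitrary representatives, so members of a Sobolev space and their higher
  derivatives fit in directly.\<close>

definition weak_gradient_on :: "(real^'n) set \<Rightarrow> ereal \<Rightarrow> (real^'n \<Rightarrow> real) \<Rightarrow> ('n \<Rightarrow> real^'n \<Rightarrow> real) \<Rightarrow> bool" where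
  "weak_gradient_on \<Omega> p u D \<longleftrightarrow> u \<in> Lp_space p \<Omega> \<and>
     (\<forall>i. D i \<in> Lp_space p \<Omega> \<and> is_weak_deriv \<Omega> (unit_index i) u (D i))"

text \<open>Divides by a number \<open>T\<close> that dominates a multiple of the norm. Leaving
  \<open>T\<close> free instead of equal to that multiple covers functions of norm zero, since
  \<open>T\<close> may then be any positive number.\<close>

lemma normalize_weak_gradient:
  fixes \<Omega> :: "(real^'n) set" and p :: real
  assumes \<Omega>: "open \<Omega>" "bounded \<Omega>" and p: "1 \<le> p"
  shows "\<exists>K>0. \<forall>u D T. weak_gradient_on \<Omega> p u D \<longrightarrow> 0 < T \<longrightarrow>
     K * (Lp_norm p \<Omega> u + (\<Sum>i\<in>UNIV. Lp_norm p \<Omega> (D i))) \<le> T \<longrightarrow>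
     (\<exists>U D'. weak_gradient \<Omega> U D' \<and> (\<integral>z. \<bar>U z\<bar> \<partial>lborel) \<le> 1 \<and>
       (\<integral>\<^sup>+z. ennreal ((\<Sum>i\<in>UNIV. \<bar>D' i z\<bar>) powr p) \<partial>lborel) \<le> 1 \<and>
       U \<in> borel_measurable borel \<and> (AE x in lebesgue_on \<Omega>. u x = T * U x))"
proof -
  let ?N = "real CARD('n)"
  define k where "k = measure lebesgue \<Omega> powr (1 - 1 / p)"
  have k: "0 \<le> k" by (simp add: k_def)
  \<comment> \<open>The square of the dimension serves the bound for the gradient, \<open>k\<close>
    the passage from L^p to L^1, and 1 makes \<open>K\<close> positive.\<close>
  define K where "K = ?N * ?N + k + 1"
  have N1: "1 \<le> ?N" by simp
  have K: "0 < K" using k by (simp add: K_def add_nonneg_pos)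
  have lm: "\<Omega> \<in> lmeasurable" using \<Omega> by (intro lmeasurable_open)
  have s: "\<Omega> \<in> sets lebesgue" using \<Omega> by auto
  have "\<exists>U D'. weak_gradient \<Omega> U D' \<and> (\<integral>z. \<bar>U z\<bar> \<partial>lborel) \<le> 1 \<and>
       (\<integral>\<^sup>+z. ennreal ((\<Sum>i\<in>UNIV. \<bar>D' i z\<bar>) powr p) \<partial>lborel) \<le> 1 \<and>
       U \<in> borel_measurable borel \<and> (AE x in lebesgue_on \<Omega>. u x = T * U x)"
    if uD: "weak_gradient_on \<Omega> p u D" and T: "0 < T"
      and KT: "K * (Lp_norm p \<Omega> u + (\<Sum>i\<in>UNIV. Lp_norm p \<Omega> (D i))) \<le> T" for u D T
  proof -
    define M where "M = Lp_norm p \<Omega> u + (\<Sum>i\<in>UNIV. Lp_norm p \<Omega> (D i))"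
    have M: "0 \<le> M" "Lp_norm p \<Omega> u \<le> M" "\<And>i. Lp_norm p \<Omega> (D i) \<le> M"
    proof -
      have n: "0 \<le> (\<Sum>i\<in>UNIV. Lp_norm p \<Omega> (D i))" by (intro sum_nonneg) simp
      show "0 \<le> M" "Lp_norm p \<Omega> u \<le> M" using n by (auto simp: M_def)
      have "Lp_norm p \<Omega> (D i) \<le> (\<Sum>i\<in>UNIV. Lp_norm p \<Omega> (D i))" for i
        by (rule member_le_sum) auto
      then show "Lp_norm p \<Omega> (D i) \<le> M" for i using Lp_norm_nonneg[of p \<Omega> u] unfolding M_def by (meson add_increasing)
    qed
    have KMT: "K * M \<le> T" using KT by (simp only: M_def)
    have Lu: "u \<in> Lp_space p \<Omega>" and LD: "\<And>i. D i \<in> Lp_space p \<Omega>"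
      and wd: "\<And>i. is_weak_deriv \<Omega> (unit_index i) u (D i)"
      using uD by (auto simp: weak_gradient_on_def)
    have mu: "u \<in> borel_measurable (lebesgue_on \<Omega>)" and mD: "\<And>i. D i \<in> borel_measurable (lebesgue_on \<Omega>)"
      using Lu LD by (auto simp: Lp_space_def)
    obtain U where U: "U \<in> borel_measurable borel" "\<forall>x. x \<notin> \<Omega> \<longrightarrow> U x = 0" "AE x in lebesgue_on \<Omega>. u x = U x"
      using borel_version[OF mu \<Omega>(1)] by (elim exE conjE)
    have "\<forall>i. \<exists>V. V \<in> borel_measurable borel \<and> (\<forall>x. x \<notin> \<Omega> \<longrightarrow> V x = 0) \<and> (AE x in lebesgue_on \<Omega>. D i x = V x)"
      using borel_version[OF mD \<Omega>(1)] by (rule allI)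
    from choice[OF this] obtain V where V: "\<forall>i. V i \<in> borel_measurable borel \<and> (\<forall>x. x \<notin> \<Omega> \<longrightarrow> V i x = 0) \<and> (AE x in lebesgue_on \<Omega>. D i x = V i x)" ..
    have Um [measurable]: "U \<in> borel_measurable borel" by (rule U(1))
    have Vm [measurable]: "V i \<in> borel_measurable borel" for i using V by simp
    have p1: "(1::ereal) \<le> ereal p" using p by (simp add: one_ereal_def)
    have borel_lebesgue: "g \<in> borel_measurable (lebesgue_on \<Omega>)" if "g \<in> borel_measurable borel" for g :: "real^'n \<Rightarrow> real"
      using that by (intro measurable_restrict_space1 measurable_completion) simp
    have conv: "integrable lborel G" "(\<integral>x. G x * \<psi> x \<partial>lborel) = (\<integral>x. g x * \<psi> x \<partial>lebesgue_on \<Omega>)"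
      if g: "g \<in> Lp_space p \<Omega>" and G: "G \<in> borel_measurable borel" "\<forall>x. x \<notin> \<Omega> \<longrightarrow> G x = 0" "AE x in lebesgue_on \<Omega>. g x = G x"
        and \<psi>: "\<psi> \<in> borel_measurable borel" for g G \<psi>
    proof -
      have gm: "g \<in> borel_measurable (lebesgue_on \<Omega>)" using g by (simp add: Lp_space_def)
      have "integrable (lebesgue_on \<Omega>) g" by (rule Lp_integrable[OF p1 g lm])
      then have "integrable (lebesgue_on \<Omega>) G"
        using integrable_cong_AE[OF gm borel_lebesgue[OF G(1)] G(3)] by simp
      then show "integrable lborel G" using integral_lebesgue_on_borel(2)[OF G(1) \<Omega>(1)] G(2) by simp
      have "(\<integral>x. g x * \<psi> x \<partial>lebesgue_on \<Omega>) = (\<integral>x. G x * \<psi> x \<partial>lebesgue_on \<Omega>)"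
      proof (rule integral_cong_AE)
        show "AE x in lebesgue_on \<Omega>. g x * \<psi> x = G x * \<psi> x" using G(3) by eventually_elim simp
      qed (intro borel_measurable_times gm borel_lebesgue G(1) \<psi>)+
      also have "\<dots> = (\<integral>x. G x * \<psi> x \<partial>lborel)"
        by (rule integral_lebesgue_on_borel(1)[OF _ \<Omega>(1)]) (use G \<psi> in auto)
      finally show "(\<integral>x. G x * \<psi> x \<partial>lborel) = (\<integral>x. g x * \<psi> x \<partial>lebesgue_on \<Omega>)" by simp
    qed
    have tb: "\<phi> \<in> borel_measurable borel" if "test_fun \<Omega> \<phi>" for \<phi>
      by (rule borel_measurable_continuous_onI[OF continuous_on_test_fun[OF that]])
    have wg: "weak_gradient \<Omega> U V"
      unfolding weak_gradient_def
    proof (intro conjI allI impI)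
      show "integrable lborel U" by (rule conv(1)[where \<psi>="\<lambda>_. 0", OF Lu U]) simp
      show "integrable lborel (V i)" for i using V by (intro conv(1)[where \<psi>="\<lambda>_. 0", OF LD[of i]]) auto
      fix i \<phi> assume \<phi>: "test_fun \<Omega> \<phi>"
      have "(\<integral>x. U x * partial i \<phi> x \<partial>lborel) = (\<integral>x. u x * partial i \<phi> x \<partial>lebesgue_on \<Omega>)"
        by (rule conv(2)[OF Lu U tb[OF test_fun_partial[OF \<phi>]]])
      also have "\<dots> = - (\<integral>x. D i x * \<phi> x \<partial>lebesgue_on \<Omega>)" by (rule is_weak_deriv_unit_index[OF wd \<phi>])
      also have "(\<integral>x. D i x * \<phi> x \<partial>lebesgue_on \<Omega>) = (\<integral>x. V i x * \<phi> x \<partial>lborel)"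
        by (rule conv(2)[symmetric, OF LD[of i] _ _ _ tb[OF \<phi>]]) (use V in auto)
      finally show "(\<integral>x. U x * partial i \<phi> x \<partial>lborel) = - (\<integral>x. V i x * \<phi> x \<partial>lborel)" .
    qed
    have u1: "(\<integral>z. \<bar>U z\<bar> \<partial>lborel) \<le> T"
    proof -
      have "(\<integral>z. \<bar>U z\<bar> \<partial>lborel) = (\<integral>z. \<bar>U z\<bar> \<partial>lebesgue_on \<Omega>)"
        by (rule integral_lebesgue_on_borel(1)[OF _ \<Omega>(1), symmetric]) (use U in auto)
      also have "\<dots> = (\<integral>z. \<bar>u z\<bar> \<partial>lebesgue_on \<Omega>)"
      proof (rule integral_cong_AE)
        show "AE x in lebesgue_on \<Omega>. \<bar>U x\<bar> = \<bar>u x\<bar>" using U(3) by eventually_elim simp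
      qed (use mu borel_lebesgue[OF U(1)] in auto)
      also have "\<dots> = Lp_norm (ereal 1) \<Omega> u"
        by (simp add: Lp_norm_def powr_one')
      also have "\<dots> \<le> measure lebesgue \<Omega> powr (1 / 1 - real_of_ereal (1 / ereal p)) * Lp_norm p \<Omega> u"
        by (rule Lp_mono_exponent(2)[OF _ _ Lu lm]) (use p in auto)
      also have "real_of_ereal (1 / ereal p) = 1 / p" using p by (simp add: one_ereal_def)
      also have "measure lebesgue \<Omega> powr (1 / 1 - 1 / p) * Lp_norm p \<Omega> u \<le> k * M"
        using M(2) k by (simp add: k_def mult_left_mono)
      also have "\<dots> \<le> K * M" using M(1) by (intro mult_right_mono) (auto simp: K_def)
      finally show ?thesis using KMT by simp
    qed
    have D1: "(\<integral>\<^sup>+z. ennreal ((\<Sum>i\<in>UNIV. \<bar>inverse T * V i z\<bar>) powr p) \<partial>lborel) \<le> 1"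
    proof -
      have Vi: "(\<integral>\<^sup>+z. ennreal ((?N * \<bar>inverse T * V i z\<bar>) powr p) \<partial>lborel) \<le> ennreal ((?N / T) powr p * M powr p)" for i
      proof -
        have e: "(?N * \<bar>inverse T * V i z\<bar>) powr p = (?N / T) powr p * \<bar>V i z\<bar> powr p" for z
          using T by (simp add: abs_mult divide_inverse powr_mult mult.assoc)
        have "(\<integral>\<^sup>+z. ennreal ((?N * \<bar>inverse T * V i z\<bar>) powr p) \<partial>lborel) =
          (\<integral>\<^sup>+z. ennreal ((?N / T) powr p) * ennreal (\<bar>V i z\<bar> powr p) \<partial>lborel)"
          unfolding e by (intro nn_integral_cong ennreal_mult) auto
        also have "\<dots> = ennreal ((?N / T) powr p) * (\<integral>\<^sup>+z. ennreal (\<bar>V i z\<bar> powr p) \<partial>lborel)"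
          by (rule nn_integral_cmult) measurable
        also have "(\<integral>\<^sup>+z. ennreal (\<bar>V i z\<bar> powr p) \<partial>lborel) = ennreal (Lp_norm p \<Omega> (D i) powr p)"
        proof -
          have "(\<integral>\<^sup>+z. ennreal (\<bar>V i z\<bar> powr p) \<partial>lborel) = (\<integral>\<^sup>+z. ennreal (\<bar>V i z\<bar> powr p) * indicator \<Omega> z \<partial>lborel)"
            using V by (intro nn_integral_cong) (auto simp: indicator_def)
          also have "\<dots> = (\<integral>\<^sup>+z. ennreal (\<bar>V i z\<bar> powr p) \<partial>lebesgue_on \<Omega>)"
            by (rule nn_integral_lebesgue_on_borel[symmetric, OF _ \<Omega>(1)]) measurable
          also have "\<dots> = (\<integral>\<^sup>+z. ennreal (\<bar>D i z\<bar> powr p) \<partial>lebesgue_on \<Omega>)"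
          proof (rule nn_integral_cong_AE)
            have "AE x in lebesgue_on \<Omega>. D i x = V i x" using V by simp
            then show "AE x in lebesgue_on \<Omega>. ennreal (\<bar>V i x\<bar> powr p) = ennreal (\<bar>D i x\<bar> powr p)" by eventually_elim simp
          qed
          also have "\<dots> = ennreal (\<integral>z. \<bar>D i z\<bar> powr p \<partial>lebesgue_on \<Omega>)"
            using LD[of i] by (intro nn_integral_eq_integral) (auto simp: Lp_space_def)
          finally show ?thesis using p by (simp add: Lp_norm_powr)
        qed
        also have "ennreal ((?N / T) powr p) * ennreal (Lp_norm p \<Omega> (D i) powr p) \<le> ennreal ((?N / T) powr p) * ennreal (M powr p)"
          using p by (intro mult_left_mono ennreal_leI powr_mono2 M(3)) auto
        also have "\<dots> = ennreal ((?N / T) powr p * M powr p)" by (rule ennreal_mult[symmetric]) auto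
        finally show ?thesis .
      qed
      have "(\<integral>\<^sup>+z. ennreal ((\<Sum>i\<in>UNIV. \<bar>inverse T * V i z\<bar>) powr p) \<partial>lborel) \<le>
        (\<integral>\<^sup>+z. (\<Sum>i\<in>UNIV. ennreal ((?N * \<bar>inverse T * V i z\<bar>) powr p)) \<partial>lborel)"
      proof (rule nn_integral_mono)
        fix z
        have "ennreal ((\<Sum>i\<in>UNIV. \<bar>inverse T * V i z\<bar>) powr p) \<le> ennreal (\<Sum>i\<in>UNIV. (?N * \<bar>inverse T * V i z\<bar>) powr p)"
          by (rule ennreal_leI[OF sum_powr_le]) (use p in simp)
        also have "\<dots> = (\<Sum>i\<in>UNIV. ennreal ((?N * \<bar>inverse T * V i z\<bar>) powr p))" by (rule sum_ennreal[symmetric]) simp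
        finally show "ennreal ((\<Sum>i\<in>UNIV. \<bar>inverse T * V i z\<bar>) powr p) \<le> (\<Sum>i\<in>UNIV. ennreal ((?N * \<bar>inverse T * V i z\<bar>) powr p))" .
      qed
      also have "\<dots> = (\<Sum>i\<in>UNIV. \<integral>\<^sup>+z. ennreal ((?N * \<bar>inverse T * V i z\<bar>) powr p) \<partial>lborel)"
        by (rule nn_integral_sum) measurable
      also have "\<dots> \<le> (\<Sum>i\<in>(UNIV :: 'n set). ennreal ((?N / T) powr p * M powr p))" by (rule sum_mono) (rule Vi)
      also have "\<dots> = ennreal (\<Sum>i\<in>(UNIV :: 'n set). (?N / T) powr p * M powr p)" by (rule sum_ennreal) simp
      also have "\<dots> \<le> ennreal 1"
      proof (rule ennreal_leI)
        \<comment> \<open>One dimension factor comes from \<open>sum_powr_le\<close>, a second one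
          from the number of summands, drawn under the power here.\<close>
        have "?N \<le> ?N powr p" using powr_mono[OF p N1] by simp
        then have "(\<Sum>i\<in>(UNIV :: 'n set). (?N / T) powr p * M powr p) \<le> ?N powr p * ((?N / T) powr p * M powr p)"
          by (simp add: mult_right_mono)
        also have "\<dots> = (?N * ?N * M / T) powr p"
          using T M(1) by (simp add: powr_mult powr_divide mult_ac)
        also have "\<dots> \<le> 1 powr p"
        proof (rule powr_mono2)
          have "?N * ?N * M \<le> K * M" using M(1) k by (intro mult_right_mono) (auto simp: K_def)
          then show "?N * ?N * M / T \<le> 1" using KMT T by simp
        qed (use p M(1) T in auto)
        finally show "(\<Sum>i\<in>(UNIV :: 'n set). (?N / T) powr p * M powr p) \<le> 1" by simp
      qed
      finally show ?thesis by simp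
    qed
    show ?thesis
    proof (intro exI conjI)
      show "weak_gradient \<Omega> (\<lambda>x. inverse T * U x) (\<lambda>i x. inverse T * V i x)" by (rule weak_gradient_cmult[OF wg])
      have "(\<integral>z. \<bar>inverse T * U z\<bar> \<partial>lborel) = inverse T * (\<integral>z. \<bar>U z\<bar> \<partial>lborel)"
        using T by (simp add: abs_mult)
      also have "\<dots> \<le> inverse T * T" using u1 T by (intro mult_left_mono) auto
      finally show "(\<integral>z. \<bar>inverse T * U z\<bar> \<partial>lborel) \<le> 1" using T by simp
      show "(\<integral>\<^sup>+z. ennreal ((\<Sum>i\<in>UNIV. \<bar>inverse T * V i z\<bar>) powr p) \<partial>lborel) \<le> 1" by (rule D1)
      show "(\<lambda>x. inverse T * U x) \<in> borel_measurable borel" by measurable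
      show "AE x in lebesgue_on \<Omega>. u x = T * (inverse T * U x)" using U(3) by eventually_elim (use T in simp)
    qed
  qed
  then show ?thesis using K by (intro exI[of _ K]) blast
qed

text \<open>A relation between exponents only, with the constant hidden, so that embeddings can be
  weakened on either side and chained.\<close>

definition sobolev_embeds :: "(real^'n) set \<Rightarrow> ereal \<Rightarrow> ereal \<Rightarrow> bool" where
  "sobolev_embeds \<Omega> p q \<longleftrightarrow> (\<exists>C>0. \<forall>u D. weak_gradient_on \<Omega> p u D \<longrightarrow>
     u \<in> Lp_space q \<Omega> \<and> Lp_norm q \<Omega> u \<le> C * (Lp_norm p \<Omega> u + (\<Sum>i\<in>UNIV. Lp_norm p \<Omega> (D i))))"

lemma sobolev_embeds_infinity:
  fixes \<Omega> :: "(real^'n) set" and p :: real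
  assumes \<Omega>: "lipschitz_domain \<Omega>" "bounded \<Omega>" and p: "1 \<le> p" "CARD('n) < p"
  shows "sobolev_embeds \<Omega> p \<infinity>"
proof -
  have op: "open \<Omega>" using \<Omega>(1) by (simp add: lipschitz_domain_def)
  have s: "\<Omega> \<in> sets lebesgue" using op by auto
  obtain K where K: "0 < K" "\<forall>u D T. weak_gradient_on \<Omega> p u D \<longrightarrow> 0 < T \<longrightarrow>
     K * (Lp_norm p \<Omega> u + (\<Sum>i\<in>UNIV. Lp_norm p \<Omega> (D i))) \<le> T \<longrightarrow>
     (\<exists>U D'. weak_gradient \<Omega> U D' \<and> (\<integral>z. \<bar>U z\<bar> \<partial>lborel) \<le> 1 \<and>
       (\<integral>\<^sup>+z. ennreal ((\<Sum>i\<in>UNIV. \<bar>D' i z\<bar>) powr p) \<partial>lborel) \<le> 1 \<and>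
       U \<in> borel_measurable borel \<and> (AE x in lebesgue_on \<Omega>. u x = T * U x))"
    using normalize_weak_gradient[OF op \<Omega>(2) p(1)] by (elim exE conjE)
  obtain C where C: "0 < C" "\<forall>u D. weak_gradient \<Omega> u D \<longrightarrow> (\<integral>z. \<bar>u z\<bar> \<partial>lborel) \<le> 1 \<longrightarrow>
     (\<integral>\<^sup>+z. ennreal ((\<Sum>i\<in>UNIV. \<bar>D i z\<bar>) powr p) \<partial>lborel) \<le> 1 \<longrightarrow>
     (AE x in lborel. x \<in> \<Omega> \<longrightarrow> \<bar>u x\<bar> \<le> C)"
    using global_embedding_infinity[OF \<Omega> p] by (elim exE conjE)
  have "u \<in> Lp_space \<infinity> \<Omega> \<and> Lp_norm \<infinity> \<Omega> u \<le> (C * K) * (Lp_norm p \<Omega> u + (\<Sum>i\<in>UNIV. Lp_norm p \<Omega> (D i)))"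
    if uD: "weak_gradient_on \<Omega> p u D" for u D
  proof -
    define M where "M = Lp_norm p \<Omega> u + (\<Sum>i\<in>UNIV. Lp_norm p \<Omega> (D i))"
    have M: "0 \<le> M" unfolding M_def by (intro add_nonneg_nonneg sum_nonneg) auto
    have um: "u \<in> borel_measurable (lebesgue_on \<Omega>)" using uD by (simp add: weak_gradient_on_def Lp_space_def)
    have b: "u \<in> Lp_space \<infinity> \<Omega> \<and> Lp_norm \<infinity> \<Omega> u \<le> C * T" if T: "0 < T" "K * M \<le> T" for T
    proof -
      obtain U D' where U: "weak_gradient \<Omega> U D'" "(\<integral>z. \<bar>U z\<bar> \<partial>lborel) \<le> 1"
       "(\<integral>\<^sup>+z. ennreal ((\<Sum>i\<in>UNIV. \<bar>D' i z\<bar>) powr p) \<partial>lborel) \<le> 1" "AE x in lebesgue_on \<Omega>. u x = T * U x"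
        using K(2)[rule_format, OF uD T(1) T(2)[unfolded M_def]] by (elim exE conjE)
      have "AE x in lborel. x \<in> \<Omega> \<longrightarrow> \<bar>U x\<bar> \<le> C" by (rule C(2)[rule_format, OF U(1-3)])
      then have "AE x in lebesgue. x \<in> \<Omega> \<longrightarrow> \<bar>U x\<bar> \<le> C" by (rule AE_completion)
      then have "AE x in lebesgue_on \<Omega>. \<bar>U x\<bar> \<le> C" using s by (subst AE_restrict_space_iff) auto
      then have "AE x in lebesgue_on \<Omega>. \<bar>u x\<bar> \<le> C * T"
        using U(4)
      proof eventually_elim
        case (elim x)
        then show ?case using T(1) by (simp add: abs_mult mult.commute mult_right_mono)
      qed
      from Lp_infinityI[OF um this] show ?thesis using C(1) T(1) by simp
    qed
    have KM: "0 \<le> K * M" using K(1) M by simp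
    show ?thesis
    proof
      show "u \<in> Lp_space \<infinity> \<Omega>" using b[of "K * M + 1"] KM by simp
      \<comment> \<open>\<open>K * M\<close> may be zero and is then no admissible divisor, so it is
        approached from above by positive values of \<open>T\<close>.\<close>
      have "Lp_norm \<infinity> \<Omega> u \<le> C * (K * M) + e" if "0 < e" for e
      proof -
        have "0 < e / C" using that C(1) by simp
        then have "Lp_norm \<infinity> \<Omega> u \<le> C * (K * M + e / C)" using KM by (intro b[THEN conjunct2]) linarith+
        then show ?thesis using C(1) by (simp add: distrib_left)
      qed
      then have "Lp_norm \<infinity> \<Omega> u \<le> C * (K * M)" by (rule field_le_epsilon)
      then show "Lp_norm \<infinity> \<Omega> u \<le> (C * K) * (Lp_norm p \<Omega> u + (\<Sum>i\<in>UNIV. Lp_norm p \<Omega> (D i)))"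
        by (simp only: M_def mult.assoc)
    qed
  qed
  moreover have "0 < C * K" using C(1) K(1) by simp
  ultimately show ?thesis unfolding sobolev_embeds_def by blast
qed

lemma sobolev_embeds_critical:
  fixes \<Omega> :: "(real^'n) set" and p q :: real
  assumes \<Omega>: "lipschitz_domain \<Omega>" "bounded \<Omega>" and p: "1 < p" "p < CARD('n)"
    and q: "q = CARD('n) * p / (CARD('n) - p)"
  shows "sobolev_embeds \<Omega> p q"
proof -
  have op: "open \<Omega>" using \<Omega>(1) by (simp add: lipschitz_domain_def)
  have s: "\<Omega> \<in> sets lebesgue" using op by auto
  have q0: "0 < q" unfolding q using p by simp
  have p1: "1 \<le> p" using p by simp
  obtain K where K: "0 < K" "\<forall>u D T. weak_gradient_on \<Omega> p u D \<longrightarrow> 0 < T \<longrightarrow>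
     K * (Lp_norm p \<Omega> u + (\<Sum>i\<in>UNIV. Lp_norm p \<Omega> (D i))) \<le> T \<longrightarrow>
     (\<exists>U D'. weak_gradient \<Omega> U D' \<and> (\<integral>z. \<bar>U z\<bar> \<partial>lborel) \<le> 1 \<and>
       (\<integral>\<^sup>+z. ennreal ((\<Sum>i\<in>UNIV. \<bar>D' i z\<bar>) powr p) \<partial>lborel) \<le> 1 \<and>
       U \<in> borel_measurable borel \<and> (AE x in lebesgue_on \<Omega>. u x = T * U x))"
    using normalize_weak_gradient[OF op \<Omega>(2) p1] by (elim exE conjE)
  obtain C where C: "0 < C" "\<forall>u D. weak_gradient \<Omega> u D \<longrightarrow> (\<integral>z. \<bar>u z\<bar> \<partial>lborel) \<le> 1 \<longrightarrow>
     (\<integral>\<^sup>+z. ennreal ((\<Sum>i\<in>UNIV. \<bar>D i z\<bar>) powr p) \<partial>lborel) \<le> 1 \<longrightarrow>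
     (\<integral>\<^sup>+x. ennreal (\<bar>u x\<bar> powr q) * indicator \<Omega> x \<partial>lborel) \<le> ennreal C"
    using global_embedding[OF \<Omega> p, folded q] by (elim exE conjE)
  \<comment> \<open>The global estimate bounds the integral of the q-th power; the norm needs the
    root.\<close>
  define c where "c = C powr (1 / q)"
  have c: "0 < c" "c powr q = C" using C(1) q0 by (auto simp: c_def powr_powr)
  have "u \<in> Lp_space q \<Omega> \<and> Lp_norm q \<Omega> u \<le> (c * K) * (Lp_norm p \<Omega> u + (\<Sum>i\<in>UNIV. Lp_norm p \<Omega> (D i)))"
    if uD: "weak_gradient_on \<Omega> p u D" for u D
  proof -
    define M where "M = Lp_norm p \<Omega> u + (\<Sum>i\<in>UNIV. Lp_norm p \<Omega> (D i))"
    have M: "0 \<le> M" unfolding M_def by (intro add_nonneg_nonneg sum_nonneg) auto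
    have um: "u \<in> borel_measurable (lebesgue_on \<Omega>)" using uD by (simp add: weak_gradient_on_def Lp_space_def)
    have b: "u \<in> Lp_space q \<Omega> \<and> Lp_norm q \<Omega> u \<le> c * T" if T: "0 < T" "K * M \<le> T" for T
    proof -
      obtain U D' where U: "weak_gradient \<Omega> U D'" "(\<integral>z. \<bar>U z\<bar> \<partial>lborel) \<le> 1"
       "(\<integral>\<^sup>+z. ennreal ((\<Sum>i\<in>UNIV. \<bar>D' i z\<bar>) powr p) \<partial>lborel) \<le> 1"
       "U \<in> borel_measurable borel" "AE x in lebesgue_on \<Omega>. u x = T * U x"
        using K(2)[rule_format, OF uD T(1) T(2)[unfolded M_def]] by (elim exE conjE)
      note [measurable] = U(4)
      have I: "(\<integral>\<^sup>+x. ennreal (\<bar>u x\<bar> powr q) \<partial>lebesgue_on \<Omega>) \<le> ennreal ((c * T) powr q)"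
      proof -
        have "(\<integral>\<^sup>+x. ennreal (\<bar>u x\<bar> powr q) \<partial>lebesgue_on \<Omega>) = (\<integral>\<^sup>+x. ennreal (T powr q) * ennreal (\<bar>U x\<bar> powr q) \<partial>lebesgue_on \<Omega>)"
        proof (rule nn_integral_cong_AE)
          show "AE x in lebesgue_on \<Omega>. ennreal (\<bar>u x\<bar> powr q) = ennreal (T powr q) * ennreal (\<bar>U x\<bar> powr q)"
            using U(5)
          proof eventually_elim
            case (elim x)
            then show ?case using T(1) by (simp add: abs_mult powr_mult ennreal_mult)
          qed
        qed
        also have "\<dots> = (\<integral>\<^sup>+x. ennreal (T powr q) * ennreal (\<bar>U x\<bar> powr q) * indicator \<Omega> x \<partial>lborel)"
          by (rule nn_integral_lebesgue_on_borel[OF _ op]) measurable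
        also have "\<dots> = (\<integral>\<^sup>+x. ennreal (T powr q) * (ennreal (\<bar>U x\<bar> powr q) * indicator \<Omega> x) \<partial>lborel)"
          by (simp only: mult.assoc)
        also have "\<dots> = ennreal (T powr q) * (\<integral>\<^sup>+x. ennreal (\<bar>U x\<bar> powr q) * indicator \<Omega> x \<partial>lborel)"
        proof (rule nn_integral_cmult)
          have [measurable]: "\<Omega> \<in> sets borel" using op by simp
          show "(\<lambda>x. ennreal (\<bar>U x\<bar> powr q) * indicator \<Omega> x) \<in> borel_measurable lborel" by measurable
        qed
        also have "\<dots> \<le> ennreal (T powr q) * ennreal C"
          by (rule mult_left_mono[OF C(2)[rule_format, OF U(1-3)]]) simp
        also have "\<dots> = ennreal (T powr q * C)" using C(1) by (simp add: ennreal_mult)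
        also have "T powr q * C = (c * T) powr q" using c T(1) by (simp add: powr_mult)
        finally show ?thesis .
      qed
      have m: "(\<lambda>x. \<bar>u x\<bar> powr q) \<in> borel_measurable (lebesgue_on \<Omega>)" using um by measurable
      have i: "integrable (lebesgue_on \<Omega>) (\<lambda>x. \<bar>u x\<bar> powr q)"
      proof (rule integrableI_bounded[OF m])
        show "(\<integral>\<^sup>+x. ennreal (norm (\<bar>u x\<bar> powr q)) \<partial>lebesgue_on \<Omega>) < \<infinity>"
          using le_less_trans[OF I, of \<infinity>] by simp
      qed
      have "ennreal (\<integral>x. \<bar>u x\<bar> powr q \<partial>lebesgue_on \<Omega>) \<le> ennreal ((c * T) powr q)"
        using I by (subst nn_integral_eq_integral[symmetric, OF i]) auto
      then have "(\<integral>x. \<bar>u x\<bar> powr q \<partial>lebesgue_on \<Omega>) \<le> (c * T) powr q" by (simp add: ennreal_le_iff)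
      then have "Lp_norm q \<Omega> u \<le> c * T"
        using q0 c(1) T(1) by (subst Lp_norm_le_iff) auto
      moreover have "u \<in> Lp_space q \<Omega>" using um i by (simp add: Lp_space_def)
      ultimately show ?thesis by simp
    qed
    have KM: "0 \<le> K * M" using K(1) M by simp
    show ?thesis
    proof
      show "u \<in> Lp_space q \<Omega>" using b[of "K * M + 1"] KM by simp
      have "Lp_norm q \<Omega> u \<le> c * (K * M) + e" if "0 < e" for e
      proof -
        have "0 < e / c" using that c(1) by simp
        then have "Lp_norm q \<Omega> u \<le> c * (K * M + e / c)" using KM by (intro b[THEN conjunct2]) linarith+
        then show ?thesis using c(1) by (simp add: distrib_left)
      qed
      then have "Lp_norm q \<Omega> u \<le> c * (K * M)" by (rule field_le_epsilon)
      then show "Lp_norm q \<Omega> u \<le> (c * K) * (Lp_norm p \<Omega> u + (\<Sum>i\<in>UNIV. Lp_norm p \<Omega> (D i)))"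
        by (simp only: M_def mult.assoc)
    qed
  qed
  moreover have "0 < c * K" using c(1) K(1) by simp
  ultimately show ?thesis unfolding sobolev_embeds_def by blast
qed

section \<open>Choice and chaining of exponents\<close>

lemma sobolev_embeds_mono_right:
  fixes \<Omega> :: "(real^'n) set"
  assumes e: "sobolev_embeds \<Omega> p r" and q: "1 \<le> q" "q \<le> r" and \<Omega>: "open \<Omega>" "bounded \<Omega>"
  shows "sobolev_embeds \<Omega> p q"
proof -
  obtain C where C: "0 < C" "\<forall>u D. weak_gradient_on \<Omega> p u D \<longrightarrow>
     u \<in> Lp_space r \<Omega> \<and> Lp_norm r \<Omega> u \<le> C * (Lp_norm p \<Omega> u + (\<Sum>i\<in>UNIV. Lp_norm p \<Omega> (D i)))"
    using e unfolding sobolev_embeds_def by (elim exE conjE)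
  have lm: "\<Omega> \<in> lmeasurable" using \<Omega> by (intro lmeasurable_open)
  obtain C' where C': "0 < C'" "\<forall>f\<in>Lp_space r \<Omega>. f \<in> Lp_space q \<Omega> \<and> Lp_norm q \<Omega> f \<le> C' * Lp_norm r \<Omega> f"
    using Lp_embedding[OF q lm] by (elim exE conjE)
  have "u \<in> Lp_space q \<Omega> \<and> Lp_norm q \<Omega> u \<le> (C' * C) * (Lp_norm p \<Omega> u + (\<Sum>i\<in>UNIV. Lp_norm p \<Omega> (D i)))"
    if uD: "weak_gradient_on \<Omega> p u D" for u D
  proof -
    have u: "u \<in> Lp_space r \<Omega>" "Lp_norm r \<Omega> u \<le> C * (Lp_norm p \<Omega> u + (\<Sum>i\<in>UNIV. Lp_norm p \<Omega> (D i)))"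
      using C(2)[rule_format, OF uD] by auto
    have "Lp_norm q \<Omega> u \<le> C' * Lp_norm r \<Omega> u" "u \<in> Lp_space q \<Omega>" using C'(2)[rule_format, OF u(1)] by auto
    moreover have "C' * Lp_norm r \<Omega> u \<le> C' * (C * (Lp_norm p \<Omega> u + (\<Sum>i\<in>UNIV. Lp_norm p \<Omega> (D i))))"
      using C'(1) by (intro mult_left_mono u(2)) simp
    ultimately show ?thesis unfolding mult.assoc by (blast intro: order_trans)
  qed
  moreover have "0 < C' * C" using C C' by simp
  ultimately show ?thesis unfolding sobolev_embeds_def by blast
qed

lemma sobolev_embeds_mono_left:
  fixes \<Omega> :: "(real^'n) set"
  assumes e: "sobolev_embeds \<Omega> p q" and p: "1 \<le> p" "p \<le> r" and \<Omega>: "open \<Omega>" "bounded \<Omega>"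
  shows "sobolev_embeds \<Omega> r q"
proof -
  obtain C where C: "0 < C" "\<forall>u D. weak_gradient_on \<Omega> p u D \<longrightarrow>
     u \<in> Lp_space q \<Omega> \<and> Lp_norm q \<Omega> u \<le> C * (Lp_norm p \<Omega> u + (\<Sum>i\<in>UNIV. Lp_norm p \<Omega> (D i)))"
    using e unfolding sobolev_embeds_def by (elim exE conjE)
  have lm: "\<Omega> \<in> lmeasurable" using \<Omega> by (intro lmeasurable_open)
  obtain C' where C': "0 < C'" "\<forall>f\<in>Lp_space r \<Omega>. f \<in> Lp_space p \<Omega> \<and> Lp_norm p \<Omega> f \<le> C' * Lp_norm r \<Omega> f"
    using Lp_embedding[OF p lm] by (elim exE conjE)
  have "u \<in> Lp_space q \<Omega> \<and> Lp_norm q \<Omega> u \<le> (C * C') * (Lp_norm r \<Omega> u + (\<Sum>i\<in>UNIV. Lp_norm r \<Omega> (D i)))"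
    if uD: "weak_gradient_on \<Omega> r u D" for u D
  proof -
    have u: "u \<in> Lp_space r \<Omega>" and D: "\<And>i. D i \<in> Lp_space r \<Omega>" using uD by (auto simp: weak_gradient_on_def)
    have "weak_gradient_on \<Omega> p u D" using uD C'(2) by (simp add: weak_gradient_on_def)
    from C(2)[rule_format, OF this]
    have 1: "u \<in> Lp_space q \<Omega>" "Lp_norm q \<Omega> u \<le> C * (Lp_norm p \<Omega> u + (\<Sum>i\<in>UNIV. Lp_norm p \<Omega> (D i)))" by auto
    have "Lp_norm p \<Omega> u + (\<Sum>i\<in>UNIV. Lp_norm p \<Omega> (D i)) \<le> C' * Lp_norm r \<Omega> u + (\<Sum>i\<in>UNIV. C' * Lp_norm r \<Omega> (D i))"
      using C'(2) u D by (intro add_mono sum_mono) auto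
    also have "\<dots> = C' * (Lp_norm r \<Omega> u + (\<Sum>i\<in>UNIV. Lp_norm r \<Omega> (D i)))" by (simp add: distrib_left sum_distrib_left)
    finally have "C * (Lp_norm p \<Omega> u + (\<Sum>i\<in>UNIV. Lp_norm p \<Omega> (D i))) \<le> C * (C' * (Lp_norm r \<Omega> u + (\<Sum>i\<in>UNIV. Lp_norm r \<Omega> (D i))))"
      using C(1) by (intro mult_left_mono) auto
    then show ?thesis using 1 unfolding mult.assoc by (blast intro: order_trans)
  qed
  moreover have "0 < C * C'" using C C' by simp
  ultimately show ?thesis unfolding sobolev_embeds_def by blast
qed

lemma weak_gradient_on_weak_deriv:
  fixes w :: "real^'n \<Rightarrow> real"
  assumes \<Omega>: "open \<Omega>" and w: "w \<in> sobolev k p \<Omega>" and \<alpha>: "mi_order \<alpha> < k"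
  shows "weak_gradient_on \<Omega> p (weak_deriv \<Omega> \<alpha> w) (\<lambda>i. weak_deriv \<Omega> (\<lambda>j. \<alpha> j + unit_index i j) w)"
proof -
  have le: "mi_order \<alpha> \<le> k" "mi_order (\<lambda>j. \<alpha> j + unit_index i j) \<le> k" for i using \<alpha> by (auto simp: mi_order_add)
  show ?thesis
    unfolding weak_gradient_on_def
  proof (intro conjI allI)
    fix i
    show "is_weak_deriv \<Omega> (unit_index i) (weak_deriv \<Omega> \<alpha> w) (weak_deriv \<Omega> (\<lambda>j. \<alpha> j + unit_index i j) w)"
      by (rule is_weak_deriv_shift[OF sobolev_weak_deriv(1)[OF \<Omega> w le(1)] sobolev_weak_deriv(1)[OF \<Omega> w le(2)]])
  qed (rule sobolev_weak_deriv(2)[OF \<Omega> w le(1)] sobolev_weak_deriv(2)[OF \<Omega> w le(2)])+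
qed

lemma sobolev_embeds_weak_deriv:
  fixes \<Omega> :: "(real^'n) set"
  assumes e: "sobolev_embeds \<Omega> p q" and \<Omega>: "open \<Omega>" and p: "1 \<le> p"
  shows "\<exists>C>0. \<forall>k. \<forall>w\<in>sobolev k p \<Omega>. \<forall>\<alpha>. mi_order \<alpha> < k \<longrightarrow>
     weak_deriv \<Omega> \<alpha> w \<in> Lp_space q \<Omega> \<and> Lp_norm q \<Omega> (weak_deriv \<Omega> \<alpha> w) \<le> C * sobolev_norm k p \<Omega> w"
proof -
  obtain C where C: "0 < C" "\<forall>u D. weak_gradient_on \<Omega> p u D \<longrightarrow>
     u \<in> Lp_space q \<Omega> \<and> Lp_norm q \<Omega> u \<le> C * (Lp_norm p \<Omega> u + (\<Sum>i\<in>UNIV. Lp_norm p \<Omega> (D i)))"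
    using e unfolding sobolev_embeds_def by (elim exE conjE)
  have "weak_deriv \<Omega> \<alpha> w \<in> Lp_space q \<Omega> \<and>
      Lp_norm q \<Omega> (weak_deriv \<Omega> \<alpha> w) \<le> (C * (1 + real CARD('n))) * sobolev_norm k p \<Omega> w"
    if w: "w \<in> sobolev k p \<Omega>" and \<alpha>: "mi_order \<alpha> < k" for k w and \<alpha> :: "'n \<Rightarrow> nat"
  proof -
    have le: "mi_order \<alpha> \<le> k" "mi_order (\<lambda>j. \<alpha> j + unit_index i j) \<le> k" for i using \<alpha> by (auto simp: mi_order_add)
    note 1 = C(2)[rule_format, OF weak_gradient_on_weak_deriv[OF \<Omega> w \<alpha>]]
    have "Lp_norm p \<Omega> (weak_deriv \<Omega> \<alpha> w) + (\<Sum>i\<in>(UNIV::'n set). Lp_norm p \<Omega> (weak_deriv \<Omega> (\<lambda>j. \<alpha> j + unit_index i j) w))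
      \<le> sobolev_norm k p \<Omega> w + (\<Sum>i\<in>(UNIV::'n set). sobolev_norm k p \<Omega> w)"
      by (intro add_mono sum_mono Lp_norm_le_sobolev_norm le p)
    also have "\<dots> = (1 + real CARD('n)) * sobolev_norm k p \<Omega> w" by (simp add: distrib_right)
    finally have "C * (Lp_norm p \<Omega> (weak_deriv \<Omega> \<alpha> w) + (\<Sum>i\<in>(UNIV::'n set). Lp_norm p \<Omega> (weak_deriv \<Omega> (\<lambda>j. \<alpha> j + unit_index i j) w)))
      \<le> C * ((1 + real CARD('n)) * sobolev_norm k p \<Omega> w)" using C(1) by (intro mult_left_mono) auto
    then show ?thesis using 1 unfolding mult.assoc by (blast intro: order_trans)
  qed
  moreover have "0 < C * (1 + real CARD('n))" using C(1) by (simp add: add_pos_nonneg)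
  ultimately show ?thesis by blast
qed

text \<open>The exponent 2 is the borderline of the embedding on planar domains, so one starts from an exponent
  slightly below.\<close>

lemma sobolev_embeds_dim_eq:
  fixes \<Omega> :: "(real^'n) set" and q :: ereal
  assumes \<Omega>: "lipschitz_domain \<Omega>" "bounded \<Omega>" and N: "2 \<le> CARD('n)" and q: "1 \<le> q" "q < \<infinity>"
  shows "sobolev_embeds \<Omega> (ereal (real CARD('n))) q"
proof -
  have op: "open \<Omega>" using \<Omega>(1) by (simp add: lipschitz_domain_def)
  let ?N = "real CARD('n)"
  have N2: "2 \<le> ?N" using N by simp
  obtain r where r: "q = ereal r" using q by (cases q) auto
  define t where "t = max r 3"
  have t: "3 \<le> t" "r \<le> t" by (auto simp: t_def)
  \<comment> \<open>This is the exponent whose critical exponent is \<open>t\<close>. It stays below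
    the dimension, and \<open>t \<ge> 3\<close> makes it exceed 1 already in dimension 2.\<close>
  define p where "p = ?N * t / (?N + t)"
  have p: "1 < p" "p < ?N"
  proof -
    have "2 * t \<le> ?N * t" using N2 t by (intro mult_right_mono) auto
    moreover have "2 * ?N < t * ?N" using N2 t by (intro mult_strict_right_mono) auto
    ultimately have lt: "?N + t < ?N * t" using mult.commute[of t ?N] by linarith
    have "0 < ?N + t" using N2 t by linarith
    then show "1 < p" unfolding p_def using lt by (simp only: less_divide_eq_1_pos)
    show "p < ?N" using N2 t by (simp add: p_def pos_divide_less_eq distrib_left)
  qed
  have "t = ?N * p / (?N - p)"
  proof -
    have nt: "?N + t \<noteq> 0" using N2 t by linarith
    have "?N - p = ?N * ?N / (?N + t)" using nt by (simp add: p_def field_simps)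
    moreover have "?N * p = ?N * ?N * t / (?N + t)" by (simp add: p_def)
    ultimately show ?thesis using nt N2 by simp
  qed
  from sobolev_embeds_critical[OF \<Omega> p this] have "sobolev_embeds \<Omega> (ereal p) (ereal t)" .
  then have "sobolev_embeds \<Omega> (ereal p) q"
    by (rule sobolev_embeds_mono_right[OF _ q(1) _ op \<Omega>(2)]) (simp add: r t)
  then show ?thesis
    by (rule sobolev_embeds_mono_left[OF _ _ _ op \<Omega>(2)]) (use p in \<open>auto simp: one_ereal_def\<close>)
qed

text \<open>The exponent 2 lies above the dimension in dimension 1, equals it in dimension 2 and
  lies below it afterwards; the three regimes of the first-order embedding apply in turn.\<close>

lemma sobolev_embeds_1_2:
  fixes \<Omega> :: "(real^'n) set" and q :: ereal
  assumes \<Omega>: "lipschitz_domain \<Omega>" "bounded \<Omega>" and q: "1 \<le> q"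
    and q2: "CARD('n) = 2 \<Longrightarrow> q < \<infinity>"
    and q3: "2 < CARD('n) \<Longrightarrow> q \<le> ereal (2 * real CARD('n) / (real CARD('n) - 2))"
  shows "sobolev_embeds \<Omega> 2 q"
proof -
  have op: "open \<Omega>" using \<Omega>(1) by (simp add: lipschitz_domain_def)
  consider "CARD('n) = 1" | "CARD('n) = 2" | "2 < CARD('n)"
    using zero_less_card_finite[where 'a='n] by linarith
  then show ?thesis
  proof cases
    case 1
    have "sobolev_embeds \<Omega> (ereal 2) \<infinity>" by (rule sobolev_embeds_infinity[OF \<Omega>]) (use 1 in auto)
    then show ?thesis by (intro sobolev_embeds_mono_right[OF _ q _ op \<Omega>(2)]) auto
  next
    case 2
    have "sobolev_embeds \<Omega> (ereal (real CARD('n))) q" by (rule sobolev_embeds_dim_eq[OF \<Omega> _ q q2[OF 2]]) (use 2 in simp)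
    then show ?thesis using 2 by simp
  next
    case 3
    have "sobolev_embeds \<Omega> (ereal 2) (ereal (2 * real CARD('n) / (real CARD('n) - 2)))"
      by (rule sobolev_embeds_critical[OF \<Omega>]) (use 3 in auto)
    then show ?thesis by (intro sobolev_embeds_mono_right[OF _ q q3[OF 3] op \<Omega>(2)]) simp
  qed
qed

text \<open>Two first-order embeddings in succession. Up to dimension 3 the intermediate exponent
  exceeds the dimension, so the second step reaches L^\<infinity>; in dimension 4 it is the
  borderline exponent 4; beyond that both steps are critical, and 1/2 - 2/d yields the exponent
  2d/(d - 4).\<close>

lemma sobolev_embeds_second:
  fixes \<Omega> :: "(real^'n) set" and q :: ereal
  assumes \<Omega>: "lipschitz_domain \<Omega>" "bounded \<Omega>" and q: "1 \<le> q"
    and q4: "CARD('n) = 4 \<Longrightarrow> q < \<infinity>"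
    and q5: "4 < CARD('n) \<Longrightarrow> q \<le> ereal (2 * real CARD('n) / (real CARD('n) - 4))"
  shows "\<exists>p\<ge>1. sobolev_embeds \<Omega> 2 p \<and> sobolev_embeds \<Omega> p q"
proof -
  let ?N = "real CARD('n)"
  have op: "open \<Omega>" using \<Omega>(1) by (simp add: lipschitz_domain_def)
  consider "CARD('n) = 1" | "CARD('n) = 2" | "CARD('n) = 3" | "CARD('n) = 4" | "4 < CARD('n)"
    using zero_less_card_finite[where 'a='n] by linarith
  then show ?thesis
  proof cases
    case 1
    have "sobolev_embeds \<Omega> 2 (ereal 2)" by (rule sobolev_embeds_1_2[OF \<Omega>]) (use 1 in \<open>auto simp: one_ereal_def\<close>)
    moreover have "sobolev_embeds \<Omega> (ereal 2) \<infinity>" by (rule sobolev_embeds_infinity[OF \<Omega>]) (use 1 in auto)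
    then have "sobolev_embeds \<Omega> (ereal 2) q" by (intro sobolev_embeds_mono_right[OF _ q _ op \<Omega>(2)]) auto
    ultimately show ?thesis by (intro exI[of _ "ereal 2"]) (auto simp: one_ereal_def)
  next
    case 2
    have "sobolev_embeds \<Omega> 2 (ereal 4)" by (rule sobolev_embeds_1_2[OF \<Omega>]) (use 2 in \<open>auto simp: one_ereal_def\<close>)
    moreover have "sobolev_embeds \<Omega> (ereal 4) \<infinity>" by (rule sobolev_embeds_infinity[OF \<Omega>]) (use 2 in auto)
    then have "sobolev_embeds \<Omega> (ereal 4) q" by (intro sobolev_embeds_mono_right[OF _ q _ op \<Omega>(2)]) auto
    ultimately show ?thesis by (intro exI[of _ "ereal 4"]) (auto simp: one_ereal_def)
  next
    case 3
    have "sobolev_embeds \<Omega> 2 (ereal 6)" by (rule sobolev_embeds_1_2[OF \<Omega>]) (use 3 in \<open>auto simp: one_ereal_def\<close>)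
    moreover have "sobolev_embeds \<Omega> (ereal 6) \<infinity>" by (rule sobolev_embeds_infinity[OF \<Omega>]) (use 3 in auto)
    then have "sobolev_embeds \<Omega> (ereal 6) q" by (intro sobolev_embeds_mono_right[OF _ q _ op \<Omega>(2)]) auto
    ultimately show ?thesis by (intro exI[of _ "ereal 6"]) (auto simp: one_ereal_def)
  next
    case 4
    have "sobolev_embeds \<Omega> 2 (ereal 4)" by (rule sobolev_embeds_1_2[OF \<Omega>]) (use 4 in \<open>auto simp: one_ereal_def\<close>)
    moreover have "sobolev_embeds \<Omega> (ereal ?N) q" by (rule sobolev_embeds_dim_eq[OF \<Omega> _ q q4[OF 4]]) (use 4 in simp)
    ultimately show ?thesis using 4 by (intro exI[of _ "ereal 4"]) (auto simp: one_ereal_def)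
  next
    case 5
    have N: "4 < ?N" using 5 by simp
    define p where "p = 2 * ?N / (?N - 2)"
    have p: "1 < p" "p < ?N"
    proof -
      show "1 < p" using N by (simp add: p_def)
      have "2 * ?N < ?N * (?N - 2)" using N by (subst mult.commute) (intro mult_strict_left_mono, auto)
      then show "p < ?N" using N by (simp add: p_def pos_divide_less_eq)
    qed
    have eq: "2 * ?N / (?N - 4) = ?N * p / (?N - p)"
    proof -
      have n2: "?N - 2 \<noteq> 0" and n4: "?N - 4 \<noteq> 0" and n0: "?N \<noteq> 0" using N by linarith+
      have "?N - p = ?N * (?N - 4) / (?N - 2)" using n2 by (simp add: p_def field_simps)
      moreover have "?N * p = ?N * (2 * ?N) / (?N - 2)" by (simp add: p_def)
      ultimately show ?thesis using n2 n4 n0 by simp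
    qed
    have "sobolev_embeds \<Omega> 2 (ereal p)"
      by (rule sobolev_embeds_1_2[OF \<Omega>]) (use 5 p in \<open>auto simp: one_ereal_def p_def\<close>)
    moreover have "sobolev_embeds \<Omega> (ereal p) (ereal (2 * ?N / (?N - 4)))"
      by (rule sobolev_embeds_critical[OF \<Omega> p eq])
    then have "sobolev_embeds \<Omega> (ereal p) q" by (rule sobolev_embeds_mono_right[OF _ q q5[OF 5] op \<Omega>(2)])
    ultimately show ?thesis using p by (intro exI[of _ "ereal p"]) (auto simp: one_ereal_def)
  qed
qed

text \<open>Of two available derivatives \<nu> are kept in the target norm. With \<nu> = 1 one
  embedding step is applied to the function and its first derivatives; with \<nu> = 0 two steps are
  applied to the function. The restrictions of (B3) are the corresponding limits on the
  exponent.\<close>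

lemma sobolev_2_2_embedding:
  fixes \<Omega> :: "(real^'n) set" and q :: ereal
  assumes \<Omega>: "lipschitz_domain \<Omega>" "bounded \<Omega>" and q: "1 \<le> q" and \<nu>: "\<nu> \<in> {0, 1}"
    and q_eq: "real CARD('n) = 4 - 2 * real \<nu> \<longrightarrow> q < \<infinity>"
    and q_gt: "real CARD('n) > 4 - 2 * real \<nu> \<longrightarrow> q \<le> ereal (2 * real CARD('n) / (real CARD('n) - 4 + 2 * real \<nu>))"
  shows "\<exists>C>0. \<forall>w\<in>sobolev 2 2 \<Omega>. sobolev_norm \<nu> q \<Omega> w \<le> C * sobolev_norm 2 2 \<Omega> w"
proof -
  have op: "open \<Omega>" using \<Omega>(1) by (simp add: lipschitz_domain_def)
  have two: "1 \<le> (2::ereal)" by simp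
  show ?thesis
  proof (cases "\<nu> = 1")
    case True
    have "sobolev_embeds \<Omega> 2 q"
    proof (rule sobolev_embeds_1_2[OF \<Omega> q])
      show "q < \<infinity>" if "CARD('n) = 2" using q_eq that True by simp
      show "q \<le> ereal (2 * real CARD('n) / (real CARD('n) - 2))" if "2 < CARD('n)"
        using q_gt that True by (simp add: diff_add_eq[symmetric])
    qed
    from sobolev_embeds_weak_deriv[OF this op two]
    obtain C where C: "0 < C" "\<forall>k. \<forall>w\<in>sobolev k 2 \<Omega>. \<forall>\<alpha>. mi_order \<alpha> < k \<longrightarrow>
      weak_deriv \<Omega> \<alpha> w \<in> Lp_space q \<Omega> \<and> Lp_norm q \<Omega> (weak_deriv \<Omega> \<alpha> w) \<le> C * sobolev_norm k 2 \<Omega> w" by (elim exE conjE)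
    define n where "n = real (card {\<alpha> :: 'n \<Rightarrow> nat. mi_order \<alpha> \<le> 1})"
    have "sobolev_norm \<nu> q \<Omega> w \<le> ((n + 1) * C) * sobolev_norm 2 2 \<Omega> w" if w: "w \<in> sobolev 2 2 \<Omega>" for w
    proof -
      have "sobolev_norm \<nu> q \<Omega> w \<le> n * (C * sobolev_norm 2 2 \<Omega> w)"
        unfolding True n_def using C(2) w by (intro sobolev_norm_le_bound[OF q]) simp
      also have "\<dots> \<le> (n + 1) * (C * sobolev_norm 2 2 \<Omega> w)"
        using C(1) by (intro mult_right_mono) auto
      finally show ?thesis by (simp only: mult.assoc)
    qed
    moreover have "0 < (n + 1) * C" using C(1) by (simp add: n_def add_nonneg_pos)
    ultimately show ?thesis by blast
  next
    case False
    then have \<nu>0: "\<nu> = 0" using \<nu> by simp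
    have "\<exists>p\<ge>1. sobolev_embeds \<Omega> 2 p \<and> sobolev_embeds \<Omega> p q"
    proof (rule sobolev_embeds_second[OF \<Omega> q])
      show "q < \<infinity>" if "CARD('n) = 4" using q_eq that \<nu>0 by simp
      show "q \<le> ereal (2 * real CARD('n) / (real CARD('n) - 4))" if "4 < CARD('n)"
        using q_gt that \<nu>0 by simp
    qed
    then obtain p where p: "1 \<le> p" "sobolev_embeds \<Omega> 2 p" "sobolev_embeds \<Omega> p q" by (elim exE conjE)
    from sobolev_embeds_weak_deriv[OF p(2) op two]
    obtain C where C: "0 < C" "\<forall>k. \<forall>w\<in>sobolev k 2 \<Omega>. \<forall>\<alpha>. mi_order \<alpha> < k \<longrightarrow>
      weak_deriv \<Omega> \<alpha> w \<in> Lp_space p \<Omega> \<and> Lp_norm p \<Omega> (weak_deriv \<Omega> \<alpha> w) \<le> C * sobolev_norm k 2 \<Omega> w" by (elim exE conjE)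
    obtain C' where C': "0 < C'" "\<forall>u D. weak_gradient_on \<Omega> p u D \<longrightarrow>
     u \<in> Lp_space q \<Omega> \<and> Lp_norm q \<Omega> u \<le> C' * (Lp_norm p \<Omega> u + (\<Sum>i\<in>UNIV. Lp_norm p \<Omega> (D i)))"
      using p(3) unfolding sobolev_embeds_def by (elim exE conjE)
    have "sobolev_norm \<nu> q \<Omega> w \<le> (C' * ((1 + real CARD('n)) * C)) * sobolev_norm 2 2 \<Omega> w" if w: "w \<in> sobolev 2 2 \<Omega>" for w
    proof -
      define X where "X = C * sobolev_norm 2 2 \<Omega> w"
      have d: "weak_deriv \<Omega> \<alpha> w \<in> Lp_space p \<Omega>" "Lp_norm p \<Omega> (weak_deriv \<Omega> \<alpha> w) \<le> X" if "mi_order \<alpha> < 2" for \<alpha>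
        using C(2)[rule_format, OF w that] by (auto simp: X_def)
      have 0: "weak_deriv \<Omega> (\<lambda>_. 0) w = w" by (simp add: weak_deriv_def mi_order_def)
      have o0: "mi_order (\<lambda>_::'n. 0) < 2" by (simp add: mi_order_def)
      have wg: "weak_gradient_on \<Omega> 2 w (\<lambda>i. weak_deriv \<Omega> (unit_index i) w)"
        using weak_gradient_on_weak_deriv[OF op w o0] by (simp add: 0)
      have "weak_gradient_on \<Omega> p w (\<lambda>i. weak_deriv \<Omega> (unit_index i) w)"
        using wg d(1)[OF o0] d(1)[of "unit_index i" for i] by (simp add: weak_gradient_on_def 0)
      from C'(2)[rule_format, OF this]
      have "Lp_norm q \<Omega> w \<le> C' * (Lp_norm p \<Omega> w + (\<Sum>i\<in>UNIV. Lp_norm p \<Omega> (weak_deriv \<Omega> (unit_index i) w)))" by simp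
      also have "\<dots> \<le> C' * (X + (\<Sum>i\<in>(UNIV::'n set). X))"
        using C'(1) d(2)[OF o0] d(2)[of "unit_index i" for i] by (intro mult_left_mono add_mono sum_mono) (auto simp: 0)
      also have "\<dots> = (C' * ((1 + real CARD('n)) * C)) * sobolev_norm 2 2 \<Omega> w" by (simp add: X_def algebra_simps)
      finally show ?thesis by (simp only: \<nu>0 sobolev_norm_0[OF q])
    qed
    moreover have "0 < C' * ((1 + real CARD('n)) * C)" using C(1) C'(1) by (simp add: add_pos_nonneg)
    ultimately show ?thesis by blast
  qed
qed

section \<open>Functions with vanishing trace\<close>

lemma smooth_fun_imp_smooth_upto: "smooth_fun f \<Longrightarrow> smooth_upto n f"
proof (induction n arbitrary: f)
  case (Suc n)
  have "f differentiable (at x)" for x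
    using Suc.prems[unfolded smooth_fun_def, rule_format, of "[]" x] by simp
  then show ?case using Suc.IH[OF smooth_fun_partial[OF Suc.prems]] by simp
qed simp

lemma smooth_fun_lincomb:
  assumes "smooth_fun f" "smooth_fun g" shows "smooth_fun (\<lambda>x. a * f x + b * g x)"
proof (rule smooth_funI)
  fix n
  have "smooth_upto n f" "smooth_upto n g" using assms by (auto intro: smooth_fun_imp_smooth_upto)
  then show "smooth_upto n (\<lambda>x. a * f x + b * g x)"
    by (rule smooth_upto_add[OF smooth_upto_mult[OF smooth_upto_const] smooth_upto_mult[OF smooth_upto_const]])
qed

lemma continuous_on_smooth_fun: "smooth_fun f \<Longrightarrow> continuous_on A f"
proof (rule continuous_at_imp_continuous_on, rule ballI)
  fix x
  assume "smooth_fun f"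
  then have "partials [] f differentiable (at x)" unfolding smooth_fun_def by blast
  then show "isCont f x" by (simp add: differentiable_imp_continuous_within)
qed

text \<open>The measurable sets of \<open>measure_of\<close> are determined by the generating sets,
  so measurability of the boundary integrands becomes ordinary Borel measurability.\<close>

lemma sets_hausdorff_measure [simp]: "sets (hausdorff_measure s) = sets borel"
proof -
  have "sets (hausdorff_measure s :: 'a measure) = sigma_sets UNIV (sets borel)"
    unfolding hausdorff_measure_def by (rule sets_measure_of) simp
  also have "\<dots> = sets borel" using sets.sigma_sets_eq[of "borel :: 'a measure"] by simp
  finally show ?thesis .
qed

lemma borel_measurable_hausdorff_measure [simp]:
  "borel_measurable (hausdorff_measure s) = (borel_measurable borel :: ('a::metric_space \<Rightarrow> 'b::topological_space) set)"
  by (rule measurable_cong_sets) auto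

text \<open>The trace is defined through approximating sequences, so those of \<open>u\<close> and
  \<open>v\<close> are combined. The boundary integrals of squares are handled by (x + y)^2 <= 2 x^2
  + 2 y^2. Errors and interpolation differences become admissible arguments of the forms in this
  way.\<close>

lemma H10_lincomb:
  fixes u v :: "real^'n \<Rightarrow> real"
  assumes \<Omega>: "open \<Omega>" and u: "u \<in> H10 \<Omega>" and v: "v \<in> H10 \<Omega>"
  shows "(\<lambda>x. a * u x + b * v x) \<in> H10 \<Omega>"
proof -
  let ?H = "hausdorff_measure (CARD('n) - 1) :: (real^'n) measure"
  have two: "1 \<le> (2::ereal)" by simp
  have us: "u \<in> sobolev 1 2 \<Omega>" and vs: "v \<in> sobolev 1 2 \<Omega>" using u v by (auto simp: H10_def)
  obtain f where f: "\<forall>k. smooth_fun (f k) \<and> f k \<in> sobolev 1 2 \<Omega>"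
    "(\<lambda>k. sobolev_norm 1 2 \<Omega> (f k - u)) \<longlonglongrightarrow> 0"
    "(\<lambda>k. \<integral>\<^sup>+x\<in>frontier \<Omega>. ennreal ((f k x - 0)\<^sup>2) \<partial>?H) \<longlonglongrightarrow> 0"
    using u unfolding H10_def has_trace_def by auto
  obtain g where g: "\<forall>k. smooth_fun (g k) \<and> g k \<in> sobolev 1 2 \<Omega>"
    "(\<lambda>k. sobolev_norm 1 2 \<Omega> (g k - v)) \<longlonglongrightarrow> 0"
    "(\<lambda>k. \<integral>\<^sup>+x\<in>frontier \<Omega>. ennreal ((g k x - 0)\<^sup>2) \<partial>?H) \<longlonglongrightarrow> 0"
    using v unfolding H10_def has_trace_def by auto
  define w where "w k x = a * f k x + b * g k x" for k x
  define c where "c = real (card {\<alpha> :: 'n \<Rightarrow> nat. mi_order \<alpha> \<le> 1}) * 2"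
  have "has_trace \<Omega> (\<lambda>x. a * u x + b * v x) (\<lambda>x. 0)"
    unfolding has_trace_def
  proof (intro exI[of _ w] conjI allI)
    show "smooth_fun (w k)" for k unfolding w_def using f(1) g(1) by (intro smooth_fun_lincomb) auto
    show "w k \<in> sobolev 1 2 \<Omega>" for k unfolding w_def using f(1) g(1) by (intro sobolev_lincomb(1)[OF \<Omega> two]) auto
    have d: "h - z = (\<lambda>x. 1 * h x + (-1) * z x)" for h z :: "real^'n \<Rightarrow> real" by (simp add: fun_eq_iff)
    have le: "sobolev_norm 1 2 \<Omega> (w k - (\<lambda>x. a * u x + b * v x)) \<le>
      c * (\<bar>a\<bar> * sobolev_norm 1 2 \<Omega> (f k - u) + \<bar>b\<bar> * sobolev_norm 1 2 \<Omega> (g k - v))" for k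
    proof -
      have m: "f k - u \<in> sobolev 1 2 \<Omega>" "g k - v \<in> sobolev 1 2 \<Omega>"
        unfolding d by (rule sobolev_lincomb(1)[OF \<Omega> two], use f(1) g(1) us vs in \<open>simp; fail\<close>,
          use us vs in \<open>simp; fail\<close>)+
      have "w k - (\<lambda>x. a * u x + b * v x) = (\<lambda>x. a * (f k - u) x + b * (g k - v) x)"
        by (simp add: w_def fun_eq_iff algebra_simps)
      then show ?thesis using sobolev_lincomb(2)[OF \<Omega> two m, of a b] by (simp add: c_def mult.assoc)
    qed
    have "(\<lambda>k. c * (\<bar>a\<bar> * sobolev_norm 1 2 \<Omega> (f k - u) + \<bar>b\<bar> * sobolev_norm 1 2 \<Omega> (g k - v))) \<longlonglongrightarrow> c * (\<bar>a\<bar> * 0 + \<bar>b\<bar> * 0)"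
      by (rule tendsto_mult[OF tendsto_const
        tendsto_add[OF tendsto_mult[OF tendsto_const f(2)] tendsto_mult[OF tendsto_const g(2)]]])
    then have lim: "(\<lambda>k. c * (\<bar>a\<bar> * sobolev_norm 1 2 \<Omega> (f k - u) + \<bar>b\<bar> * sobolev_norm 1 2 \<Omega> (g k - v))) \<longlonglongrightarrow> 0"
      by (simp only: mult_zero_right add_0)
    show "(\<lambda>k. sobolev_norm 1 2 \<Omega> (w k - (\<lambda>x. a * u x + b * v x))) \<longlonglongrightarrow> 0"
      by (rule tendsto_sandwich[OF always_eventually always_eventually tendsto_const lim])
        (simp_all only: le sobolev_norm_nonneg simp_thms)
    have [measurable]: "f k \<in> borel_measurable borel" "g k \<in> borel_measurable borel" for k
      using f(1) g(1) by (auto intro!: borel_measurable_continuous_onI continuous_on_smooth_fun)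
    have le2: "(\<integral>\<^sup>+x\<in>frontier \<Omega>. ennreal ((w k x - 0)\<^sup>2) \<partial>?H) \<le>
      ennreal (2 * a\<^sup>2) * (\<integral>\<^sup>+x\<in>frontier \<Omega>. ennreal ((f k x - 0)\<^sup>2) \<partial>?H) +
      ennreal (2 * b\<^sup>2) * (\<integral>\<^sup>+x\<in>frontier \<Omega>. ennreal ((g k x - 0)\<^sup>2) \<partial>?H)" for k
    proof -
      have "(\<integral>\<^sup>+x\<in>frontier \<Omega>. ennreal ((w k x - 0)\<^sup>2) \<partial>?H) \<le>
        (\<integral>\<^sup>+x. ennreal (2 * a\<^sup>2) * (ennreal ((f k x - 0)\<^sup>2) * indicator (frontier \<Omega>) x) +
          ennreal (2 * b\<^sup>2) * (ennreal ((g k x - 0)\<^sup>2) * indicator (frontier \<Omega>) x) \<partial>?H)"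
      proof (rule nn_integral_mono)
        fix x
        have "(w k x - 0)\<^sup>2 \<le> 2 * a\<^sup>2 * (f k x - 0)\<^sup>2 + 2 * b\<^sup>2 * (g k x - 0)\<^sup>2"
          using sum_squares_bound[of "a * f k x" "b * g k x"]
          by (simp add: w_def power2_sum power_mult_distrib)
        then have "ennreal ((w k x - 0)\<^sup>2) \<le> ennreal (2 * a\<^sup>2 * (f k x - 0)\<^sup>2 + 2 * b\<^sup>2 * (g k x - 0)\<^sup>2)"
          by (rule ennreal_leI)
        also have "\<dots> = ennreal (2 * a\<^sup>2) * ennreal ((f k x - 0)\<^sup>2) + ennreal (2 * b\<^sup>2) * ennreal ((g k x - 0)\<^sup>2)"
          by (simp add: ennreal_plus ennreal_mult)
        finally show "ennreal ((w k x - 0)\<^sup>2) * indicator (frontier \<Omega>) x \<le>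
          ennreal (2 * a\<^sup>2) * (ennreal ((f k x - 0)\<^sup>2) * indicator (frontier \<Omega>) x) +
          ennreal (2 * b\<^sup>2) * (ennreal ((g k x - 0)\<^sup>2) * indicator (frontier \<Omega>) x)"
          by (cases "x \<in> frontier \<Omega>") auto
      qed
      also have "\<dots> = ennreal (2 * a\<^sup>2) * (\<integral>\<^sup>+x\<in>frontier \<Omega>. ennreal ((f k x - 0)\<^sup>2) \<partial>?H) +
        ennreal (2 * b\<^sup>2) * (\<integral>\<^sup>+x\<in>frontier \<Omega>. ennreal ((g k x - 0)\<^sup>2) \<partial>?H)"
      proof -
        have m: "(\<lambda>x. ennreal ((F x - 0)\<^sup>2) * indicator (frontier \<Omega>) x) \<in> borel_measurable ?H"
          if "F \<in> borel_measurable borel" for F :: "real^'n \<Rightarrow> real"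
        proof -
          have [measurable]: "frontier \<Omega> \<in> sets borel" by (rule borel_closed) simp
          show ?thesis using that by simp
        qed
        show ?thesis
          by (subst nn_integral_add; (intro borel_measurable_times_ennreal m borel_measurable_const)?)
            (auto simp: nn_integral_cmult m)
      qed
      finally show ?thesis .
    qed
    have "(\<lambda>k. ennreal (2 * a\<^sup>2) * (\<integral>\<^sup>+x\<in>frontier \<Omega>. ennreal ((f k x - 0)\<^sup>2) \<partial>?H) +
      ennreal (2 * b\<^sup>2) * (\<integral>\<^sup>+x\<in>frontier \<Omega>. ennreal ((g k x - 0)\<^sup>2) \<partial>?H)) \<longlonglongrightarrow> ennreal (2 * a\<^sup>2) * 0 + ennreal (2 * b\<^sup>2) * 0"
      by (rule tendsto_add[OF ennreal_tendsto_cmult[OF _ f(3)] ennreal_tendsto_cmult[OF _ g(3)]])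
        (rule ennreal_less_top)+
    then have lim2: "(\<lambda>k. ennreal (2 * a\<^sup>2) * (\<integral>\<^sup>+x\<in>frontier \<Omega>. ennreal ((f k x - 0)\<^sup>2) \<partial>?H) +
      ennreal (2 * b\<^sup>2) * (\<integral>\<^sup>+x\<in>frontier \<Omega>. ennreal ((g k x - 0)\<^sup>2) \<partial>?H)) \<longlonglongrightarrow> 0"
      by (simp only: mult_zero_right add_0)
    show "(\<lambda>k. \<integral>\<^sup>+x\<in>frontier \<Omega>. ennreal ((w k x - 0)\<^sup>2) \<partial>?H) \<longlonglongrightarrow> 0"
      by (rule tendsto_sandwich[OF always_eventually always_eventually tendsto_const lim2])
        (simp_all only: le2 zero_le simp_thms)
  qed
  moreover have "(\<lambda>x. a * u x + b * v x) \<in> sobolev 1 2 \<Omega>" by (rule sobolev_lincomb(1)[OF \<Omega> two us vs])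
  ultimately show ?thesis by (simp add: H10_def)
qed

section \<open>Essential supports\<close>

lemma ess_supp_mono:
  fixes f g :: "'a::euclidean_space \<Rightarrow> real"
  assumes \<Omega>: "open \<Omega>" and ae: "AE x in lebesgue_on \<Omega>. g x = 0 \<longrightarrow> f x = 0"
  shows "ess_supp \<Omega> f \<subseteq> ess_supp \<Omega> g"
proof
  fix x assume x: "x \<in> ess_supp \<Omega> f"
  have "\<not> ae_eq (\<Omega> \<inter> U) g 0" if U: "open U" "x \<in> U" for U
  proof
    assume "ae_eq (\<Omega> \<inter> U) g 0"
    then have g: "AE x in lebesgue_on (\<Omega> \<inter> U). g x = 0" by (simp add: ae_eq_def)
    have "AE x in lebesgue_on (\<Omega> \<inter> U). g x = 0 \<longrightarrow> f x = 0"
      by (rule AE_lebesgue_on_subset[OF ae]) (use \<Omega> U in auto)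
    with g have "AE x in lebesgue_on (\<Omega> \<inter> U). f x = 0" by eventually_elim simp
    then have "ae_eq (\<Omega> \<inter> U) f 0" by (simp add: ae_eq_def)
    then show False using x U by (auto simp: ess_supp_def)
  qed
  then show "x \<in> ess_supp \<Omega> g" using x by (auto simp: ess_supp_def)
qed

lemma ess_supp_subset: "ess_supp \<Omega> f \<subseteq> \<Omega>"
  by (auto simp: ess_supp_def)

lemma ess_supp_borel: "open \<Omega> \<Longrightarrow> ess_supp \<Omega> f \<in> sets borel"
proof -
  assume \<Omega>: "open \<Omega>"
  have "ess_supp \<Omega> f = \<Omega> - \<Union>{U. open U \<and> ae_eq (\<Omega> \<inter> U) f 0}" by (auto simp: ess_supp_def)
  moreover have "open (\<Union>{U. open U \<and> ae_eq (\<Omega> \<inter> U) f 0})" by (rule open_Union) simp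
  ultimately show ?thesis using \<Omega> by (metis borel_open sets.Diff)
qed

text \<open>(B2) asks for an open set, whereas an essential support is only relatively closed. Outer
  regularity supplies an open set at the cost of at most another \<open>m\<close>, hence the factor
  2 and the positive bound \<open>m\<close>.\<close>

lemma ess_supp_open_cover:
  fixes f :: "'a::euclidean_space \<Rightarrow> real"
  assumes \<Omega>: "open \<Omega>" "bounded \<Omega>" and m: "measure lebesgue (ess_supp \<Omega> f) \<le> m" "0 < m"
  shows "\<exists>R. open R \<and> R \<subseteq> \<Omega> \<and> ess_supp \<Omega> f \<subseteq> R \<and> measure lebesgue R \<le> 2 * m"
proof -
  let ?S = "ess_supp \<Omega> f"
  have S: "?S \<in> sets lebesgue" using ess_supp_borel[OF \<Omega>(1), of f] by auto
  obtain T where T: "open T" "?S \<subseteq> T" "T - ?S \<in> lmeasurable" "emeasure lebesgue (T - ?S) < ennreal m"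
    by (rule sets_lebesgue_outer_open[OF S m(2)])
  have lm: "\<Omega> \<inter> T \<in> lmeasurable" "?S \<in> lmeasurable"
  proof -
    show "\<Omega> \<inter> T \<in> lmeasurable" using \<Omega> T(1) by (intro lmeasurable_open) (auto intro: bounded_subset)
    show "?S \<in> lmeasurable" using S \<Omega>(2) ess_supp_subset[of \<Omega> f]
      by (intro bounded_set_imp_lmeasurable) (auto intro: bounded_subset)
  qed
  have "measure lebesgue (\<Omega> \<inter> T) \<le> measure lebesgue (?S \<union> (T - ?S))"
  proof (rule measure_mono_fmeasurable)
    show "?S \<union> (T - ?S) \<in> lmeasurable" using lm(2) T(3) by (rule fmeasurable.Un)
    show "\<Omega> \<inter> T \<in> sets lebesgue" using lm(1) by (rule fmeasurableD)
  qed auto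
  also have "\<dots> \<le> measure lebesgue ?S + measure lebesgue (T - ?S)"
    by (rule measure_Un_le[OF fmeasurableD[OF lm(2)] fmeasurableD[OF T(3)]])
  also have "measure lebesgue (T - ?S) \<le> m"
  proof -
    have "emeasure lebesgue (T - ?S) = ennreal (measure lebesgue (T - ?S))" using T(3) by (rule emeasure_eq_measure2)
    then show ?thesis using T(4) m(2) by (simp add: ennreal_less_iff)
  qed
  finally have "measure lebesgue (\<Omega> \<inter> T) \<le> 2 * m" using m(1) by simp
  moreover have "ess_supp \<Omega> f \<subseteq> \<Omega> \<inter> T" using T(2) ess_supp_subset[of \<Omega> f] by blast
  moreover have "open (\<Omega> \<inter> T)" using \<Omega>(1) T(1) by (rule open_Int)
  ultimately show ?thesis by (intro exI[of _ "\<Omega> \<inter> T"]) simp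
qed

text \<open>Only countably many values of \<open>t\<close> are attained by \<open>- v / b\<close> on a set of positive measure; for all others
  \<open>v + t b\<close> vanishes only where both functions do.\<close>

lemma exists_generic_combination:
  fixes v b :: "'a::euclidean_space \<Rightarrow> real"
  assumes \<Omega>: "\<Omega> \<in> lmeasurable" and v: "v \<in> borel_measurable (lebesgue_on \<Omega>)" and b: "b \<in> borel_measurable (lebesgue_on \<Omega>)"
  shows "\<exists>t. AE x in lebesgue_on \<Omega>. v x + t * b x = 0 \<longrightarrow> v x = 0 \<and> b x = 0"
proof -
  define \<rho> where "\<rho> x = - v x / b x" for x
  have \<rho>m: "\<rho> \<in> borel_measurable (lebesgue_on \<Omega>)" unfolding \<rho>_def using v b by measurable
  interpret finite_measure "lebesgue_on \<Omega>" using \<Omega> by (rule finite_measure_lebesgue_on)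
  interpret D: finite_measure "distr (lebesgue_on \<Omega>) borel \<rho>" by (rule finite_measure_distr[OF \<rho>m])
  have "countable (insert 0 {t. measure (distr (lebesgue_on \<Omega>) borel \<rho>) {t} \<noteq> 0})"
    by (rule countable_insert[OF D.countable_support])
  then have "insert 0 {t. measure (distr (lebesgue_on \<Omega>) borel \<rho>) {t} \<noteq> 0} \<noteq> UNIV"
    using uncountable_UNIV_real by metis
  then obtain t where t: "t \<noteq> 0" "measure (distr (lebesgue_on \<Omega>) borel \<rho>) {t} = 0" by auto
  have "measure (lebesgue_on \<Omega>) (\<rho> -` {t} \<inter> \<Omega>) = 0"
    using t(2) by (subst (asm) measure_distr[OF \<rho>m]) auto
  then have "emeasure (lebesgue_on \<Omega>) (\<rho> -` {t} \<inter> \<Omega>) = 0" by (simp add: emeasure_eq_measure)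
  moreover have "\<rho> -` {t} \<inter> \<Omega> \<in> sets (lebesgue_on \<Omega>)" using measurable_sets[OF \<rho>m, of "{t}"] by simp
  ultimately have "AE x in lebesgue_on \<Omega>. x \<notin> \<rho> -` {t} \<inter> \<Omega>" by (intro AE_not_in null_setsI)
  then have "AE x in lebesgue_on \<Omega>. v x + t * b x = 0 \<longrightarrow> v x = 0 \<and> b x = 0"
  proof (rule AE_mp, intro AE_I2 impI)
    fix x assume x: "x \<in> space (lebesgue_on \<Omega>)" "x \<notin> \<rho> -` {t} \<inter> \<Omega>" "v x + t * b x = 0"
    have "b x = 0"
    proof (rule ccontr)
      assume "b x \<noteq> 0"
      then have "\<rho> x = t" using x(3) by (simp add: \<rho>_def field_simps)
      then show False using x(1,2) by simp
    qed
    then show "v x = 0 \<and> b x = 0" using x(3) by simp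
  qed
  then show ?thesis ..
qed

text \<open>Elements of \<open>B\<close> are absorbed one after the other, each by adding a generic
  multiple. Closure of \<open>F\<close> is asked only up to null sets because the defects
  \<open>w - T w\<close> satisfy linearity only in that sense.\<close>

lemma exists_generic_element:
  fixes F :: "('a::euclidean_space \<Rightarrow> real) set"
  assumes \<Omega>: "\<Omega> \<in> lmeasurable" and F: "F \<noteq> {}" "\<And>f. f \<in> F \<Longrightarrow> f \<in> borel_measurable (lebesgue_on \<Omega>)"
    and lin: "\<And>f g t. f \<in> F \<Longrightarrow> g \<in> F \<Longrightarrow> \<exists>h\<in>F. AE x in lebesgue_on \<Omega>. h x = f x + t * g x"
    and B: "finite B" "B \<subseteq> F"
  shows "\<exists>v\<in>F. \<forall>b\<in>B. AE x in lebesgue_on \<Omega>. v x = 0 \<longrightarrow> b x = 0"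
  using B
proof (induction B rule: finite_induct)
  case empty
  then show ?case using F(1) by auto
next
  case (insert b B)
  then obtain v where v: "v \<in> F" "\<forall>b\<in>B. AE x in lebesgue_on \<Omega>. v x = 0 \<longrightarrow> b x = 0" by auto
  have b: "b \<in> F" using insert.prems by simp
  obtain t where t: "AE x in lebesgue_on \<Omega>. v x + t * b x = 0 \<longrightarrow> v x = 0 \<and> b x = 0"
    using exists_generic_combination[OF \<Omega> F(2)[OF v(1)] F(2)[OF b]] ..
  obtain h where h: "h \<in> F" "AE x in lebesgue_on \<Omega>. h x = v x + t * b x" using lin[OF v(1) b, of t] ..
  have hv: "AE x in lebesgue_on \<Omega>. h x = 0 \<longrightarrow> v x = 0 \<and> b x = 0"
    using h(2) t by eventually_elim simp
  show ?case
  proof (intro bexI[OF _ h(1)] ballI)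
    fix c assume c: "c \<in> insert b B"
    show "AE x in lebesgue_on \<Omega>. h x = 0 \<longrightarrow> c x = 0"
    proof (cases "c = b")
      case True
      show ?thesis using hv unfolding True by eventually_elim simp
    next
      case False
      then have "AE x in lebesgue_on \<Omega>. v x = 0 \<longrightarrow> c x = 0" using c v(2) by simp
      with hv show ?thesis by eventually_elim simp
    qed
  qed
qed

lemma Lp_norm_eq_0_imp:
  assumes p: "1 \<le> p" and f: "f \<in> Lp_space p S" and 0: "Lp_norm p S f = 0"
  shows "AE x in lebesgue_on S. f x = 0"
proof (cases p)
  case PInf
  have "AE x in lebesgue_on S. \<bar>f x\<bar> \<le> 0" using AE_le_Lp_norm_infinity[of f S] f 0 PInf by simp
  then show ?thesis by eventually_elim simp
next
  case (real s)
  then have s: "1 \<le> s" using p by simp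
  have i: "integrable (lebesgue_on S) (\<lambda>x. \<bar>f x\<bar> powr s)" using f real by (simp add: Lp_space_def)
  have "(\<integral>x. \<bar>f x\<bar> powr s \<partial>lebesgue_on S) = 0" using Lp_norm_powr[of s S f] 0 s real by simp
  then have "AE x in lebesgue_on S. \<bar>f x\<bar> powr s = 0"
    by (subst (asm) integral_nonneg_eq_0_iff_AE[OF i]) auto
  then show ?thesis by eventually_elim simp
qed (use p in auto)

section \<open>Sums of discrete spaces and the support of all defects\<close>

lemma function_space_plus:
  assumes "function_space \<Omega> A" "function_space \<Omega> B"
  shows "function_space \<Omega> (A + B)"
  unfolding function_space_def
proof (intro conjI ballI allI impI)
  have "0 + 0 \<in> A + B" using assms unfolding function_space_def by (intro set_plus_intro) blast+
  then show "0 \<in> A + B" by simp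
next
  fix f g assume "f \<in> A + B" "g \<in> A + B"
  then obtain a b c d where f: "f = a + b" "a \<in> A" "b \<in> B" and g: "g = c + d" "c \<in> A" "d \<in> B"
    by (elim set_plus_elim)
  have "(a + c) + (b + d) \<in> A + B"
    using assms f(2,3) g(2,3) unfolding function_space_def by (intro set_plus_intro) simp_all
  then show "f + g \<in> A + B" by (simp only: f(1) g(1) ac_simps)
next
  fix c :: real and f assume "f \<in> A + B"
  then obtain a b where f: "f = a + b" "a \<in> A" "b \<in> B" by (elim set_plus_elim)
  have "(\<lambda>x. c * a x) + (\<lambda>x. c * b x) \<in> A + B"
    using assms f(2,3) unfolding function_space_def by (intro set_plus_intro) simp_all
  moreover have "(\<lambda>x. c * a x) + (\<lambda>x. c * b x) = (\<lambda>x. c * f x)"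
    by (simp add: f(1) fun_eq_iff distrib_left)
  ultimately show "(\<lambda>x. c * f x) \<in> A + B" by simp
next
  fix f g assume "f \<in> A + B" and ae: "ae_eq \<Omega> f g"
  then obtain a b where f: "f = a + b" "a \<in> A" "b \<in> B" by (elim set_plus_elim)
  \<comment> \<open>The change on a null set is moved into the second summand, which is closed under
    such changes.\<close>
  have "ae_eq \<Omega> b (g - a)" using ae unfolding ae_eq_def f(1) by eventually_elim simp
  then have "g - a \<in> B" using assms(2) f(3) unfolding function_space_def by simp
  then have "a + (g - a) \<in> A + B" by (rule set_plus_intro[OF f(2)])
  then show "g \<in> A + B" by simp
qed

text \<open>The element \<open>v\<close> is a generic linear combination of a finite spanning set.\<close>

lemma exists_maximal_defect_support:
  fixes A B :: "('a::euclidean_space \<Rightarrow> real) set"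
  assumes \<Omega>: "open \<Omega>" "bounded \<Omega>" and p: "1 \<le> p"
    and A: "finite_dimensional_space \<Omega> A" "A \<subseteq> Lp_space p \<Omega>"
    and B: "finite_dimensional_space \<Omega> B" "B \<subseteq> Lp_space p \<Omega>"
    and lin: "linear_map_on \<Omega> (A + B) T"
    and T: "\<forall>w\<in>A + B. T w \<in> Lp_space p \<Omega>"
    and bdd: "\<forall>w\<in>A + B. Lp_norm p \<Omega> (T w) \<le> C * Lp_norm p \<Omega> w"
  shows "\<exists>v\<in>A + B. (\<Union>w\<in>A + B. ess_supp \<Omega> (w - T w)) \<subseteq> ess_supp \<Omega> (v - T v)"
proof -
  let ?L = "lebesgue_on \<Omega>"
  define W where "W = A + B"
  have s: "\<Omega> \<in> sets lebesgue" and lm: "\<Omega> \<in> lmeasurable" using \<Omega> by (auto intro: lmeasurable_open)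
  have fsA: "function_space \<Omega> A" and fsB: "function_space \<Omega> B"
    using A(1) B(1) by (auto simp: finite_dimensional_space_def)
  have fsW: "function_space \<Omega> W" unfolding W_def by (rule function_space_plus[OF fsA fsB])
  have W0: "0 \<in> W" and Wadd: "\<And>f g. f \<in> W \<Longrightarrow> g \<in> W \<Longrightarrow> f + g \<in> W"
    and Wscale: "\<And>c f. f \<in> W \<Longrightarrow> (\<lambda>x. c * f x) \<in> W"
    using fsW by (simp_all add: function_space_def)
  have 0: "0 \<in> A" "0 \<in> B" using fsA fsB by (simp_all add: function_space_def)
  have AW: "f \<in> W" if "f \<in> A" for f using set_plus_intro[OF that 0(2)] by (simp add: W_def)
  have BW: "f \<in> W" if "f \<in> B" for f using set_plus_intro[OF 0(1) that] by (simp add: W_def)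
  have Tadd: "AE x in ?L. T (f + g) x = T f x + T g x" if "f \<in> W" "g \<in> W" for f g
    using lin that by (simp add: linear_map_on_def W_def ae_eq_def)
  have Tscale: "AE x in ?L. T (\<lambda>x. c * f x) x = c * T f x" if "f \<in> W" for f c
    using lin that by (simp add: linear_map_on_def W_def ae_eq_def)
  have WLp: "f \<in> Lp_space p \<Omega>" if f: "f \<in> W" for f
  proof -
    obtain a b where ab: "f = a + b" "a \<in> A" "b \<in> B" using f unfolding W_def by (elim set_plus_elim)
    have "(\<lambda>x. 1 * a x + 1 * b x) \<in> Lp_space p \<Omega>" using ab A(2) B(2) by (intro Lp_lincomb(1)[OF p]) auto
    moreover have "(\<lambda>x. 1 * a x + 1 * b x) = f" by (simp add: ab(1) fun_eq_iff)
    ultimately show ?thesis by simp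
  qed
  \<comment> \<open>Linearity on representatives does not say that \<open>T\<close> respects almost
    everywhere equality; the norm bound supplies this.\<close>
  have Tnull: "AE x in ?L. T f x = 0" if f: "f \<in> W" "AE x in ?L. 0 = f x" for f
  proof -
    have "Lp_norm p \<Omega> f = 0" using Lp_space_cong_AE(2)[OF s f(2) zero_in_Lp_space[of p]] p
      Lp_norm_zero[of p \<Omega>] by (simp add: less_le_trans[OF _ p])
    then have "Lp_norm p \<Omega> (T f) \<le> 0" using bdd f(1) by (metis W_def mult_zero_right)
    then have "Lp_norm p \<Omega> (T f) = 0" by (simp add: order_antisym)
    moreover have "T f \<in> Lp_space p \<Omega>" using T f(1) by (simp add: W_def)
    ultimately show ?thesis by (intro Lp_norm_eq_0_imp[OF p])
  qed
  define D where "D f = f - T f" for f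
  obtain BA where BA: "finite BA" "BA \<subseteq> A" "\<forall>f\<in>A. \<exists>c. ae_eq \<Omega> f (\<lambda>x. \<Sum>b\<in>BA. c b * b x)"
    using A(1) unfolding finite_dimensional_space_def by (elim conjE exE)
  obtain BB where BB: "finite BB" "BB \<subseteq> B" "\<forall>f\<in>B. \<exists>c. ae_eq \<Omega> f (\<lambda>x. \<Sum>b\<in>BB. c b * b x)"
    using B(1) unfolding finite_dimensional_space_def by (elim conjE exE)
  have "\<exists>d\<in>D ` W. \<forall>b\<in>D ` (BA \<union> BB). AE x in ?L. d x = 0 \<longrightarrow> b x = 0"
  proof (rule exists_generic_element[OF lm])
    show "D ` W \<noteq> {}" using W0 by blast
    show "f \<in> borel_measurable ?L" if f: "f \<in> D ` W" for f
    proof -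
      obtain w where w: "w \<in> W" "f = D w" using f by (elim imageE)
      have "w \<in> borel_measurable ?L" "T w \<in> borel_measurable ?L"
        using WLp[OF w(1)] T w(1) by (simp_all add: Lp_space_def W_def)
      then have "(\<lambda>x. w x - T w x) \<in> borel_measurable ?L" by (rule borel_measurable_diff)
      moreover have "(\<lambda>x. w x - T w x) = f" by (simp add: w(2) D_def fun_eq_iff)
      ultimately show ?thesis by simp
    qed
    show "\<exists>h\<in>D ` W. AE x in ?L. h x = f x + t * g x" if fg: "f \<in> D ` W" "g \<in> D ` W" for f g t
    proof -
      obtain v where v: "v \<in> W" "f = D v" using fg(1) by (elim imageE)
      obtain w where w: "w \<in> W" "g = D w" using fg(2) by (elim imageE)
      have tw: "(\<lambda>x. t * w x) \<in> W" by (rule Wscale[OF w(1)])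
      have "AE x in ?L. D (v + (\<lambda>x. t * w x)) x = f x + t * g x"
        using Tadd[OF v(1) tw] Tscale[OF w(1), of t]
        by eventually_elim (simp add: D_def v(2) w(2) algebra_simps)
      moreover have "D (v + (\<lambda>x. t * w x)) \<in> D ` W" by (rule imageI[OF Wadd[OF v(1) tw]])
      ultimately show ?thesis by (rule bexI[rotated -1, rotated])
    qed
    show "finite (D ` (BA \<union> BB))" using BA(1) BB(1) by simp
    show "D ` (BA \<union> BB) \<subseteq> D ` W" using BA(2) BB(2) AW BW by (intro image_mono) auto
  qed
  then obtain v where v: "v \<in> W" "\<forall>b\<in>BA \<union> BB. AE x in ?L. D v x = 0 \<longrightarrow> D b x = 0"
    by (elim bexE imageE) simp
  \<comment> \<open>The functions whose defect vanishes where that of \<open>v\<close> does. This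
    set is closed under linear combinations and under changes on null sets and contains both
    spanning sets, so it is all of \<open>W\<close>.\<close>
  define K where "K = {w \<in> W. AE x in ?L. D v x = 0 \<longrightarrow> D w x = 0}"
  have Kcomb: "(\<lambda>x. f x + c * g x) \<in> K" if f: "f \<in> K" and g: "g \<in> K" for f g c
  proof -
    have fW: "f \<in> W" and gW: "(\<lambda>x. c * g x) \<in> W" and g': "g \<in> W" using f g Wscale by (auto simp: K_def)
    have e: "(\<lambda>x. f x + c * g x) = f + (\<lambda>x. c * g x)" by (simp add: fun_eq_iff)
    have "AE x in ?L. D v x = 0 \<longrightarrow> D f x = 0" "AE x in ?L. D v x = 0 \<longrightarrow> D g x = 0"
      using f g by (simp_all add: K_def)
    then have "AE x in ?L. D v x = 0 \<longrightarrow> D (f + (\<lambda>x. c * g x)) x = 0"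
      using Tadd[OF fW gW] Tscale[OF g', of c]
      by eventually_elim (auto simp: D_def algebra_simps)
    then show ?thesis unfolding e using Wadd[OF fW gW] by (simp add: K_def)
  qed
  have Kae: "g \<in> K" if f: "f \<in> K" and g: "g \<in> W" "ae_eq \<Omega> g f" for f g
  proof -
    have fW: "f \<in> W" using f by (simp add: K_def)
    define n where "n = g + (\<lambda>x. (-1) * f x)"
    have nW: "n \<in> W" unfolding n_def by (rule Wadd[OF g(1) Wscale[OF fW]])
    have n0: "AE x in ?L. 0 = n x" using g(2) unfolding ae_eq_def n_def by eventually_elim simp
    have "AE x in ?L. D v x = 0 \<longrightarrow> D f x = 0" using f by (simp add: K_def)
    moreover have "AE x in ?L. T g x = T n x + T f x"
    proof -
      have "n + f = g" by (simp add: n_def fun_eq_iff)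
      then show ?thesis using Tadd[OF nW fW] by simp
    qed
    moreover have "AE x in ?L. T n x = 0" by (rule Tnull[OF nW n0])
    moreover have "AE x in ?L. g x = f x" using g(2) by (simp add: ae_eq_def)
    ultimately have "AE x in ?L. D v x = 0 \<longrightarrow> D g x = 0" by eventually_elim (auto simp: D_def)
    then show ?thesis using g(1) by (simp add: K_def)
  qed
  have K0: "(\<lambda>x. 0) \<in> K"
  proof -
    have z: "(\<lambda>x. 0) = (0 :: 'a \<Rightarrow> real)" by (simp add: fun_eq_iff)
    have "AE x in ?L. T 0 x = 0" by (rule Tnull[OF W0]) simp
    then have "AE x in ?L. D v x = 0 \<longrightarrow> D 0 x = 0" by eventually_elim (simp add: D_def)
    then show ?thesis unfolding z using W0 by (simp add: K_def)
  qed
  have Ksum: "(\<lambda>x. \<Sum>b\<in>S. c b * b x) \<in> K" if "finite S" "S \<subseteq> K" for S c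
    using that
  proof (induction S rule: finite_induct)
    case (insert b S)
    have "(\<lambda>x. (\<Sum>b\<in>S. c b * b x) + c b * b x) \<in> K"
      by (rule Kcomb) (use insert in auto)
    then show ?case using insert.hyps by (simp add: add.commute)
  qed (simp add: K0)
  have Kbasis: "BA \<subseteq> K" "BB \<subseteq> K" using v(2) BA(2) BB(2) AW BW by (auto simp: K_def)
  have "w \<in> K" if w: "w \<in> W" for w
  proof -
    obtain a b where ab: "w = a + b" "a \<in> A" "b \<in> B" using w unfolding W_def by (elim set_plus_elim)
    obtain ca where ca: "ae_eq \<Omega> a (\<lambda>x. \<Sum>b\<in>BA. ca b * b x)" using BA(3)[rule_format, OF ab(2)] ..
    obtain cb where cb: "ae_eq \<Omega> b (\<lambda>x. \<Sum>b\<in>BB. cb b * b x)" using BB(3)[rule_format, OF ab(3)] ..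
    have "a \<in> K" by (rule Kae[OF Ksum[OF BA(1) Kbasis(1)] AW[OF ab(2)] ca])
    moreover have "b \<in> K" by (rule Kae[OF Ksum[OF BB(1) Kbasis(2)] BW[OF ab(3)] cb])
    ultimately have "(\<lambda>x. a x + 1 * b x) \<in> K" by (rule Kcomb)
    moreover have "(\<lambda>x. a x + 1 * b x) = w" by (simp add: ab(1) fun_eq_iff)
    ultimately show ?thesis by simp
  qed
  then have "ess_supp \<Omega> (D w) \<subseteq> ess_supp \<Omega> (D v)" if "w \<in> W" for w
    using that by (intro ess_supp_mono[OF \<Omega>(1)]) (simp add: K_def)
  then show ?thesis using v(1) unfolding W_def D_def by (intro bexI[of _ v] UN_least) simp_all
qed

section \<open>Energy and duality estimates\<close>

lemma sobolev_diff:
  fixes u v :: "real^'n \<Rightarrow> real"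
  assumes \<Omega>: "open \<Omega>" and p: "1 \<le> p" and u: "u \<in> sobolev k p \<Omega>" and v: "v \<in> sobolev k p \<Omega>"
  shows "u - v \<in> sobolev k p \<Omega>"
    and "sobolev_norm k p \<Omega> (u - v) \<le>
      2 * real (card {\<alpha> :: 'n \<Rightarrow> nat. mi_order \<alpha> \<le> k}) * (sobolev_norm k p \<Omega> u + sobolev_norm k p \<Omega> v)"
proof -
  have e: "u - v = (\<lambda>x. 1 * u x + (-1) * v x)" by (simp add: fun_eq_iff)
  show "u - v \<in> sobolev k p \<Omega>" unfolding e by (rule sobolev_lincomb(1)[OF \<Omega> p u v])
  show "sobolev_norm k p \<Omega> (u - v) \<le>
      2 * real (card {\<alpha> :: 'n \<Rightarrow> nat. mi_order \<alpha> \<le> k}) * (sobolev_norm k p \<Omega> u + sobolev_norm k p \<Omega> v)"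
    unfolding e using sobolev_lincomb(2)[OF \<Omega> p u v, of 1 "-1"] by (simp add: algebra_simps)
qed

lemma H10_diff:
  fixes u v :: "real^'n \<Rightarrow> real"
  assumes "open \<Omega>" "u \<in> H10 \<Omega>" "v \<in> H10 \<Omega>"
  shows "u - v \<in> H10 \<Omega>"
proof -
  have "u - v = (\<lambda>x. 1 * u x + (-1) * v x)" by (simp add: fun_eq_iff)
  then show ?thesis using H10_lincomb[OF assms, of 1 "-1"] by simp
qed

lemma bilinear_form_on_H10_diff:
  fixes u v w :: "real^'n \<Rightarrow> real"
  assumes \<Omega>: "open \<Omega>" and a: "bilinear_form_on (H10 \<Omega>) a"
    and u: "u \<in> H10 \<Omega>" and v: "v \<in> H10 \<Omega>" and w: "w \<in> H10 \<Omega>"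
  shows "a (u - v) w = a u w - a v w" "a w (u - v) = a w u - a w v"
proof -
  have d: "u - v \<in> H10 \<Omega>" by (rule H10_diff[OF \<Omega> u v])
  have e: "(u - v) + v = u" by simp
  show "a (u - v) w = a u w - a v w" "a w (u - v) = a w u - a w v"
    using a[unfolded bilinear_form_on_def, THEN conjunct1, rule_format, OF d v w] unfolding e by simp_all
qed

text \<open>Two separate exponents, because the uses differ: in the energy estimate both arguments
  gain from the small set, while in the duality estimate the second one is measured in H^1 and keeps
  its approximation order.\<close>

lemma local_continuity_small_support:
  fixes v w :: "real^'n \<Rightarrow> real" and r s :: ereal
  assumes \<Omega>: "open \<Omega>" "bounded \<Omega>" and a: "local_continuity \<Omega> V C a" "0 \<le> C"
    and r: "2 \<le> r" and v: "v \<in> V" "v \<in> sobolev 1 r \<Omega>"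
    and s: "2 \<le> s" and w: "w \<in> V" "w \<in> sobolev 1 s \<Omega>"
    and m: "measure lebesgue (ess_supp \<Omega> w) \<le> m" "0 < m"
  defines "n \<equiv> real (card {\<alpha> :: 'n \<Rightarrow> nat. mi_order \<alpha> \<le> 1})"
  shows "\<bar>a v w\<bar> \<le> C * (n * ((2 * m) powr (1 / 2 - real_of_ereal (1 / r)) * sobolev_norm 1 r \<Omega> v)) *
    (n * ((2 * m) powr (1 / 2 - real_of_ereal (1 / s)) * sobolev_norm 1 s \<Omega> w))"
proof -
  obtain R where R: "open R" "R \<subseteq> \<Omega>" "ess_supp \<Omega> w \<subseteq> R" "measure lebesgue R \<le> 2 * m"
    using ess_supp_open_cover[OF \<Omega> m] by (elim exE conjE)
  have bR: "bounded R" using \<Omega>(2) R(2) by (rule bounded_subset)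
  have bd: "sobolev_norm 1 2 R f \<le> n * ((2 * m) powr (1 / 2 - real_of_ereal (1 / t)) * sobolev_norm 1 t \<Omega> f)"
    if t: "2 \<le> t" and f: "f \<in> sobolev 1 t \<Omega>" for t f
  proof -
    \<comment> \<open>The power of the measure has a nonnegative exponent, so the measure of
      \<open>R\<close> may be replaced by its upper bound.\<close>
    have "real_of_ereal (1 / t) \<le> 1 / 2"
    proof (cases t)
      case (real x)
      then have "2 \<le> x" using t by simp
      then show ?thesis using real by (simp add: field_simps one_ereal_def)
    qed (use t in auto)
    then have "measure lebesgue R powr (1 / 2 - real_of_ereal (1 / t)) \<le> (2 * m) powr (1 / 2 - real_of_ereal (1 / t))"
      using R(4) by (intro powr_mono2) auto
    moreover have "sobolev_norm 1 (ereal 2) R f \<le> n * (measure lebesgue R powr (1 / 2 - real_of_ereal (1 / t)) * sobolev_norm 1 t \<Omega> f)"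
      unfolding n_def by (rule sobolev_norm_restrict[OF \<Omega>(1) R(1,2) bR]) (use t f in auto)
    ultimately have "sobolev_norm 1 (ereal 2) R f \<le> n * ((2 * m) powr (1 / 2 - real_of_ereal (1 / t)) * sobolev_norm 1 t \<Omega> f)"
      using mult_left_mono[OF mult_right_mono[OF _ sobolev_norm_nonneg], of _ _ n 1 t \<Omega> f]
      by (smt (verit) n_def of_nat_0_le_iff)
    then show ?thesis by simp
  qed
  have "\<bar>a v w\<bar> \<le> C * sobolev_norm 1 2 R v * sobolev_norm 1 2 R w"
    using a(1) R v(1) w(1) unfolding local_continuity_def by simp
  also have "\<dots> \<le> C * (n * ((2 * m) powr (1 / 2 - real_of_ereal (1 / r)) * sobolev_norm 1 r \<Omega> v)) *
    (n * ((2 * m) powr (1 / 2 - real_of_ereal (1 / s)) * sobolev_norm 1 s \<Omega> w))"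
    by (intro mult_mono mult_left_mono bd[OF r v(2)] bd[OF s w(2)] mult_nonneg_nonneg a(2)) (auto simp: n_def)
  finally show ?thesis .
qed

text \<open>\<open>P\<close> is the common test function. Everything is multiplied by h^2, which
  compensates the negative powers of h from the inverse estimates and matches the factor h that
  accompanies the H^1 norm in the duality estimate. The powers are arranged as squares in view of
  the later square root.\<close>

lemma energy_estimate:
  fixes e1 e2 P :: "real^'n \<Rightarrow> real" and a ap :: "(real^'n \<Rightarrow> real) \<Rightarrow> (real^'n \<Rightarrow> real) \<Rightarrow> real"
    and \<eta> q :: ereal and \<mu> \<nu> :: nat
  assumes \<Omega>: "open \<Omega>" "bounded \<Omega>" and \<eta>: "2 \<le> \<eta>" and h: "0 < h" and \<nu>: "\<nu> \<in> {0, 1}"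
    and bil: "bilinear_form_on (H10 \<Omega>) ap"
    and coer: "\<forall>u\<in>H10 \<Omega>. \<alpha> * (sobolev_norm 1 2 \<Omega> u)\<^sup>2 \<le> ap u u"
    and loc: "local_continuity \<Omega> (H10 \<Omega>) CB ap" "0 \<le> CB"
    and e1: "e1 \<in> H10 \<Omega>" "e1 \<in> sobolev 1 \<eta> \<Omega>" and e2: "e2 \<in> H10 \<Omega>" "e2 \<in> sobolev 1 \<eta> \<Omega>"
    and P: "P \<in> H10 \<Omega>" "P \<in> sobolev 1 \<eta> \<Omega>"
    and orth: "ap e1 P = 0" "a e2 P = 0"
    and inv: "\<forall>m\<in>{0, 1}. sobolev_norm m \<eta> \<Omega> P \<le> C2 * h powr (- real m) * sobolev_norm 0 \<eta> \<Omega> P"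
    and stab: "sobolev_norm 0 \<eta> \<Omega> P \<le> C3 * sobolev_norm 0 \<eta> \<Omega> (e1 - e2)"
    and supp: "measure lebesgue (ess_supp \<Omega> ((e1 - e2) - P)) \<le> m" "0 < m"
    and pert: "\<bar>ap e2 P - a e2 P\<bar> \<le> C1 * h powr \<delta> * sobolev_norm \<mu> \<eta> \<Omega> e2 * sobolev_norm \<nu> q \<Omega> P"
    and emb: "sobolev_norm \<nu> q \<Omega> P \<le> Cq * sobolev_norm \<nu> \<eta> \<Omega> P"
    and nonneg: "0 \<le> C1" "0 \<le> C2" "0 \<le> C3" "0 \<le> Cq"
  defines "\<kappa> \<equiv> 2 * real (card {\<alpha> :: 'n \<Rightarrow> nat. mi_order \<alpha> \<le> 1})"
    and "H \<equiv> (2 * m) powr (1 / 2 - real_of_ereal (1 / \<eta>))"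
    and "T \<equiv> sobolev_norm 0 \<eta> \<Omega> e1 + sobolev_norm 0 \<eta> \<Omega> e2"
    and "Q \<equiv> h * (sobolev_norm 1 \<eta> \<Omega> e1 + sobolev_norm 1 \<eta> \<Omega> e2)"
  shows "\<alpha> * (h * sobolev_norm 1 2 \<Omega> (e1 - e2))\<^sup>2 \<le>
    (C1 * Cq * C2 * C3 * \<kappa>) * (h powr ((\<delta> + 2 - real \<mu> - real \<nu>) / 2))\<^sup>2 * ((h ^ \<mu> * sobolev_norm \<mu> \<eta> \<Omega> e2) * T)
    + (CB * \<kappa> ^ 5 * (1 + C2 * C3)) * H\<^sup>2 * (Q + T)\<^sup>2"
proof -
  define z where "z = e1 - e2"
  have \<eta>1: "1 \<le> \<eta>" using \<eta> by (rule order_trans[rotated]) simp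
  have card_le: "card {\<alpha> :: 'n \<Rightarrow> nat. mi_order \<alpha> \<le> 0} \<le> card {\<alpha> :: 'n \<Rightarrow> nat. mi_order \<alpha> \<le> 1}"
    by (rule card_mono[OF finite_multi_indices]) auto
  have "(\<lambda>_. 0) \<in> {\<alpha> :: 'n \<Rightarrow> nat. mi_order \<alpha> \<le> 1}" by (simp add: mi_order_def)
  then have "card {\<alpha> :: 'n \<Rightarrow> nat. mi_order \<alpha> \<le> 1} > 0"
    using finite_multi_indices[of 1, where 'n='n] by (auto simp: card_gt_0_iff)
  then have \<kappa>: "1 \<le> \<kappa>" unfolding \<kappa>_def by linarith
  have z: "z \<in> H10 \<Omega>" unfolding z_def by (rule H10_diff[OF \<Omega>(1) e1(1) e2(1)])
  have s0: "e1 \<in> sobolev 0 \<eta> \<Omega>" "e2 \<in> sobolev 0 \<eta> \<Omega>" using e1(2) e2(2) by (auto simp: sobolev_def)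
  have T0: "0 \<le> T" and Q0: "0 \<le> Q" using h by (simp_all add: T_def Q_def)
  define Z0 where "Z0 = sobolev_norm 0 \<eta> \<Omega> z"
  define Z1 where "Z1 = sobolev_norm 1 \<eta> \<Omega> z"
  have Zn: "0 \<le> Z0" "0 \<le> Z1" by (simp_all add: Z0_def Z1_def)
  have Z0: "Z0 \<le> \<kappa> * T"
  proof -
    have "Z0 \<le> 2 * real (card {\<alpha> :: 'n \<Rightarrow> nat. mi_order \<alpha> \<le> 0}) * T"
      unfolding Z0_def z_def T_def by (rule sobolev_diff(2)[OF \<Omega>(1) \<eta>1 s0])
    also have "\<dots> \<le> \<kappa> * T" unfolding \<kappa>_def using card_le T0 by (intro mult_right_mono) simp_all
    finally show ?thesis .
  qed
  have Z1: "h * Z1 \<le> \<kappa> * Q"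
  proof -
    have "Z1 \<le> \<kappa> * (sobolev_norm 1 \<eta> \<Omega> e1 + sobolev_norm 1 \<eta> \<Omega> e2)"
      unfolding Z1_def z_def \<kappa>_def by (rule sobolev_diff(2)[OF \<Omega>(1) \<eta>1 e1(2) e2(2)])
    then have "h * Z1 \<le> h * (\<kappa> * (sobolev_norm 1 \<eta> \<Omega> e1 + sobolev_norm 1 \<eta> \<Omega> e2))"
      using h by (intro mult_left_mono) simp_all
    then show ?thesis by (simp add: Q_def mult.left_commute)
  qed
  have z1: "z \<in> sobolev 1 \<eta> \<Omega>" unfolding z_def by (rule sobolev_diff(1)[OF \<Omega>(1) \<eta>1 e1(2) e2(2)])
  have zP: "z - P \<in> H10 \<Omega>" "z - P \<in> sobolev 1 \<eta> \<Omega>"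
    by (rule H10_diff[OF \<Omega>(1) z P(1)], rule sobolev_diff(1)[OF \<Omega>(1) \<eta>1 z1 P(2)])
  have P0: "sobolev_norm 0 \<eta> \<Omega> P \<le> C3 * Z0" using stab by (simp add: Z0_def z_def)
  have Pm: "sobolev_norm k \<eta> \<Omega> P \<le> C2 * h powr (- real k) * (C3 * Z0)" if "k \<in> {0, 1}" for k
    by (rule order_trans[OF inv[rule_format, OF that] mult_left_mono[OF P0]]) (use nonneg in simp)
  have split: "ap z z = ap z P + ap z (z - P)"
    using bilinear_form_on_H10_diff(2)[OF \<Omega>(1) bil z P(1) z] by simp
  define S where "S = h ^ \<mu> * sobolev_norm \<mu> \<eta> \<Omega> e2"
  have S0: "0 \<le> S" using h by (simp add: S_def)
  have first: "h\<^sup>2 * ap z P \<le> (C1 * Cq * C2 * C3 * \<kappa>) * (h powr ((\<delta> + 2 - real \<mu> - real \<nu>) / 2))\<^sup>2 * (S * T)"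
  proof -
    \<comment> \<open>Orthogonality of \<open>e1\<close> leaves only \<open>e2\<close>; since
      \<open>a e2 P\<close> vanishes too, it may be subtracted, and the perturbation of the forms
      appears.\<close>
    have "ap z P = - ap e2 P"
      unfolding z_def using bilinear_form_on_H10_diff(1)[OF \<Omega>(1) bil e1(1) e2(1) P(1)] orth(1) by simp
    then have "ap z P \<le> \<bar>ap e2 P - a e2 P\<bar>" using orth(2) by simp
    also have "\<dots> \<le> C1 * h powr \<delta> * sobolev_norm \<mu> \<eta> \<Omega> e2 * sobolev_norm \<nu> q \<Omega> P" by (rule pert)
    also have "\<dots> \<le> C1 * h powr \<delta> * sobolev_norm \<mu> \<eta> \<Omega> e2 * (Cq * (C2 * h powr (- real \<nu>) * (C3 * (\<kappa> * T))))"
    proof (rule mult_left_mono)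
      have "sobolev_norm \<nu> q \<Omega> P \<le> Cq * (C2 * h powr (- real \<nu>) * (C3 * Z0))"
        by (rule order_trans[OF emb mult_left_mono[OF Pm[OF \<nu>] nonneg(4)]])
      also have "\<dots> \<le> Cq * (C2 * h powr (- real \<nu>) * (C3 * (\<kappa> * T)))"
        using nonneg Z0 by (intro mult_left_mono) simp_all
      finally show "sobolev_norm \<nu> q \<Omega> P \<le> Cq * (C2 * h powr (- real \<nu>) * (C3 * (\<kappa> * T)))" .
    qed (use nonneg in simp)
    finally have "h\<^sup>2 * ap z P \<le> h\<^sup>2 * (C1 * h powr \<delta> * sobolev_norm \<mu> \<eta> \<Omega> e2 * (Cq * (C2 * h powr (- real \<nu>) * (C3 * (\<kappa> * T)))))"
      by (rule mult_left_mono) simp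
    also have "\<dots> = (C1 * Cq * C2 * C3 * \<kappa>) * (h\<^sup>2 * h powr \<delta> * h powr (- real \<nu>)) * (sobolev_norm \<mu> \<eta> \<Omega> e2 * T)"
      by (simp only: ac_simps)
    \<comment> \<open>The power h^\<mu> is split off to accompany the \<mu>-norm of
      \<open>e2\<close> in \<open>S\<close>; what remains is written as a square.\<close>
    also have "h\<^sup>2 * h powr \<delta> * h powr (- real \<nu>) = (h powr ((\<delta> + 2 - real \<mu> - real \<nu>) / 2))\<^sup>2 * h ^ \<mu>"
    proof -
      have "h\<^sup>2 = h powr 2" "h ^ \<mu> = h powr real \<mu>" using h by (simp_all add: powr_realpow)
      moreover have "(h powr ((\<delta> + 2 - real \<mu> - real \<nu>) / 2))\<^sup>2 = h powr (\<delta> + 2 - real \<mu> - real \<nu>)"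
        by (simp add: power2_eq_square flip: powr_add)
      ultimately show ?thesis by (simp add: algebra_simps flip: powr_add)
    qed
    finally show ?thesis by (simp only: S_def ac_simps)
  qed
  have second: "h\<^sup>2 * ap z (z - P) \<le> (CB * \<kappa> ^ 5 * (1 + C2 * C3)) * H\<^sup>2 * (Q + T)\<^sup>2"
  proof -
    define n where "n = real (card {\<alpha> :: 'n \<Rightarrow> nat. mi_order \<alpha> \<le> 1})"
    have n: "0 \<le> n" "n \<le> \<kappa>" by (simp_all add: n_def \<kappa>_def)
    have H0: "0 \<le> H" by (simp add: H_def)
    \<comment> \<open>The inverse estimate applies to \<open>P\<close> only. Its factor 1/h is
      cancelled by the \<open>h\<close> in front, and stability of the map returns to the zero-order
      norm of \<open>z\<close>.\<close>
    have ZP: "h * sobolev_norm 1 \<eta> \<Omega> (z - P) \<le> \<kappa>\<^sup>2 * ((1 + C2 * C3) * (Q + T))"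
    proof -
      have "sobolev_norm 1 \<eta> \<Omega> (z - P) \<le> \<kappa> * (Z1 + sobolev_norm 1 \<eta> \<Omega> P)"
        unfolding Z1_def \<kappa>_def by (rule sobolev_diff(2)[OF \<Omega>(1) \<eta>1 z1 P(2)])
      also have "\<dots> \<le> \<kappa> * (Z1 + C2 * h powr (- real 1) * (C3 * Z0))"
        using Pm[of 1] \<kappa> by (intro mult_left_mono) simp_all
      finally have "h * sobolev_norm 1 \<eta> \<Omega> (z - P) \<le> h * (\<kappa> * (Z1 + C2 * h powr (- real 1) * (C3 * Z0)))"
        using h by (intro mult_left_mono) simp_all
      also have "\<dots> = \<kappa> * (h * Z1 + C2 * C3 * Z0)"
        using h by (simp add: powr_minus_divide field_simps)
      also have "\<dots> \<le> \<kappa> * (\<kappa> * Q + C2 * C3 * (\<kappa> * T))"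
        using \<kappa> Z0 Z1 nonneg by (intro mult_left_mono add_mono) simp_all
      also have "\<dots> = \<kappa>\<^sup>2 * (Q + C2 * C3 * T)" by (simp add: power2_eq_square algebra_simps)
      also have "\<dots> \<le> \<kappa>\<^sup>2 * ((1 + C2 * C3) * (Q + T))"
        using nonneg Q0 T0 by (intro mult_left_mono) (simp_all add: algebra_simps)
      finally show ?thesis .
    qed
    have "h\<^sup>2 * ap z (z - P) \<le> h\<^sup>2 * (CB * (n * (H * Z1)) * (n * (H * sobolev_norm 1 \<eta> \<Omega> (z - P))))"
    proof (rule mult_left_mono)
      have "\<bar>ap z (z - P)\<bar> \<le> CB * (n * (H * Z1)) * (n * (H * sobolev_norm 1 \<eta> \<Omega> (z - P)))"
        unfolding n_def H_def Z1_def
        by (rule local_continuity_small_support[OF \<Omega> loc \<eta> z z1 \<eta> zP supp[folded z_def]])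
      then show "ap z (z - P) \<le> CB * (n * (H * Z1)) * (n * (H * sobolev_norm 1 \<eta> \<Omega> (z - P)))" by linarith
    qed simp
    also have "\<dots> = CB * n\<^sup>2 * H\<^sup>2 * ((h * Z1) * (h * sobolev_norm 1 \<eta> \<Omega> (z - P)))"
      by (simp only: power2_eq_square ac_simps)
    \<comment> \<open>Origin of \<kappa>^5: two factors from restricting both norms to the small
      set, one from the triangle inequality for \<open>z\<close> and two from those behind
      \<open>z - P\<close>.\<close>
    also have "\<dots> \<le> CB * \<kappa>\<^sup>2 * H\<^sup>2 * ((\<kappa> * (Q + T)) * (\<kappa>\<^sup>2 * ((1 + C2 * C3) * (Q + T))))"
    proof -
      have "h * Z1 \<le> \<kappa> * (Q + T)" using Z1 T0 \<kappa> by (simp add: algebra_simps add_increasing2)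
      then have le: "(h * Z1) * (h * sobolev_norm 1 \<eta> \<Omega> (z - P)) \<le> (\<kappa> * (Q + T)) * (\<kappa>\<^sup>2 * ((1 + C2 * C3) * (Q + T)))"
        by (rule mult_mono[OF _ ZP]) (use h Zn Q0 T0 \<kappa> in simp_all)
      have le': "CB * n\<^sup>2 * H\<^sup>2 \<le> CB * \<kappa>\<^sup>2 * H\<^sup>2"
        using n loc(2) by (intro mult_right_mono mult_left_mono power_mono) simp_all
      show ?thesis by (rule mult_mono[OF le' le]) (use loc(2) h Zn in simp_all)
    qed
    also have "\<dots> = (CB * \<kappa> ^ 5 * (1 + C2 * C3)) * H\<^sup>2 * (Q + T)\<^sup>2"
      by (simp only: power2_eq_square power_def numeral_eq_Suc) (simp add: ac_simps eval_nat_numeral)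
    finally show ?thesis .
  qed
  have "\<alpha> * (h * sobolev_norm 1 2 \<Omega> z)\<^sup>2 = h\<^sup>2 * (\<alpha> * (sobolev_norm 1 2 \<Omega> z)\<^sup>2)"
    by (simp add: power_mult_distrib)
  also have "\<dots> \<le> h\<^sup>2 * ap z z" using coer z by (intro mult_left_mono) simp_all
  also have "\<dots> = h\<^sup>2 * ap z P + h\<^sup>2 * ap z (z - P)" by (simp add: split distrib_left)
  also have "\<dots> \<le> (C1 * Cq * C2 * C3 * \<kappa>) * (h powr ((\<delta> + 2 - real \<mu> - real \<nu>) / 2))\<^sup>2 * (S * T)
    + (CB * \<kappa> ^ 5 * (1 + C2 * C3)) * H\<^sup>2 * (Q + T)\<^sup>2"
    by (rule add_mono[OF first second])
  finally show ?thesis unfolding S_def z_def .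
qed

text \<open>By the regularity of the dual solution each of the three terms carries the factor
  \<open>Y\<close>, the L^2 norm of \<open>e1 - e2\<close>; it is divided out at the end.\<close>

lemma duality_estimate:
  fixes e1 e2 w I J :: "real^'n \<Rightarrow> real" and a ap :: "(real^'n \<Rightarrow> real) \<Rightarrow> (real^'n \<Rightarrow> real) \<Rightarrow> real"
    and \<eta> q :: ereal and \<mu> \<nu> :: nat
  assumes \<Omega>: "open \<Omega>" "bounded \<Omega>" and \<eta>: "2 \<le> \<eta>" and h: "0 < h"
    and bil: "bilinear_form_on (H10 \<Omega>) a"
    and loc: "local_continuity \<Omega> (H10 \<Omega>) CB a" "0 \<le> CB"
    and e1: "e1 \<in> H10 \<Omega>" "e1 \<in> sobolev 1 \<eta> \<Omega>" and e2: "e2 \<in> H10 \<Omega>"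
    and w: "w \<in> H10 \<Omega>" and I: "I \<in> H10 \<Omega>" and J: "J \<in> H10 \<Omega>"
    and dual: "\<forall>y\<in>H10 \<Omega>. a y w = (\<integral>x. (e1 - e2) x * y x \<partial>lebesgue_on \<Omega>)"
    and smooth: "sobolev_norm 2 2 \<Omega> w \<le> CS * Lp_norm 2 \<Omega> (e1 - e2)"
    and orth: "a e2 I = 0" "ap e1 J = 0"
    and approx: "sobolev_norm 1 2 \<Omega> (I - w) + sobolev_norm 1 2 \<Omega> (J - w) \<le> C5 * h * sobolev_seminorm 2 2 \<Omega> w"
    and stab: "sobolev_norm \<nu> q \<Omega> J \<le> C4 * sobolev_norm \<nu> q \<Omega> w"
    and emb: "sobolev_norm \<nu> q \<Omega> w \<le> Ce * sobolev_norm 2 2 \<Omega> w"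
    and supp: "measure lebesgue (ess_supp \<Omega> (J - I)) \<le> m" "0 < m"
    and pert: "\<bar>ap e1 J - a e1 J\<bar> \<le> C1 * h powr \<delta> * sobolev_norm \<mu> \<eta> \<Omega> e1 * sobolev_norm \<nu> q \<Omega> J"
    and nonneg: "0 \<le> C1" "0 \<le> C4" "0 \<le> C5" "0 \<le> Ce" "0 \<le> CS"
  defines "\<kappa> \<equiv> 2 * real (card {\<alpha> :: 'n \<Rightarrow> nat. mi_order \<alpha> \<le> 1})"
    and "n2 \<equiv> real (card {\<alpha> :: 'n \<Rightarrow> nat. mi_order \<alpha> = 2})"
    and "H \<equiv> (2 * m) powr (1 / 2 - real_of_ereal (1 / \<eta>))"
  shows "Lp_norm 2 \<Omega> (e1 - e2) \<le>
    (CB * C5 * n2 * CS) * (h * sobolev_norm 1 2 \<Omega> (e1 - e2)) +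
    (CB * C5 * n2 * CS * \<kappa> ^ 3) * (H * (h * sobolev_norm 1 \<eta> \<Omega> e1)) +
    (C1 * C4 * Ce * CS) * (h powr \<delta> * sobolev_norm \<mu> \<eta> \<Omega> e1)" (is "_ \<le> ?F + ?G + ?P")
proof -
  define z where "z = e1 - e2"
  define Y where "Y = Lp_norm 2 \<Omega> z"
  have Y0: "0 \<le> Y" by (simp add: Y_def)
  have z: "z \<in> H10 \<Omega>" unfolding z_def by (rule H10_diff[OF \<Omega>(1) e1(1) e2(1)])
  have two: "1 \<le> (2::ereal)" by simp
  have H1: "f \<in> sobolev 1 2 \<Omega>" if "f \<in> H10 \<Omega>" for f using that by (simp add: H10_def)
  have n: "0 \<le> n2" "0 \<le> \<kappa>" by (simp_all add: n2_def \<kappa>_def)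
  have H0: "0 \<le> H" by (simp add: H_def)
  have Iw: "I - w \<in> H10 \<Omega>" and Jw: "J - w \<in> H10 \<Omega>" and JI: "J - I \<in> H10 \<Omega>"
    using H10_diff[OF \<Omega>(1)] w I J by simp_all
  have ap_bd: "sobolev_norm 1 2 \<Omega> (I - w) + sobolev_norm 1 2 \<Omega> (J - w) \<le> C5 * h * (n2 * (CS * Y))"
  proof -
    have "sobolev_seminorm 2 2 \<Omega> w \<le> n2 * sobolev_norm 2 2 \<Omega> w"
      unfolding n2_def by (rule sobolev_seminorm_le_norm[OF two])
    also have "\<dots> \<le> n2 * (CS * Y)" using smooth n by (intro mult_left_mono) (simp_all add: Y_def z_def)
    finally have "C5 * h * sobolev_seminorm 2 2 \<Omega> w \<le> C5 * h * (n2 * (CS * Y))"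
      using nonneg h by (intro mult_left_mono) simp_all
    with approx show ?thesis by linarith
  qed
  have "Y\<^sup>2 = a z w"
    using dual[folded z_def, rule_format, OF z] Lp_norm_two_square[where z = z and S = \<Omega>] by (simp only: Y_def)
  \<comment> \<open>\<open>w\<close> is replaced by \<open>I\<close>, where orthogonality removes
    \<open>e2\<close>; then \<open>I\<close> is replaced by \<open>J\<close>, where
    \<open>ap e1 J = 0\<close> may be subtracted.\<close>
  also have "\<dots> = - a z (I - w) + (- a e1 (J - I) + (a e1 J - ap e1 J))"
    using bilinear_form_on_H10_diff(2)[OF \<Omega>(1) bil I w z] bilinear_form_on_H10_diff(2)[OF \<Omega>(1) bil J I e1(1)]
      bilinear_form_on_H10_diff(1)[OF \<Omega>(1) bil e1(1) e2 I] orth by (simp add: z_def)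
  also have "\<dots> \<le> \<bar>a z (I - w)\<bar> + \<bar>a e1 (J - I)\<bar> + \<bar>ap e1 J - a e1 J\<bar>" by linarith
  also have "\<bar>a z (I - w)\<bar> \<le> (CB * C5 * n2 * CS) * (h * sobolev_norm 1 2 \<Omega> z) * Y"
  proof -
    \<comment> \<open>With the whole domain as \<open>R\<close> the local continuity is ordinary
      continuity.\<close>
    have "\<bar>a z (I - w)\<bar> \<le> CB * sobolev_norm 1 2 \<Omega> z * sobolev_norm 1 2 \<Omega> (I - w)"
      using loc(1)[unfolded local_continuity_def, rule_format, of \<Omega> z "I - w"] \<Omega>(1) z Iw
        ess_supp_subset[of \<Omega> "I - w"] by simp
    also have "\<dots> \<le> CB * sobolev_norm 1 2 \<Omega> z * (C5 * h * (n2 * (CS * Y)))"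
    proof (rule mult_left_mono)
      show "sobolev_norm 1 2 \<Omega> (I - w) \<le> C5 * h * (n2 * (CS * Y))"
        using ap_bd sobolev_norm_nonneg[of 1 2 \<Omega> "J - w"] by linarith
    qed (use loc(2) in simp)
    finally show ?thesis by (simp only: ac_simps)
  qed
  also have "\<bar>a e1 (J - I)\<bar> \<le> (CB * C5 * n2 * CS * \<kappa> ^ 3) * (H * (h * sobolev_norm 1 \<eta> \<Omega> e1)) * Y"
  proof -
    define c where "c = real (card {\<alpha> :: 'n \<Rightarrow> nat. mi_order \<alpha> \<le> 1})"
    have c: "0 \<le> c" "c \<le> \<kappa>" by (simp_all add: c_def \<kappa>_def)
    have "\<bar>a e1 (J - I)\<bar> \<le> CB * (c * (H * sobolev_norm 1 \<eta> \<Omega> e1)) *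
      (c * ((2 * m) powr (1 / 2 - real_of_ereal (1 / 2)) * sobolev_norm 1 2 \<Omega> (J - I)))"
      unfolding c_def H_def
      by (rule local_continuity_small_support[OF \<Omega> loc \<eta> e1 order_refl JI H1[OF JI] supp])
    \<comment> \<open>The exponent is 1/2 - 1/2 = 0: the gain from the small set is taken for
      \<open>e1\<close> only, and \<open>J - I\<close> contributes the factor h.\<close>
    also have "(2 * m) powr (1 / 2 - real_of_ereal (1 / 2)) = 1"
    proof -
      have "1 / (2::ereal) = ereal (1 / 2)" by (simp add: one_ereal_def numeral_eq_ereal)
      then show ?thesis using supp(2) by simp
    qed
    also have "CB * (c * (H * sobolev_norm 1 \<eta> \<Omega> e1)) * (c * (1 * sobolev_norm 1 2 \<Omega> (J - I))) =
      c * c * (CB * H * sobolev_norm 1 \<eta> \<Omega> e1) * sobolev_norm 1 2 \<Omega> (J - I)" by (simp only: ac_simps mult_1_left)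
    also have "\<dots> \<le> \<kappa> * \<kappa> * (CB * H * sobolev_norm 1 \<eta> \<Omega> e1) * (\<kappa> * (C5 * h * (n2 * (CS * Y))))"
    proof (rule mult_mono)
      have "J - I = (J - w) - (I - w)" by simp
      then have "sobolev_norm 1 2 \<Omega> (J - I) \<le> \<kappa> * (sobolev_norm 1 2 \<Omega> (J - w) + sobolev_norm 1 2 \<Omega> (I - w))"
        unfolding \<kappa>_def using sobolev_diff(2)[OF \<Omega>(1) two H1[OF Jw] H1[OF Iw]] by (simp only:)
      also have "\<dots> \<le> \<kappa> * (C5 * h * (n2 * (CS * Y)))"
        using ap_bd n(2) by (intro mult_left_mono) simp_all
      finally show "sobolev_norm 1 2 \<Omega> (J - I) \<le> \<kappa> * (C5 * h * (n2 * (CS * Y)))" .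
      show "c * c * (CB * H * sobolev_norm 1 \<eta> \<Omega> e1) \<le> \<kappa> * \<kappa> * (CB * H * sobolev_norm 1 \<eta> \<Omega> e1)"
        using c loc(2) H0 n(2) by (intro mult_right_mono mult_mono) simp_all
    qed (use loc(2) H0 n(2) in simp_all)
    finally show ?thesis by (simp only: power3_eq_cube ac_simps)
  qed
  also have "\<bar>ap e1 J - a e1 J\<bar> \<le> (C1 * C4 * Ce * CS) * (h powr \<delta> * sobolev_norm \<mu> \<eta> \<Omega> e1) * Y"
  proof -
    have "sobolev_norm \<nu> q \<Omega> J \<le> C4 * (Ce * (CS * Y))"
    proof -
      have "Ce * sobolev_norm 2 2 \<Omega> w \<le> Ce * (CS * Y)"
        using smooth nonneg by (intro mult_left_mono) (simp_all add: Y_def z_def)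
      with emb have "sobolev_norm \<nu> q \<Omega> w \<le> Ce * (CS * Y)" by linarith
      then have "C4 * sobolev_norm \<nu> q \<Omega> w \<le> C4 * (Ce * (CS * Y))" using nonneg by (intro mult_left_mono)
      with stab show ?thesis by linarith
    qed
    then have "C1 * h powr \<delta> * sobolev_norm \<mu> \<eta> \<Omega> e1 * sobolev_norm \<nu> q \<Omega> J \<le>
      C1 * h powr \<delta> * sobolev_norm \<mu> \<eta> \<Omega> e1 * (C4 * (Ce * (CS * Y)))"
      using nonneg by (intro mult_left_mono) simp_all
    with pert have "\<bar>ap e1 J - a e1 J\<bar> \<le> C1 * h powr \<delta> * sobolev_norm \<mu> \<eta> \<Omega> e1 * (C4 * (Ce * (CS * Y)))"
      by linarith
    then show ?thesis by (simp only: ac_simps)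
  qed
  finally have sq: "Y * Y \<le> (?F + ?G + ?P) * Y"
    by (simp only: z_def power2_eq_square distrib_right)
  \<comment> \<open>Covers the case \<open>Y = 0\<close>, where division is impossible and the claim
    is the nonnegativity of the right-hand side.\<close>
  have "0 \<le> ?F + ?G + ?P" using nonneg n loc(2) h H0 by simp
  then have "Y \<le> ?F + ?G + ?P" using sq Y0 by (cases "Y = 0") (simp_all add: mult_le_cancel_right)
  then show ?thesis by (simp only: Y_def z_def)
qed

text \<open>Pure arithmetic: \<open>x\<close> stands for h times the H^1 norm and \<open>Y\<close>
  for the L^2 norm of the difference, while \<open>t\<close> bounds all powers of h at once. The
  energy bound is resolved by u^2 + v^2 <= (u + v)^2 and inserted into the duality bound.\<close>

lemma combine_energy_duality:
  fixes \<alpha> E1 E2 D1 D2 D3 t x S T Q Y :: real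
  assumes \<alpha>: "0 < \<alpha>" and nonneg: "0 \<le> E1" "0 \<le> E2" "0 \<le> D1" "0 \<le> D2" "0 \<le> D3" "0 \<le> t" "0 \<le> S" "0 \<le> T" "0 \<le> Q"
    and energy: "\<alpha> * x\<^sup>2 \<le> E1 * t\<^sup>2 * (S * T) + E2 * t\<^sup>2 * (Q + T)\<^sup>2"
    and dual: "Y \<le> D1 * x + D2 * (t * (Q + T)) + D3 * (t * (Q + T))"
  shows "Y \<le> (D1 * (sqrt (E1 / \<alpha>) + sqrt (E2 / \<alpha>)) + D2 + D3) * t * (Q + T + sqrt S * sqrt T)"
proof -
  define u where "u = sqrt (E1 / \<alpha>) * t * (sqrt S * sqrt T)"
  define v where "v = sqrt (E2 / \<alpha>) * t * (Q + T)"
  define W where "W = Q + T + sqrt S * sqrt T"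
  have uv: "0 \<le> u" "0 \<le> v" using nonneg \<alpha> by (simp_all add: u_def v_def)
  have le: "sqrt S * sqrt T \<le> W" "Q + T \<le> W" using nonneg by (simp_all add: W_def)
  have "x\<^sup>2 \<le> (E1 * t\<^sup>2 * (S * T) + E2 * t\<^sup>2 * (Q + T)\<^sup>2) / \<alpha>"
    using energy \<alpha> by (simp add: pos_le_divide_eq mult.commute)
  also have "\<dots> = u\<^sup>2 + v\<^sup>2"
    using nonneg \<alpha> by (simp add: u_def v_def power_mult_distrib add_divide_distrib)
  also have "\<dots> \<le> (u + v)\<^sup>2" using uv by (simp add: power2_sum)
  finally have "x \<le> u + v" using uv by (intro power2_le_imp_le[of x "u + v"]) simp_all
  also have "\<dots> \<le> sqrt (E1 / \<alpha>) * t * W + sqrt (E2 / \<alpha>) * t * W"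
    unfolding u_def v_def using le nonneg \<alpha> by (intro add_mono mult_left_mono) simp_all
  finally have "D1 * x \<le> D1 * (sqrt (E1 / \<alpha>) * t * W + sqrt (E2 / \<alpha>) * t * W)"
    using nonneg by (intro mult_left_mono)
  moreover have "D2 * (t * (Q + T)) \<le> D2 * (t * W)" "D3 * (t * (Q + T)) \<le> D3 * (t * W)"
    using le nonneg by (auto intro!: mult_left_mono)
  ultimately have "Y \<le> D1 * (sqrt (E1 / \<alpha>) * t * W + sqrt (E2 / \<alpha>) * t * W) + D2 * (t * W) + D3 * (t * W)"
    using dual by linarith
  then show ?thesis unfolding W_def[symmetric] by (simp add: algebra_simps)
qed

text \<open>Because \<open>h0\<close> may exceed 1, a larger exponent is not simply better; it is
  exchanged for the smaller one at the price of a power of \<open>h0\<close>.\<close>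

lemma powr_le_powr_scaled:
  fixes h h0 \<sigma> c :: real
  assumes "0 < h" "h \<le> h0" "\<sigma> \<le> c"
  shows "h powr c \<le> h0 powr (c - \<sigma>) * h powr \<sigma>"
proof -
  have "h powr c = h powr (c - \<sigma>) * h powr \<sigma>" by (simp flip: powr_add)
  also have "\<dots> \<le> h0 powr (c - \<sigma>) * h powr \<sigma>"
    using assms by (intro mult_right_mono powr_mono2) simp_all
  finally show ?thesis .
qed

section \<open>The L^2 distance of the two projections\<close>

lemma ess_supp_minus_commute:
  fixes f g :: "'a::euclidean_space \<Rightarrow> real"
  assumes "open \<Omega>" shows "ess_supp \<Omega> (f - g) = ess_supp \<Omega> (g - f)"
  by (intro equalityI ess_supp_mono[OF assms]) simp_all

theorem theorem2p4:
  fixes \<Omega> :: "(real^'n) set" and V Vbar :: "(real^'n \<Rightarrow> real) set"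
    and h0 \<gamma> \<delta> \<sigma>' :: real and \<eta> q :: ereal and \<mu> \<nu> :: nat
    and a ap :: "real \<Rightarrow> (real^'n \<Rightarrow> real) \<Rightarrow> (real^'n \<Rightarrow> real) \<Rightarrow> real"
    and Vh Vhp :: "real \<Rightarrow> (real^'n \<Rightarrow> real) set"
    and r rp \<pi> ih ihp :: "real \<Rightarrow> (real^'n \<Rightarrow> real) \<Rightarrow> (real^'n \<Rightarrow> real)"
  assumes domain: "lipschitz_domain \<Omega>" "bounded \<Omega>"
    and V: "V = H10 \<Omega>"
    and h0: "h0 > 0"
    and bilinear: "\<forall>h\<in>{0<..h0}. bilinear_form_on V (a h) \<and> bilinear_form_on V (ap h)"
    and coercive: "\<exists>\<alpha>>0. \<exists>M>0. \<forall>h\<in>{0<..h0}.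
          coercive_continuous \<Omega> V \<alpha> M (a h) \<and> coercive_continuous \<Omega> V \<alpha> M (ap h)"
    and fe_spaces: "\<forall>h\<in>{0<..h0}. Vh h \<subseteq> V \<and> finite_dimensional_space \<Omega> (Vh h) \<and>
          Vhp h \<subseteq> V \<and> finite_dimensional_space \<Omega> (Vhp h)"
    and projectors: "\<forall>h\<in>{0<..h0}. galerkin_projector (a h) V (Vh h) (r h) \<and>
          galerkin_projector (ap h) V (Vhp h) (rp h)"
    and \<eta>: "2 \<le> \<eta>"
    and A1: "\<forall>h\<in>{0<..h0}. Vh h \<subseteq> sobolev 1 \<eta> \<Omega> \<inter> V \<and> Vhp h \<subseteq> sobolev 1 \<eta> \<Omega> \<inter> V"
    and A2: "\<exists>C>0. \<forall>m\<in>{0, 1}. \<forall>h\<in>{0<..h0}. \<forall>w \<in> Vhp h \<inter> Vh h.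
          sobolev_norm m \<eta> \<Omega> w \<le> C * h powr (- real m) * sobolev_norm 0 \<eta> \<Omega> w"
    and A3: "\<gamma> \<ge> 0"
          "\<forall>h\<in>{0<..h0}. linear_map_on \<Omega> (Vhp h + Vh h) (\<pi> h)"
          "\<forall>h\<in>{0<..h0}. \<forall>w \<in> Vhp h + Vh h. \<pi> h w \<in> Vhp h \<inter> Vh h"
          "\<exists>C>0. \<forall>h\<in>{0<..h0}. \<forall>w \<in> Vhp h + Vh h.
             sobolev_norm 0 \<eta> \<Omega> (\<pi> h w) \<le> C * sobolev_norm 0 \<eta> \<Omega> w \<and>
             measure lebesgue (ess_supp \<Omega> (\<pi> h w - w)) \<le> C * h powr \<gamma>"
    and A4: "\<delta> \<ge> 0" "1 \<le> q" "q \<le> \<eta>" "\<mu> \<in> {0, 1}" "\<nu> \<in> {0, 1}"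
          "\<exists>C1>0. \<forall>h\<in>{0<..h0}. \<forall>v \<in> sobolev 1 \<eta> \<Omega> \<inter> V. \<forall>w \<in> sobolev 1 \<eta> \<Omega> \<inter> V.
             \<bar>ap h v w - a h v w\<bar>
               \<le> C1 * h powr \<delta> * sobolev_norm \<mu> \<eta> \<Omega> v * sobolev_norm \<nu> q \<Omega> w"
    and B1: "\<exists>C>0. \<forall>h\<in>{0<..h0}.
          smoothing_property \<Omega> V C (a h) \<and> smoothing_property \<Omega> V C (ap h)"
    and B2: "\<exists>C>0. \<forall>h\<in>{0<..h0}.
          local_continuity \<Omega> V C (a h) \<and> local_continuity \<Omega> V C (ap h)"
    and B3: "real CARD('n) = 4 - 2 * real \<nu> \<longrightarrow> q < \<infinity>"
          "real CARD('n) > 4 - 2 * real \<nu> \<longrightarrow>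
             q \<le> ereal (2 * real CARD('n) / (real CARD('n) - 4 + 2 * real \<nu>))"
    and Vbar: "function_space \<Omega> Vbar" "sobolev 2 2 \<Omega> \<inter> V \<subseteq> Vbar" "Vbar \<subseteq> V"
    and interpolation: "\<forall>h\<in>{0<..h0}. \<forall>w\<in>Vbar. ih h w \<in> Vh h \<and> ihp h w \<in> Vhp h"
    and B4: "\<exists>C>0. \<forall>h\<in>{0<..h0}. \<forall>w \<in> sobolev 2 2 \<Omega> \<inter> V.
          sobolev_norm \<nu> q \<Omega> (ih h w) + sobolev_norm \<nu> q \<Omega> (ihp h w)
            \<le> C * sobolev_norm \<nu> q \<Omega> w"
    and B5: "\<exists>C>0. \<forall>h\<in>{0<..h0}. \<forall>w \<in> sobolev 2 2 \<Omega> \<inter> V.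
          sobolev_norm 1 2 \<Omega> (ih h w - w) + sobolev_norm 1 2 \<Omega> (ihp h w - w)
            \<le> C * h * sobolev_seminorm 2 2 \<Omega> w"
    and B6: "\<forall>h\<in>{0<..h0}. \<forall>w \<in> sobolev 2 2 \<Omega> \<inter> V.
          ess_supp \<Omega> (ihp h w - ih h w) \<subseteq> (\<Union>v \<in> Vh h + Vhp h. ess_supp \<Omega> (v - \<pi> h v))"
    and \<sigma>': "\<sigma>' = Min {\<gamma> * (1/2 - real_of_ereal (1/\<eta>)), (\<delta> + 2 - real \<mu> - real \<nu>) / 2, \<delta> - real \<mu>}"
  shows "\<exists>C>0. \<forall>h\<in>{0<..h0}. \<forall>u \<in> sobolev 1 \<eta> \<Omega> \<inter> V.
     sobolev_norm 0 2 \<Omega> (rp h u - r h u) \<le> C * h powr \<sigma>' *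
       (h * sobolev_norm 1 \<eta> \<Omega> (rp h u - u) + h * sobolev_norm 1 \<eta> \<Omega> (r h u - u)
        + sobolev_norm 0 \<eta> \<Omega> (rp h u - u) + sobolev_norm 0 \<eta> \<Omega> (r h u - u)
        + sqrt (h ^ \<mu> * sobolev_norm \<mu> \<eta> \<Omega> (r h u - u)) *
          sqrt (sobolev_norm 0 \<eta> \<Omega> (rp h u - u) + sobolev_norm 0 \<eta> \<Omega> (r h u - u))
        + h ^ \<mu> * sobolev_norm \<mu> \<eta> \<Omega> (r h u - u))"
proof -
  let ?I = "{0<..h0}"
  define \<theta> where "\<theta> = 1 / 2 - real_of_ereal (1 / \<eta>)"
  define \<kappa> where "\<kappa> = 2 * real (card {\<alpha> :: 'n \<Rightarrow> nat. mi_order \<alpha> \<le> 1})"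
  define n2 where "n2 = real (card {\<alpha> :: 'n \<Rightarrow> nat. mi_order \<alpha> = 2})"
  have op: "open \<Omega>" using domain(1) by (simp add: lipschitz_domain_def)
  have lm: "\<Omega> \<in> lmeasurable" using op domain(2) by (intro lmeasurable_open)
  have \<eta>1: "1 \<le> \<eta>" using \<eta> by (rule order_trans[rotated]) simp
  obtain \<alpha> M where \<alpha>: "\<alpha> > 0" and co: "\<forall>h\<in>?I. coercive_continuous \<Omega> V \<alpha> M (a h) \<and> coercive_continuous \<Omega> V \<alpha> M (ap h)"
    using coercive by (elim exE conjE)
  obtain C2 where C2: "C2 > 0" "\<forall>m\<in>{0, 1}. \<forall>h\<in>?I. \<forall>w \<in> Vhp h \<inter> Vh h.
      sobolev_norm m \<eta> \<Omega> w \<le> C2 * h powr (- real m) * sobolev_norm 0 \<eta> \<Omega> w"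
    using A2 by (elim exE conjE)
  obtain C3 where C3: "C3 > 0" "\<forall>h\<in>?I. \<forall>w \<in> Vhp h + Vh h.
      sobolev_norm 0 \<eta> \<Omega> (\<pi> h w) \<le> C3 * sobolev_norm 0 \<eta> \<Omega> w \<and>
      measure lebesgue (ess_supp \<Omega> (\<pi> h w - w)) \<le> C3 * h powr \<gamma>"
    using A3(4) by (elim exE conjE)
  obtain C1 where C1: "C1 > 0" "\<forall>h\<in>?I. \<forall>v \<in> sobolev 1 \<eta> \<Omega> \<inter> V. \<forall>w \<in> sobolev 1 \<eta> \<Omega> \<inter> V.
      \<bar>ap h v w - a h v w\<bar> \<le> C1 * h powr \<delta> * sobolev_norm \<mu> \<eta> \<Omega> v * sobolev_norm \<nu> q \<Omega> w"
    using A4(6) by (elim exE conjE)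
  obtain CS where CS: "CS > 0" "\<forall>h\<in>?I. smoothing_property \<Omega> V CS (a h) \<and> smoothing_property \<Omega> V CS (ap h)"
    using B1 by (elim exE conjE)
  obtain CB where CB: "CB > 0" "\<forall>h\<in>?I. local_continuity \<Omega> V CB (a h) \<and> local_continuity \<Omega> V CB (ap h)"
    using B2 by (elim exE conjE)
  obtain C4 where C4: "C4 > 0" "\<forall>h\<in>?I. \<forall>w \<in> sobolev 2 2 \<Omega> \<inter> V.
      sobolev_norm \<nu> q \<Omega> (ih h w) + sobolev_norm \<nu> q \<Omega> (ihp h w) \<le> C4 * sobolev_norm \<nu> q \<Omega> w"
    using B4 by (elim exE conjE)
  obtain C5 where C5: "C5 > 0" "\<forall>h\<in>?I. \<forall>w \<in> sobolev 2 2 \<Omega> \<inter> V.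
      sobolev_norm 1 2 \<Omega> (ih h w - w) + sobolev_norm 1 2 \<Omega> (ihp h w - w) \<le> C5 * h * sobolev_seminorm 2 2 \<Omega> w"
    using B5 by (elim exE conjE)
  \<comment> \<open>The perturbation bound (A4) uses the exponent \<open>q\<close>, the inverse
    estimate (A2) the exponent \<open>\<eta>\<close>; \<open>Cq\<close> converts between
    them.\<close>
  obtain Cq where Cq: "Cq > 0" "\<forall>f\<in>sobolev \<nu> \<eta> \<Omega>. f \<in> sobolev \<nu> q \<Omega> \<and> sobolev_norm \<nu> q \<Omega> f \<le> Cq * sobolev_norm \<nu> \<eta> \<Omega> f"
    using sobolev_norm_embedding[OF op domain(2) A4(2,3), of \<nu>] by (elim exE conjE)
  obtain Ce where Ce: "Ce > 0" "\<forall>w\<in>sobolev 2 2 \<Omega>. sobolev_norm \<nu> q \<Omega> w \<le> Ce * sobolev_norm 2 2 \<Omega> w"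
    using sobolev_2_2_embedding[OF domain A4(2,5) B3] by (elim exE conjE)
  define E1 where "E1 = C1 * Cq * C2 * C3 * \<kappa>"
  define E2 where "E2 = CB * \<kappa> ^ 5 * (1 + C2 * C3)"
  define D1 where "D1 = CB * C5 * n2 * CS"
  define D2 where "D2 = CB * C5 * n2 * CS * \<kappa> ^ 3"
  define D3 where "D3 = C1 * C4 * Ce * CS"
  \<comment> \<open>\<open>k1\<close>, \<open>k2\<close> and \<open>k3\<close> compare the three
    powers of h in the estimates with \<open>h powr \<sigma>'\<close>. The factor with
    \<open>C3\<close> comes from the doubled measure bound of the open cover.\<close>
  define k1 where "k1 = (2 * C3) powr \<theta> * h0 powr (\<gamma> * \<theta> - \<sigma>')"
  define k2 where "k2 = h0 powr ((\<delta> + 2 - real \<mu> - real \<nu>) / 2 - \<sigma>')"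
  define k3 where "k3 = h0 powr (\<delta> - real \<mu> - \<sigma>')"
  define k where "k = k1 + k2 + k3"
  have k: "0 \<le> k1" "0 \<le> k2" "0 \<le> k3" by (simp_all add: k1_def k2_def k3_def)
  have nonneg: "0 \<le> \<kappa>" "0 \<le> n2" by (simp_all add: \<kappa>_def n2_def)
  have DE: "0 \<le> E1" "0 \<le> E2" "0 \<le> D1" "0 \<le> D2" "0 \<le> D3"
    using C1(1) C2(1) C3(1) C4(1) C5(1) Cq(1) Ce(1) CS(1) CB(1) nonneg
    by (simp_all add: E1_def E2_def D1_def D2_def D3_def)
  define K where "K = (D1 * (sqrt (E1 / \<alpha>) + sqrt (E2 / \<alpha>)) + D2 + D3) * k"
  have K0: "0 \<le> K" using DE k \<alpha> by (simp add: K_def k_def)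
  have \<sigma>'_le: "\<sigma>' \<le> \<gamma> * \<theta>" "\<sigma>' \<le> (\<delta> + 2 - real \<mu> - real \<nu>) / 2" "\<sigma>' \<le> \<delta> - real \<mu>"
    unfolding \<sigma>' \<theta>_def by (rule Min_le; simp)+
  have main: "sobolev_norm 0 2 \<Omega> (rp h u - r h u) \<le> K * h powr \<sigma>' *
      (h * (sobolev_norm 1 \<eta> \<Omega> (rp h u - u) + sobolev_norm 1 \<eta> \<Omega> (r h u - u))
        + (sobolev_norm 0 \<eta> \<Omega> (rp h u - u) + sobolev_norm 0 \<eta> \<Omega> (r h u - u))
        + sqrt (h ^ \<mu> * sobolev_norm \<mu> \<eta> \<Omega> (r h u - u)) *
          sqrt (sobolev_norm 0 \<eta> \<Omega> (rp h u - u) + sobolev_norm 0 \<eta> \<Omega> (r h u - u)))"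
    if h: "h \<in> ?I" and u: "u \<in> sobolev 1 \<eta> \<Omega> \<inter> V" for h u
  proof -
    have h': "0 < h" "h \<le> h0" using h by auto
    define e1 where "e1 = rp h u - u"
    define e2 where "e2 = r h u - u"
    define S where "S = h ^ \<mu> * sobolev_norm \<mu> \<eta> \<Omega> e2"
    define T where "T = sobolev_norm 0 \<eta> \<Omega> e1 + sobolev_norm 0 \<eta> \<Omega> e2"
    define Q where "Q = h * (sobolev_norm 1 \<eta> \<Omega> e1 + sobolev_norm 1 \<eta> \<Omega> e2)"
    \<comment> \<open>Serves twice: for the defect of the projection difference and for the set in
      (B6), which lies in the support of a single defect.\<close>
    define m where "m = C3 * h powr \<gamma>"
    define H where "H = (2 * m) powr (1 / 2 - real_of_ereal (1 / \<eta>))"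
    define t where "t = k * h powr \<sigma>'"
    have m0: "0 < m" using C3(1) h' by (simp add: m_def)
    have STQ: "0 \<le> S" "0 \<le> T" "0 \<le> Q" using h' by (simp_all add: S_def T_def Q_def)
    have t0: "0 \<le> t" using k by (simp add: t_def k_def)
    have kt: "c * h powr \<sigma>' \<le> t" if "c \<in> {k1, k2, k3}" for c
      unfolding t_def by (rule mult_right_mono) (use that k in \<open>auto simp: k_def\<close>)
    have Ht: "H \<le> t"
    proof -
      have "H = (2 * C3) powr \<theta> * h powr (\<gamma> * \<theta>)"
        using C3(1) unfolding H_def m_def \<theta>_def mult.assoc[symmetric]
        by (subst powr_mult) (simp_all add: powr_powr)
      also have "\<dots> \<le> (2 * C3) powr \<theta> * (h0 powr (\<gamma> * \<theta> - \<sigma>') * h powr \<sigma>')"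
        by (rule mult_left_mono[OF powr_le_powr_scaled[OF h' \<sigma>'_le(1)]]) simp
      also have "\<dots> = k1 * h powr \<sigma>'" by (simp add: k1_def)
      also have "\<dots> \<le> t" by (rule kt) simp
      finally show ?thesis .
    qed
    have h2t: "h powr ((\<delta> + 2 - real \<mu> - real \<nu>) / 2) \<le> t"
      by (rule order_trans[OF powr_le_powr_scaled[OF h' \<sigma>'_le(2)], folded k2_def]) (rule kt, simp)
    have h3t: "h powr (\<delta> - real \<mu>) \<le> t"
      by (rule order_trans[OF powr_le_powr_scaled[OF h' \<sigma>'_le(3)], folded k3_def]) (rule kt, simp)

    have gal: "rp h u \<in> Vhp h" "r h u \<in> Vh h"
      and orth: "\<forall>w\<in>Vhp h. ap h e1 w = 0" "\<forall>w\<in>Vh h. a h e2 w = 0"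
      using projectors[rule_format, OF h] u by (auto simp: galerkin_projector_def e1_def e2_def)
    have VhD: "w \<in> H10 \<Omega>" "w \<in> sobolev 1 \<eta> \<Omega>" if "w \<in> Vh h" for w
      using A1[rule_format, OF h] that V by auto
    have VhpD: "w \<in> H10 \<Omega>" "w \<in> sobolev 1 \<eta> \<Omega>" if "w \<in> Vhp h" for w
      using A1[rule_format, OF h] that V by auto
    have uD: "u \<in> H10 \<Omega>" "u \<in> sobolev 1 \<eta> \<Omega>" using u V by auto
    have e1: "e1 \<in> H10 \<Omega>" "e1 \<in> sobolev 1 \<eta> \<Omega>" unfolding e1_def
      by (rule H10_diff[OF op VhpD(1)[OF gal(1)] uD(1)], rule sobolev_diff(1)[OF op \<eta>1 VhpD(2)[OF gal(1)] uD(2)])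
    have e2: "e2 \<in> H10 \<Omega>" "e2 \<in> sobolev 1 \<eta> \<Omega>" unfolding e2_def
      by (rule H10_diff[OF op VhD(1)[OF gal(2)] uD(1)], rule sobolev_diff(1)[OF op \<eta>1 VhD(2)[OF gal(2)] uD(2)])
    have e12: "e1 - e2 = rp h u - r h u" by (simp add: e1_def e2_def)
    have fs: "finite_dimensional_space \<Omega> (Vh h)" "finite_dimensional_space \<Omega> (Vhp h)"
      using fe_spaces[rule_format, OF h] by simp_all
    have zW: "e1 - e2 \<in> Vhp h + Vh h"
    proof -
      have "(\<lambda>x. (-1) * r h u x) \<in> Vh h"
        using fs(1) gal(2) unfolding finite_dimensional_space_def function_space_def by blast
      then have "rp h u + (\<lambda>x. (-1) * r h u x) \<in> Vhp h + Vh h" by (rule set_plus_intro[OF gal(1)])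
      moreover have "rp h u + (\<lambda>x. (-1) * r h u x) = e1 - e2" by (simp add: e12 fun_eq_iff)
      ultimately show ?thesis by simp
    qed
    define P where "P = \<pi> h (e1 - e2)"
    have P: "P \<in> Vhp h" "P \<in> Vh h" using A3(3)[rule_format, OF h zW] by (simp_all add: P_def)
    note C3P = C3(2)[rule_format, OF h zW, folded P_def m_def]
    have supp: "measure lebesgue (ess_supp \<Omega> ((e1 - e2) - P)) \<le> m"
      using C3P by (simp only: ess_supp_minus_commute[OF op])
    have bil: "bilinear_form_on (H10 \<Omega>) (a h)" "bilinear_form_on (H10 \<Omega>) (ap h)"
      using bilinear[rule_format, OF h] V by simp_all
    have loc: "local_continuity \<Omega> (H10 \<Omega>) CB (a h)" "local_continuity \<Omega> (H10 \<Omega>) CB (ap h)"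
      using CB(2)[rule_format, OF h] V by simp_all
    have pert: "\<bar>ap h v w - a h v w\<bar> \<le> C1 * h powr \<delta> * sobolev_norm \<mu> \<eta> \<Omega> v * sobolev_norm \<nu> q \<Omega> w"
      if "v \<in> H10 \<Omega>" "v \<in> sobolev 1 \<eta> \<Omega>" "w \<in> H10 \<Omega>" "w \<in> sobolev 1 \<eta> \<Omega>" for v w
      by (rule C1(2)[rule_format, OF h]) (use that V in simp_all)
    have nn: "0 \<le> C1" "0 \<le> C2" "0 \<le> C3" "0 \<le> C4" "0 \<le> C5" "0 \<le> Cq" "0 \<le> Ce" "0 \<le> CS" "0 \<le> CB"
      using C1(1) C2(1) C3(1) C4(1) C5(1) Cq(1) Ce(1) CS(1) CB(1) by simp_all

    have "\<alpha> * (h * sobolev_norm 1 2 \<Omega> (e1 - e2))\<^sup>2 \<le>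
      E1 * (h powr ((\<delta> + 2 - real \<mu> - real \<nu>) / 2))\<^sup>2 * (S * T) + E2 * H\<^sup>2 * (Q + T)\<^sup>2"
      unfolding E1_def E2_def S_def T_def Q_def H_def \<kappa>_def
    proof (rule energy_estimate[where a = "a h" and ap = "ap h" and P = P])
      show "\<forall>v\<in>H10 \<Omega>. \<alpha> * (sobolev_norm 1 2 \<Omega> v)\<^sup>2 \<le> ap h v v"
        using co[rule_format, OF h] V by (simp add: coercive_continuous_def)
      show "\<forall>j\<in>{0, 1}. sobolev_norm j \<eta> \<Omega> P \<le> C2 * h powr (- real j) * sobolev_norm 0 \<eta> \<Omega> P"
        using C2(2) h P by simp
      show "sobolev_norm 0 \<eta> \<Omega> P \<le> C3 * sobolev_norm 0 \<eta> \<Omega> (e1 - e2)" using C3P by simp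
      have "P \<in> sobolev \<nu> \<eta> \<Omega>" using VhD(2)[OF P(2)] A4(5) by (auto simp: sobolev_def)
      then show "sobolev_norm \<nu> q \<Omega> P \<le> Cq * sobolev_norm \<nu> \<eta> \<Omega> P" using Cq(2) by simp
      show "ap h e1 P = 0" "a h e2 P = 0" using orth P by simp_all
      show "\<bar>ap h e2 P - a h e2 P\<bar> \<le> C1 * h powr \<delta> * sobolev_norm \<mu> \<eta> \<Omega> e2 * sobolev_norm \<nu> q \<Omega> P"
        by (rule pert[OF e2 VhD[OF P(2)]])
    qed (fact op domain(2) \<eta> h'(1) A4(5) bil(2) loc(2) nn e1 e2 VhD[OF P(2)] supp m0)+
    also have "\<dots> \<le> E1 * t\<^sup>2 * (S * T) + E2 * t\<^sup>2 * (Q + T)\<^sup>2"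
      using h2t Ht DE STQ by (intro add_mono mult_right_mono mult_left_mono power_mono) (simp_all add: H_def)
    finally have energy: "\<alpha> * (h * sobolev_norm 1 2 \<Omega> (e1 - e2))\<^sup>2 \<le> E1 * t\<^sup>2 * (S * T) + E2 * t\<^sup>2 * (Q + T)\<^sup>2" .

    \<comment> \<open>The projection difference itself is the right-hand side of the dual problem,
      so testing with it produces the square of its L^2 norm.\<close>
    have "e1 - e2 \<in> Lp_space 2 \<Omega>" using H10_diff[OF op e1(1) e2(1)] by (simp add: H10_def sobolev_def)
    then obtain w where w: "w \<in> H10 \<Omega>" "\<forall>y\<in>H10 \<Omega>. a h y w = (\<integral>x. (e1 - e2) x * y x \<partial>lebesgue_on \<Omega>)"
      "w \<in> sobolev 2 2 \<Omega>" "sobolev_norm 2 2 \<Omega> w \<le> CS * Lp_norm 2 \<Omega> (e1 - e2)"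
      using CS(2)[rule_format, OF h] V unfolding smoothing_property_def by auto
    have wV: "w \<in> sobolev 2 2 \<Omega> \<inter> V" using w(1,3) V by simp
    have IJ: "ih h w \<in> Vh h" "ihp h w \<in> Vhp h" using interpolation[rule_format, OF h] Vbar(2) wV by auto
    have sW: "Vh h + Vhp h = Vhp h + Vh h" by (rule add.commute)
    have suppIJ: "measure lebesgue (ess_supp \<Omega> (ihp h w - ih h w)) \<le> m"
    proof -
      \<comment> \<open>(A3) bounds the support of one defect; a maximal one makes this bound
        available for the whole union in (B6).\<close>
      have "\<exists>v\<in>Vhp h + Vh h. (\<Union>f\<in>Vhp h + Vh h. ess_supp \<Omega> (f - \<pi> h f)) \<subseteq> ess_supp \<Omega> (v - \<pi> h v)"
      proof (rule exists_maximal_defect_support[OF op domain(2) \<eta>1 fs(2) _ fs(1)])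
        show "Vhp h \<subseteq> Lp_space \<eta> \<Omega>" "Vh h \<subseteq> Lp_space \<eta> \<Omega>"
          using VhD(2) VhpD(2) by (auto simp: sobolev_def)
        show "linear_map_on \<Omega> (Vhp h + Vh h) (\<pi> h)" by (rule A3(2)[rule_format, OF h])
        show "\<forall>f\<in>Vhp h + Vh h. \<pi> h f \<in> Lp_space \<eta> \<Omega>"
          using A3(3)[rule_format, OF h] VhD(2) by (auto simp: sobolev_def)
        show "\<forall>f\<in>Vhp h + Vh h. Lp_norm \<eta> \<Omega> (\<pi> h f) \<le> C3 * Lp_norm \<eta> \<Omega> f"
          using C3(2)[rule_format, OF h] by (simp add: sobolev_norm_0[OF \<eta>1])
      qed
      then obtain v where v: "v \<in> Vhp h + Vh h"
        "(\<Union>f\<in>Vhp h + Vh h. ess_supp \<Omega> (f - \<pi> h f)) \<subseteq> ess_supp \<Omega> (v - \<pi> h v)" by (elim bexE)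
      have "ess_supp \<Omega> (ihp h w - ih h w) \<subseteq> ess_supp \<Omega> (v - \<pi> h v)"
        using B6[rule_format, OF h wV] v(2) unfolding sW by (rule order_trans)
      then have "measure lebesgue (ess_supp \<Omega> (ihp h w - ih h w)) \<le> measure lebesgue (ess_supp \<Omega> (v - \<pi> h v))"
      proof (rule measure_mono_fmeasurable)
        show "ess_supp \<Omega> (ihp h w - ih h w) \<in> sets lebesgue" using ess_supp_borel[OF op] by simp
        show "ess_supp \<Omega> (v - \<pi> h v) \<in> lmeasurable"
          using ess_supp_borel[OF op] bounded_subset[OF domain(2) ess_supp_subset]
          by (intro bounded_set_imp_lmeasurable) simp_all
      qed
      also have "\<dots> \<le> m"
        using C3(2)[rule_format, OF h v(1)] unfolding m_def by (simp only: ess_supp_minus_commute[OF op])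
      finally show ?thesis .
    qed
    have "Lp_norm 2 \<Omega> (e1 - e2) \<le> D1 * (h * sobolev_norm 1 2 \<Omega> (e1 - e2)) +
      D2 * (H * (h * sobolev_norm 1 \<eta> \<Omega> e1)) + D3 * (h powr \<delta> * sobolev_norm \<mu> \<eta> \<Omega> e1)"
      unfolding D1_def D2_def D3_def H_def \<kappa>_def n2_def
    proof (rule duality_estimate[where a = "a h" and ap = "ap h" and w = w and I = "ih h w" and J = "ihp h w" and \<nu> = \<nu> and q = q])
      show "a h e2 (ih h w) = 0" "ap h e1 (ihp h w) = 0" using orth IJ by simp_all
      show "sobolev_norm 1 2 \<Omega> (ih h w - w) + sobolev_norm 1 2 \<Omega> (ihp h w - w) \<le> C5 * h * sobolev_seminorm 2 2 \<Omega> w"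
        by (rule C5(2)[rule_format, OF h wV])
      show "sobolev_norm \<nu> q \<Omega> (ihp h w) \<le> C4 * sobolev_norm \<nu> q \<Omega> w"
        using C4(2)[rule_format, OF h wV] sobolev_norm_nonneg[of \<nu> q \<Omega> "ih h w"] by linarith
      show "sobolev_norm \<nu> q \<Omega> w \<le> Ce * sobolev_norm 2 2 \<Omega> w" using Ce(2) w(3) by simp
      show "\<bar>ap h e1 (ihp h w) - a h e1 (ihp h w)\<bar> \<le>
        C1 * h powr \<delta> * sobolev_norm \<mu> \<eta> \<Omega> e1 * sobolev_norm \<nu> q \<Omega> (ihp h w)"
        by (rule pert[OF e1 VhpD[OF IJ(2)]])
    qed (fact op domain(2) \<eta> h'(1) bil(1) loc(1) nn e1 e2(1) w VhD(1)[OF IJ(1)] VhpD(1)[OF IJ(2)] suppIJ m0)+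
    moreover have "D2 * (H * (h * sobolev_norm 1 \<eta> \<Omega> e1)) \<le> D2 * (t * (Q + T))"
    proof -
      have "h * sobolev_norm 1 \<eta> \<Omega> e1 \<le> Q + T" using h' STQ(2) by (simp add: Q_def distrib_left add_increasing2)
      then have "H * (h * sobolev_norm 1 \<eta> \<Omega> e1) \<le> t * (Q + T)"
        using Ht t0 h' by (rule_tac mult_mono) simp_all
      then show ?thesis using DE by (intro mult_left_mono)
    qed
    moreover have "D3 * (h powr \<delta> * sobolev_norm \<mu> \<eta> \<Omega> e1) \<le> D3 * (t * (Q + T))"
    proof -
      \<comment> \<open>The factor h^\<mu> returns to the norm: for \<mu> = 1 the product is a
        summand of \<open>Q\<close>, for \<mu> = 0 one of \<open>T\<close>.\<close>
      have "h powr \<delta> * sobolev_norm \<mu> \<eta> \<Omega> e1 = h powr (\<delta> - real \<mu>) * (h ^ \<mu> * sobolev_norm \<mu> \<eta> \<Omega> e1)"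
        using h' by (simp add: powr_diff powr_realpow)
      also have "\<dots> \<le> t * (Q + T)"
      proof (rule mult_mono[OF h3t])
        show "h ^ \<mu> * sobolev_norm \<mu> \<eta> \<Omega> e1 \<le> Q + T"
          using A4(4) h' STQ by (auto simp: Q_def T_def distrib_left)
      qed (use h' t0 in simp_all)
      finally show ?thesis using DE by (intro mult_left_mono)
    qed
    ultimately have dual: "Lp_norm 2 \<Omega> (e1 - e2) \<le>
      D1 * (h * sobolev_norm 1 2 \<Omega> (e1 - e2)) + D2 * (t * (Q + T)) + D3 * (t * (Q + T))" by linarith
    have "Lp_norm 2 \<Omega> (e1 - e2) \<le>
      (D1 * (sqrt (E1 / \<alpha>) + sqrt (E2 / \<alpha>)) + D2 + D3) * t * (Q + T + sqrt S * sqrt T)"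
      by (rule combine_energy_duality[OF \<alpha> DE t0 STQ energy dual])
    also have "\<dots> = K * h powr \<sigma>' * (Q + T + sqrt S * sqrt T)" by (simp add: K_def t_def)
    finally show ?thesis
      unfolding e12 S_def Q_def T_def e1_def e2_def by (simp add: sobolev_norm_0)
  qed
  show ?thesis
  proof (intro exI[of _ "K + 1"] conjI ballI)
    fix h u assume h: "h \<in> ?I" and u: "u \<in> sobolev 1 \<eta> \<Omega> \<inter> V"
    \<comment> \<open>From \<open>main\<close> on only nonnegative factors are enlarged:
      \<open>K\<close> to the positive \<open>K + 1\<close>, and the bracket by its last
      summand.\<close>
    have "0 \<le> h ^ \<mu> * sobolev_norm \<mu> \<eta> \<Omega> (r h u - u)" "0 \<le> h" using h by simp_all
    then show "sobolev_norm 0 2 \<Omega> (rp h u - r h u) \<le> (K + 1) * h powr \<sigma>' *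
       (h * sobolev_norm 1 \<eta> \<Omega> (rp h u - u) + h * sobolev_norm 1 \<eta> \<Omega> (r h u - u)
        + sobolev_norm 0 \<eta> \<Omega> (rp h u - u) + sobolev_norm 0 \<eta> \<Omega> (r h u - u)
        + sqrt (h ^ \<mu> * sobolev_norm \<mu> \<eta> \<Omega> (r h u - u)) *
          sqrt (sobolev_norm 0 \<eta> \<Omega> (rp h u - u) + sobolev_norm 0 \<eta> \<Omega> (r h u - u))
        + h ^ \<mu> * sobolev_norm \<mu> \<eta> \<Omega> (r h u - u))"
      by (intro order_trans[OF main[OF h u] mult_mono] mult_right_mono)
        (use K0 in \<open>simp_all add: distrib_left\<close>)
  qed (use K0 in simp)
qed

end
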